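(* Let $N:[0,\infty)\to\mathbb R$ be a $C^2_{loc}$ function with $N(0)=0$, let $s_0\ge1/2$, and let $\delta=\delta(N,s_0)>0$ be the small constant described in the context. Suppose that the initial data $(u_0,u_1)\in H^{s_0+1}_x(\mathbb R^n)\times H^{s_0}_x(\mathbb R^n)$ has $$\|(u_0,u_1)\|_{\dot H^{5/4}_x\times\dot H^{1/4}_x}=\epsilon$$ and $$\|(u_0,u_1)\|_{\dot H^1_x\times L^2_x}=\delta_0\ll_{s_0,\epsilon}\delta .$$ Then there exists a unique solution $u\in C^0_t([0,T],H^{s_0+1}_x)\cap C^1_t([0,T],H^{s_0}_x)$ to $$u''=(1+N(\|\nabla u\|_{L^2_x}^2))\Delta u,\qquad u(0)=u_0,\quad u'(0)=u_1,$$ where $T\sim_{s_0}1/\epsilon^4$. Furthermore, for all $0\le s\le s_0$, the following energy estimate holds on $[0,T]$: $$\sup_{0\le t\le T}\|(u,\partial_tu)\|_{\dot H^{s+1}_x\times\dot H^s_x}\lesssim_{s_0,\epsilon}\|(u_0,u_1)\|_{\dot H^{s+1}_x\times\dot H^s_x}.$$ In particular $$\sup_{0\le t\le T}\|(u,\partial_tu)\|_{\dot H^1_x\times L^2_x}\le\delta$$ and $$\sup_{0\le t\le T}\|(u,\partial_tu)\|_{\dot H^{5/4}_x\times\dot H^{1/4}_x}\lesssim\epsilon .$$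
   Context: $u'=\partial_tu$ denotes the time derivative. $\dot H^\sigma_x$ has norm $\|f\|_{\dot H^\sigma_x}=\||\xi|^\sigma\hat f\|_{L^2_\xi}$, and $\|(f,g)\|^2_{\dot H^{1+s}_x\times\dot H^s_x}=\|f\|^2_{\dot H^{1+s}_x}+\|g\|^2_{\dot H^s_x}$. $X\lesssim_{a}Y$ means $X\le CY$ with $C$ depending only on the subscripted parameters $a$ and on $N$ (dependence on $N$ is always allowed and suppressed); $X\sim_aY$ means both $X\lesssim_aY$ and $Y\lesssim_aX$; $\delta_0\ll_{s_0,\epsilon}\delta$ means $\delta_0\le c\,\delta$ for a sufficiently small constant $c>0$ depending only on $s_0,\epsilon$ (and $N$). The constant $\delta$: it is a small positive number depending only on $N$ and $s_0$ with the following property. For every solution $u\in C^0_t([0,T'],H^{s_0+1}_x)\cap C^1_t([0,T'],H^{s_0}_x)$ of the equation there is a family of functions $E^s(t)$, $0\le s\le s_0$, such that at every $t\in[0,T']$ with $\|(u(t),u'(t))\|_{\dot H^1_x\times L^2_x}\le\delta$ one has, for all $0\le s\le s_0$, $\|(u(t),u'(t))\|^2_{\dot H^{1+s}_x\times\dot H^s_x}\sim_{s_0}E^s(t)$ and $\partial_tE^s(t)\lesssim_{s_0}E^s(t)(E^{1/4}(t))^2$. *)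

theory Defs
  imports "HOL-Analysis.Analysis"
begin

text \<open>
  All functions on space are complex valued. Elements of \<open>L\<^sup>2\<close> are represented by Borel functions;
  identities between them are meant almost everywhere.
\<close>

definition square_integrable :: "('a::euclidean_space \<Rightarrow> complex) \<Rightarrow> bool" where
  "square_integrable f \<longleftrightarrow>
     f \<in> borel_measurable lborel \<and> integrable lborel (\<lambda>x. (cmod (f x))\<^sup>2)"

definition l2norm :: "('a::euclidean_space \<Rightarrow> complex) \<Rightarrow> real" where
  "l2norm f = sqrt (LINT x|lborel. (cmod (f x))\<^sup>2)"


section \<open>The Fourier transform on \<open>L\<^sup>2\<close>\<close>

text \<open>The normalisation is the unitary one, so that \<open>l2norm\<close> is preserved.\<close>

definition fourier_integral :: "('a::euclidean_space \<Rightarrow> complex) \<Rightarrow> 'a \<Rightarrow> complex" where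
  "fourier_integral f \<xi> =
     complex_of_real ((2 * pi) powr (- real DIM('a) / 2)) *
       (LINT x|lborel. exp (- \<i> * complex_of_real (x \<bullet> \<xi>)) * f x)"

text \<open>
  For \<open>f\<close> in \<open>L\<^sup>2\<close> the transform is the \<open>L\<^sup>2\<close> limit of the transforms of the truncations of \<open>f\<close> to
  balls, which are integrable. The limit is stated with the Lebesgue integral in \<open>ennreal\<close>, so
  that a divergent integral cannot be mistaken for \<open>0\<close>.
\<close>

definition is_fourier :: "('a::euclidean_space \<Rightarrow> complex) \<Rightarrow> ('a \<Rightarrow> complex) \<Rightarrow> bool" where
  "is_fourier f g \<longleftrightarrow> square_integrable g \<and>
     ((\<lambda>R. \<integral>\<^sup>+\<xi>. ennreal ((cmod (g \<xi> -
             fourier_integral (\<lambda>x. indicator (cball 0 R) x *\<^sub>R f x) \<xi>))\<^sup>2) \<partial>lborel)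
        \<longlongrightarrow> 0) at_top"

definition fourier :: "('a::euclidean_space \<Rightarrow> complex) \<Rightarrow> 'a \<Rightarrow> complex" where
  "fourier f = (SOME g. is_fourier f g)"


section \<open>Sobolev spaces\<close>

text \<open>
  Only orders \<open>\<sigma> \<ge> 0\<close> are used, for which \<open>H\<^sup>\<sigma>\<close> is a subspace of \<open>L\<^sup>2\<close>. The norms below are only
  meaningful for functions for which the integral in question is finite.
\<close>

definition sobolev :: "real \<Rightarrow> ('a::euclidean_space \<Rightarrow> complex) set" where
  "sobolev \<sigma> = {f. square_integrable f \<and>
     square_integrable (\<lambda>\<xi>. complex_of_real ((1 + (norm \<xi>)\<^sup>2) powr (\<sigma> / 2)) * fourier f \<xi>)}"

definition sobolev_norm :: "real \<Rightarrow> ('a::euclidean_space \<Rightarrow> complex) \<Rightarrow> real" where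
  "sobolev_norm \<sigma> f =
     l2norm (\<lambda>\<xi>. complex_of_real ((1 + (norm \<xi>)\<^sup>2) powr (\<sigma> / 2)) * fourier f \<xi>)"

definition hdot_norm :: "real \<Rightarrow> ('a::euclidean_space \<Rightarrow> complex) \<Rightarrow> real" where
  "hdot_norm \<sigma> f = l2norm (\<lambda>\<xi>. complex_of_real (norm \<xi> powr \<sigma>) * fourier f \<xi>)"

definition hdot_pair_norm ::
  "real \<Rightarrow> ('a::euclidean_space \<Rightarrow> complex) \<Rightarrow> ('a \<Rightarrow> complex) \<Rightarrow> real" where
  "hdot_pair_norm s f g = sqrt ((hdot_norm (1 + s) f)\<^sup>2 + (hdot_norm s g)\<^sup>2)"

definition hdot1_l2_norm :: "('a::euclidean_space \<Rightarrow> complex) \<Rightarrow> ('a \<Rightarrow> complex) \<Rightarrow> real" where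
  "hdot1_l2_norm f g = sqrt ((hdot_norm 1 f)\<^sup>2 + (l2norm g)\<^sup>2)"


section \<open>Test functions and weak derivatives\<close>

definition partial_deriv ::
  "'a::euclidean_space \<Rightarrow> ('a \<Rightarrow> complex) \<Rightarrow> 'a \<Rightarrow> complex" where
  "partial_deriv b f x = frechet_derivative f (at x) b"

primrec C_diff :: "nat \<Rightarrow> ('a::euclidean_space \<Rightarrow> complex) \<Rightarrow> bool" where
  "C_diff 0 f \<longleftrightarrow> continuous_on UNIV f"
| "C_diff (Suc k) f \<longleftrightarrow>
     (\<forall>x. f differentiable (at x)) \<and> (\<forall>b\<in>Basis. C_diff k (partial_deriv b f))"

definition test_function :: "('a::euclidean_space \<Rightarrow> complex) \<Rightarrow> bool" where
  "test_function \<phi> \<longleftrightarrow> (\<forall>k. C_diff k \<phi>) \<and> (\<exists>R. \<forall>x. norm x > R \<longrightarrow> \<phi> x = 0)"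

definition laplacian :: "('a::euclidean_space \<Rightarrow> complex) \<Rightarrow> 'a \<Rightarrow> complex" where
  "laplacian \<phi> x = (\<Sum>b\<in>Basis. partial_deriv b (partial_deriv b \<phi>) x)"

definition is_weak_partial ::
  "'a::euclidean_space \<Rightarrow> ('a \<Rightarrow> complex) \<Rightarrow> ('a \<Rightarrow> complex) \<Rightarrow> bool" where
  "is_weak_partial b f g \<longleftrightarrow> square_integrable g \<and>
     (\<forall>\<phi>. test_function \<phi> \<longrightarrow>
        (LINT x|lborel. f x * partial_deriv b \<phi> x) = - (LINT x|lborel. g x * \<phi> x))"

definition weak_partial ::
  "'a::euclidean_space \<Rightarrow> ('a \<Rightarrow> complex) \<Rightarrow> 'a \<Rightarrow> complex" where
  "weak_partial b f = (SOME g. is_weak_partial b f g)"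

definition grad_l2norm :: "('a::euclidean_space \<Rightarrow> complex) \<Rightarrow> real" where
  "grad_l2norm f = sqrt (\<Sum>b\<in>Basis. (l2norm (weak_partial b f))\<^sup>2)"


section \<open>The Kirchhoff equation\<close>

definition C2_loc :: "(real \<Rightarrow> real) \<Rightarrow> bool" where
  "C2_loc N \<longleftrightarrow> (\<exists>N' N''.
     (\<forall>y\<ge>0. (N has_real_derivative N' y) (at y within {0..})) \<and>
     (\<forall>y\<ge>0. (N' has_real_derivative N'' y) (at y within {0..})) \<and>
     continuous_on {0..} N'')"

definition sobolev_continuous ::
  "real \<Rightarrow> real \<Rightarrow> (real \<Rightarrow> 'a::euclidean_space \<Rightarrow> complex) \<Rightarrow> bool" where
  "sobolev_continuous \<sigma> T u \<longleftrightarrow> (\<forall>t\<in>{0..T}. u t \<in> sobolev \<sigma> \<and>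
     ((\<lambda>\<tau>. sobolev_norm \<sigma> (\<lambda>x. u \<tau> x - u t x)) \<longlongrightarrow> 0) (at t within {0..T}))"

definition sobolev_time_deriv ::
  "real \<Rightarrow> real \<Rightarrow> (real \<Rightarrow> 'a::euclidean_space \<Rightarrow> complex) \<Rightarrow> (real \<Rightarrow> 'a \<Rightarrow> complex) \<Rightarrow> bool" where
  "sobolev_time_deriv \<sigma> T u u' \<longleftrightarrow> (\<forall>t\<in>{0..T}.
     ((\<lambda>\<tau>. sobolev_norm \<sigma> (\<lambda>x. (u \<tau> x - u t x) / complex_of_real (\<tau> - t) - u' t x)) \<longlongrightarrow> 0)
       (at t within {0..T}))"

text \<open>
  \<open>u'\<close> is the time derivative of \<open>u\<close>, determined by \<open>u\<close> up to null sets. As \<open>s\<^sub>0 - 1\<close> may be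
  negative, \<open>u'' = (1 + N (\<parallel>\<nabla>u\<parallel>\<^sup>2)) \<Delta>u\<close> is an identity of distributions in space at each time,
  so it is tested against smooth compactly supported functions.
\<close>

definition kirchhoff_solution ::
  "(real \<Rightarrow> real) \<Rightarrow> real \<Rightarrow> real \<Rightarrow>
   (real \<Rightarrow> 'a::euclidean_space \<Rightarrow> complex) \<Rightarrow> (real \<Rightarrow> 'a \<Rightarrow> complex) \<Rightarrow> bool" where
  "kirchhoff_solution N s0 T u u' \<longleftrightarrow>
     sobolev_continuous (s0 + 1) T u \<and>
     sobolev_continuous s0 T u' \<and>
     sobolev_time_deriv s0 T u u' \<and>
     (\<forall>t\<in>{0..T}. \<forall>\<phi>. test_function \<phi> \<longrightarrow>
        ((\<lambda>\<tau>. LINT x|lborel. u' \<tau> x * \<phi> x) has_vector_derivative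
           complex_of_real (1 + N ((grad_l2norm (u t))\<^sup>2)) *
             (LINT x|lborel. u t x * laplacian \<phi> x))
          (at t within {0..T}))"

text \<open>
  The admissible smallness thresholds \<open>\<delta>\<close> for given \<open>N\<close> and \<open>s\<^sub>0\<close>. The constant \<open>C\<close> is uniform in
  the solution, in time and in \<open>s\<close>. The type argument fixes the underlying Euclidean space.
\<close>

definition energy_threshold ::
  "'a::euclidean_space itself \<Rightarrow> (real \<Rightarrow> real) \<Rightarrow> real \<Rightarrow> real \<Rightarrow> bool" where
  "energy_threshold _ N s0 \<delta> \<longleftrightarrow> \<delta> > 0 \<and>
     (\<exists>C>0. \<forall>T>0. \<forall>(u :: real \<Rightarrow> 'a \<Rightarrow> complex) u'. kirchhoff_solution N s0 T u u' \<longrightarrow>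
        (\<exists>E :: real \<Rightarrow> real \<Rightarrow> real. \<forall>t\<in>{0..T}. hdot1_l2_norm (u t) (u' t) \<le> \<delta> \<longrightarrow>
           (\<forall>s\<in>{0..s0}.
              (hdot_pair_norm s (u t) (u' t))\<^sup>2 \<le> C * E s t \<and>
              E s t \<le> C * (hdot_pair_norm s (u t) (u' t))\<^sup>2 \<and>
              (\<exists>D. (E s has_real_derivative D) (at t within {0..T}) \<and>
                   D \<le> C * (E s t * (E (1/4) t)\<^sup>2)))))"

end

theory Submission
  imports Defs "HOL-Probability.Probability"
begin

text \<open>
  On the frequency side the equation decouples: \<open>v(t,\<xi>)\<close>, the transform of \<open>u(t)\<close>, solves
  \<open>v'' = - a(t) |\<xi>|\<^sup>2 v\<close>, and the frequencies interact only through the scalar coefficient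
  \<open>a(t) = 1 + N(\<parallel>\<nabla>u(t)\<parallel>\<^sup>2)\<close>. Hence a solution is the same thing as a coefficient that is reproduced by
  the flow that it generates. The lemmas \<open>kirchhoff_spectral\<close>, \<open>spectral_solution_flow\<close> and
  \<open>kirchhoff_solution_of_flow\<close> make this precise in both directions; they rest on Plancherel's theorem
  and on extending the distributional equation from test functions to band-limited functions.

  The a priori bounds come from the energies. As long as the norm in \<open>H\<^sup>1 \<times> L\<^sup>2\<close> stays below the
  threshold, \<open>X = E\<^sup>1\<^sup>/\<^sup>4\<close> obeys \<open>X' \<le> C X\<^sup>3\<close> with \<open>X(0) \<le> C \<epsilon>\<^sup>2\<close>, so \<open>X\<close> is bounded by a multiple of
  \<open>\<epsilon>\<^sup>2\<close> up to a time \<open>T = \<kappa>/\<epsilon>\<^sup>4\<close>. On that interval \<open>\<integral> X\<^sup>2\<close> is bounded independently of the data, and Gronwall's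
  inequality bounds every \<open>E\<^sup>s\<close> by a multiple of its initial value. For \<open>s = 0\<close> this improves the
  smallness that was assumed, provided that \<open>\<delta>\<^sub>0\<close> is small enough, and continuity closes the argument
  (\<open>bootstrap\<close>, \<open>bounds_persist\<close>). The constants \<open>\<kappa>\<close> and \<open>A\<close> come from the energies at \<open>s\<^sub>0 = 1/2\<close> only,
  which makes them uniform in \<open>s\<^sub>0\<close>; the energies for the given \<open>s\<^sub>0\<close> supply \<open>B\<close>.

  The bound at \<open>s = 1/2\<close> controls \<open>a'\<close>, because \<open>(\<parallel>\<nabla>u\<parallel>\<^sup>2)'\<close> is a pairing of \<open>|\<xi>|\<^sup>3\<^sup>/\<^sup>2 v\<close> with
  \<open>|\<xi>|\<^sup>1\<^sup>/\<^sup>2 v'\<close>. With \<open>a'\<close> bounded and \<open>a\<close> close to \<open>1\<close> the energy of each single frequency is almost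
  conserved, uniformly in \<open>\<xi>\<close>. Comparing two such flows loses one power of \<open>|\<xi>|\<close>, and the difference of the
  two Dirichlet integrals can afford that loss since the data have \<open>3/2\<close> and \<open>1/2\<close> derivatives. The outcome is
  \<open>|a - b|\<^sup>2(t) \<le> C \<eta>\<^sup>2 + K \<integral>\<^sub>0\<^sup>t |a - b|\<^sup>2\<close> (\<open>coefficient_comparison\<close>), where \<open>\<eta>\<close> measures how far the
  coefficients are from solving their equations. For two solutions \<open>\<eta> = 0\<close>, which is uniqueness. For
  solutions with data truncated to \<open>|\<xi>| \<le> j\<close>, which exist by contraction because \<open>|\<xi>|\<^sup>2\<close> is then a
  bounded multiplier, \<open>\<eta>\<close> tends to \<open>0\<close>: the coefficients form a Cauchy sequence, and the flow of the
  limit is the solution.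
\<close>


section \<open>Square integrable functions\<close>

abbreviation "L2 \<equiv> square_integrable"

abbreviation "cor \<equiv> complex_of_real"

lemma L2D:
 assumes "L2 f"
 shows "f \<in> borel_measurable borel" "integrable lborel (%x. (cmod (f x))^2)"
 using assms by (simp_all add: square_integrable_def)

lemma L2_bound:
 assumes g: "L2 g" and [measurable]: "f \<in> borel_measurable borel"
  and le: "AE x in lborel. cmod (f x) <= C * cmod (g x)"
 shows "L2 f"
proof -
 note [measurable] = L2D(1)[OF g]
 have "integrable lborel (%x. C^2 * (cmod (g x))^2)"
  using L2D(2)[OF g] by simp
 then have "integrable lborel (%x. (cmod (f x))^2)"
 proof (rule Bochner_Integration.integrable_bound)
  show "AE x in lborel. norm ((cmod (f x))^2) <= norm (C^2 * (cmod (g x))^2)"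
   using le
  proof eventually_elim
   case (elim x)
   then have "(cmod (f x))^2 <= (C * cmod (g x))^2" by (intro power_mono) auto
   then show ?case by (simp add: power_mult_distrib)
  qed
 qed simp
 then show ?thesis by (simp add: square_integrable_def)
qed

lemma L2_add:
 assumes f: "L2 f" and g: "L2 g"
 shows "L2 (%x. f x + g x)"
proof -
 note [measurable] = L2D(1)[OF f] L2D(1)[OF g]
 have "integrable lborel (%x. 2 * (cmod (f x))^2 + 2 * (cmod (g x))^2)"
  using L2D(2)[OF f] L2D(2)[OF g] by simp
 then have "integrable lborel (%x. (cmod (f x + g x))^2)"
 proof (rule Bochner_Integration.integrable_bound)
  show "AE x in lborel. norm ((cmod (f x + g x))^2) <= norm (2 * (cmod (f x))^2 + 2 * (cmod (g x))^2)"
  proof (rule AE_I2)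
   fix x
   have "(cmod (f x + g x))^2 <= (cmod (f x) + cmod (g x))^2"
    by (intro power_mono norm_triangle_ineq) auto
   also have "\<dots> <= 2 * (cmod (f x))^2 + 2 * (cmod (g x))^2"
    using sum_squares_bound[of "cmod (f x)" "cmod (g x)"] by (simp add: power2_sum)
   finally show "norm ((cmod (f x + g x))^2) <= norm (2 * (cmod (f x))^2 + 2 * (cmod (g x))^2)"
    by simp
  qed
 qed simp
 then show ?thesis by (simp add: square_integrable_def)
qed

lemma L2_mult_bounded:
 assumes f: "L2 f" and [measurable]: "m \<in> borel_measurable borel"
  and "!!x. cmod (m x) <= C"
 shows "L2 (%x. m x * f x)"
proof -
 note [measurable] = L2D(1)[OF f]
 show ?thesis
  by (rule L2_bound[OF f, where C=C])
    (use assms(3) in \<open>auto simp: norm_mult intro!: mult_right_mono\<close>)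
qed

lemma L2_cmult:
 "L2 f ==> L2 (%x. c * f x)"
 by (rule L2_mult_bounded[where C="cmod c"]) auto

lemma L2_uminus:
 "L2 f ==> L2 (%x. - f x)"
 using L2_cmult[of f "-1"] by simp

lemma L2_diff:
 "L2 f ==> L2 g ==> L2 (%x. f x - g x)"
 using L2_add[of f "%x. - g x"] L2_uminus[of g] by simp

lemma L2_divide:
 "L2 f ==> L2 (%x. f x / c)"
 using L2_cmult[of f "1 / c"] by simp

lemma borel_measurable_cnj [measurable (raw)]:
 "f \<in> borel_measurable M ==> (%x. cnj (f x)) \<in> borel_measurable M"
 using measurable_compose[OF _ borel_measurable_continuous_onI[of cnj], of f M]
 by (simp add: continuous_on_cnj)

lemma L2_cnj:
 "L2 f ==> L2 (%x. cnj (f x))"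
 by (auto simp: square_integrable_def)

lemma L2_zero [simp]: "L2 (%x. 0)"
 by (simp add: square_integrable_def)

lemma L2_cmod:
 "L2 f ==> L2 (%x. cor (cmod (f x)))"
 by (auto simp: square_integrable_def)

lemma l2norm_nonneg [simp]: "0 <= l2norm f"
 by (simp add: l2norm_def)

lemma l2norm_power2: "(l2norm f)^2 = (LINT x|lborel. (cmod (f x))^2)"
 by (simp add: l2norm_def)

lemma l2norm_cmult: "l2norm (%x. c * f x) = cmod c * l2norm f"
 by (simp add: l2norm_def norm_mult power_mult_distrib real_sqrt_mult)

lemma l2norm_uminus [simp]: "l2norm (%x. - f x) = l2norm f"
 by (simp add: l2norm_def)

lemma l2norm_cnj [simp]: "l2norm (%x. cnj (f x)) = l2norm f"
 by (simp add: l2norm_def)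

lemma l2norm_minus_commute: "l2norm (%x. f x - g x) = l2norm (%x. g x - f x)"
 by (simp add: l2norm_def norm_minus_commute)

lemma l2norm_cong_AE:
 assumes "AE x in lborel. f x = g x" "L2 f" "L2 g"
 shows "l2norm f = l2norm g"
proof -
 note [measurable] = L2D(1)[OF assms(2)] L2D(1)[OF assms(3)]
 have "(LINT x|lborel. (cmod (f x))^2) = (LINT x|lborel. (cmod (g x))^2)"
  using assms(1) by (intro integral_cong_AE) auto
 then show ?thesis by (simp add: l2norm_def)
qed

lemma l2norm_mono:
 assumes "L2 g" "AE x in lborel. cmod (f x) <= cmod (g x)"
  "f \<in> borel_measurable borel"
 shows "l2norm f <= l2norm g"
proof -
 have "L2 f"
  using L2_bound[OF assms(1,3), of 1] assms(2) by simp
 then show ?thesis unfolding l2norm_def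
  using assms(2) L2D(2)[OF assms(1)] L2D(2)[of f]
  by (intro real_sqrt_le_mono integral_mono_AE) (auto intro: power_mono)
qed

lemma L2_mult_integrable:
 assumes f: "L2 f" and g: "L2 g"
 shows "integrable lborel (%x. f x * g x)"
proof -
 note [measurable] = L2D(1)[OF f] L2D(1)[OF g]
 have "integrable lborel (%x. (cmod (f x))^2 + (cmod (g x))^2)"
  using L2D(2)[OF f] L2D(2)[OF g] by simp
 then show ?thesis
 proof (rule Bochner_Integration.integrable_bound)
  show "AE x in lborel. norm (f x * g x) <= norm ((cmod (f x))^2 + (cmod (g x))^2)"
  proof (rule AE_I2)
   fix x
   have "norm (f x * g x) <= (cmod (f x))^2 + (cmod (g x))^2"
    using sum_squares_bound[of "cmod (f x)" "cmod (g x)"]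
    mult_nonneg_nonneg[OF norm_ge_zero[of "f x"] norm_ge_zero[of "g x"]] 
    unfolding norm_mult by linarith
   then show "norm (f x * g x) <= norm ((cmod (f x))^2 + (cmod (g x))^2)"
    by simp
  qed
 qed simp
qed

lemma l2norm_eq_0:
 assumes f: "L2 f"
 shows "l2norm f = 0 \<longleftrightarrow> (AE x in lborel. f x = 0)"
proof -
 have "(LINT x|lborel. (cmod (f x))^2) = 0 \<longleftrightarrow> (AE x in lborel. (cmod (f x))^2 = 0)"
  by (intro integral_nonneg_eq_0_iff_AE L2D(2)[OF f]) auto
 then show ?thesis by (simp add: l2norm_def)
qed

lemma Cauchy_Schwarz_abs:
 assumes f: "L2 f" and g: "L2 g"
 shows "(LINT x|lborel. cmod (f x) * cmod (g x)) <= l2norm f * l2norm g"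
proof (cases "l2norm f = 0 \<or> l2norm g = 0")
 case True
 then have "AE x in lborel. cmod (f x) * cmod (g x) = 0"
  using l2norm_eq_0[OF f] l2norm_eq_0[OF g] by auto
 then have "(LINT x|lborel. cmod (f x) * cmod (g x)) = 0"
  by (rule integral_eq_zero_AE)
 then show ?thesis using l2norm_nonneg[of f] l2norm_nonneg[of g] by simp
next
 case False
 define a b where "a = l2norm f" "b = l2norm g"
 have ab: "a > 0" "b > 0" using False l2norm_nonneg[of f] l2norm_nonneg[of g]
  unfolding a_b_def by linarith+
 have i: "integrable lborel (%x. cmod (f x) * cmod (g x))"
  using integrable_norm[OF L2_mult_integrable[OF f g]] by (simp add: norm_mult)
 have "(LINT x|lborel. cmod (f x) * cmod (g x))
   <= (LINT x|lborel. (b / (2 * a)) * (cmod (f x))^2 + (a / (2 * b)) * (cmod (g x))^2)"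
 proof (intro integral_mono i Bochner_Integration.integrable_add integrable_mult_right
   L2D(2) f g)
  fix x
  have "0 <= (b * cmod (f x) - a * cmod (g x))^2 / (2 * a * b)" using ab by simp
  also have "\<dots> = (b / (2 * a)) * (cmod (f x))^2 + (a / (2 * b)) * (cmod (g x))^2
    - cmod (f x) * cmod (g x)"
   using ab by (simp add: field_simps power2_eq_square)
  finally show "cmod (f x) * cmod (g x)
    <= (b / (2 * a)) * (cmod (f x))^2 + (a / (2 * b)) * (cmod (g x))^2" by simp
 qed
 also have "\<dots> = (b / (2 * a)) * a^2 + (a / (2 * b)) * b^2"
  using L2D(2)[OF f] L2D(2)[OF g]
  by (simp add: a_b_def l2norm_power2)
 also have "\<dots> = a * b" using ab by (simp add: field_simps power2_eq_square)
 finally show ?thesis by (simp add: a_b_def)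
qed

lemma Cauchy_Schwarz_l2:
 assumes f: "L2 f" and g: "L2 g"
 shows "cmod (LINT x|lborel. f x * g x) <= l2norm f * l2norm g"
proof -
 have "cmod (LINT x|lborel. f x * g x) <= (LINT x|lborel. cmod (f x * g x))"
  by (rule integral_norm_bound)
 also have "\<dots> <= l2norm f * l2norm g"
  using Cauchy_Schwarz_abs[OF f g] by (simp add: norm_mult)
 finally show ?thesis .
qed

lemma l2norm_triangle:
 assumes f: "L2 f" and g: "L2 g"
 shows "l2norm (%x. f x + g x) <= l2norm f + l2norm g"
proof -
 have i: "integrable lborel (%x. cmod (f x) * cmod (g x))"
  using integrable_norm[OF L2_mult_integrable[OF f g]] by (simp add: norm_mult)
 have "(l2norm (%x. f x + g x))^2
   <= (LINT x|lborel. (cmod (f x))^2 + 2 * (cmod (f x) * cmod (g x)) + (cmod (g x))^2)"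
  unfolding l2norm_power2
 proof (intro integral_mono Bochner_Integration.integrable_add integrable_mult_right i
   L2D(2) f g L2_add)
  fix x
  have "(cmod (f x + g x))^2 <= (cmod (f x) + cmod (g x))^2"
   by (intro power_mono norm_triangle_ineq) auto
  then show "(cmod (f x + g x))^2
    <= (cmod (f x))^2 + 2 * (cmod (f x) * cmod (g x)) + (cmod (g x))^2"
   by (simp add: power2_sum)
 qed
 also have "\<dots> = (l2norm f)^2 + 2 * (LINT x|lborel. cmod (f x) * cmod (g x)) + (l2norm g)^2"
  using i L2D(2)[OF f] L2D(2)[OF g] by (simp add: l2norm_power2)
 also have "\<dots> <= (l2norm f)^2 + 2 * (l2norm f * l2norm g) + (l2norm g)^2"
  using Cauchy_Schwarz_abs[OF f g] by simp
 also have "\<dots> = (l2norm f + l2norm g)^2" by (simp add: power2_sum)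
 finally show ?thesis by (rule power2_le_imp_le) simp
qed

lemma l2norm_triangle_diff:
 assumes "L2 f" "L2 g" "L2 h"
 shows "l2norm (%x. f x - h x) <= l2norm (%x. f x - g x) + l2norm (%x. g x - h x)"
 using l2norm_triangle[of "%x. f x - g x" "%x. g x - h x"] assms
 by (simp add: L2_diff)

lemma abs_l2norm_diff_le:
 assumes f: "L2 f" and g: "L2 g"
 shows "\<bar>l2norm f - l2norm g\<bar> <= l2norm (%x. f x - g x)"
 using l2norm_triangle[OF L2_diff[OF f g] g]
  l2norm_triangle[OF L2_diff[OF g f] f] l2norm_minus_commute[of f g]
 by simp

lemma tendsto_l2norm:
 assumes "!!k. L2 (F k)" "L2 f"
  "((%k. l2norm (%x. F k x - f x)) \<longlongrightarrow> 0) L"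
 shows "((%k. l2norm (F k)) \<longlongrightarrow> l2norm f) L"
proof (rule Lim_null[THEN iffD2], rule Lim_null_comparison[OF _ assms(3)])
 show "\<forall>\<^sub>F k in L. norm (l2norm (F k) - l2norm f) <= l2norm (%x. F k x - f x)"
  using abs_l2norm_diff_le[OF assms(1,2)] by simp
qed

lemma tendsto_l2_pairing:
 assumes F: "!!k. L2 (F k)" "L2 f"
  and G: "!!k. L2 (G k)" "L2 g"
  and limF: "((%k. l2norm (%x. F k x - f x)) \<longlongrightarrow> 0) L"
  and limG: "((%k. l2norm (%x. G k x - g x)) \<longlongrightarrow> 0) L"
 shows "((%k. LINT x|lborel. F k x * G k x) \<longlongrightarrow> (LINT x|lborel. f x * g x)) L"
proof (rule Lim_null[THEN iffD2], rule Lim_null_comparison)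
 have "((%k. l2norm (%x. F k x - f x) * l2norm (G k) + l2norm f * l2norm (%x. G k x - g x))
   \<longlongrightarrow> 0 * l2norm g + l2norm f * 0) L"
  by (intro tendsto_intros limF limG tendsto_l2norm G)
 then show "((%k. l2norm (%x. F k x - f x) * l2norm (G k) + l2norm f * l2norm (%x. G k x - g x))
   \<longlongrightarrow> 0) L" by simp
 have "norm ((LINT x|lborel. F k x * G k x) - (LINT x|lborel. f x * g x))
   <= l2norm (%x. F k x - f x) * l2norm (G k) + l2norm f * l2norm (%x. G k x - g x)" for k
 proof -
  have "(LINT x|lborel. F k x * G k x) - (LINT x|lborel. f x * g x)
    = (LINT x|lborel. (F k x - f x) * G k x) + (LINT x|lborel. f x * (G k x - g x))"
   by (simp add: left_diff_distrib right_diff_distrib L2_mult_integrable F G)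
  then show ?thesis
   using Cauchy_Schwarz_l2[OF L2_diff[OF F(1)[of k] F(2)] G(1)[of k]]
    Cauchy_Schwarz_l2[OF F(2) L2_diff[OF G(1)[of k] G(2)]]
   by (metis (no_types, lifting) add_mono norm_triangle_le)
 qed
 then show "\<forall>\<^sub>F k in L. norm ((LINT x|lborel. F k x * G k x) - (LINT x|lborel. f x * g x))
   <= l2norm (%x. F k x - f x) * l2norm (G k) + l2norm f * l2norm (%x. G k x - g x)"
  by simp
qed

lemma l2norm_dominated_convergence:
 fixes F :: "nat => 'a::euclidean_space => complex"
 assumes G: "L2 G" and [measurable]: "!!k. F k \<in> borel_measurable borel"
  and bd: "!!k. AE x in lborel. cmod (F k x) <= cmod (G x)"
  and lim: "AE x in lborel. (%k. F k x) \<longlonglongrightarrow> 0"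
 shows "(%k. l2norm (F k)) \<longlonglongrightarrow> 0"
proof -
 have "(%k. LINT x|lborel. (cmod (F k x))^2) \<longlonglongrightarrow> (LINT x|(lborel :: 'a measure). 0)"
 proof (rule integral_dominated_convergence)
  show "integrable lborel (%x. (cmod (G x))^2)" using G by (rule L2D)
  show "AE x in lborel. (%k. (cmod (F k x))^2) \<longlonglongrightarrow> 0"
   using lim
  proof eventually_elim
   case (elim x)
   then show ?case
    using tendsto_power[OF tendsto_norm_zero[OF elim], of 2] by simp
  qed
  show "AE x in lborel. norm ((cmod (F k x))^2) <= (cmod (G x))^2" for k
   using bd[of k] by eventually_elim (auto intro: power_mono)
 qed auto
 then have "(%k. sqrt (LINT x|lborel. (cmod (F k x))^2)) \<longlonglongrightarrow> sqrt 0"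
  by (intro tendsto_real_sqrt) simp
 then show ?thesis by (simp add: l2norm_def)
qed

lemma l2norm_dominated_convergence_at:
 fixes F :: "'b::first_countable_topology => 'a::euclidean_space => complex"
 assumes G: "L2 G" and meas: "!!k. k \<in> S ==> F k \<in> borel_measurable borel"
  and bd: "!!k. k \<in> S ==> k \<noteq> t ==> AE x in lborel. cmod (F k x) <= cmod (G x)"
  and lim: "AE x in lborel. ((%k. F k x) \<longlongrightarrow> 0) (at t within S)"
 shows "((%k. l2norm (F k)) \<longlongrightarrow> 0) (at t within S)"
 unfolding tendsto_at_iff_sequentially comp_def
proof (intro allI impI)
 fix X assume X: "\<forall>i. X i \<in> S - {t}" and XL: "X \<longlonglongrightarrow> t"
 show "(%k. l2norm (F (X k))) \<longlonglongrightarrow> 0"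
 proof (rule l2norm_dominated_convergence[OF G])
  show "AE x in lborel. (%k. F (X k) x) \<longlonglongrightarrow> 0"
   using lim
  proof eventually_elim
   case (elim x)
   then show ?case using X XL unfolding tendsto_at_iff_sequentially comp_def by blast
  qed
 qed (use X in \<open>auto intro: meas bd\<close>)
qed

lemma nn_integral_L2:
 assumes "L2 f"
 shows "(\<integral>\<^sup>+x. ennreal ((cmod (f x))^2) \<partial>lborel) = ennreal ((l2norm f)^2)"
 unfolding l2norm_power2
 by (rule nn_integral_eq_integral) (use L2D(2)[OF assms] in auto)

lemma L2I_nn:
 assumes "f \<in> borel_measurable borel" "(\<integral>\<^sup>+x. ennreal ((cmod (f x))^2) \<partial>lborel) < \<infinity>"
 shows "L2 f"
 using assms by (auto simp: square_integrable_def integrable_iff_bounded)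

lemma l2_fatou:
 fixes F :: "nat => 'a::euclidean_space => complex"
 assumes F: "!!k. L2 (F k)" and [measurable]: "f \<in> borel_measurable borel"
  and lim: "AE x in lborel. (%k. F k x) \<longlonglongrightarrow> f x"
  and le: "!!k. k >= k0 ==> l2norm (F k) <= c"
 shows "L2 f" "l2norm f <= c"
proof -
 note [measurable] = L2D(1)[OF F]
 have c0: "0 <= c" using le[of k0] l2norm_nonneg[of "F k0"] by linarith
 have "(\<integral>\<^sup>+x. ennreal ((cmod (f x))^2) \<partial>lborel)
   = (\<integral>\<^sup>+x. liminf (%k. ennreal ((cmod (F k x))^2)) \<partial>lborel)"
 proof (rule nn_integral_cong_AE)
  show "AE x in lborel. ennreal ((cmod (f x))^2) = liminf (%k. ennreal ((cmod (F k x))^2))"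
   using lim
  proof eventually_elim
   case (elim x)
   then have "(%k. ennreal ((cmod (F k x))^2)) \<longlonglongrightarrow> ennreal ((cmod (f x))^2)"
    by (intro tendsto_intros)
   then show ?case by (intro lim_imp_Liminf[symmetric]) auto
  qed
 qed
 also have "\<dots> <= liminf (%k. \<integral>\<^sup>+x. ennreal ((cmod (F k x))^2) \<partial>lborel)"
  by (rule nn_integral_liminf) auto
 also have "\<dots> <= ennreal (c^2)"
 proof (rule Liminf_le)
  have "(\<integral>\<^sup>+x. ennreal ((cmod (F k x))^2) \<partial>lborel) <= ennreal (c^2)" if "k >= k0" for k
   using le[OF that] by (auto simp: nn_integral_L2[OF F] intro: power_mono)
  then show "\<forall>\<^sub>F k in sequentially. (\<integral>\<^sup>+x. ennreal ((cmod (F k x))^2) \<partial>lborel) <= ennreal (c^2)"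
   by (auto simp: eventually_sequentially)
 qed simp
 finally have *: "(\<integral>\<^sup>+x. ennreal ((cmod (f x))^2) \<partial>lborel) <= ennreal (c^2)" .
 also have "\<dots> < \<infinity>" by simp
 finally show sf: "L2 f" by (intro L2I_nn) auto
 have "(l2norm f)^2 <= c^2"
  using * unfolding nn_integral_L2[OF sf] by simp
 then show "l2norm f <= c" using c0 by (rule power2_le_imp_le)
qed

text \<open>
  Completeness of \<open>L\<^sup>2\<close>. Along a subsequence with \<open>\<parallel>d\<^sub>k\<parallel> \<le> 2\<^bsup>-k\<^esup>\<close> for the increments \<open>d\<^sub>k\<close>, the
  function \<open>\<Sum> 2\<^sup>k |d\<^sub>k|\<^sup>2\<close> is integrable, hence finite almost everywhere, and
  \<open>|d\<^sub>k| \<le> 2\<^bsup>-k\<^esup> + 2\<^sup>k |d\<^sub>k|\<^sup>2\<close> makes the subsequence converge there.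
\<close>

lemma l2_complete:
 fixes F :: "nat => 'a::euclidean_space => complex"
 assumes F: "!!k. L2 (F k)"
  and Cauchy: "!!e. e > 0 ==> \<exists>M. \<forall>j\<ge>M. \<forall>k\<ge>M. l2norm (%x. F j x - F k x) < e"
 obtains g where "L2 g" "(%k. l2norm (%x. F k x - g x)) \<longlonglongrightarrow> 0"
proof -
 note [measurable] = L2D(1)[OF F]
 have "\<exists>M. \<forall>k. \<forall>i\<ge>M k. \<forall>j\<ge>M k. l2norm (%x. F i x - F j x) < (1/2)^k"
  by (rule choice) (use Cauchy in simp)
 then obtain M where M: "!!k i j. i >= M k ==> j >= M k ==> l2norm (%x. F i x - F j x) < (1/2)^k"
  by blast
 define r where "r k = (\<Sum>i\<le>k. M i) + k" for k
 have rM: "r k >= M k" for k unfolding r_def by (simp add: atMost_Suc trans_le_add1 sum_nonneg_leq_bound member_le_sum)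
 have rmono: "r k <= r (Suc k)" for k by (simp add: r_def)
 define d where "d k x = F (r (Suc k)) x - F (r k) x" for k x
 have sd: "L2 (d k)" for k unfolding d_def by (intro L2_diff F)
 note [measurable] = L2D(1)[OF sd]
 have ld: "l2norm (d k) <= (1/2)^k" for k
  unfolding d_def using M[of k "r (Suc k)" "r k"] rM[of k] rmono[of k] by simp
 have "(\<integral>\<^sup>+x. (\<Sum>k. ennreal (2^k * (cmod (d k x))^2)) \<partial>lborel)
   = (\<Sum>k. \<integral>\<^sup>+x. ennreal (2^k * (cmod (d k x))^2) \<partial>lborel)"
  by (rule nn_integral_suminf) auto
 also have "\<dots> <= (\<Sum>k. ennreal ((1/2)^k))"
 proof (intro suminf_le summableI)
  fix k
  have "(\<integral>\<^sup>+x. ennreal (2^k * (cmod (d k x))^2) \<partial>lborel) = ennreal (2^k * (l2norm (d k))^2)"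
   by (simp add: ennreal_mult nn_integral_cmult nn_integral_L2[OF sd])
  also have "2^k * (l2norm (d k))^2 <= 2^k * ((1/2)^k)^2"
   using ld[of k] by (intro mult_left_mono power_mono) auto
  also have "2^k * ((1/2::real)^k)^2 = (1/2)^k" by (simp add: power2_eq_square power_one_over)
  finally show "(\<integral>\<^sup>+x. ennreal (2^k * (cmod (d k x))^2) \<partial>lborel) <= ennreal ((1/2)^k)"
   by (simp add: ennreal_leI)
 qed
 also have "\<dots> = ennreal (\<Sum>k. (1/2)^k)" by (intro suminf_ennreal2) auto
 also have "\<dots> < \<infinity>" by simp
 finally have "AE x in lborel. (\<Sum>k. ennreal (2^k * (cmod (d k x))^2)) \<noteq> \<infinity>"
  by (intro nn_integral_noteq_infinite) auto
 then have conv: "AE x in lborel. convergent (%k. F (r k) x)"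
 proof eventually_elim
  case (elim x)
  have s1: "summable (%k. 2^k * (cmod (d k x))^2)"
   by (rule summable_suminf_not_top) (use elim in auto)
  have s2: "summable (%k. (1/2::real)^k + 2^k * (cmod (d k x))^2)"
   by (intro summable_add s1 summable_geometric) simp
  have s3: "summable (%k. d k x)"
  proof (rule summable_comparison_test'[OF s2])
   fix k :: nat
   show "norm (d k x) <= (1/2)^k + 2^k * (cmod (d k x))^2"
   proof -
    have "0 <= ((1/2)^k + (2::real)^k * (cmod (d k x))^2) - norm (d k x)"
    proof -
     have "0 <= (1 - 2^k * cmod (d k x))^2 + 2^k * cmod (d k x)" by simp
     also have "\<dots> = 2^k * (((1/2)^k + (2::real)^k * (cmod (d k x))^2) - norm (d k x))"
      by (simp add: power2_eq_square algebra_simps power_one_over)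
     finally show ?thesis
      using zero_less_power[of "2::real" k] unfolding zero_le_mult_iff by linarith
    qed
    then show ?thesis by simp
   qed
  qed
  have "F (r k) x = F (r 0) x + (\<Sum>i<k. d i x)" for k
   by (induction k) (auto simp: d_def)
  then have eq: "(%k. F (r k) x) = (%k. F (r 0) x + (\<Sum>i<k. d i x))" by (rule ext)
  have "convergent (%k. F (r 0) x + (\<Sum>i<k. d i x))"
   using summable_LIMSEQ[OF s3] by (intro convergent_add convergent_const) (auto simp: convergent_def)
  then show ?case by (simp only: eq)
 qed
 define g where "g x = lim (%k. F (r k) x)" for x
 have [measurable]: "g \<in> borel_measurable borel"
  unfolding g_def by (rule borel_measurable_lim_metric) measurable
 have lim: "AE x in lborel. (%k. F (r k) x) \<longlonglongrightarrow> g x"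
  using conv by eventually_elim (simp add: g_def convergent_LIMSEQ_iff)
 have rk: "r k >= M j" if "k >= j" for j k
  using rM[of j] lift_Suc_mono_le[of r, OF rmono that] by simp
 have fat: "L2 (%x. F i x - g x) \<and> l2norm (%x. F i x - g x) <= (1/2)^j" if "i >= M j" for i j
 proof -
  have "AE x in lborel. (%k. F i x - F (r k) x) \<longlonglongrightarrow> F i x - g x"
   using lim by eventually_elim (intro tendsto_intros)
  then show ?thesis
   using l2_fatou[of "%k x. F i x - F (r k) x" "%x. F i x - g x" j "(1/2)^j"]
    M[OF that rk] by (auto intro: L2_diff F less_imp_le)
 qed
 have "L2 (%x. F (M 0) x - (F (M 0) x - g x))"
  by (rule L2_diff[OF F]) (use fat in auto)
 moreover have "(%x. F (M 0) x - (F (M 0) x - g x)) = g" by (rule ext) simp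
 ultimately have "L2 g" by (simp only:)
 moreover have "(%k. l2norm (%x. F k x - g x)) \<longlonglongrightarrow> 0"
 proof (rule LIMSEQ_I)
  fix e :: real assume "e > 0"
  then obtain j where "(1/2)^j < e" using real_arch_pow_inv[of e "1/2"] by auto
  then show "\<exists>no. \<forall>n\<ge>no. norm (l2norm (%x. F n x - g x) - 0) < e"
   using fat[of j] by (intro exI[of _ "M j"]) (auto intro: le_less_trans)
 qed
 ultimately show ?thesis by (rule that)
qed

lemma cball_sets_borel [measurable]: "cball (a::'a::metric_space) r \<in> sets borel"
 by simp

section \<open>Approximation by continuous functions of compact support\<close>

lemma continuous_compact_support:
 fixes g :: "'a::euclidean_space => complex"
 assumes c: "continuous_on UNIV g" and supp: "!!x. norm x > R ==> g x = 0"
 shows "g \<in> borel_measurable borel" "integrable lborel g" "L2 g"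
  "\<exists>M. \<forall>x. cmod (g x) <= M"
proof -
 show m[measurable]: "g \<in> borel_measurable borel" by (rule borel_measurable_continuous_onI[OF c])
 have "compact (g ` cball 0 R)"
  by (intro compact_continuous_image continuous_on_subset[OF c]) auto
 then obtain M where M: "!!x. x \<in> cball 0 R ==> cmod (g x) <= M"
  unfolding bounded_iff[symmetric] by (metis bounded_iff compact_imp_bounded imageI)
 have M': "cmod (g x) <= max M 0 * indicator (cball 0 R) x" for x
  using M[of x] supp[of x] by (auto simp: indicator_def not_le)
 then show "\<exists>M. \<forall>x. cmod (g x) <= M"
  by (intro exI[of _ "max M 0"] allI order_trans[OF M']) (auto simp: indicator_def)
 have i: "integrable lborel (%x. C * indicator (cball (0::'a) R) x :: real)" for C
  by (intro integrable_mult_right integrable_real_indicator)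
   (auto simp: emeasure_bounded_finite[unfolded infinity_ennreal_def])
 show "integrable lborel g"
  by (rule Bochner_Integration.integrable_bound[OF i[of "max M 0"]])
    (use M' in \<open>auto intro!: AE_I2 order_trans[OF M']\<close>)
 have "(cmod (g x))^2 <= (max M 0)^2 * indicator (cball 0 R) x" for x
  using power_mono[OF M'[of x], of 2] by (auto simp: indicator_def split: if_splits)
 then have "integrable lborel (%x. (cmod (g x))^2)"
  by (intro Bochner_Integration.integrable_bound[OF i[of "(max M 0)^2"]]) auto
 then show "L2 g" by (simp add: square_integrable_def)
qed

lemma truncation_tendsto:
 fixes f :: "'a::euclidean_space => complex"
 assumes f: "L2 f"
 shows "(%k. l2norm (%x. indicator (cball 0 (real k)) x *\<^sub>R f x - f x)) \<longlonglongrightarrow> 0"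
proof (rule l2norm_dominated_convergence[OF f])
 note [measurable] = L2D(1)[OF f]
 show "(%x. indicator (cball 0 (real k)) x *\<^sub>R f x - f x) \<in> borel_measurable borel" for k by measurable
 show "AE x in lborel. (%k. indicator (cball 0 (real k)) x *\<^sub>R f x - f x) \<longlonglongrightarrow> 0"
 proof (rule AE_I2)
  fix x :: 'a
  obtain k0 where "norm x <= real k0" using real_arch_simple by blast
  then have "\<forall>\<^sub>F k in sequentially. 0 = indicator (cball 0 (real k)) x *\<^sub>R f x - f x"
   by (auto simp: eventually_sequentially intro!: exI[of _ k0])
  then show "(%k. indicator (cball 0 (real k)) x *\<^sub>R f x - f x) \<longlonglongrightarrow> 0"
   by (rule Lim_transform_eventually[OF tendsto_const])
 qed
qed (auto simp: indicator_def)

lemma L2_indicator: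
 assumes f: "L2 f" and [measurable]: "S \<in> sets borel"
 shows "L2 (%x. indicator S x *\<^sub>R f x)"
proof -
 note [measurable] = L2D(1)[OF f]
 show ?thesis
  by (rule L2_bound[OF f, where C=1]) (auto simp: indicator_def)
qed

lemma L2_indicator_cball:
 "L2 (%x::'a::euclidean_space. indicator (cball 0 R) x :: complex)"
proof -
 have "integrable lborel (%x::'a. indicator (cball 0 R) x :: real)"
  by (intro integrable_real_indicator) (auto simp: emeasure_bounded_finite[unfolded infinity_ennreal_def])
 moreover have "(%x::'a. (cmod (indicator (cball 0 R) x))^2) = indicator (cball 0 R)"
  by (auto simp: indicator_def)
 ultimately show ?thesis by (simp add: square_integrable_def)
qed

lemma integrable_truncation:
 fixes f :: "'a::euclidean_space => complex"
 assumes f: "L2 f"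
 shows "integrable lborel (%x. indicator (cball 0 R) x *\<^sub>R f x)"
proof -
 from L2_mult_integrable[OF L2_indicator_cball f] show ?thesis
  by (simp add: scaleR_conv_of_real of_real_indicator)
qed

lemma Cc_dense:
 fixes f :: "'a::euclidean_space => complex"
 assumes f: "L2 f" and supp: "!!x. norm x > R ==> f x = 0" and e: "e > 0"
 obtains g where "continuous_on UNIV g" "!!x. norm x > R + 1 ==> g x = 0"
  "l2norm (%x. g x - f x) < e"
proof -
 note [measurable] = L2D(1)[OF f]
 have "(%k. l2norm (%x. (if cmod (f x) <= real k then f x else 0) - f x)) \<longlonglongrightarrow> 0"
 proof (rule l2norm_dominated_convergence[OF f])
  show "AE x in lborel. (%k. (if cmod (f x) <= real k then f x else 0) - f x) \<longlonglongrightarrow> 0"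
  proof (rule AE_I2)
   fix x :: 'a
   obtain k0 where "cmod (f x) <= real k0" using real_arch_simple by blast
   then have "\<forall>\<^sub>F k in sequentially. 0 = (if cmod (f x) <= real k then f x else 0) - f x"
    by (auto simp: eventually_sequentially intro!: exI[of _ k0])
   then show "(%k. (if cmod (f x) <= real k then f x else 0) - f x) \<longlonglongrightarrow> 0"
    by (rule Lim_transform_eventually[OF tendsto_const])
  qed
 qed auto
 then have "\<forall>\<^sub>F k in sequentially. l2norm (%x. (if cmod (f x) <= real k then f x else 0) - f x) < e / 2"
  by (rule order_tendstoD) (use e in simp)
 then obtain k where k: "l2norm (%x. (if cmod (f x) <= real k then f x else 0) - f x) < e / 2"
  by (auto simp: eventually_sequentially)
 define f1 where "f1 x = (if cmod (f x) <= real k then f x else 0)" for x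
 have [measurable]: "f1 \<in> borel_measurable borel" unfolding f1_def by measurable
 have s1: "L2 f1"
  by (rule L2_bound[OF f, where C=1]) (auto simp: f1_def)
 define m where "m = real k + 1"
 have m0: "m > 0" by (simp add: m_def)
 have f1m: "cmod (f1 x) <= m" for x by (auto simp: f1_def m_def)
 have "f1 measurable_on UNIV"
  by (rule lebesgue_measurable_imp_measurable_on) (auto intro!: measurable_completion)
 then obtain N G where N: "negligible N" and G: "!!n. continuous_on UNIV (G n)"
  and GL: "!!x. x \<notin> N ==> (%n. G n x) \<longlonglongrightarrow> f1 x"
  unfolding measurable_on_def by auto
 define cl where "cl z = (m / max m (cmod z)) *\<^sub>R z" for z
 define \<eta> where "\<eta> x = cor (max 0 (min 1 (R + 1 - norm x)))" for x :: 'a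
 define H where "H n x = \<eta> x * cl (G n x)" for n x
 have clc: "continuous_on UNIV cl" unfolding cl_def using m0 by (intro continuous_intros) auto
 have cH: "continuous_on UNIV (H n)" for n
  unfolding H_def \<eta>_def
  by (intro continuous_intros continuous_on_compose2[OF clc G]) auto
 have sH: "H n x = 0" if "norm x > R + 1" for n x using that by (simp add: H_def \<eta>_def)
 have clm: "cmod (cl z) <= m" for z
  using m0 by (simp add: cl_def field_simps max_def)
 have clid: "cl (f1 x) = f1 x" for x using f1m[of x] m0 by (simp add: cl_def max_def)
 have \<eta>1: "cmod (\<eta> x) <= 1" for x by (simp add: \<eta>_def)
 have \<eta>f: "\<eta> x * f1 x = f1 x" for x
  using supp[of x] by (cases "norm x > R") (auto simp: \<eta>_def f1_def)
 define B where "B x = 2 * cor m * indicator (cball 0 (R+1)) x" for x :: 'a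
 have sB: "L2 B"
  unfolding B_def by (rule L2_cmult[OF L2_indicator_cball])
 have "(%n. l2norm (%x. H n x - f1 x)) \<longlonglongrightarrow> 0"
 proof (rule l2norm_dominated_convergence[OF sB])
  show "(%x. H n x - f1 x) \<in> borel_measurable borel" for n
   using borel_measurable_continuous_onI[OF cH[of n]] by measurable
  show "AE x in lborel. cmod (H n x - f1 x) <= cmod (B x)" for n
  proof (rule AE_I2)
   fix x
   show "cmod (H n x - f1 x) <= cmod (B x)"
   proof (cases "norm x > R + 1")
    case True then show ?thesis using sH[of x n] supp[of x] by (simp add: f1_def)
   next
    case False
    have "cmod (H n x) <= 1 * m" unfolding H_def norm_mult
     by (intro mult_mono \<eta>1 clm) auto
    then have "cmod (H n x - f1 x) <= m + m" using f1m[of x]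
     by (metis mult_1 add_mono norm_triangle_le_diff)
    then show ?thesis using False m0 by (simp add: B_def norm_mult)
   qed
  qed
  have "AE x in lborel. x \<notin> N"
   using AE_not_in[of N lebesgue] N by (simp add: negligible_iff_null_sets AE_completion_iff)
  then show "AE x in lborel. (%n. H n x - f1 x) \<longlonglongrightarrow> 0"
  proof eventually_elim
   case (elim x)
   have "(%n. cl (G n x)) \<longlonglongrightarrow> cl (f1 x)"
    by (rule continuous_on_tendsto_compose[OF clc GL[OF elim]]) auto
   then have "(%n. \<eta> x * cl (G n x) - f1 x) \<longlonglongrightarrow> \<eta> x * cl (f1 x) - f1 x"
    by (intro tendsto_intros)
   then show ?case by (simp add: H_def clid \<eta>f)
  qed
 qed
 then have "\<forall>\<^sub>F n in sequentially. l2norm (%x. H n x - f1 x) < e / 2"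
  by (rule order_tendstoD) (use e in simp)
 then obtain n where n: "l2norm (%x. H n x - f1 x) < e / 2"
  by (auto simp: eventually_sequentially)
 have "l2norm (%x. H n x - f x) <= l2norm (%x. H n x - f1 x) + l2norm (%x. f1 x - f x)"
  by (intro l2norm_triangle_diff f s1 continuous_compact_support(3)[OF cH sH])
 also have "\<dots> < e" using n k by (simp add: f1_def)
 finally show ?thesis using that[OF cH sH] by blast
qed

section \<open>The Fourier transform\<close>

lemma norm_exp_imag [simp]: "cmod (exp (- \<i> * cor r)) = 1"
 by (simp add: norm_exp_eq_Re)

lemma measurable_fourier_kernel [measurable]:
 "(%x::'a::euclidean_space. exp (- \<i> * cor (x \<bullet> \<xi>))) \<in> borel_measurable borel"
 "(%x::'a::euclidean_space. exp (- \<i> * cor (\<xi> \<bullet> x))) \<in> borel_measurable borel"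
 by (intro borel_measurable_continuous_onI continuous_intros)+

lemma integrable_fourier_kernel:
 fixes f :: "'a::euclidean_space => complex"
 assumes f: "integrable lborel f"
 shows "integrable lborel (%x. exp (- \<i> * cor (x \<bullet> \<xi>)) * f x)"
proof -
 note [measurable] = borel_measurable_integrable[OF f, simplified]
 show ?thesis
  by (rule Bochner_Integration.integrable_bound[OF f]) (auto simp: norm_mult simp del: mult_minus_left)
qed

lemma fourier_integral_diff:
 assumes "integrable lborel f" "integrable lborel g"
 shows "fourier_integral (%x. f x - g x) \<xi> = fourier_integral f \<xi> - fourier_integral g \<xi>"
 using integrable_fourier_kernel[OF assms(1)] integrable_fourier_kernel[OF assms(2)]
 by (simp add: fourier_integral_def right_diff_distrib)

lemma fourier_integral_cmult:
 "fourier_integral (%x. c * f x) \<xi> = c * fourier_integral f \<xi>"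
proof -
 have "(LINT x|lborel. exp (- \<i> * cor (x \<bullet> \<xi>)) * (c * f x))
   = c * (LINT x|lborel. exp (- \<i> * cor (x \<bullet> \<xi>)) * f x)"
  by (subst integral_mult_right_zero[symmetric]) (simp add: ac_simps)
 then show ?thesis by (simp add: fourier_integral_def)
qed

lemma norm_fourier_integral_le:
 fixes f :: "'a::euclidean_space => complex"
 shows "cmod (fourier_integral f \<xi>) <= (2 * pi) powr (- real DIM('a) / 2) * (LINT x|lborel. cmod (f x))"
proof -
 have "cmod (LINT x|lborel. exp (- \<i> * cor (x \<bullet> \<xi>)) * f x)
   <= (LINT x|lborel. cmod (exp (- \<i> * cor (x \<bullet> \<xi>)) * f x))"
  by (rule integral_norm_bound)
 then show ?thesis
  by (simp add: fourier_integral_def norm_mult mult_left_mono del: mult_minus_left)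
qed

lemma measurable_fourier_integral:
 fixes f :: "'a::euclidean_space => complex"
 assumes [measurable]: "f \<in> borel_measurable borel"
 shows "fourier_integral f \<in> borel_measurable borel"
proof -
 have [measurable]: "(%z::'a \<times> 'a. exp (- \<i> * cor (snd z \<bullet> fst z))) \<in> borel_measurable (borel \<Otimes>\<^sub>M borel)"
  unfolding borel_prod by (intro borel_measurable_continuous_onI continuous_intros)
 have "(%z::'a \<times> 'a. exp (- \<i> * cor (snd z \<bullet> fst z)) * f (snd z)) \<in> borel_measurable (borel \<Otimes>\<^sub>M borel)"
  by measurable
 then have "(%\<xi>. LINT x|lborel. exp (- \<i> * cor (x \<bullet> \<xi>)) * f x) \<in> borel_measurable borel"
  by (intro lborel.borel_measurable_lebesgue_integral) (simp add: split_beta)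
 then show ?thesis unfolding fourier_integral_def[abs_def] by measurable
qed

lemma fourier_integral_multiplication:
 fixes f g :: "'a::euclidean_space => complex"
 assumes f: "integrable lborel f" and g: "integrable lborel g"
 shows "(LINT x|lborel. fourier_integral f x * g x) = (LINT x|lborel. f x * fourier_integral g x)"
proof -
 note [measurable] = borel_measurable_integrable[OF f, simplified] borel_measurable_integrable[OF g, simplified]
 let ?K = "%x \<xi>. exp (- \<i> * cor (x \<bullet> \<xi>)) * f x * g \<xi>"
 have [measurable]: "(%z::'a \<times> 'a. exp (- \<i> * cor (fst z \<bullet> snd z))) \<in> borel_measurable (borel \<Otimes>\<^sub>M borel)"
  unfolding borel_prod by (intro borel_measurable_continuous_onI continuous_intros)
 have int: "integrable (lborel \<Otimes>\<^sub>M lborel) (%(x, \<xi>). ?K x \<xi>)"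
 proof (rule lborel_pair.Fubini_integrable)
  show "(%(x, \<xi>). ?K x \<xi>) \<in> borel_measurable (lborel \<Otimes>\<^sub>M lborel)"
   unfolding split_beta by measurable
  have "integrable lborel (%x. (LINT \<xi>|lborel. cmod (g \<xi>)) * cmod (f x))"
   using integrable_norm[OF f] by simp
  then show "integrable lborel (%x. LINT y|lborel. norm (case (x, y) of (x, \<xi>) => ?K x \<xi>))"
   by (simp add: norm_mult mult.commute del: mult_minus_left)
  show "AE x in lborel. integrable lborel (%y. case (x, y) of (x, \<xi>) => ?K x \<xi>)"
  proof (rule AE_I2)
   fix x
   have "integrable lborel (%\<xi>. f x * (exp (- \<i> * cor (\<xi> \<bullet> x)) * g \<xi>))"
    by (intro integrable_mult_right integrable_fourier_kernel g)
   then show "integrable lborel (%y. case (x, y) of (x, \<xi>) => ?K x \<xi>)"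
    by (simp add: ac_simps inner_commute)
  qed
 qed
 have *: "(LINT \<xi>|lborel. LINT x|lborel. ?K x \<xi>) = (LINT x|lborel. LINT \<xi>|lborel. ?K x \<xi>)"
  using lborel_pair.Fubini_integral[OF int] by simp
 have 1: "(LINT x|lborel. ?K x \<xi>) = (LINT x|lborel. exp (- \<i> * cor (x \<bullet> \<xi>)) * f x) * g \<xi>" for \<xi>
  by (rule integral_mult_left_zero)
 have 2: "(LINT \<xi>|lborel. ?K x \<xi>) = f x * (LINT \<xi>|lborel. exp (- \<i> * cor (\<xi> \<bullet> x)) * g \<xi>)" for x
  by (subst integral_mult_right_zero[symmetric]) (simp add: ac_simps inner_commute)
 show ?thesis
  using * unfolding 1 2 fourier_integral_def
  by (simp add: mult.assoc mult.left_commute[of _ "cor _"])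
qed

text \<open>Gaussians: dimension one comes from the characteristic function of the normal distribution.\<close>

lemma integral_lborel_prod_coordinates:
 fixes f :: "'a::euclidean_space => real => complex"
 assumes f: "!!b. b \<in> Basis ==> integrable lborel (f b)"
 shows "(LINT x|lborel. (\<Prod>b\<in>Basis. f b (x \<bullet> b))) = (\<Prod>b\<in>Basis. LINT t|lborel. f b t)"
  "integrable lborel (%x::'a. \<Prod>b\<in>Basis. f b (x \<bullet> b))"
proof -
 interpret product_sigma_finite "%_::'a. lborel :: real measure" ..
 let ?g = "%h::'a => real. \<Sum>b\<in>Basis. h b *\<^sub>R b"
 have m[measurable]: "f b \<in> borel_measurable borel" if "b \<in> Basis" for b
  using borel_measurable_integrable[OF f[OF that]] by simp
 have [measurable]: "(%x::'a. \<Prod>b\<in>Basis. f b (x \<bullet> b)) \<in> borel_measurable borel"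
  by (intro borel_measurable_prod) measurable
 have g[measurable]: "?g \<in> measurable (PiM Basis (%_. lborel)) borel"
  by (intro borel_measurable_sum borel_measurable_scaleR measurable_component_singleton) auto
 have e: "(\<Prod>b\<in>Basis. f b (?g h \<bullet> b)) = (\<Prod>b\<in>Basis. f b (h b))" for h
  by (intro prod.cong refl) (simp add: inner_sum_left_Basis)
 have "(LINT x|lborel. (\<Prod>b\<in>Basis. f b (x \<bullet> b)))
   = (LINT x|distr (PiM Basis (%_::'a. lborel)) borel ?g. (\<Prod>b\<in>Basis. f b (x \<bullet> b)))"
  using lborel_eq[where 'a='a] by simp
 also have "\<dots> = (LINT h|PiM Basis (%_::'a. lborel). (\<Prod>b\<in>Basis. f b (h b)))"
  by (subst integral_distr) (simp_all only: e g, measurable)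
 also have "\<dots> = (\<Prod>b\<in>Basis. LINT t|lborel. f b t)"
  by (rule product_integral_prod) (use f in auto)
 finally show "(LINT x|lborel. (\<Prod>b\<in>Basis. f b (x \<bullet> b))) = (\<Prod>b\<in>Basis. LINT t|lborel. f b t)" .
 have "integrable (distr (PiM Basis (%_::'a. lborel)) borel ?g) (%x. \<Prod>b\<in>Basis. f b (x \<bullet> b))"
  by (subst integrable_distr_eq) (simp_all only: e g, measurable, rule product_integrable_prod, use f in auto)
 then show "integrable lborel (%x::'a. \<Prod>b\<in>Basis. f b (x \<bullet> b))"
  using lborel_eq[where 'a='a] by simp
qed

lemma gaussian_1d:
 fixes z :: real
 shows "integrable lborel (%t. exp (- \<i> * cor (z * t)) * cor (exp (- t\<^sup>2 / 2)))"
  "(LINT t|lborel. exp (- \<i> * cor (z * t)) * cor (exp (- t\<^sup>2 / 2)))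
   = cor (sqrt (2 * pi) * exp (- z\<^sup>2 / 2))"
proof -
 have d: "std_normal_density t = exp (- t\<^sup>2 / 2) / sqrt (2 * pi)" for t
  by (simp add: std_normal_density_def)
 have i: "integrable lborel (%t. sqrt (2 * pi) * std_normal_density t)"
  by (intro integrable_mult_right integrable_normal_density) auto
 have [measurable]: "(%t. exp (- \<i> * cor (z * t))) \<in> borel_measurable borel"
  by (intro borel_measurable_continuous_onI continuous_intros)
 show "integrable lborel (%t. exp (- \<i> * cor (z * t)) * cor (exp (- t\<^sup>2 / 2)))"
  by (rule Bochner_Integration.integrable_bound[OF i])
   (auto simp: d norm_mult simp del: mult_minus_left of_real_mult)
 have "(LINT t|lborel. std_normal_density t *\<^sub>R iexp ((- z) * t)) = cor (exp (- (z^2) / 2))"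
  using fun_cong[OF char_std_normal_distribution, of "- z"]
  by (simp add: char_def integral_density)
 then have "(LINT t|lborel. cor (sqrt (2 * pi)) * (std_normal_density t *\<^sub>R iexp ((- z) * t)))
   = cor (sqrt (2 * pi)) * cor (exp (- (z^2) / 2))"
  by (simp only: integral_mult_right_zero)
 moreover have "cor (sqrt (2 * pi)) * (std_normal_density t *\<^sub>R iexp ((- z) * t))
   = exp (- \<i> * cor (z * t)) * cor (exp (- t\<^sup>2 / 2))" for t
  by (simp add: d scaleR_conv_of_real)
 ultimately show "(LINT t|lborel. exp (- \<i> * cor (z * t)) * cor (exp (- t\<^sup>2 / 2)))
   = cor (sqrt (2 * pi) * exp (- z\<^sup>2 / 2))"
  by simp
qed

lemma gaussian_fourier:
 fixes z :: "'a::euclidean_space"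
 shows "integrable lborel (%x::'a. exp (- \<i> * cor (x \<bullet> z)) * cor (exp (- (norm x)\<^sup>2 / 2)))"
  "(LINT x|lborel. exp (- \<i> * cor (x \<bullet> z)) * cor (exp (- (norm x)\<^sup>2 / 2)))
   = cor ((2 * pi) powr (real DIM('a) / 2) * exp (- (norm z)\<^sup>2 / 2))"
proof -
 let ?f = "%(b::'a) t. exp (- \<i> * cor ((z \<bullet> b) * t)) * cor (exp (- t\<^sup>2 / 2))"
 have sq: "(norm x)^2 = (\<Sum>b\<in>Basis. (x \<bullet> b)^2)" for x :: 'a
  unfolding power2_norm_eq_inner euclidean_inner[of x x] by (simp only: power2_eq_square)
 have e1: "cor (exp (- (norm x)\<^sup>2 / 2)) = (\<Prod>b\<in>Basis. cor (exp (- (x \<bullet> b)\<^sup>2 / 2)))" for x :: 'a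
  by (simp add: sq exp_sum[symmetric] sum_divide_distrib sum_negf flip: of_real_prod)
 have e2: "exp (- \<i> * cor (x \<bullet> z)) = (\<Prod>b\<in>Basis. exp (- \<i> * cor ((z \<bullet> b) * (x \<bullet> b))))" for x
  by (simp add: euclidean_inner[of x z] exp_sum[symmetric] sum_distrib_left sum_negf mult.commute)
 have e: "exp (- \<i> * cor (x \<bullet> z)) * cor (exp (- (norm x)\<^sup>2 / 2)) = (\<Prod>b\<in>Basis. ?f b (x \<bullet> b))" for x
  unfolding e1 e2 by (rule prod.distrib[symmetric])
 show "integrable lborel (%x::'a. exp (- \<i> * cor (x \<bullet> z)) * cor (exp (- (norm x)\<^sup>2 / 2)))"
  unfolding e by (intro integral_lborel_prod_coordinates gaussian_1d)
 have "(LINT x|lborel. exp (- \<i> * cor (x \<bullet> z)) * cor (exp (- (norm x)\<^sup>2 / 2)))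
   = (\<Prod>b\<in>Basis. LINT t|lborel. ?f b t)"
  unfolding e by (intro integral_lborel_prod_coordinates gaussian_1d)
 also have "\<dots> = (\<Prod>b\<in>Basis. cor (sqrt (2 * pi)) * cor (exp (- (z \<bullet> b)\<^sup>2 / 2)))"
  by (intro prod.cong refl) (simp only: gaussian_1d(2) of_real_mult[of "sqrt (2 * pi)"])
 also have "\<dots> = cor (sqrt (2 * pi)) ^ DIM('a) * cor (exp (- (norm z)\<^sup>2 / 2))"
  by (simp only: prod.distrib e1[symmetric] prod_constant)
 also have "cor (sqrt (2 * pi)) ^ DIM('a) = cor ((2 * pi) powr (real DIM('a) / 2))"
  by (simp add: powr_half_sqrt[symmetric] powr_realpow[symmetric] powr_powr flip: of_real_power)
 finally show "(LINT x|lborel. exp (- \<i> * cor (x \<bullet> z)) * cor (exp (- (norm x)\<^sup>2 / 2)))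
   = cor ((2 * pi) powr (real DIM('a) / 2) * exp (- (norm z)\<^sup>2 / 2))"
  by simp
qed

lemma lborel_integral_affine:
 fixes f :: "'a::euclidean_space => complex"
 assumes c: "c \<noteq> 0" and [measurable]: "f \<in> borel_measurable borel"
 shows "(LINT x|lborel. f x) = cor (\<bar>c\<bar> ^ DIM('a)) * (LINT x|lborel. f (t + c *\<^sub>R x))"
  "integrable lborel f \<longleftrightarrow> integrable lborel (%x. f (t + c *\<^sub>R x))"
proof -
 have "(LINT x|lborel. f x) = (LINT x|density (distr lborel borel (%x. t + c *\<^sub>R x)) (%_. ennreal (\<bar>c\<bar> ^ DIM('a))). f x)"
  using lborel_affine[OF c, of t] by simp
 also have "\<dots> = cor (\<bar>c\<bar> ^ DIM('a)) * (LINT x|lborel. f (t + c *\<^sub>R x))"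
  by (subst integral_density) (auto simp: integral_distr scaleR_conv_of_real)
 finally show "(LINT x|lborel. f x) = cor (\<bar>c\<bar> ^ DIM('a)) * (LINT x|lborel. f (t + c *\<^sub>R x))" .
 have "integrable lborel f = integrable (density (distr lborel borel (%x. t + c *\<^sub>R x)) (%_. ennreal (\<bar>c\<bar> ^ DIM('a)))) f"
  using lborel_affine[OF c, of t] by simp
 also have "\<dots> = integrable lborel (%x. \<bar>c\<bar> ^ DIM('a) *\<^sub>R f (t + c *\<^sub>R x))"
  by (subst integrable_density) (auto simp: integrable_distr_eq)
 also have "\<dots> = integrable lborel (%x. f (t + c *\<^sub>R x))"
 proof
  assume "integrable lborel (%x. \<bar>c\<bar> ^ DIM('a) *\<^sub>R f (t + c *\<^sub>R x))"
  then have "integrable lborel (%x. inverse (\<bar>c\<bar> ^ DIM('a)) *\<^sub>R (\<bar>c\<bar> ^ DIM('a) *\<^sub>R f (t + c *\<^sub>R x)))"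
   by (rule integrable_scaleR_right)
  then show "integrable lborel (%x. f (t + c *\<^sub>R x))" using c by simp
 qed (rule integrable_scaleR_right)
 finally show "integrable lborel f \<longleftrightarrow> integrable lborel (%x. f (t + c *\<^sub>R x))" .
qed

text \<open>
  Plancherel for continuous \<open>f\<close> of compact support: with a Gaussian factor of width \<open>1/\<epsilon>\<close> on
  the frequency side both integrals converge absolutely, and applying the multiplication formula
  twice turns \<open>\<integral> |F f|\<^sup>2 exp(-\<epsilon>\<^sup>2|\<xi>|\<^sup>2/2)\<close> into \<open>\<integral> f S\<^sub>\<epsilon>\<close>, where \<open>S\<^sub>\<epsilon>\<close> averages \<open>cnj f\<close> over a
  Gaussian of width \<open>\<epsilon>\<close>.
\<close>

lemma gaussian_regularised_plancherel:
 fixes f :: "'a::euclidean_space => complex"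
 assumes c: "continuous_on UNIV f" and supp: "!!x. norm x > R ==> f x = 0" and e: "e > 0"
 shows "(LINT \<xi>|lborel. fourier_integral f \<xi> * (cor (exp (- (norm (e *\<^sub>R \<xi>))\<^sup>2 / 2)) * cnj (fourier_integral f \<xi>)))
  = (LINT x|lborel. f x * (cor ((2 * pi) powr (- real DIM('a) / 2)) *
    (LINT h|lborel. cor (exp (- (norm h)\<^sup>2 / 2)) * cnj (f (x - e *\<^sub>R h)))))"
proof -
 note f = continuous_compact_support[OF c supp]
 note [measurable] = f(1)
 define C where "C = cor ((2 * pi) powr (- real DIM('a) / 2))"
 define k where "k y = cnj (f (- y))" for y
 have ck: "continuous_on UNIV k"
  unfolding k_def by (intro continuous_intros continuous_on_compose2[OF c]) auto
 have ki: "integrable lborel k"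
  by (rule continuous_compact_support(2)[OF ck, of R]) (simp add: k_def supp)
 have [measurable]: "k \<in> borel_measurable borel" by (rule borel_measurable_continuous_onI[OF ck])
 have refl: "(LINT x|lborel. g x) = (LINT x|lborel. g (- x))" if "g \<in> borel_measurable borel" for g :: "'a => complex"
  using lborel_integral_affine(1)[of "-1" g 0] that by simp
 have Fk: "cnj (fourier_integral f \<xi>) = fourier_integral k \<xi>" for \<xi>
 proof -
  have "fourier_integral k \<xi> = C * (LINT x|lborel. exp (- \<i> * cor ((- x) \<bullet> \<xi>)) * k (- x))"
   unfolding fourier_integral_def C_def by (subst refl) auto
  also have "\<dots> = C * (LINT x|lborel. cnj (exp (- \<i> * cor (x \<bullet> \<xi>)) * f x))"
   by (simp add: k_def exp_cnj)
  also have "\<dots> = C * cnj (LINT x|lborel. exp (- \<i> * cor (x \<bullet> \<xi>)) * f x)"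
   by (simp only: Bochner_Integration.integral_cnj)
  also have "\<dots> = cnj (fourier_integral f \<xi>)"
   by (simp only: fourier_integral_def C_def complex_cnj_mult complex_cnj_complex_of_real)
  finally show ?thesis by simp
 qed
 define G where "G x \<xi> = exp (- \<i> * cor (\<xi> \<bullet> x)) * cor (exp (- (norm (e *\<^sub>R \<xi>))\<^sup>2 / 2))" for x \<xi> :: 'a
 have Gm[measurable]: "G x \<in> borel_measurable borel" for x
  unfolding G_def by measurable
 have G': "G x (0 + (1/e) *\<^sub>R h) = exp (- \<i> * cor (h \<bullet> ((1/e) *\<^sub>R x))) * cor (exp (- (norm h)\<^sup>2 / 2))" for x h
  using e by (simp add: G_def)
 have Gi: "integrable lborel (G x)" for x
  using lborel_integral_affine(2)[of "1/e" "G x" 0] gaussian_fourier(1)[of "(1/e) *\<^sub>R x"] e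
  unfolding G' by simp
 have FG: "fourier_integral (G x) y = cor ((1/e) ^ DIM('a)) * cor (exp (- (norm ((1/e) *\<^sub>R (x + y)))\<^sup>2 / 2))" for x y
 proof -
  have "fourier_integral (G x) y = C * (LINT \<xi>|lborel. G (x + y) \<xi>)"
   unfolding fourier_integral_def C_def G_def
   by (simp add: mult.assoc[symmetric] exp_add[symmetric] inner_add_right algebra_simps)
  also have "(LINT \<xi>|lborel. G (x + y) \<xi>) = cor ((1/e) ^ DIM('a)) *
    cor ((2 * pi) powr (real DIM('a) / 2) * exp (- (norm ((1/e) *\<^sub>R (x + y)))\<^sup>2 / 2))"
   using lborel_integral_affine(1)[of "1/e" "G (x + y)" 0] gaussian_fourier(2)[of "(1/e) *\<^sub>R (x + y)"] e
   unfolding G' by simp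
  also have "C * \<dots> = cor ((1/e) ^ DIM('a)) * cor (exp (- (norm ((1/e) *\<^sub>R (x + y)))\<^sup>2 / 2))"
   by (simp add: C_def powr_minus_divide)
  finally show ?thesis .
 qed
 define g where "g \<xi> = cor (exp (- (norm (e *\<^sub>R \<xi>))\<^sup>2 / 2)) * cnj (fourier_integral f \<xi>)" for \<xi>
 have gk: "g \<xi> = cor (exp (- (norm (e *\<^sub>R \<xi>))\<^sup>2 / 2)) * fourier_integral k \<xi>" for \<xi>
  by (simp add: g_def Fk)
 have [measurable]: "fourier_integral k \<in> borel_measurable borel"
  by (rule measurable_fourier_integral) simp
 have gi: "integrable lborel g"
 proof (rule Bochner_Integration.integrable_bound)
  let ?M = "(2 * pi) powr (- real DIM('a) / 2) * (LINT x|lborel. cmod (k x))"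
  show "integrable lborel (%\<xi>. cor ?M * G 0 \<xi>)" by (intro integrable_mult_right Gi)
  show "g \<in> borel_measurable lborel" unfolding gk[abs_def] by measurable
  show "AE x in lborel. norm (g x) <= norm (cor ?M * G 0 x)"
   using norm_fourier_integral_le[of k]
   by (intro AE_I2) (auto simp: gk G_def norm_mult mult.commute intro!: mult_left_mono
     intro: order_trans[OF _ abs_ge_self])
 qed
 have Fg: "fourier_integral g x = C * (LINT h|lborel. cor (exp (- (norm h)\<^sup>2 / 2)) * cnj (f (x - e *\<^sub>R h)))" for x
 proof -
  have "fourier_integral g x = C * (LINT \<xi>|lborel. fourier_integral k \<xi> * G x \<xi>)"
   unfolding fourier_integral_def[of g] C_def gk G_def by (simp add: ac_simps)
  also have "(LINT \<xi>|lborel. fourier_integral k \<xi> * G x \<xi>) = (LINT y|lborel. k y * fourier_integral (G x) y)"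
   by (rule fourier_integral_multiplication[OF ki Gi])
  also have "\<dots> = cor (e ^ DIM('a)) * (LINT h|lborel. k (- x + e *\<^sub>R h) * fourier_integral (G x) (- x + e *\<^sub>R h))"
   using e by (subst lborel_integral_affine(1)[of e _ "- x"])
    (auto intro!: borel_measurable_times measurable_fourier_integral)
  also have "\<dots> = (LINT h|lborel. cor (e ^ DIM('a)) * (k (- x + e *\<^sub>R h) * fourier_integral (G x) (- x + e *\<^sub>R h)))"
   by (rule integral_mult_right_zero[symmetric])
  also have "\<dots> = (LINT h|lborel. cor (exp (- (norm h)\<^sup>2 / 2)) * cnj (f (x - e *\<^sub>R h)))"
   using e by (intro Bochner_Integration.integral_cong) (simp_all add: FG k_def power_one_over)
  finally show ?thesis .
 qed
 have "(LINT \<xi>|lborel. fourier_integral f \<xi> * g \<xi>) = (LINT x|lborel. f x * fourier_integral g x)"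
  by (rule fourier_integral_multiplication[OF f(2) gi])
 then show ?thesis unfolding Fg C_def g_def .
qed

lemma plancherel_Cc:
 fixes f :: "'a::euclidean_space => complex"
 assumes c: "continuous_on UNIV f" and supp: "!!x. norm x > R ==> f x = 0"
 shows "L2 (fourier_integral f)" "l2norm (fourier_integral f) = l2norm f"
proof -
 note f = continuous_compact_support[OF c supp]
 note [measurable] = f(1)
 have [measurable]: "fourier_integral f \<in> borel_measurable borel"
  by (rule measurable_fourier_integral) simp
 obtain M where M: "!!x. cmod (f x) <= M" using f(4) by blast
 define C where "C = cor ((2 * pi) powr (- real DIM('a) / 2))"
 define \<gamma> where "\<gamma> h = cor (exp (- (norm h)\<^sup>2 / 2))" for h :: 'a
 have \<gamma>[measurable]: "\<gamma> \<in> borel_measurable borel" unfolding \<gamma>_def by measurable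
 have \<gamma>i: "integrable lborel \<gamma>" using gaussian_fourier(1)[of "0::'a"] by (simp add: \<gamma>_def[abs_def])
 have \<gamma>1: "C * (LINT h|lborel. \<gamma> h) = 1"
  using gaussian_fourier(2)[of "0::'a"]
  by (simp add: \<gamma>_def[abs_def] C_def powr_minus_divide flip: of_real_mult)
 define e where "e k = 1 / real (Suc k)" for k
 have e0: "e k > 0" for k by (simp add: e_def)
 have eL: "e \<longlonglongrightarrow> 0" unfolding e_def by (rule LIMSEQ_Suc[OF lim_1_over_n])
 define S where "S k x = C * (LINT h|lborel. \<gamma> h * cnj (f (x - e k *\<^sub>R h)))" for k x
 have bound: "norm (\<gamma> h * cnj (f y)) <= M * cmod (\<gamma> h)" for h y
  using mult_right_mono[OF M[of y], of "cmod (\<gamma> h)"] by (simp add: norm_mult mult.commute)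
 have M\<gamma>: "integrable lborel (%h. M * cmod (\<gamma> h))" using \<gamma>i by simp
 have Sm[measurable]: "S k \<in> borel_measurable borel" for k
 proof -
  have "(%z::'a \<times> 'a. f (fst z - e k *\<^sub>R snd z)) \<in> borel_measurable (borel \<Otimes>\<^sub>M borel)"
   unfolding borel_prod
   by (intro borel_measurable_continuous_onI continuous_on_compose2[OF c] continuous_intros) auto
  then have "(%z::'a \<times> 'a. \<gamma> (snd z) * cnj (f (fst z - e k *\<^sub>R snd z))) \<in> borel_measurable (borel \<Otimes>\<^sub>M borel)"
   by measurable
  then have "(%x. LINT h|lborel. \<gamma> h * cnj (f (x - e k *\<^sub>R h))) \<in> borel_measurable borel"
   by (intro lborel.borel_measurable_lebesgue_integral) (simp add: split_beta)
  then show ?thesis unfolding S_def[abs_def] by measurable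
 qed
 have SL: "(%k. S k x) \<longlonglongrightarrow> cnj (f x)" for x
 proof -
  have "(%k. LINT h|lborel. \<gamma> h * cnj (f (x - e k *\<^sub>R h))) \<longlonglongrightarrow> (LINT h|lborel. \<gamma> h * cnj (f x))"
  proof (rule integral_dominated_convergence[OF _ _ M\<gamma>])
   show "AE h in lborel. (%k. \<gamma> h * cnj (f (x - e k *\<^sub>R h))) \<longlonglongrightarrow> \<gamma> h * cnj (f x)"
   proof (rule AE_I2)
    fix h
    have "(%k. x - e k *\<^sub>R h) \<longlonglongrightarrow> x - 0 *\<^sub>R h" by (intro tendsto_intros eL)
    then have "(%k. f (x - e k *\<^sub>R h)) \<longlonglongrightarrow> f x"
     by (intro continuous_on_tendsto_compose[OF c]) auto
    then show "(%k. \<gamma> h * cnj (f (x - e k *\<^sub>R h))) \<longlonglongrightarrow> \<gamma> h * cnj (f x)"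
     by (intro tendsto_intros)
   qed
  qed (use bound in auto)
  then have "(%k. S k x) \<longlonglongrightarrow> C * (LINT h|lborel. \<gamma> h * cnj (f x))"
   unfolding S_def by (intro tendsto_intros)
  then show ?thesis using \<gamma>1 by (simp add: mult.assoc[symmetric])
 qed
 have Sb: "cmod (S k x) <= cmod C * (M * (LINT h|lborel. cmod (\<gamma> h)))" for k x
 proof -
  have "cmod (LINT h|lborel. \<gamma> h * cnj (f (x - e k *\<^sub>R h))) <= (LINT h|lborel. M * cmod (\<gamma> h))"
   by (intro order_trans[OF integral_norm_bound] integral_mono integrable_norm M\<gamma> bound
     Bochner_Integration.integrable_bound[OF M\<gamma>])
    (auto intro!: order_trans[OF bound])
  then show ?thesis by (simp add: S_def norm_mult mult_left_mono)
 qed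
 have lim: "(%k. LINT x|lborel. f x * S k x) \<longlonglongrightarrow> (LINT x|lborel. f x * cnj (f x))"
 proof (rule integral_dominated_convergence)
  show "integrable lborel (%x. cmod (f x) * (cmod C * (M * (LINT h|lborel. cmod (\<gamma> h)))))"
   using f(2) by simp
  show "AE x in lborel. (%k. f x * S k x) \<longlonglongrightarrow> f x * cnj (f x)"
   by (intro AE_I2 tendsto_intros SL)
  show "AE x in lborel. norm (f x * S k x) <= cmod (f x) * (cmod C * (M * (LINT h|lborel. cmod (\<gamma> h))))" for k
   by (auto simp: norm_mult intro!: mult_left_mono Sb)
 qed auto
 let ?F = "fourier_integral f"
 let ?w = "%k (\<xi>::'a). exp (- (norm (e k *\<^sub>R \<xi>))\<^sup>2 / 2) :: real"
 have wi: "integrable lborel (?w k)" for k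
 proof -
  have "integrable lborel (%\<xi>. \<gamma> (0 + e k *\<^sub>R \<xi>))"
   using lborel_integral_affine(2)[of "e k" \<gamma> 0] e0[of k] \<gamma>i by (simp add: less_imp_neq[symmetric])
  from integrable_norm[OF this] show ?thesis by (simp add: \<gamma>_def)
 qed
 have Ji: "integrable lborel (%\<xi>. ?w k \<xi> * (cmod (?F \<xi>))^2)" for k
 proof (rule Bochner_Integration.integrable_bound)
  let ?B = "((2 * pi) powr (- real DIM('a) / 2) * (LINT x|lborel. cmod (f x)))^2"
  show "integrable lborel (%\<xi>. ?w k \<xi> * ?B)" using wi by (rule integrable_mult_left)
  show "AE \<xi> in lborel. norm (?w k \<xi> * (cmod (?F \<xi>))^2) <= norm (?w k \<xi> * ?B)"
  proof (rule AE_I2)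
   fix \<xi>
   have "(cmod (?F \<xi>))^2 <= ?B" by (intro power_mono norm_fourier_integral_le) auto
   then show "norm (?w k \<xi> * (cmod (?F \<xi>))^2) <= norm (?w k \<xi> * ?B)" by simp
  qed
 qed measurable
 have J: "cor (LINT \<xi>|lborel. ?w k \<xi> * (cmod (?F \<xi>))^2) = (LINT x|lborel. f x * S k x)" for k
 proof -
  have "cor (LINT \<xi>|lborel. ?w k \<xi> * (cmod (?F \<xi>))^2)
   = (LINT \<xi>|lborel. ?F \<xi> * (cor (?w k \<xi>) * cnj (?F \<xi>)))"
   unfolding integral_complex_of_real[symmetric] by (intro Bochner_Integration.integral_cong refl)
     (simp add: complex_norm_square mult.left_commute del: of_real_power)
  then show ?thesis
   using gaussian_regularised_plancherel[OF c supp e0[of k]]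
   unfolding S_def C_def \<gamma>_def by simp
 qed
 have "(%k. cor (LINT \<xi>|lborel. ?w k \<xi> * (cmod (?F \<xi>))^2)) \<longlonglongrightarrow> cor ((l2norm f)^2)"
  unfolding J using lim
  by (simp add: l2norm_power2 complex_norm_square[symmetric] flip: integral_complex_of_real of_real_power)
 then have JL: "(%k. LINT \<xi>|lborel. ?w k \<xi> * (cmod (?F \<xi>))^2) \<longlonglongrightarrow> (l2norm f)^2"
  by (simp only: tendsto_of_real_iff)
 have mono: "AE \<xi> in lborel. mono (%k. ?w k \<xi> * (cmod (?F \<xi>))^2)"
 proof (rule AE_I2, rule monoI)
  fix \<xi> :: 'a and i j :: nat assume "i <= j"
  then have "e j <= e i" by (simp add: e_def frac_le)
  then have "norm (e j *\<^sub>R \<xi>) <= norm (e i *\<^sub>R \<xi>)" using e0[of i] e0[of j] by (auto intro!: mult_right_mono)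
  then have "(norm (e j *\<^sub>R \<xi>))^2 <= (norm (e i *\<^sub>R \<xi>))^2" by (intro power_mono) auto
  then show "?w i \<xi> * (cmod (?F \<xi>))^2 <= ?w j \<xi> * (cmod (?F \<xi>))^2"
   by (intro mult_right_mono) auto
 qed
 have pt: "AE \<xi> in lborel. (%k. ?w k \<xi> * (cmod (?F \<xi>))^2) \<longlonglongrightarrow> (cmod (?F \<xi>))^2"
 proof (rule AE_I2)
  fix \<xi> :: 'a
  have "(%k. ?w k \<xi> * (cmod (?F \<xi>))^2) \<longlonglongrightarrow> exp (- (norm (0 *\<^sub>R \<xi>))\<^sup>2 / 2) * (cmod (?F \<xi>))^2"
   by (intro tendsto_intros eL) auto
  then show "(%k. ?w k \<xi> * (cmod (?F \<xi>))^2) \<longlonglongrightarrow> (cmod (?F \<xi>))^2" by simp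
 qed
 have m2: "(%\<xi>. (cmod (?F \<xi>))^2) \<in> borel_measurable lborel" by measurable
 show sq: "L2 ?F"
  using integrable_monotone_convergence(1)[OF Ji mono pt JL m2] by (simp add: square_integrable_def)
 have "(l2norm ?F)^2 = (l2norm f)^2"
  using integral_monotone_convergence[OF Ji mono pt JL m2] by (simp add: l2norm_power2)
 then show "l2norm ?F = l2norm f" by (simp add: power2_eq_iff_nonneg)
qed

text \<open>
  From continuous functions to all square integrable \<open>f\<close> supported in a ball: there \<open>L\<^sup>2\<close>
  convergence implies \<open>L\<^sup>1\<close> convergence, so transforms converge pointwise, and by Fatou also in \<open>L\<^sup>2\<close>.
\<close>

lemma l1_le_l2_cball:
 fixes f :: "'a::euclidean_space => complex"
 assumes f: "L2 f" and supp: "!!x. norm x > R ==> f x = 0"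
 shows "integrable lborel f"
  "(LINT x|lborel. cmod (f x)) <= l2norm (indicator (cball 0 R) :: 'a => complex) * l2norm f"
proof -
 have e: "f x = indicator (cball 0 R) x *\<^sub>R f x" for x using supp[of x] by (auto simp: indicator_def)
 show "integrable lborel f" using integrable_truncation[OF f, of R] by (simp add: e[symmetric])
 have "(%x. cmod (f x)) = (%x. cmod (indicator (cball 0 R) x :: complex) * cmod (f x))"
  using supp by (auto simp: indicator_def fun_eq_iff not_le)
 then show "(LINT x|lborel. cmod (f x)) <= l2norm (indicator (cball 0 R) :: 'a => complex) * l2norm f"
  using Cauchy_Schwarz_abs[OF L2_indicator_cball[of R] f] by (simp only:)
qed

lemma plancherel_bounded_support:
 fixes f :: "'a::euclidean_space => complex"
 assumes f: "L2 f" and supp: "!!x. norm x > R ==> f x = 0"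
 shows "L2 (fourier_integral f)" "l2norm (fourier_integral f) = l2norm f"
proof -
 note [measurable] = L2D(1)[OF f]
 have [measurable]: "fourier_integral f \<in> borel_measurable borel"
  by (rule measurable_fourier_integral) simp
 have "\<exists>g. \<forall>k. continuous_on UNIV (g k) \<and> (\<forall>x. norm x > R + 1 \<longrightarrow> g k x = 0) \<and> l2norm (%x. g k x - f x) < 1 / real (Suc k)"
 proof (rule choice, rule allI)
  fix k :: nat
  show "\<exists>g. continuous_on UNIV g \<and> (\<forall>x. norm x > R + 1 \<longrightarrow> g x = 0) \<and> l2norm (%x. g x - f x) < 1 / real (Suc k)"
   by (rule Cc_dense[OF f supp, where e="1 / real (Suc k)"]) auto
 qed
 then obtain g where cg: "!!k. continuous_on UNIV (g k)" and sg: "!!k x. norm x > R + 1 ==> g k x = 0"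
  and lg: "!!k. l2norm (%x. g k x - f x) < 1 / real (Suc k)" by blast
 have g: "g k \<in> borel_measurable borel" "integrable lborel (g k)" "L2 (g k)" for k
  by (rule continuous_compact_support[OF cg sg], assumption)+
 have supp': "norm x > R + 1 ==> f x = 0" for x by (rule supp) simp
 note fi = l1_le_l2_cball(1)[OF f supp']
 have gL: "(%k. l2norm (%x. g k x - f x)) \<longlonglongrightarrow> 0"
 proof (rule tendsto_sandwich[OF _ _ tendsto_const])
  show "(%k. 1 / real (Suc k)) \<longlonglongrightarrow> 0" by (rule LIMSEQ_Suc[OF lim_1_over_n])
 qed (use lg in \<open>auto intro!: always_eventually less_imp_le\<close>)
 have pw: "(%k. fourier_integral (g k) \<xi>) \<longlonglongrightarrow> fourier_integral f \<xi>" for \<xi>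
 proof (rule Lim_null[THEN iffD2], rule Lim_null_comparison)
  let ?C = "(2 * pi) powr (- real DIM('a) / 2) * l2norm (indicator (cball 0 (R+1)) :: 'a => complex)"
  have "norm (fourier_integral (g k) \<xi> - fourier_integral f \<xi>) <= ?C * l2norm (%x. g k x - f x)" for k
  proof -
   have "norm (fourier_integral (g k) \<xi> - fourier_integral f \<xi>) = norm (fourier_integral (%x. g k x - f x) \<xi>)"
    by (simp add: fourier_integral_diff g fi)
   also have "\<dots> <= (2 * pi) powr (- real DIM('a) / 2) * (LINT x|lborel. cmod (g k x - f x))"
    by (rule norm_fourier_integral_le)
   also have "\<dots> <= (2 * pi) powr (- real DIM('a) / 2) * (l2norm (indicator (cball 0 (R+1)) :: 'a => complex) * l2norm (%x. g k x - f x))"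
    by (intro mult_left_mono l1_le_l2_cball L2_diff g f) (auto simp: sg supp')
   finally show ?thesis by (simp add: mult.assoc)
  qed
  then show "\<forall>\<^sub>F k in sequentially. norm (fourier_integral (g k) \<xi> - fourier_integral f \<xi>) <= ?C * l2norm (%x. g k x - f x)"
   by simp
  show "(%k. ?C * l2norm (%x. g k x - f x)) \<longlonglongrightarrow> 0"
   using tendsto_mult_left[OF gL, of ?C] by simp
 qed
 have Pg: "L2 (fourier_integral (g k))" "l2norm (fourier_integral (g k)) = l2norm (g k)" for k
  by (rule plancherel_Cc[OF cg sg], assumption)+
 have dist: "l2norm (%x. fourier_integral (g i) x - fourier_integral (g j) x) = l2norm (%x. g i x - g j x)" for i j
 proof -
  have "fourier_integral (%x. g i x - g j x) = (%x. fourier_integral (g i) x - fourier_integral (g j) x)"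
   by (rule ext, rule fourier_integral_diff[OF g(2) g(2)])
  then show ?thesis
   using plancherel_Cc(2)[of "%x. g i x - g j x" "R + 1"] cg sg
   by (simp add: continuous_on_diff)
 qed
 have sq: "L2 (%x. fourier_integral (g i) x - fourier_integral f x) \<and>
   l2norm (%x. fourier_integral (g i) x - fourier_integral f x) <= 2 / real (Suc i)" for i
 proof -
  have le: "l2norm (%x. fourier_integral (g i) x - fourier_integral (g j) x) <= 2 / real (Suc i)" if "j >= i" for j
  proof -
   have "l2norm (%x. g i x - g j x) <= l2norm (%x. g i x - f x) + l2norm (%x. f x - g j x)"
    by (intro l2norm_triangle_diff g f)
   also have "\<dots> <= 1 / real (Suc i) + 1 / real (Suc j)"
    using lg[of i] lg[of j] l2norm_minus_commute[of f "g j"] by simp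
   also have "1 / real (Suc j) <= 1 / real (Suc i)" using that by (simp add: frac_le)
   finally show ?thesis by (simp add: dist)
  qed
  have [measurable]: "fourier_integral (g i) \<in> borel_measurable borel"
   by (rule measurable_fourier_integral[OF g(1)])
  have s: "L2 (%x. fourier_integral (g i) x - fourier_integral (g j) x)" for j
   by (intro L2_diff Pg)
  have l: "AE x in lborel. (%j. fourier_integral (g i) x - fourier_integral (g j) x)
    \<longlonglongrightarrow> fourier_integral (g i) x - fourier_integral f x"
   by (intro AE_I2 tendsto_intros pw)
  show ?thesis
   using l2_fatou[OF s _ l le] by simp
 qed
 have "L2 (%x. fourier_integral (g 0) x - (fourier_integral (g 0) x - fourier_integral f x))"
  by (rule L2_diff[OF Pg(1)]) (use sq in auto)
 then show sf: "L2 (fourier_integral f)" by simp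
 have "(%i. l2norm (fourier_integral (g i))) \<longlonglongrightarrow> l2norm (fourier_integral f)"
 proof (rule tendsto_l2norm[OF Pg(1) sf], rule tendsto_sandwich[OF _ _ tendsto_const])
  show "(%k. 2 / real (Suc k)) \<longlonglongrightarrow> 0"
   using tendsto_mult_left[OF LIMSEQ_Suc[OF lim_1_over_n], of "2::real"] by simp
 qed (use sq in auto)
 moreover have "(%i. l2norm (fourier_integral (g i))) \<longlonglongrightarrow> l2norm f"
  unfolding Pg(2) by (rule tendsto_l2norm[OF g(3) f gL])
 ultimately show "l2norm (fourier_integral f) = l2norm f" by (rule LIMSEQ_unique)
qed

lemma fourier_exists:
 fixes f :: "'a::euclidean_space => complex"
 assumes f: "L2 f"
 shows "\<exists>g. is_fourier f g"
proof -
 define tr where "tr R x = indicator (cball 0 R) x *\<^sub>R f x" for R x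
 have st: "L2 (tr R)" for R
  unfolding tr_def by (rule L2_indicator[OF f]) simp
 have trf: "(%x. indicator (cball 0 R) x *\<^sub>R f x) = tr R" for R
  by (simp add: tr_def fun_eq_iff)
 have it: "integrable lborel (tr R)" for R
  unfolding tr_def by (rule integrable_truncation[OF f])
 have d: "l2norm (%x. fourier_integral (tr R) x - fourier_integral (tr R') x) = l2norm (%x. tr R x - tr R' x)" for R R'
 proof -
  have "fourier_integral (%x. tr R x - tr R' x) = (%x. fourier_integral (tr R) x - fourier_integral (tr R') x)"
   by (rule ext, rule fourier_integral_diff[OF it it])
  moreover have "l2norm (fourier_integral (%x. tr R x - tr R' x)) = l2norm (%x. tr R x - tr R' x)"
   by (rule plancherel_bounded_support(2)[OF L2_diff[OF st st], where R="max R R'"])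
    (auto simp: tr_def)
  ultimately show ?thesis by simp
 qed
 have sF: "L2 (fourier_integral (tr R))" for R
  by (rule plancherel_bounded_support(1)[OF st, where R=R]) (auto simp: tr_def)
 have tL: "(%k. l2norm (%x. tr (real k) x - f x)) \<longlonglongrightarrow> 0"
  using truncation_tendsto[OF f] by (simp add: tr_def)
 obtain g where g: "L2 g" and gL: "(%k. l2norm (%x. fourier_integral (tr (real k)) x - g x)) \<longlonglongrightarrow> 0"
 proof (rule l2_complete[of "%k. fourier_integral (tr (real k))"])
  fix e :: real assume "e > 0"
  then have "\<forall>\<^sub>F k in sequentially. l2norm (%x. tr (real k) x - f x) < e / 2"
   using order_tendstoD(2)[OF tL, of "e/2"] by simp
  then obtain M where M: "!!k. k >= M ==> l2norm (%x. tr (real k) x - f x) < e / 2"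
   by (auto simp: eventually_sequentially)
  show "\<exists>M. \<forall>j\<ge>M. \<forall>k\<ge>M. l2norm (%x. fourier_integral (tr (real j)) x - fourier_integral (tr (real k)) x) < e"
  proof (intro exI allI impI)
   fix j k assume "j >= M" "k >= M"
   have "l2norm (%x. tr (real j) x - tr (real k) x) <= l2norm (%x. tr (real j) x - f x) + l2norm (%x. f x - tr (real k) x)"
    by (intro l2norm_triangle_diff st f)
   then show "l2norm (%x. fourier_integral (tr (real j)) x - fourier_integral (tr (real k)) x) < e"
    using M[OF \<open>j >= M\<close>] M[OF \<open>k >= M\<close>] l2norm_minus_commute[of f "tr (real k)"] by (simp add: d)
  qed
 qed (use sF in auto)
 have tR: "((%R. l2norm (%x. tr R x - f x)) \<longlongrightarrow> 0) at_top"
 proof (rule tendstoI)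
  fix e :: real assume "e > 0"
  then have "\<forall>\<^sub>F k in sequentially. l2norm (%x. tr (real k) x - f x) < e"
   using order_tendstoD(2)[OF tL, of e] by simp
  then obtain M where M: "l2norm (%x. tr (real M) x - f x) < e"
   by (auto simp: eventually_sequentially)
  have "l2norm (%x. tr R x - f x) <= l2norm (%x. tr (real M) x - f x)" if "R >= real M" for R
   by (rule l2norm_mono[OF L2_diff[OF st f] _ L2D(1)[OF L2_diff[OF st f]]])
    (use that in \<open>auto simp: tr_def indicator_def\<close>)
  then show "\<forall>\<^sub>F R in at_top. dist (l2norm (%x. tr R x - f x)) 0 < e"
   unfolding eventually_at_top_linorder using M by (intro exI[of _ "real M"]) (auto intro: le_less_trans)
 qed
 have gR: "((%R. l2norm (%x. g x - fourier_integral (tr R) x)) \<longlongrightarrow> 0) at_top"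
 proof (rule tendstoI)
  fix e :: real assume e: "e > 0"
  have "\<forall>\<^sub>F k in sequentially. l2norm (%x. fourier_integral (tr (real k)) x - g x) < e/3 \<and> l2norm (%x. tr (real k) x - f x) < e / 3"
   using order_tendstoD(2)[OF tL, of "e/3"] order_tendstoD(2)[OF gL, of "e/3"] e by (simp add: eventually_conj)
  then obtain k where k: "l2norm (%x. fourier_integral (tr (real k)) x - g x) < e/3" "l2norm (%x. tr (real k) x - f x) < e / 3"
   by (auto simp: eventually_sequentially)
  have ev: "\<forall>\<^sub>F R in at_top. l2norm (%x. tr R x - f x) < e / 3"
   using order_tendstoD(2)[OF tR, of "e/3"] e by simp
  show "\<forall>\<^sub>F R in at_top. dist (l2norm (%x. g x - fourier_integral (tr R) x)) 0 < e"
   using ev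
  proof eventually_elim
   case (elim R)
   have "l2norm (%x. g x - fourier_integral (tr R) x)
    <= l2norm (%x. g x - fourier_integral (tr (real k)) x) + l2norm (%x. fourier_integral (tr (real k)) x - fourier_integral (tr R) x)"
    by (intro l2norm_triangle_diff sF g)
   moreover have "l2norm (%x. tr (real k) x - tr R x) <= l2norm (%x. tr (real k) x - f x) + l2norm (%x. f x - tr R x)"
    by (intro l2norm_triangle_diff st f)
   ultimately show ?case
    using k elim l2norm_minus_commute[of f "tr R"] l2norm_minus_commute[of g "fourier_integral (tr (real k))"] by (simp add: d)
  qed
 qed
 have "((%R. ennreal ((l2norm (%x. g x - fourier_integral (tr R) x))^2)) \<longlongrightarrow> ennreal (0^2)) at_top"
  by (intro tendsto_intros gR)
 then have "is_fourier f g"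
  using g by (simp add: is_fourier_def trf L2_diff sF
   flip: nn_integral_L2)
 then show ?thesis by (rule exI[of "is_fourier f"])
qed

lemma fourier_is_fourier: "L2 f ==> is_fourier f (fourier f)"
 unfolding fourier_def by (rule someI_ex[OF fourier_exists])

lemma L2_fourier: "L2 f ==> L2 (fourier f)"
 using fourier_is_fourier by (auto simp: is_fourier_def)

lemma fourier_truncation:
 fixes f :: "'a::euclidean_space => complex"
 assumes f: "L2 f"
 defines "tr \<equiv> %k x. indicator (cball 0 (real k)) x *\<^sub>R f x"
 shows "L2 (tr k)" "integrable lborel (tr k)"
  "L2 (fourier_integral (tr k))" "l2norm (fourier_integral (tr k)) = l2norm (tr k)"
  "(%k. l2norm (%x. tr k x - f x)) \<longlonglongrightarrow> 0"
  "(%k. l2norm (%x. fourier_integral (tr k) x - fourier f x)) \<longlonglongrightarrow> 0"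
proof -
 show st: "L2 (tr k)" for k
  unfolding tr_def by (rule L2_indicator[OF f]) simp
 show it: "integrable lborel (tr k)"
  unfolding tr_def by (rule integrable_truncation[OF f])
 show sF: "L2 (fourier_integral (tr k))" for k
  by (rule plancherel_bounded_support(1)[OF st, where R="real k"]) (auto simp: tr_def)
 show "l2norm (fourier_integral (tr k)) = l2norm (tr k)"
  by (rule plancherel_bounded_support(2)[OF st, where R="real k"]) (auto simp: tr_def)
 show "(%k. l2norm (%x. tr k x - f x)) \<longlonglongrightarrow> 0"
  using truncation_tendsto[OF f] by (simp add: tr_def)
 have "((%R. \<integral>\<^sup>+\<xi>. ennreal ((cmod (fourier f \<xi> -
       fourier_integral (%x. indicator (cball 0 R) x *\<^sub>R f x) \<xi>))^2) \<partial>lborel)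
    \<longlongrightarrow> 0) at_top"
  using fourier_is_fourier[OF f] by (simp add: is_fourier_def)
 from filterlim_compose[OF this filterlim_real_sequentially]
 have "(%k. \<integral>\<^sup>+\<xi>. ennreal ((cmod (fourier f \<xi> - fourier_integral (tr k) \<xi>))^2) \<partial>lborel) \<longlonglongrightarrow> 0"
  by (simp add: tr_def)
 then have "(%k. ennreal ((l2norm (%x. fourier f x - fourier_integral (tr k) x))^2)) \<longlonglongrightarrow> ennreal 0"
  by (simp add: nn_integral_L2 L2_diff sF L2_fourier f)
 then have "(%k. (l2norm (%x. fourier f x - fourier_integral (tr k) x))^2) \<longlonglongrightarrow> 0"
  by (simp only: tendsto_ennreal_iff[OF always_eventually[OF allI[OF zero_le_power2]]])
 then have "(%k. sqrt ((l2norm (%x. fourier f x - fourier_integral (tr k) x))^2)) \<longlonglongrightarrow> sqrt 0"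
  by (rule tendsto_real_sqrt)
 then show "(%k. l2norm (%x. fourier_integral (tr k) x - fourier f x)) \<longlonglongrightarrow> 0"
  by (simp add: l2norm_minus_commute[of "fourier f"])
qed

theorem plancherel: "L2 f ==> l2norm (fourier f) = l2norm f"
proof -
 assume f: "L2 f"
 note F = fourier_truncation[OF f]
 show ?thesis
  using tendsto_l2norm[OF F(3) L2_fourier[OF f] F(6)] tendsto_l2norm[OF F(1) f F(5)]
  unfolding F(4) by (rule LIMSEQ_unique)
qed

theorem fourier_multiplication:
 assumes f: "L2 f" and g: "L2 g"
 shows "(LINT x|lborel. fourier f x * g x) = (LINT x|lborel. f x * fourier g x)"
proof (rule LIMSEQ_unique)
 note F = fourier_truncation[OF f] and G = fourier_truncation[OF g]
 show "(%k. LINT x|lborel. fourier_integral (%x. indicator (cball 0 (real k)) x *\<^sub>R f x) x * (indicator (cball 0 (real k)) x *\<^sub>R g x))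
   \<longlonglongrightarrow> (LINT x|lborel. fourier f x * g x)"
  by (intro tendsto_l2_pairing L2_fourier F G f g)
 show "(%k. LINT x|lborel. fourier_integral (%x. indicator (cball 0 (real k)) x *\<^sub>R f x) x * (indicator (cball 0 (real k)) x *\<^sub>R g x))
   \<longlonglongrightarrow> (LINT x|lborel. f x * fourier g x)"
  unfolding fourier_integral_multiplication[OF F(2) G(2)]
  by (intro tendsto_l2_pairing L2_fourier F G f g)
qed

text \<open>
  The pointwise limit of the transforms of the truncations is the integral, their \<open>L\<^sup>2\<close> limit is
  the \<open>L\<^sup>2\<close> transform; Fatou identifies the two.
\<close>

lemma fourier_eq_fourier_integral:
 fixes f :: "'a::euclidean_space => complex"
 assumes f: "L2 f" and fi: "integrable lborel f"
 shows "AE x in lborel. fourier f x = fourier_integral f x"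
proof -
 note [measurable] = L2D(1)[OF f] L2D(1)[OF L2_fourier[OF f]]
 have [measurable]: "fourier_integral f \<in> borel_measurable borel"
  by (rule measurable_fourier_integral) simp
 define tr where "tr k x = indicator (cball 0 (real k)) x *\<^sub>R f x" for k x
 note F = fourier_truncation[OF f, folded tr_def]
 have pw: "(%k. fourier_integral (tr k) \<xi>) \<longlonglongrightarrow> fourier_integral f \<xi>" for \<xi>
 proof -
  have "(%k. LINT x|lborel. exp (- \<i> * cor (x \<bullet> \<xi>)) * tr k x) \<longlonglongrightarrow> (LINT x|lborel. exp (- \<i> * cor (x \<bullet> \<xi>)) * f x)"
  proof (rule integral_dominated_convergence[OF _ _ integrable_norm[OF fi]])
   show "AE x in lborel. (%k. exp (- \<i> * cor (x \<bullet> \<xi>)) * tr k x) \<longlonglongrightarrow> exp (- \<i> * cor (x \<bullet> \<xi>)) * f x"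
   proof (rule AE_I2)
    fix x :: 'a
    obtain k0 where "norm x <= real k0" using real_arch_simple by blast
    then have "\<forall>\<^sub>F k in sequentially. exp (- \<i> * cor (x \<bullet> \<xi>)) * f x = exp (- \<i> * cor (x \<bullet> \<xi>)) * tr k x"
     by (auto simp: eventually_sequentially tr_def intro!: exI[of _ k0])
    then show "(%k. exp (- \<i> * cor (x \<bullet> \<xi>)) * tr k x) \<longlonglongrightarrow> exp (- \<i> * cor (x \<bullet> \<xi>)) * f x"
     by (rule Lim_transform_eventually[OF tendsto_const])
   qed
   show "AE x in lborel. norm (exp (- \<i> * cor (x \<bullet> \<xi>)) * tr k x) <= norm (f x)" for k
    by (auto simp: norm_mult tr_def indicator_def simp del: mult_minus_left)
   show "(%x. exp (- \<i> * cor (x \<bullet> \<xi>)) * tr k x) \<in> borel_measurable lborel" for k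
    unfolding tr_def by measurable
  qed measurable
  then show ?thesis unfolding fourier_integral_def by (intro tendsto_intros)
 qed
 have "l2norm (%x. fourier_integral f x - fourier f x) <= e" "L2 (%x. fourier_integral f x - fourier f x)" if "e > 0" for e
 proof -
  have "\<forall>\<^sub>F k in sequentially. l2norm (%x. fourier_integral (tr k) x - fourier f x) < e"
   using order_tendstoD(2)[OF F(6) that] .
  then obtain k0 where k0: "!!k. k >= k0 ==> l2norm (%x. fourier_integral (tr k) x - fourier f x) <= e"
   by (auto simp: eventually_sequentially intro: less_imp_le)
  have l: "AE x in lborel. (%k. fourier_integral (tr k) x - fourier f x) \<longlonglongrightarrow> fourier_integral f x - fourier f x"
   by (intro AE_I2 tendsto_intros pw)
  have s: "L2 (%x. fourier_integral (tr k) x - fourier f x)" for k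
   by (intro L2_diff F L2_fourier f)
  show "l2norm (%x. fourier_integral f x - fourier f x) <= e" "L2 (%x. fourier_integral f x - fourier f x)"
   using l2_fatou[OF s _ l k0] by auto
 qed
 then have "l2norm (%x. fourier_integral f x - fourier f x) = 0" and s: "L2 (%x. fourier_integral f x - fourier f x)"
  using field_le_epsilon[of "l2norm (%x. fourier_integral f x - fourier f x)" 0] l2norm_nonneg[of "%x. fourier_integral f x - fourier f x"]
  by (auto intro: antisym zero_less_one)
 then have "AE x in lborel. fourier_integral f x - fourier f x = 0" by (simp add: l2norm_eq_0)
 then show ?thesis by eventually_elim simp
qed

lemma fourier_unique:
 assumes s: "!!k. L2 (F k)" and "L2 a" "L2 b"
  "(%k. l2norm (%x. F k x - a x)) \<longlonglongrightarrow> 0" "(%k. l2norm (%x. F k x - b x)) \<longlonglongrightarrow> 0"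
 shows "AE x in lborel. a x = b x"
proof -
 have "l2norm (%x. a x - b x) <= l2norm (%x. F k x - a x) + l2norm (%x. F k x - b x)" for k
  using l2norm_triangle_diff[of a "F k" b] assms(1-3) l2norm_minus_commute[of a "F k"] by simp
 then have "l2norm (%x. a x - b x) <= 0 + 0"
  by (intro tendsto_lowerbound[OF tendsto_add[OF assms(4,5)]]) auto
 then have "l2norm (%x. a x - b x) = 0" using l2norm_nonneg[of "%x. a x - b x"] by linarith
 then have "AE x in lborel. a x - b x = 0" using assms(2,3) by (simp add: l2norm_eq_0 L2_diff)
 then show ?thesis by eventually_elim simp
qed

lemma fourier_diff:
 fixes f g :: "'a::euclidean_space => complex"
 assumes f: "L2 f" and g: "L2 g"
 shows "AE x in lborel. fourier (%x. f x - g x) x = fourier f x - fourier g x"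
proof -
 let ?t = "%f k x. indicator (cball 0 (real k)) x *\<^sub>R (f x :: complex)"
 note F = fourier_truncation[OF f] and G = fourier_truncation[OF g]
 note d = L2_diff[OF f g]
 note D = fourier_truncation[OF d]
 have e: "fourier_integral (?t (%x. f x - g x) k) x = fourier_integral (?t f k) x - fourier_integral (?t g k) x" for k x
  using fourier_integral_diff[OF F(2)[of k] G(2)[of k], of x] by (simp add: scaleR_diff_right)
 show ?thesis
 proof (rule fourier_unique[OF D(3) L2_fourier[OF d] _ D(6)])
  show "L2 (%x. fourier f x - fourier g x)"
   by (intro L2_diff L2_fourier f g)
  show "(%k. l2norm (%x. fourier_integral (?t (%x. f x - g x) k) x - (fourier f x - fourier g x))) \<longlonglongrightarrow> 0"
  proof (rule tendsto_sandwich[OF _ _ tendsto_const])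
   show "(%k. l2norm (%x. fourier_integral (?t f k) x - fourier f x) + l2norm (%x. fourier_integral (?t g k) x - fourier g x)) \<longlonglongrightarrow> 0"
    using tendsto_add[OF F(6) G(6)] by simp
   have "l2norm (%x. fourier_integral (?t (%x. f x - g x) k) x - (fourier f x - fourier g x))
    <= l2norm (%x. fourier_integral (?t f k) x - fourier f x) + l2norm (%x. fourier_integral (?t g k) x - fourier g x)" for k
   proof -
    have "(%x. fourier_integral (?t (%x. f x - g x) k) x - (fourier f x - fourier g x))
     = (%x. (fourier_integral (?t f k) x - fourier f x) + - (fourier_integral (?t g k) x - fourier g x))"
     by (rule ext) (simp only: e, simp)
    then show ?thesis
     using l2norm_triangle[OF L2_diff[OF F(3)[of k] L2_fourier[OF f]]
       L2_uminus[OF L2_diff[OF G(3)[of k] L2_fourier[OF g]]]]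
     by (simp only: l2norm_uminus)
   qed
   then show "\<forall>\<^sub>F k in sequentially. l2norm (%x. fourier_integral (?t (%x. f x - g x) k) x - (fourier f x - fourier g x))
    <= l2norm (%x. fourier_integral (?t f k) x - fourier f x) + l2norm (%x. fourier_integral (?t g k) x - fourier g x)" by simp
  qed simp
 qed
qed

lemma fourier_cmult:
 fixes f :: "'a::euclidean_space => complex"
 assumes f: "L2 f"
 shows "AE x in lborel. fourier (%x. c * f x) x = c * fourier f x"
proof -
 let ?t = "%f k x. indicator (cball 0 (real k)) x *\<^sub>R (f x :: complex)"
 note F = fourier_truncation[OF f]
 note d = L2_cmult[OF f, of c]
 note D = fourier_truncation[OF d]
 have e: "fourier_integral (?t (%x. c * f x) k) x = c * fourier_integral (?t f k) x" for k x
  using fourier_integral_cmult[of c "?t f k" x] by simp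
 show ?thesis
 proof (rule fourier_unique[OF D(3) L2_fourier[OF d] _ D(6)])
  show "L2 (%x. c * fourier f x)"
   by (intro L2_cmult L2_fourier f)
  have "(%k. cmod c * l2norm (%x. fourier_integral (?t f k) x - fourier f x)) \<longlonglongrightarrow> cmod c * 0"
   by (intro tendsto_intros F)
  then show "(%k. l2norm (%x. fourier_integral (?t (%x. c * f x) k) x - c * fourier f x)) \<longlonglongrightarrow> 0"
   by (simp add: e right_diff_distrib[symmetric] l2norm_cmult)
 qed
qed

lemma fourier_cong_AE:
 assumes "L2 f" "L2 g" "AE x in lborel. f x = g x"
 shows "AE x in lborel. fourier f x = fourier g x"
proof -
 have "l2norm (%x. f x - g x) = 0"
  using assms by (subst l2norm_eq_0) (auto intro: L2_diff)
 then have "AE x in lborel. fourier (%x. f x - g x) x = 0"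
  using plancherel[OF L2_diff[OF assms(1,2)]] L2_fourier[OF L2_diff[OF assms(1,2)]]
  by (simp add: l2norm_eq_0)
 then show ?thesis using fourier_diff[OF assms(1,2)] by eventually_elim simp
qed

lemma fourier_inj_AE:
 assumes "L2 f" "L2 g" "AE x in lborel. fourier f x = fourier g x"
 shows "AE x in lborel. f x = g x"
proof -
 have "AE x in lborel. fourier (%x. f x - g x) x = 0"
  using assms(3) fourier_diff[OF assms(1,2)] by eventually_elim simp
 then have "l2norm (fourier (%x. f x - g x)) = 0"
  using L2_fourier[OF L2_diff[OF assms(1,2)]] by (simp add: l2norm_eq_0)
 then have "l2norm (%x. f x - g x) = 0"
  using plancherel[OF L2_diff[OF assms(1,2)]] by simp
 then have "AE x in lborel. f x - g x = 0"
  using assms by (simp add: l2norm_eq_0 L2_diff)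
 then show ?thesis by eventually_elim simp
qed

text \<open>
  The adjoint \<open>g \<mapsto> cnj (F (cnj g))\<close> of the isometry \<open>F\<close> is itself an isometry, so
  \<open>\<parallel>F f - g\<parallel>\<^sup>2 = \<parallel>f\<parallel>\<^sup>2 + \<parallel>g\<parallel>\<^sup>2 - 2 Re \<langle>F f, g\<rangle> = 0\<close> for \<open>f\<close> the image of \<open>g\<close> under the adjoint.
\<close>

definition inverse_fourier :: "('a::euclidean_space => complex) => 'a => complex" where
 "inverse_fourier g x = cnj (fourier (%\<xi>. cnj (g \<xi>)) x)"

lemma L2_inverse_fourier:
 "L2 g ==> L2 (inverse_fourier g)"
 unfolding inverse_fourier_def[abs_def]
 by (intro L2_cnj L2_fourier)

theorem fourier_inverse_fourier:
 assumes g: "L2 g"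
 shows "AE x in lborel. fourier (inverse_fourier g) x = g x"
proof -
 let ?f = "inverse_fourier g"
 note f = L2_inverse_fourier[OF g]
 note Ff = L2_fourier[OF f]
 have lf: "l2norm ?f = l2norm g"
  unfolding inverse_fourier_def[abs_def] by (simp add: plancherel L2_cnj g)
 have "(LINT x|lborel. fourier ?f x * cnj (g x)) = (LINT x|lborel. ?f x * cnj (?f x))"
  using fourier_multiplication[OF f L2_cnj[OF g]] by (simp add: inverse_fourier_def)
 also have "\<dots> = cor ((l2norm g)^2)"
  by (simp add: lf[symmetric] l2norm_power2 complex_norm_square[symmetric] flip: integral_complex_of_real of_real_power)
 finally have pair: "(LINT x|lborel. fourier ?f x * cnj (g x)) = cor ((l2norm g)^2)" .
 have i: "integrable lborel (%x. fourier ?f x * cnj (g x))"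
  by (intro L2_mult_integrable Ff L2_cnj g)
 have "(cmod (a - b))^2 = (cmod a)^2 - 2 * Re (a * cnj b) + (cmod b)^2" for a b :: complex
  by (simp add: cmod_power2 power2_diff algebra_simps)
 then have "(l2norm (%x. fourier ?f x - g x))^2
   = (LINT x|lborel. (cmod (fourier ?f x))^2 - 2 * Re (fourier ?f x * cnj (g x)) + (cmod (g x))^2)"
  by (simp add: l2norm_power2)
 also have "\<dots> = (l2norm (fourier ?f))^2 - 2 * (LINT x|lborel. Re (fourier ?f x * cnj (g x))) + (l2norm g)^2"
  using i L2D(2)[OF Ff] L2D(2)[OF g]
  by (subst Bochner_Integration.integral_add; (subst Bochner_Integration.integral_diff)?)
   (auto simp: l2norm_power2 simp del: times_complex.sel)
 also have "(LINT x|lborel. Re (fourier ?f x * cnj (g x))) = (l2norm g)^2"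
  using pair by (simp only: integral_Re[OF i] Re_complex_of_real)
 finally have "l2norm (%x. fourier ?f x - g x) = 0" by (simp add: plancherel[OF f] lf)
 then have "AE x in lborel. fourier ?f x - g x = 0"
  by (simp add: l2norm_eq_0 L2_diff Ff g)
 then show ?thesis by eventually_elim simp
qed

theorem parseval_bilinear:
 assumes f: "L2 f" and g: "L2 g"
 shows "(LINT x|lborel. f x * g x) = (LINT \<xi>|lborel. fourier f \<xi> * inverse_fourier g \<xi>)"
proof -
 note [measurable] = L2D(1)[OF f] L2D(1)[OF g]
  L2D(1)[OF L2_fourier[OF L2_inverse_fourier[OF g]]]
 have "(LINT x|lborel. f x * g x) = (LINT x|lborel. f x * fourier (inverse_fourier g) x)"
 proof (rule integral_cong_AE)
  show "AE x in lborel. f x * g x = f x * fourier (inverse_fourier g) x"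
   using fourier_inverse_fourier[OF g] by eventually_elim simp
 qed measurable
 then show ?thesis
  using fourier_multiplication[OF f L2_inverse_fourier[OF g]] by simp
qed

section \<open>Smooth functions\<close>

lemma has_vector_derivative_iff_tendsto:
 "(f has_vector_derivative v) (at t within S) \<longleftrightarrow> ((%s. (f s - f t) /\<^sub>R (s - t)) \<longlongrightarrow> v) (at t within S)"
proof -
 have "(f has_vector_derivative v) (at t within S)
   \<longleftrightarrow> ((%s. norm ((f s - f t) - (s - t) *\<^sub>R v) / norm (s - t)) \<longlongrightarrow> 0) (at t within S)"
  by (simp add: has_vector_derivative_def has_derivative_iff_norm bounded_linear_scaleR_left)
 also have "\<dots> \<longleftrightarrow> ((%s. norm ((f s - f t) /\<^sub>R (s - t) - v)) \<longlongrightarrow> 0) (at t within S)"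
 proof (rule filterlim_cong[OF refl refl])
  have "norm ((f s - f t) - (s - t) *\<^sub>R v) / norm (s - t) = norm ((f s - f t) /\<^sub>R (s - t) - v)" if "s \<noteq> t" for s
  proof -
   have "(f s - f t) - (s - t) *\<^sub>R v = (s - t) *\<^sub>R ((f s - f t) /\<^sub>R (s - t) - v)"
    using that by (simp add: scaleR_diff_right)
   then show ?thesis using that by (simp only: norm_scaleR) simp
  qed
  then show "\<forall>\<^sub>F s in at t within S. norm ((f s - f t) - (s - t) *\<^sub>R v) / norm (s - t) = norm ((f s - f t) /\<^sub>R (s - t) - v)"
   by (auto simp: eventually_at_filter)
 qed
 also have "\<dots> \<longleftrightarrow> ((%s. (f s - f t) /\<^sub>R (s - t)) \<longlongrightarrow> v) (at t within S)"
  by (simp add: tendsto_norm_zero_iff Lim_null[symmetric])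
 finally show ?thesis .
qed

lemma partial_deriv_eq:
 "(f has_derivative f') (at x) ==> partial_deriv b f x = f' b"
 unfolding partial_deriv_def using frechet_derivative_at by metis

lemma differentiable_partial_deriv:
 "f differentiable (at x) ==> (f has_derivative (%v. frechet_derivative f (at x) v)) (at x)"
 using frechet_derivative_works by blast

lemma C_diff_coinduct:
 assumes step: "!!f x. P f ==> f differentiable (at x)"
  and closed: "!!f b. P f ==> b \<in> Basis ==> P (partial_deriv b f)" and "P f"
 shows "C_diff k f"
 using \<open>P f\<close>
proof (induction k arbitrary: f)
 case 0
 then show ?case
  by (auto simp: continuous_on_eq_continuous_at intro!: differentiable_imp_continuous_within step)
qed (use step closed in auto)

lemma C_diff_Suc_imp: "C_diff (Suc k) f ==> C_diff k f"
proof (induction k arbitrary: f)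
 case 0
 then show ?case
  by (auto simp: continuous_on_eq_continuous_at intro!: differentiable_imp_continuous_within)
qed auto

lemma C_diff_add:
 "C_diff k f ==> C_diff k g ==> C_diff k (%x. f x + g x)"
proof (induction k arbitrary: f g)
 case 0
 then show ?case by (auto intro: continuous_on_add)
next
 case (Suc k)
 have "partial_deriv b (%x. f x + g x) = (%x. partial_deriv b f x + partial_deriv b g x)" for b
  using Suc.prems by (auto simp: fun_eq_iff partial_deriv_def[of _ f] partial_deriv_def[of _ g]
    intro!: partial_deriv_eq has_derivative_add differentiable_partial_deriv)
 then show ?case using Suc by (auto intro: differentiable_add)
qed

lemma partial_deriv_mult:
 assumes "f differentiable (at x)" "g differentiable (at x)"
 shows "partial_deriv b (%x. f x * g x) x = f x * partial_deriv b g x + partial_deriv b f x * g x"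
 using assms by (auto simp: partial_deriv_def[of _ f] partial_deriv_def[of _ g]
    intro!: partial_deriv_eq has_derivative_mult[THEN has_derivative_eq_rhs] differentiable_partial_deriv)

lemma C_diff_mult:
 "C_diff k f ==> C_diff k g ==> C_diff k (%x. f x * g x)"
proof (induction k arbitrary: f g)
 case 0
 then show ?case by (auto intro: continuous_on_mult)
next
 case (Suc k)
 have "partial_deriv b (%x. f x * g x) = (%x. f x * partial_deriv b g x + partial_deriv b f x * g x)" for b
  using Suc.prems by (auto intro!: partial_deriv_mult)
 moreover have "C_diff k f" "C_diff k g" using Suc.prems by (auto intro: C_diff_Suc_imp)
 ultimately show ?case using Suc by (auto intro: differentiable_mult C_diff_add)
qed

lemma C_diff_const: "C_diff k (%x. c)"
proof (rule C_diff_coinduct[where P="%f. \<exists>c. f = (%x. c)"])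
 show "\<exists>c'. partial_deriv b f = (%x. c')" if "\<exists>c. f = (%x. c)" for f :: "'a => complex" and b
  using that by (auto simp: fun_eq_iff intro!: exI[of _ 0] partial_deriv_eq has_derivative_const[THEN has_derivative_eq_rhs])
qed auto

lemma C_diff_linear: "C_diff k (%x. cor (c * (x \<bullet> b)))"
proof (cases k)
 case 0 then show ?thesis by (auto intro!: continuous_intros)
next
 case (Suc j)
 have d: "((%x. cor (c * (x \<bullet> b))) has_derivative (%v. cor (c * (v \<bullet> b)))) (at x)" for x
  by (auto intro!: derivative_eq_intros)
 then have "partial_deriv b' (%x. cor (c * (x \<bullet> b))) = (%x. cor (c * (b' \<bullet> b)))" for b'
  by (intro ext partial_deriv_eq)
 then show ?thesis using d unfolding Suc by (auto simp: differentiable_def C_diff_const intro!: exI)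
qed

lemma C_diff_cnj: 
 assumes "C_diff k f" shows "C_diff k (%x. cnj (f x))" 
 using assms
proof (induction k arbitrary: f)
 case 0
 then show ?case by (auto intro: continuous_on_cnj)
next
 case (Suc k)
 have d: "((%x. cnj (f x)) has_derivative (%v. cnj (frechet_derivative f (at x) v))) (at x)" for x
  using Suc.prems by (intro has_derivative_cnj differentiable_partial_deriv) auto
 then have "partial_deriv b (%x. cnj (f x)) = (%x. cnj (partial_deriv b f x))" for b
  by (intro ext) (simp add: partial_deriv_eq[OF d] partial_deriv_def)
 then show ?case using Suc d by (auto simp: differentiable_def intro!: exI)
qed

lemma partial_deriv_cnj:
 assumes "f differentiable (at x)"
 shows "partial_deriv b (%x. cnj (f x)) x = cnj (partial_deriv b f x)"
 unfolding partial_deriv_def[of b f]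
 by (rule partial_deriv_eq) (intro has_derivative_cnj differentiable_partial_deriv assms)

lemma test_function_facts:
 assumes "test_function \<phi>"
 shows "\<phi> differentiable (at x)" "continuous_on UNIV \<phi>" "\<phi> \<in> borel_measurable borel"
  "integrable lborel \<phi>" "L2 \<phi>" "\<exists>M. \<forall>x. cmod (\<phi> x) <= M"
proof -
 show c: "continuous_on UNIV \<phi>" using assms unfolding test_function_def by (metis C_diff.simps(1))
 show "\<phi> differentiable (at x)" using assms unfolding test_function_def by (metis C_diff.simps(2))
 obtain R where "\<forall>x. norm x > R \<longrightarrow> \<phi> x = 0" using assms unfolding test_function_def by blast
 then have s: "!!x. norm x > R ==> \<phi> x = 0" by blast
 show "\<phi> \<in> borel_measurable borel" "integrable lborel \<phi>" "L2 \<phi>" "\<exists>M. \<forall>x. cmod (\<phi> x) <= M"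
  by (rule continuous_compact_support[OF c s], assumption)+
qed

lemma test_function_partial_deriv:
 assumes \<phi>: "test_function \<phi>" and b: "b \<in> Basis"
 shows "test_function (partial_deriv b \<phi>)"
proof -
 obtain R where R: "!!x. norm x > R ==> \<phi> x = 0" using \<phi> unfolding test_function_def by blast
 have "partial_deriv b \<phi> x = 0" if "norm x > R" for x
 proof (rule partial_deriv_eq)
  have op: "open {x::'a. norm x > R}" by (intro open_Collect_less continuous_intros)
  show "(\<phi> has_derivative (%v. 0)) (at x)"
   by (rule has_derivative_transform_within_open[OF has_derivative_const[of 0] op]) (use that R in auto)
 qed
 moreover have "C_diff k (partial_deriv b \<phi>)" for k
  using \<phi> b unfolding test_function_def by (metis C_diff.simps(2))
 ultimately show ?thesis unfolding test_function_def by blast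
qed

lemma test_function_cnj: "test_function \<phi> ==> test_function (%x. cnj (\<phi> x))"
 unfolding test_function_def using C_diff_cnj by auto

lemma test_function_mult:
 "test_function \<eta> ==> (!!k. C_diff k \<psi>) ==> test_function (%x. \<eta> x * \<psi> x)"
 unfolding test_function_def using C_diff_mult by fastforce

lemma test_function_sum:
 assumes "finite A" "!!a. a \<in> A ==> test_function (f a)"
 shows "test_function (%x. \<Sum>a\<in>A. f a x)"
 using assms
proof (induction A rule: finite_induct)
 case empty
 show ?case by (simp add: test_function_def C_diff_const)
next
 case (insert a A)
 obtain R R' where "!!x. norm x > R ==> f a x = 0" "!!x. norm x > R' ==> (\<Sum>a\<in>A. f a x) = 0"
  using insert unfolding test_function_def by fastforce
 then have "\<exists>R. \<forall>x. norm x > R \<longrightarrow> f a x + (\<Sum>a\<in>A. f a x) = 0"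
  by (intro exI[of _ "max R R'"]) auto
 moreover have "C_diff k (%x. f a x + (\<Sum>a\<in>A. f a x))" for k
  using insert unfolding test_function_def by (intro C_diff_add) auto
 ultimately show ?case using insert.hyps by (simp add: test_function_def)
qed

lemma test_function_laplacian: "test_function \<phi> ==> test_function (laplacian \<phi>)"
 unfolding laplacian_def[abs_def]
 by (intro test_function_sum finite_Basis test_function_partial_deriv)

lemma test_function_directional:
 assumes \<phi>: "test_function \<phi>"
 shows "((%t. \<phi> (x + t *\<^sub>R b)) has_vector_derivative partial_deriv b \<phi> (x + t *\<^sub>R b)) (at t)"
proof -
 have 1: "((%t. x + t *\<^sub>R b) has_derivative (%s. s *\<^sub>R b)) (at t)"
  by (auto intro!: derivative_eq_intros)
 have 2: "(\<phi> has_derivative frechet_derivative \<phi> (at (x + t *\<^sub>R b))) (at (x + t *\<^sub>R b))"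
  by (rule differentiable_partial_deriv[OF test_function_facts(1)[OF \<phi>]])
 interpret bounded_linear "frechet_derivative \<phi> (at (x + t *\<^sub>R b))"
  using 2 by (rule has_derivative_bounded_linear)
 show ?thesis
  using diff_chain_at[OF 1 2]
  by (simp add: has_vector_derivative_def o_def partial_deriv_def scaleR)
qed

text \<open>
  The transform turns difference quotients into multiplication by \<open>(exp(\<i>t\<xi>\<^sub>b) - 1)/t\<close>; let \<open>t\<close>
  tend to zero on both sides.
\<close>

lemma fourier_integral_partial_deriv:
 fixes \<phi> :: "'a::euclidean_space => complex"
 assumes \<phi>: "test_function \<phi>" and b: "b \<in> Basis"
 shows "fourier_integral (partial_deriv b \<phi>) \<xi> = \<i> * cor (\<xi> \<bullet> b) * fourier_integral \<phi> \<xi>"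
proof -
 note [measurable] = test_function_facts(3)[OF \<phi>] test_function_facts(3)[OF test_function_partial_deriv[OF \<phi> b]]
 note \<phi>i = test_function_facts(4)[OF \<phi>]
 obtain M where M: "!!x. cmod (partial_deriv b \<phi> x) <= M"
  using test_function_facts(6)[OF test_function_partial_deriv[OF \<phi> b]] by blast
 obtain R where R: "!!x. norm x > R ==> \<phi> x = 0" using \<phi> unfolding test_function_def by blast
 define t where "t n = 1 / real (Suc n)" for n
 have t0: "0 < t n" "t n <= 1" for n by (simp_all add: t_def)
 have tL: "filterlim t (at 0) sequentially"
 proof -
  have "t \<longlonglongrightarrow> 0" unfolding t_def by (rule LIMSEQ_Suc[OF lim_1_over_n])
  then show ?thesis
   unfolding filterlim_at using t0(1) by (auto simp: less_imp_neq[symmetric] intro!: always_eventually)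
 qed
 define K where "K x = exp (- \<i> * cor (x \<bullet> \<xi>))" for x :: 'a
 have Km[measurable]: "K \<in> borel_measurable borel" unfolding K_def by measurable
 have K1: "cmod (K x) = 1" for x unfolding K_def by (rule norm_exp_imag)
 define Q where "Q n x = (\<phi> (x + t n *\<^sub>R b) - \<phi> x) / cor (t n)" for n x
 have Qb: "cmod (Q n x) <= M * indicator (cball 0 (R + 1)) x" for n x
 proof (cases "norm x > R + 1")
  case True
  have "norm x <= norm (x + t n *\<^sub>R b) + norm (t n *\<^sub>R b)" by (metis add_diff_cancel norm_triangle_ineq4)
  also have "norm (t n *\<^sub>R b) <= 1" using b t0[of n] by (simp)
  finally have "norm (x + t n *\<^sub>R b) > R" using True by simp
  then show ?thesis using R[of x] R[of "x + t n *\<^sub>R b"] True by (simp add: Q_def)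
 next
  case False
  have "\<exists>s\<in>{0<..<t n}. norm (\<phi> (x + t n *\<^sub>R b) - \<phi> (x + 0 *\<^sub>R b)) <= norm ((t n - 0) *\<^sub>R partial_deriv b \<phi> (x + s *\<^sub>R b))"
  proof (rule mvt_general)
   show "continuous_on {0..t n} (%t. \<phi> (x + t *\<^sub>R b))"
    by (intro continuous_on_compose2[OF test_function_facts(2)[OF \<phi>]] continuous_intros) auto
  qed (use t0 test_function_directional[OF \<phi>, of x b] in \<open>auto simp: has_vector_derivative_def\<close>)
  then obtain s where "norm (\<phi> (x + t n *\<^sub>R b) - \<phi> x) <= t n * norm (partial_deriv b \<phi> (x + s *\<^sub>R b))"
   using t0[of n] by auto
  also have "\<dots> <= t n * M" using M t0[of n] by (intro mult_left_mono) (auto intro: less_imp_le)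
  finally show ?thesis using False t0[of n] by (simp add: Q_def norm_divide field_simps)
 qed
 have QL: "(%n. Q n x) \<longlonglongrightarrow> partial_deriv b \<phi> x" for x
 proof -
  have "((%s. (\<phi> (x + s *\<^sub>R b) - \<phi> (x + 0 *\<^sub>R b)) /\<^sub>R (s - 0)) \<longlongrightarrow> partial_deriv b \<phi> (x + 0 *\<^sub>R b)) (at 0)"
   using test_function_directional[OF \<phi>, of x b 0] unfolding has_vector_derivative_iff_tendsto .
  from filterlim_compose[OF this tL] show ?thesis
   by (simp add: Q_def scaleR_conv_of_real divide_inverse mult.commute)
 qed
 have "(%n. LINT x|lborel. K x * Q n x) \<longlonglongrightarrow> (LINT x|lborel. K x * partial_deriv b \<phi> x)"
 proof (rule integral_dominated_convergence)
  show "integrable lborel (%x::'a. M * indicator (cball 0 (R + 1)) x)"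
   by (intro integrable_mult_right integrable_real_indicator)
    (auto simp: emeasure_bounded_finite[unfolded infinity_ennreal_def])
  show "(%x. K x * Q n x) \<in> borel_measurable lborel" for n unfolding Q_def by measurable
 qed (auto simp: norm_mult K1 Qb intro!: tendsto_intros QL)
 moreover have "(LINT x|lborel. K x * Q n x) = (exp (\<i> * cor (t n * (\<xi> \<bullet> b))) - 1) / cor (t n) * (LINT x|lborel. K x * \<phi> x)" for n
 proof -
  have i1: "integrable lborel (%x. K x * \<phi> x)" unfolding K_def by (rule integrable_fourier_kernel[OF \<phi>i])
  have e: "K x * \<phi> (x + t n *\<^sub>R b) = exp (\<i> * cor (t n * (\<xi> \<bullet> b))) * (K (t n *\<^sub>R b + 1 *\<^sub>R x) * \<phi> (t n *\<^sub>R b + 1 *\<^sub>R x))" for x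
  proof -
   have "K (t n *\<^sub>R b + 1 *\<^sub>R x) = exp (- (\<i> * cor (t n * (\<xi> \<bullet> b)))) * K x"
    unfolding K_def exp_add[symmetric] by (simp add: inner_add_left inner_commute[of b] distrib_left)
   then show ?thesis by (simp add: mult.assoc[symmetric] exp_minus_inverse add.commute del: of_real_mult)
  qed
  have "integrable lborel (%x. K (t n *\<^sub>R b + 1 *\<^sub>R x) * \<phi> (t n *\<^sub>R b + 1 *\<^sub>R x))"
   using lborel_integral_affine(2)[of 1 "%x. K x * \<phi> x" "t n *\<^sub>R b"] i1 by simp
  then have i2: "integrable lborel (%x. K x * \<phi> (x + t n *\<^sub>R b))"
   unfolding e by (rule integrable_mult_right)
  have "(LINT x|lborel. K x * \<phi> (x + t n *\<^sub>R b)) = exp (\<i> * cor (t n * (\<xi> \<bullet> b))) * (LINT x|lborel. K x * \<phi> x)"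
   using lborel_integral_affine(1)[of 1 "%x. K x * \<phi> x" "t n *\<^sub>R b"]
   unfolding e by simp
  moreover have "(LINT x|lborel. K x * Q n x) = ((LINT x|lborel. K x * \<phi> (x + t n *\<^sub>R b)) - (LINT x|lborel. K x * \<phi> x)) / cor (t n)"
   using i1 i2 by (simp add: Q_def right_diff_distrib flip: Bochner_Integration.integral_diff)
  ultimately show ?thesis by (simp add: field_simps)
 qed
 moreover have "(%n. (exp (\<i> * cor (t n * (\<xi> \<bullet> b))) - 1) / cor (t n)) \<longlonglongrightarrow> \<i> * cor (\<xi> \<bullet> b)"
 proof -
  have "((%z. exp (\<i> * cor (\<xi> \<bullet> b) * z)) has_field_derivative \<i> * cor (\<xi> \<bullet> b)) (at 0)"
   by (auto intro!: derivative_eq_intros)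
  then have 1: "((%z. (exp (\<i> * cor (\<xi> \<bullet> b) * z) - 1) / z) \<longlongrightarrow> \<i> * cor (\<xi> \<bullet> b)) (at 0)"
   by (simp add: has_field_derivative_iff)
  have "filterlim (%n. cor (t n)) (at 0) sequentially"
   using tL unfolding filterlim_at by (auto intro!: tendsto_of_real[of _ 0, simplified])
  from filterlim_compose[OF 1 this] show ?thesis by (simp add: ac_simps)
 qed
 then have "(%n. (exp (\<i> * cor (t n * (\<xi> \<bullet> b))) - 1) / cor (t n) * (LINT x|lborel. K x * \<phi> x))
   \<longlonglongrightarrow> \<i> * cor (\<xi> \<bullet> b) * (LINT x|lborel. K x * \<phi> x)"
  by (rule tendsto_mult_right)
 ultimately have "(LINT x|lborel. K x * partial_deriv b \<phi> x) = \<i> * cor (\<xi> \<bullet> b) * (LINT x|lborel. K x * \<phi> x)"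
  by (simp only: LIMSEQ_unique)
 then show ?thesis by (simp add: fourier_integral_def K_def)
qed

lemma inverse_fourier_partial_deriv:
 assumes \<phi>: "test_function \<phi>" and b: "b \<in> Basis"
 shows "AE \<xi> in lborel. inverse_fourier (partial_deriv b \<phi>) \<xi> = - \<i> * cor (\<xi> \<bullet> b) * inverse_fourier \<phi> \<xi>"
proof -
 note c = test_function_cnj[OF \<phi>]
 have e: "(%x. cnj (partial_deriv b \<phi> x)) = partial_deriv b (%x. cnj (\<phi> x))"
  by (rule ext) (simp add: partial_deriv_cnj test_function_facts(1)[OF \<phi>])
 show ?thesis
  using fourier_eq_fourier_integral[OF test_function_facts(5,4)[OF c]]
   fourier_eq_fourier_integral[OF test_function_facts(5,4)[OF test_function_partial_deriv[OF c b]]]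
 proof eventually_elim
  case (elim \<xi>)
  then show ?case
   by (simp add: inverse_fourier_def e fourier_integral_partial_deriv[OF c b])
 qed
qed

lemma fourier_add:
 assumes f: "L2 f" and g: "L2 g"
 shows "AE x in lborel. fourier (%x. f x + g x) x = fourier f x + fourier g x"
 using fourier_diff[OF f L2_cmult[OF g, of "-1"]] fourier_cmult[OF g, of "-1"]
 by eventually_elim simp

lemma fourier_sum:
 assumes "finite A" "!!a. a \<in> A ==> L2 (f a)"
 shows "L2 (%x. \<Sum>a\<in>A. f a x) \<and> (AE x in lborel. fourier (%x. \<Sum>a\<in>A. f a x) x = (\<Sum>a\<in>A. fourier (f a) x))"
 using assms
proof (induction A rule: finite_induct)
 case empty
 have "AE x in lborel. fourier (%x. 0) x = 0"
  using fourier_cmult[of "%x. 0" 0] by simp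
 then show ?case by simp
next
 case (insert a A)
 then have s: "L2 (%x. \<Sum>a\<in>A. f a x)" "L2 (f a)"
  and ae: "AE x in lborel. fourier (%x. \<Sum>a\<in>A. f a x) x = (\<Sum>a\<in>A. fourier (f a) x)" by auto
 have "AE x in lborel. fourier (%x. f a x + (\<Sum>a\<in>A. f a x)) x = fourier (f a) x + (\<Sum>a\<in>A. fourier (f a) x)"
  using fourier_add[OF s(2,1)] ae by eventually_elim simp
 then show ?case using insert.hyps L2_add[OF s(2,1)] by simp
qed

lemma inverse_fourier_laplacian:
 assumes \<phi>: "test_function \<phi>"
 shows "AE \<xi> in lborel. inverse_fourier (laplacian \<phi>) \<xi> = - cor ((norm \<xi>)^2) * inverse_fourier \<phi> \<xi>"
proof -
 let ?d = "%b. partial_deriv b (partial_deriv b \<phi>)"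
 have t: "test_function (?d b)" if "b \<in> Basis" for b
  by (intro test_function_partial_deriv \<phi> that)
 have e: "(%x. cnj (laplacian \<phi> x)) = (%x. \<Sum>b\<in>Basis. cnj (?d b x))"
  by (simp add: laplacian_def)
 have "AE \<xi> in lborel. fourier (%x. cnj (laplacian \<phi> x)) \<xi> = (\<Sum>b\<in>Basis. fourier (%x. cnj (?d b x)) \<xi>)"
  unfolding e using fourier_sum[of Basis "%b x. cnj (?d b x)"] t
  by (auto intro: L2_cnj test_function_facts)
 moreover have "AE \<xi> in lborel. \<forall>b\<in>Basis. inverse_fourier (?d b) \<xi> = - \<i> * cor (\<xi> \<bullet> b) * (- \<i> * cor (\<xi> \<bullet> b) * inverse_fourier \<phi> \<xi>)"
 proof (rule AE_finite_allI)
  fix b :: 'a assume b: "b \<in> Basis"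
  show "AE \<xi> in lborel. inverse_fourier (?d b) \<xi> = - \<i> * cor (\<xi> \<bullet> b) * (- \<i> * cor (\<xi> \<bullet> b) * inverse_fourier \<phi> \<xi>)"
   using inverse_fourier_partial_deriv[OF \<phi> b] inverse_fourier_partial_deriv[OF test_function_partial_deriv[OF \<phi> b] b]
   by eventually_elim (simp only:)
 qed simp
 ultimately show ?thesis
 proof eventually_elim
  case (elim \<xi>)
  have "inverse_fourier (laplacian \<phi>) \<xi> = (\<Sum>b\<in>Basis. inverse_fourier (?d b) \<xi>)"
   using elim(1) by (simp add: inverse_fourier_def)
  also have "\<dots> = (\<Sum>b\<in>Basis. - cor ((\<xi> \<bullet> b) * (\<xi> \<bullet> b)) * inverse_fourier \<phi> \<xi>)"
  proof (intro sum.cong refl)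
   fix b :: 'a assume "b \<in> Basis"
   have alg: "- \<i> * c * (- \<i> * c * w) = (\<i> * \<i>) * (c * c) * w" for c w :: complex by algebra
   show "inverse_fourier (?d b) \<xi> = - cor ((\<xi> \<bullet> b) * (\<xi> \<bullet> b)) * inverse_fourier \<phi> \<xi>"
    using elim(2) \<open>b \<in> Basis\<close> by (simp only: alg) simp
  qed
  also have "\<dots> = - cor ((norm \<xi>)^2) * inverse_fourier \<phi> \<xi>"
   unfolding power2_norm_eq_inner euclidean_inner[of \<xi> \<xi>]
   by (simp add: sum_distrib_right sum_negf)
  finally show ?case .
 qed
qed

section \<open>Cutoff functions\<close>

text \<open>All derivatives of \<open>exp(-1/t)\<close> have this shape, with a polynomial \<open>p\<close> in \<open>1/t\<close>.\<close>

definition flat :: "real poly => real => real" where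
 "flat p t = (if t <= 0 then 0 else poly p (1 / t) * exp (- (1 / t)))"

definition flat_deriv :: "real poly => real poly" where
 "flat_deriv p = [:0, 0, 1:] * p - [:0, 0, 1:] * pderiv p"

lemma poly_exp_tendsto_0: "((%s::real. poly p s * exp (- s)) \<longlongrightarrow> 0) at_top"
proof -
 have "((%s::real. s ^ n * poly p s * exp (- s)) \<longlongrightarrow> 0) at_top" for n
 proof (induction p arbitrary: n)
  case (pCons a p)
  have "((%s::real. a * (s ^ n / exp s) + s ^ Suc n * poly p s * exp (- s)) \<longlongrightarrow> a * 0 + 0) at_top"
   by (intro tendsto_intros pCons.IH tendsto_power_div_exp_0)
  then show ?case by (simp add: algebra_simps exp_minus divide_inverse)
 qed simp
 from this[of 0] show ?thesis by simp
qed

lemma flat_has_derivative: "(flat p has_real_derivative flat (flat_deriv p) t) (at t)"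
proof -
 consider "t > 0" | "t < 0" | "t = 0" by linarith
 then show ?thesis
 proof cases
  case 1
  have "((%t. poly p (1 / t) * exp (- (1 / t))) has_real_derivative flat (flat_deriv p) t) (at t)"
   using 1 by (auto intro!: derivative_eq_intros poly_DERIV[THEN DERIV_chain2]
     simp: flat_def flat_deriv_def field_simps power2_eq_square)
  then show ?thesis
   by (rule has_field_derivative_transform_within_open[of _ _ _ "{0<..}"]) (use 1 in \<open>auto simp: flat_def\<close>)
 next
  case 2
  have "((%t. 0) has_real_derivative flat (flat_deriv p) t) (at t)"
   using 2 by (simp add: flat_def)
  then show ?thesis
   by (rule has_field_derivative_transform_within_open[of _ _ _ "{..<0}"]) (use 2 in \<open>auto simp: flat_def\<close>)
 next
  case 3
  have "((%t. flat p t / t) \<longlongrightarrow> 0) (at_right 0)"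
  proof -
   have "((%t::real. poly ([:0, 1:] * p) (1 / t) * exp (- (1 / t))) \<longlongrightarrow> 0) (at_right 0)"
    using filterlim_compose[OF poly_exp_tendsto_0[of "[:0, 1:] * p"] filterlim_inverse_at_top_right]
    by (simp add: divide_inverse)
   then show ?thesis
    by (rule Lim_transform_eventually) (auto simp: eventually_at_filter flat_def)
  qed
  moreover have "((%t. flat p t / t) \<longlongrightarrow> 0) (at_left 0)"
   by (rule Lim_transform_eventually[OF tendsto_const]) (auto simp: eventually_at_filter flat_def)
  ultimately have "((%t. flat p t / t) \<longlongrightarrow> 0) (at 0)"
   by (rule filterlim_split_at_real[OF _ _, rotated])
  then show ?thesis using 3 by (simp add: has_field_derivative_iff flat_def)
 qed
qed

lemma flat_bounded: "\<exists>M\<ge>0. \<forall>t\<le>1. \<bar>flat p t\<bar> <= M"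
proof -
 have "continuous_on {0..1} (flat p)"
  by (meson DERIV_continuous_on DERIV_subset flat_has_derivative subset_UNIV)
 then have "bounded (flat p ` {0..1})"
  by (intro compact_imp_bounded compact_continuous_image) auto
 then obtain M where "\<forall>y\<in>flat p ` {0..1}. norm y <= M" unfolding bounded_iff by blast
 then have M: "!!t. t \<in> {0..1} ==> \<bar>flat p t\<bar> <= M" by auto
 have "\<bar>flat p t\<bar> <= max M 0" if "t <= 1" for t
  using M[of t] that by (cases "t >= 0") (auto simp: flat_def)
 then show ?thesis by (intro exI[of _ "max M 0"]) auto
qed

definition cutoff :: "real => 'a::euclidean_space => complex" where
 "cutoff R x = cor (exp 1 * flat 1 (1 - (norm x / R)\<^sup>2))"

lemma flat_radial_derivative:
 fixes x :: "'a::euclidean_space"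
 shows "((%x. cor (flat p (1 - (norm x / R)\<^sup>2))) has_derivative
   (%v. cor (flat (flat_deriv p) (1 - (norm x / R)\<^sup>2)) * cor (- 2 / R^2 * (x \<bullet> v)))) (at x)"
proof -
 have e: "(norm x / R)^2 = (1 / R^2) * (x \<bullet> x)" for x :: 'a by (simp add: power_divide power2_norm_eq_inner)
 have c: "((%x::'a. 1 - c * (x \<bullet> x)) has_derivative (%v. - 2 * c * (x \<bullet> v))) (at x)" for c
  by (auto intro!: derivative_eq_intros simp: inner_commute)
 have 1: "((%x::'a. 1 - (norm x / R)\<^sup>2) has_derivative (%v. - 2 / R^2 * (x \<bullet> v))) (at x)"
  using c[of "1 / R^2"] unfolding e by simp
 have "((%x. flat p (1 - (norm x / R)\<^sup>2)) has_derivative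
   (%v. flat (flat_deriv p) (1 - (norm x / R)\<^sup>2) * (- 2 / R^2 * (x \<bullet> v)))) (at x)"
  using diff_chain_at[OF 1 flat_has_derivative[unfolded has_field_derivative_def], of p]
  by (simp add: o_def)
 from has_derivative_of_real[OF this] show ?thesis by (simp only: of_real_mult)
qed

lemma partial_deriv_flat_radial:
 "partial_deriv b (%x. cor (flat p (1 - (norm x / R)\<^sup>2)))
  = (%x. cor (flat (flat_deriv p) (1 - (norm x / R)\<^sup>2)) * cor (- 2 / R^2 * (x \<bullet> b)))"
 by (rule ext, rule partial_deriv_eq[OF flat_radial_derivative])

lemma C_diff_flat_radial: "C_diff k (%x::'a::euclidean_space. cor (flat p (1 - (norm x / R)\<^sup>2)))"
proof (induction k arbitrary: p)
 case 0
 show ?case unfolding C_diff.simps continuous_on_eq_continuous_within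
  using has_derivative_continuous[OF flat_radial_derivative] by blast
next
 case (Suc k)
 show ?case
  unfolding C_diff.simps partial_deriv_flat_radial
  by (intro conjI ballI allI C_diff_mult C_diff_linear Suc.IH differentiableI[OF flat_radial_derivative])
qed

lemma test_function_cutoff:
 assumes "R > 0" shows "test_function (cutoff R)"
proof -
 have "C_diff k (%x. cor (exp 1) * cor (flat 1 (1 - (norm x / R)\<^sup>2)))" for k
  by (intro C_diff_mult C_diff_const C_diff_flat_radial)
 moreover have "cutoff R x = 0" if "norm x > R" for x
 proof -
  have "(norm x / R)^2 >= 1" using that assms by (intro one_le_power) simp
  then show ?thesis by (simp add: cutoff_def flat_def)
 qed
 ultimately show ?thesis by (auto simp: test_function_def cutoff_def[abs_def])
qed

lemma cutoff_tendsto: "(%k. cutoff (real (Suc k)) x) \<longlonglongrightarrow> 1"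
proof -
 have "(%k. norm x * (1 / real (Suc k))) \<longlonglongrightarrow> norm x * 0"
  by (intro tendsto_mult tendsto_const LIMSEQ_Suc[OF lim_1_over_n])
 then have "(%k. norm x / real (Suc k)) \<longlonglongrightarrow> 0" by simp
 then have "(%k. 1 - (norm x / real (Suc k))\<^sup>2) \<longlonglongrightarrow> 1 - 0\<^sup>2" by (intro tendsto_intros)
 then have q: "(%k. 1 - (norm x / real (Suc k))\<^sup>2) \<longlonglongrightarrow> 1" by simp
 have "isCont (flat 1) 1" using flat_has_derivative by (rule DERIV_isCont)
 from isCont_tendsto_compose[OF this q]
 have "(%k. flat 1 (1 - (norm x / real (Suc k))\<^sup>2)) \<longlonglongrightarrow> flat 1 1" .
 then have "(%k. cor (exp 1 * flat 1 (1 - (norm x / real (Suc k))\<^sup>2))) \<longlonglongrightarrow> cor (exp 1 * flat 1 1)"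
  by (intro tendsto_intros)
 moreover have "exp 1 * flat 1 1 = 1" by (simp add: flat_def exp_add[symmetric])
 ultimately show ?thesis by (simp add: cutoff_def)
qed

lemma cutoff_bounds:
 obtains C where "C >= 0" "!!k (x::'a::euclidean_space). cmod (cutoff (real (Suc k)) x) <= C"
  "!!k b (x::'a). b \<in> Basis ==> cmod (partial_deriv b (cutoff (real (Suc k))) x) <= C / real (Suc k)"
  "!!k b (x::'a). b \<in> Basis ==> cmod (partial_deriv b (partial_deriv b (cutoff (real (Suc k)))) x) <= C / real (Suc k)"
proof -
 let ?p1 = "flat_deriv 1" and ?p2 = "flat_deriv (flat_deriv 1)"
 obtain M0 where M0: "M0 >= 0" "!!t. t <= 1 ==> \<bar>flat 1 t\<bar> <= M0"
  using flat_bounded[of 1] by auto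
 obtain M1 where M1: "M1 >= 0" "!!t. t <= 1 ==> \<bar>flat ?p1 t\<bar> <= M1"
  using flat_bounded[of ?p1] by auto
 obtain M2 where M2: "M2 >= 0" "!!t. t <= 1 ==> \<bar>flat ?p2 t\<bar> <= M2"
  using flat_bounded[of ?p2] by auto
 define C where "C = exp 1 * (M0 + 2 * M1 + 4 * M2)"
 let ?q = "%k (x::'a). 1 - (norm x / real (Suc k))\<^sup>2"
 have q1: "?q k x <= 1" for k and x :: 'a by simp
 have d1: "partial_deriv b (cutoff (real (Suc k))) = (%x. cor (exp 1 * (flat ?p1 (?q k x) * (- 2 / (real (Suc k))^2 * (x \<bullet> b)))))" for b :: 'a and k
 proof
  fix x
  have "((%x. cor (exp 1) * cor (flat 1 (?q k x))) has_derivative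
    (%v. cor (exp 1) * (cor (flat ?p1 (?q k x)) * cor (- 2 / (real (Suc k))^2 * (x \<bullet> v))))) (at x)"
   by (rule has_derivative_mult_right[OF flat_radial_derivative])
  from partial_deriv_eq[OF this, of b]
  show "partial_deriv b (cutoff (real (Suc k))) x = cor (exp 1 * (flat ?p1 (?q k x) * (- 2 / (real (Suc k))^2 * (x \<bullet> b))))"
   unfolding cutoff_def[abs_def] of_real_mult[of "exp 1"] of_real_mult[of "flat ?p1 (?q k x)"] .
 qed
 have d2: "partial_deriv b (partial_deriv b (cutoff (real (Suc k)))) x
   = cor (exp 1 * (flat ?p2 (?q k x) * (- 2 / (real (Suc k))^2 * (x \<bullet> b)) * (- 2 / (real (Suc k))^2 * (x \<bullet> b))
    + flat ?p1 (?q k x) * (- 2 / (real (Suc k))^2)))" if b: "b \<in> Basis" for b x :: 'a and k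
 proof -
  let ?c = "- 2 / (real (Suc k))^2"
  have l: "((%x. cor (c * (x \<bullet> b))) has_derivative (%v. cor (c * (v \<bullet> b)))) (at x)" for c
   by (auto intro!: derivative_eq_intros)
  have "((%x. cor (exp 1) * (cor (flat ?p1 (?q k x)) * cor (?c * (x \<bullet> b)))) has_derivative
   (%v. cor (exp 1) * (cor (flat ?p1 (?q k x)) * cor (?c * (v \<bullet> b))
     + cor (flat ?p2 (?q k x)) * cor (?c * (x \<bullet> v)) * cor (?c * (x \<bullet> b))))) (at x)"
   by (intro has_derivative_mult_right has_derivative_mult flat_radial_derivative l)
  from partial_deriv_eq[OF this, of b] show ?thesis
   unfolding d1 of_real_mult of_real_add using b
   by (simp only: inner_same_Basis of_real_mult of_real_1 mult_1_right mult_1_left distrib_left add.commute mult.assoc mult.commute)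
 qed
 have supp: "flat p (?q k x) = 0 \<or> \<bar>x \<bullet> b\<bar> <= real (Suc k)" if "b \<in> Basis" for p k and x b :: 'a
 proof (cases "norm x <= real (Suc k)")
  case True then show ?thesis using Basis_le_norm[OF that, of x] by linarith
 next
  case False
  then have "(norm x / real (Suc k))^2 >= 1" by (intro one_le_power) simp
  then show ?thesis by (simp add: flat_def)
 qed
 show ?thesis
 proof (rule that[of C])
  show C0: "C >= 0" using M0 M1 M2 by (simp add: C_def)
  fix k and x :: 'a
  let ?n = "real (Suc k)"
  have n1: "?n >= 1" by simp
  have nn: "c / ?n^2 * ?n = c / ?n" for c by (simp add: power2_eq_square del: of_nat_Suc)
  show "cmod (cutoff ?n x) <= C"
   unfolding cutoff_def C_def norm_of_real abs_mult using M0(2)[OF q1[of x k]] M1(1) M2(1)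
   by (auto intro!: mult_mono)
  fix b :: 'a assume b: "b \<in> Basis"
  have A: "\<bar>flat ?p1 (?q k x)\<bar> * \<bar>- 2 / ?n^2 * (x \<bullet> b)\<bar> <= 2 * M1 / ?n"
  proof (cases "flat ?p1 (?q k x) = 0")
   case True then show ?thesis using M1 by simp
  next
   case False
   then have x: "\<bar>x \<bullet> b\<bar> <= ?n" using supp[OF b, of ?p1 x k] by blast
   have "\<bar>flat ?p1 (?q k x)\<bar> * \<bar>- 2 / ?n^2 * (x \<bullet> b)\<bar> <= M1 * (2 / ?n^2 * ?n)"
    using x M1 q1[of x k] by (intro mult_mono) (auto simp: abs_mult intro!: mult_left_mono divide_right_mono)
   also have "\<dots> = 2 * M1 / ?n" unfolding nn by simp
   finally show ?thesis .
  qed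
  have "cmod (partial_deriv b (cutoff ?n) x) <= exp 1 * (2 * M1 / ?n)"
   unfolding d1 norm_of_real abs_mult using A by (intro mult_mono) (auto simp: abs_mult)
  also have "\<dots> <= C / ?n" using M0 M1 M2 by (auto simp: C_def divide_right_mono)
  finally show "cmod (partial_deriv b (cutoff ?n) x) <= C / ?n" .
  have B: "\<bar>flat ?p2 (?q k x) * (- 2 / ?n^2 * (x \<bullet> b)) * (- 2 / ?n^2 * (x \<bullet> b))\<bar> <= 4 * M2 / ?n"
  proof (cases "flat ?p2 (?q k x) = 0")
   case True then show ?thesis using M2 by simp
  next
   case False
   then have x: "\<bar>x \<bullet> b\<bar> <= ?n" using supp[OF b, of ?p2 x k] by blast
   have "\<bar>flat ?p2 (?q k x) * (- 2 / ?n^2 * (x \<bullet> b)) * (- 2 / ?n^2 * (x \<bullet> b))\<bar> <= M2 * (2 / ?n^2 * ?n) * (2 / ?n^2 * ?n)"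
    unfolding abs_mult using x M2 q1[of x k]
    by (intro mult_mono) (auto simp: abs_mult intro!: mult_nonneg_nonneg mult_left_mono divide_right_mono)
   also have "\<dots> = 4 * M2 / ?n^2" unfolding nn by (simp add: power2_eq_square del: of_nat_Suc)
   also have "\<dots> <= 4 * M2 / ?n" using n1 M2 self_le_power[OF n1, of 2] by (intro divide_left_mono) auto
   finally show ?thesis .
  qed
  have D: "\<bar>flat ?p1 (?q k x) * (- 2 / ?n^2)\<bar> <= 2 * M1 / ?n"
  proof -
   have "\<bar>flat ?p1 (?q k x) * (- 2 / ?n^2)\<bar> <= M1 * (2 / ?n^2)"
    unfolding abs_mult using M1 q1[of x k] by (intro mult_mono) auto
   also have "\<dots> <= M1 * (2 / ?n)"
    using n1 M1 self_le_power[OF n1, of 2] by (intro mult_left_mono divide_left_mono) auto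
   finally show ?thesis by (simp only: times_divide_eq_right mult.commute)
  qed
  have "cmod (partial_deriv b (partial_deriv b (cutoff ?n)) x) <= exp 1 * (4 * M2 / ?n + 2 * M1 / ?n)"
   unfolding d2[OF b] norm_of_real abs_mult[of "exp 1"]
   by (intro mult_mono order_trans[OF abs_triangle_ineq] add_mono B D) auto
  also have "\<dots> <= C / ?n" using M0 M1 M2 by (auto simp: C_def add_divide_distrib[symmetric] divide_right_mono)
  finally show "cmod (partial_deriv b (partial_deriv b (cutoff ?n)) x) <= C / ?n" .
 qed
qed

section \<open>Band-limited functions as test functions\<close>

text \<open>Differentiation under the integral sign, by a quadratic Taylor bound for the kernel.\<close>

lemma exp_taylor_bound:
 fixes r :: real shows "cmod (exp (- \<i> * cor r) - 1 + \<i> * cor r) <= r^2"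
proof -
 have "cmod (iexp (- r) - (\<Sum>k\<le>1. (\<i> * cor (- r)) ^ k / fact k)) <= \<bar>- r\<bar> ^ Suc 1 / fact (Suc 1)"
  by (rule iexp_approx1)
 then have "cmod (exp (- \<i> * cor r) - 1 + \<i> * cor r) <= r^2 / 2"
  by (simp add: power2_eq_square algebra_simps numeral_2_eq_2)
 then show ?thesis by (rule order_trans) simp
qed

lemma fourier_integral_has_derivative:
 fixes h :: "'a::euclidean_space => complex"
 assumes h: "integrable lborel h" and supp: "!!\<xi>. norm \<xi> > R ==> h \<xi> = 0"
 shows "(fourier_integral h has_derivative (%v. fourier_integral (%\<xi>. - \<i> * cor (\<xi> \<bullet> v) * h \<xi>) x)) (at x)"
proof -
 note [measurable] = borel_measurable_integrable[OF h, simplified]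
 define C where "C = cor ((2 * pi) powr (- real DIM('a) / 2))"
 define g where "g v \<xi> = - \<i> * cor (\<xi> \<bullet> v) * h \<xi>" for v \<xi>
 have gb: "cmod (g v \<xi>) <= (\<bar>R\<bar> * norm v) * cmod (h \<xi>)" for v \<xi>
 proof (cases "norm \<xi> > R")
  case False
  have "\<bar>\<xi> \<bullet> v\<bar> <= norm \<xi> * norm v" by (rule Cauchy_Schwarz_ineq2)
  also have "\<dots> <= \<bar>R\<bar> * norm v" using False by (intro mult_right_mono) auto
  finally show ?thesis by (simp add: g_def norm_mult mult_right_mono)
 qed (simp add: g_def supp)
 have gi: "integrable lborel (g v)" for v
 proof (rule Bochner_Integration.integrable_bound)
  show "integrable lborel (%\<xi>. (\<bar>R\<bar> * norm v) * cmod (h \<xi>))" using h by simp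
  show "g v \<in> borel_measurable lborel" unfolding g_def by measurable
  show "AE x in lborel. norm (g v x) <= norm ((\<bar>R\<bar> * norm v) * cmod (h x))"
   using gb[of v] by (intro AE_I2 order_trans[OF gb]) simp
 qed
 have gadd: "fourier_integral (g (v + w)) x = fourier_integral (g v) x + fourier_integral (g w) x" for v w
  using integrable_fourier_kernel[OF gi[of v]] integrable_fourier_kernel[OF gi[of w]]
  by (simp add: fourier_integral_def g_def inner_add_right algebra_simps)
 have gscale: "fourier_integral (g (r *\<^sub>R v)) x = r *\<^sub>R fourier_integral (g v) x" for r v
 proof -
  have "g (r *\<^sub>R v) = (%\<xi>. cor r * g v \<xi>)" by (auto simp: g_def fun_eq_iff)
  then show ?thesis by (simp add: fourier_integral_cmult scaleR_conv_of_real)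
 qed
 let ?I = "LINT \<xi>|lborel. cmod (h \<xi>)"
 have gn: "cmod (fourier_integral (g v) x) <= norm v * (cmod C * (\<bar>R\<bar> * ?I))" for v
 proof -
  have "cmod (fourier_integral (g v) x) <= cmod C * (LINT \<xi>|lborel. cmod (g v \<xi>))"
   using norm_fourier_integral_le[of "g v" x] by (simp add: C_def)
  also have "\<dots> <= cmod C * (LINT \<xi>|lborel. (\<bar>R\<bar> * norm v) * cmod (h \<xi>))"
   by (intro mult_left_mono integral_mono integrable_norm gi gb) (use h in auto)
  finally show ?thesis by (simp add: ac_simps)
 qed
 have bl: "bounded_linear (%v. fourier_integral (g v) x)"
  by (rule bounded_linear_intro[OF gadd gscale gn])
 have quad: "cmod (fourier_integral h (x + v) - fourier_integral h x - fourier_integral (g v) x) <= (cmod C * (R^2 * ?I)) * (norm v)^2" for v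
 proof -
  let ?K = "%\<xi>. exp (- \<i> * cor (\<xi> \<bullet> x))"
  let ?E = "%\<xi>. exp (- \<i> * cor (\<xi> \<bullet> v)) - 1 + \<i> * cor (\<xi> \<bullet> v)"
  have eq: "exp (- \<i> * cor (\<xi> \<bullet> (x + v))) * h \<xi> - ?K \<xi> * h \<xi> - ?K \<xi> * g v \<xi> = ?K \<xi> * ?E \<xi> * h \<xi>" for \<xi>
  proof -
   have "exp (- \<i> * cor (\<xi> \<bullet> (x + v))) = ?K \<xi> * exp (- \<i> * cor (\<xi> \<bullet> v))"
    unfolding exp_add[symmetric] by (simp add: inner_add_right distrib_left)
   moreover have "a * b * w - a * w - a * (- \<i> * c * w) = a * (b - 1 + \<i> * c) * w" for a b c w :: complex by algebra
   ultimately show ?thesis unfolding g_def by (simp only:)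
  qed
  have i: "integrable lborel (%\<xi>. ?K \<xi> * ?E \<xi> * h \<xi>)"
   unfolding eq[symmetric] by (intro Bochner_Integration.integrable_diff integrable_fourier_kernel h gi)
  have "fourier_integral h (x + v) - fourier_integral h x - fourier_integral (g v) x = C * (LINT \<xi>|lborel. ?K \<xi> * ?E \<xi> * h \<xi>)"
   using integrable_fourier_kernel[OF h, of x] integrable_fourier_kernel[OF h, of "x + v"] integrable_fourier_kernel[OF gi[of v], of x]
   unfolding eq[symmetric] by (simp add: fourier_integral_def C_def right_diff_distrib)
  then have nrm: "cmod (fourier_integral h (x + v) - fourier_integral h x - fourier_integral (g v) x)
    = cmod C * cmod (LINT \<xi>|lborel. ?K \<xi> * ?E \<xi> * h \<xi>)" by (simp only: norm_mult)
  have "cmod (LINT \<xi>|lborel. ?K \<xi> * ?E \<xi> * h \<xi>) <= (LINT \<xi>|lborel. cmod (?K \<xi> * ?E \<xi> * h \<xi>))"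
   by (rule integral_norm_bound)
  also have "\<dots> <= (LINT \<xi>|lborel. (R^2 * (norm v)^2) * cmod (h \<xi>))"
  proof (intro integral_mono integrable_norm i)
   fix \<xi>
   show "cmod (?K \<xi> * ?E \<xi> * h \<xi>) <= (R^2 * (norm v)^2) * cmod (h \<xi>)"
   proof (cases "norm \<xi> > R")
    case False
    have "\<bar>\<xi> \<bullet> v\<bar> <= norm \<xi> * norm v" by (rule Cauchy_Schwarz_ineq2)
    also have "\<dots> <= \<bar>R\<bar> * norm v" using False by (intro mult_right_mono) auto
    finally have "\<bar>\<xi> \<bullet> v\<bar>^2 <= (\<bar>R\<bar> * norm v)^2" by (intro power_mono) auto
    then have "(\<xi> \<bullet> v)^2 <= R^2 * (norm v)^2" by (simp add: power_mult_distrib)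
    then have "cmod (?E \<xi>) <= R^2 * (norm v)^2" using exp_taylor_bound[of "\<xi> \<bullet> v"] by linarith
    then show ?thesis unfolding norm_mult norm_exp_imag by (simp add: mult_right_mono)
   qed (simp add: supp)
  qed (use h in auto)
  finally have "cmod (LINT \<xi>|lborel. ?K \<xi> * ?E \<xi> * h \<xi>) <= (R^2 * (norm v)^2) * ?I"
   by (simp only: integral_mult_right_zero)
  then have "cmod C * cmod (LINT \<xi>|lborel. ?K \<xi> * ?E \<xi> * h \<xi>) <= cmod C * ((R^2 * (norm v)^2) * ?I)"
   by (rule mult_left_mono) simp
  then show ?thesis unfolding nrm by (simp only: ac_simps)
 qed
 show ?thesis
  unfolding has_derivative_def g_def[symmetric]
 proof (intro conjI bl)
  let ?q = "%y. ((fourier_integral h y - fourier_integral h x) - fourier_integral (g (y - x)) x) /\<^sub>R norm (y - x)"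
  have "((%y. (cmod C * (R^2 * ?I)) * norm (y - x)) \<longlongrightarrow> (cmod C * (R^2 * ?I)) * norm (x - x)) (at x)"
   by (intro tendsto_intros)
  then have 1: "((%y. (cmod C * (R^2 * ?I)) * norm (y - x)) \<longlongrightarrow> 0) (at x)" by simp
  have "norm (?q y) <= (cmod C * (R^2 * ?I)) * norm (y - x)" for y
  proof (cases "y = x")
   case False
   have "norm (?q y) = cmod (fourier_integral h (x + (y - x)) - fourier_integral h x - fourier_integral (g (y - x)) x) / norm (y - x)"
    by (simp only: norm_scaleR) (simp add: divide_inverse mult.commute)
   also have "\<dots> <= (cmod C * (R^2 * ?I)) * (norm (y - x))^2 / norm (y - x)"
    by (intro divide_right_mono quad) simp
   also have "\<dots> = (cmod C * (R^2 * ?I)) * norm (y - x)"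
    using False by (simp add: power2_eq_square)
   finally show ?thesis .
  qed simp
  then have "(?q \<longlongrightarrow> 0) (at x)"
   by (intro Lim_null_comparison[OF _ 1]) auto
  then show "((%y. ((fourier_integral h y - fourier_integral h (netlimit (at x))) - fourier_integral (g (y - netlimit (at x))) x) /\<^sub>R norm (y - netlimit (at x))) \<longlongrightarrow> 0) (at x)"
   by (simp add: netlimit_at)
 qed
qed

definition band_limited :: "real => ('a::euclidean_space => complex) => bool" where
 "band_limited R h \<longleftrightarrow> L2 h \<and> (\<forall>\<xi>. norm \<xi> > R \<longrightarrow> h \<xi> = 0)"

lemma band_limited_mult:
 assumes h: "band_limited R h" and m: "continuous_on UNIV m"
 shows "band_limited R (%\<xi>. m \<xi> * h \<xi>)"
proof -
 have s: "L2 h" and z: "!!\<xi>. norm \<xi> > R ==> h \<xi> = 0" using h by (auto simp: band_limited_def)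
 note [measurable] = L2D(1)[OF s] borel_measurable_continuous_onI[OF m]
 have "bounded (m ` cball 0 R)"
  by (intro compact_imp_bounded compact_continuous_image continuous_on_subset[OF m]) auto
 then obtain C where "\<forall>y\<in>m ` cball 0 R. norm y <= C" unfolding bounded_iff by blast
 then have C: "cmod (m \<xi>) <= C" if "norm \<xi> <= R" for \<xi> using that by auto
 have "L2 (%\<xi>. m \<xi> * h \<xi>)"
 proof (rule L2_bound[OF s])
  show "AE x in lborel. cmod (m x * h x) <= C * cmod (h x)"
  proof (rule AE_I2)
   fix x show "cmod (m x * h x) <= C * cmod (h x)"
    using C[of x] z[of x] by (cases "norm x <= R") (auto simp: norm_mult mult_right_mono)
  qed
 qed measurable
 then show ?thesis using z by (simp add: band_limited_def)
qed

lemma band_limited_facts: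
 assumes "band_limited R h"
 shows "L2 h" "integrable lborel h" "L2 (fourier_integral h)"
  "AE x in lborel. fourier h x = fourier_integral h x"
  "(fourier_integral h has_derivative (%v. fourier_integral (%\<xi>. - \<i> * cor (\<xi> \<bullet> v) * h \<xi>) x)) (at x)"
proof -
 have s: "L2 h" and z: "!!\<xi>. norm \<xi> > R ==> h \<xi> = 0"
  using assms by (auto simp: band_limited_def)
 show "L2 h" by fact
 show i: "integrable lborel h" by (rule l1_le_l2_cball(1)[OF s z])
 show "L2 (fourier_integral h)" by (rule plancherel_bounded_support(1)[OF s z])
 show "AE x in lborel. fourier h x = fourier_integral h x" by (rule fourier_eq_fourier_integral[OF s i])
 show "(fourier_integral h has_derivative (%v. fourier_integral (%\<xi>. - \<i> * cor (\<xi> \<bullet> v) * h \<xi>) x)) (at x)"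
  by (rule fourier_integral_has_derivative[OF i z])
qed

lemma band_limited_deriv:
 "band_limited R h ==> band_limited R (%\<xi>. - \<i> * cor (\<xi> \<bullet> b) * h \<xi>)"
 by (rule band_limited_mult) (auto intro!: continuous_intros)

lemma partial_deriv_fourier_integral:
 "band_limited R h ==> partial_deriv b (fourier_integral h) = fourier_integral (%\<xi>. - \<i> * cor (\<xi> \<bullet> b) * h \<xi>)"
 by (rule ext, rule partial_deriv_eq, rule band_limited_facts(5))

lemma C_diff_fourier_integral:
 assumes "band_limited R h" shows "C_diff k (fourier_integral h)"
proof (rule C_diff_coinduct[where P="%f. \<exists>h. band_limited R h \<and> f = fourier_integral h"])
 show "f differentiable (at x)" if "\<exists>h. band_limited R h \<and> f = fourier_integral h" for f :: "'a => complex" and x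
  using that band_limited_facts(5) by (auto simp: differentiable_def)
 show "\<exists>h. band_limited R h \<and> partial_deriv b f = fourier_integral h"
  if "\<exists>h. band_limited R h \<and> f = fourier_integral h" for f :: "'a => complex" and b
  using that partial_deriv_fourier_integral band_limited_deriv by blast
qed (use assms in blast)

lemma laplacian_fourier_integral:
 assumes h: "band_limited R h"
 shows "laplacian (fourier_integral h) = fourier_integral (%\<xi>. - cor ((norm \<xi>)^2) * h \<xi>)"
proof
 fix x
 let ?g = "%b \<xi>. - \<i> * cor (\<xi> \<bullet> b) * (- \<i> * cor (\<xi> \<bullet> b) * h \<xi>)"
 have g: "band_limited R (?g b)" for b by (intro band_limited_deriv h)
 have alg: "- \<i> * c * (- \<i> * c * w) = (\<i> * \<i>) * (c * c) * w" for c w :: complex by algebra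
 have "laplacian (fourier_integral h) x = (\<Sum>b\<in>Basis. fourier_integral (?g b) x)"
  unfolding laplacian_def partial_deriv_fourier_integral[OF h] partial_deriv_fourier_integral[OF band_limited_deriv[OF h]] ..
 also have "\<dots> = fourier_integral (%\<xi>. \<Sum>b\<in>Basis. ?g b \<xi>) x"
 proof -
  have "(LINT \<xi>|lborel. exp (- \<i> * cor (\<xi> \<bullet> x)) * (\<Sum>b\<in>Basis. ?g b \<xi>))
    = (\<Sum>b\<in>Basis. LINT \<xi>|lborel. exp (- \<i> * cor (\<xi> \<bullet> x)) * ?g b \<xi>)"
   unfolding sum_distrib_left
   by (rule Bochner_Integration.integral_sum) (rule integrable_fourier_kernel[OF band_limited_facts(2)[OF g]])
  then show ?thesis unfolding fourier_integral_def by (simp only: sum_distrib_left)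
 qed
 also have "(%\<xi>. \<Sum>b\<in>Basis. ?g b \<xi>) = (%\<xi>. - cor ((norm \<xi>)^2) * h \<xi>)"
 proof
  fix \<xi> :: 'a
  have "(\<Sum>b\<in>Basis. ?g b \<xi>) = (\<Sum>b\<in>Basis. - cor ((\<xi> \<bullet> b) * (\<xi> \<bullet> b)) * h \<xi>)"
   by (intro sum.cong refl) (simp only: alg, simp)
  also have "\<dots> = - cor ((norm \<xi>)^2) * h \<xi>"
   unfolding power2_norm_eq_inner euclidean_inner[of \<xi> \<xi>] by (simp add: sum_distrib_right sum_negf)
  finally show "(\<Sum>b\<in>Basis. ?g b \<xi>) = - cor ((norm \<xi>)^2) * h \<xi>" .
 qed
 finally show "laplacian (fourier_integral h) x = fourier_integral (%\<xi>. - cor ((norm \<xi>)^2) * h \<xi>) x" .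
qed

text \<open>
  A band-limited \<open>\<psi>\<close> is smooth but not of compact support; the products with wide cutoffs are test
  functions which approximate \<open>\<psi>\<close>, and their Laplacians approximate \<open>\<Delta>\<psi>\<close>.
\<close>

lemma laplacian_mult:
 assumes "!!k. C_diff k f" "!!k. C_diff k g"
 shows "laplacian (%x. f x * g x) x = f x * laplacian g x
   + (\<Sum>b\<in>Basis. 2 * partial_deriv b f x * partial_deriv b g x + partial_deriv b (partial_deriv b f) x * g x)"
proof -
 have d: "f differentiable (at x)" "g differentiable (at x)" for x
  using assms(1)[of 1] assms(2)[of 1] by auto
 have dd: "partial_deriv b f differentiable (at x)" "partial_deriv b g differentiable (at x)" if "b \<in> Basis" for b x
  using assms(1)[of "Suc 1"] assms(2)[of "Suc 1"] that by auto
 have 1: "partial_deriv b (%x. f x * g x) = (%x. f x * partial_deriv b g x + partial_deriv b f x * g x)" for b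
  by (intro ext partial_deriv_mult d)
 have add: "partial_deriv b (%x. F x + G x) x = partial_deriv b F x + partial_deriv b G x"
  if "F differentiable (at x)" "G differentiable (at x)" for F G :: "'a => complex" and b
  using that by (auto simp: partial_deriv_def[of _ F] partial_deriv_def[of _ G]
    intro!: partial_deriv_eq has_derivative_add differentiable_partial_deriv)
 have "partial_deriv b (partial_deriv b (%x. f x * g x)) x = f x * partial_deriv b (partial_deriv b g) x
   + (2 * partial_deriv b f x * partial_deriv b g x + partial_deriv b (partial_deriv b f) x * g x)" if b: "b \<in> Basis" for b
  unfolding 1
  by (subst add) (auto simp: partial_deriv_mult d dd[OF b] algebra_simps intro!: differentiable_mult d dd[OF b])
 then show ?thesis by (simp add: laplacian_def sum.distrib sum_distrib_left)
qed

lemma L2_sum: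
 "finite A ==> (!!a. a \<in> A ==> L2 (f a)) ==> L2 (%x. \<Sum>a\<in>A. f a x)"
 using fourier_sum by blast

lemma band_limited_approx:
 fixes h :: "'a::euclidean_space => complex"
 assumes h: "band_limited R h"
 defines "\<psi> \<equiv> fourier_integral h"
 obtains T where "!!k::nat. test_function (T k)" "(%k. l2norm (%x. T k x - \<psi> x)) \<longlonglongrightarrow> 0"
  "(%k. l2norm (%x. laplacian (T k) x - laplacian \<psi> x)) \<longlonglongrightarrow> 0"
  "L2 \<psi>" "L2 (laplacian \<psi>)"
proof -
 obtain C where C: "C >= 0" "!!k (x::'a). cmod (cutoff (real (Suc k)) x) <= C"
  "!!k b (x::'a). b \<in> Basis ==> cmod (partial_deriv b (cutoff (real (Suc k))) x) <= C / real (Suc k)"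
  "!!k b (x::'a). b \<in> Basis ==> cmod (partial_deriv b (partial_deriv b (cutoff (real (Suc k)))) x) <= C / real (Suc k)"
  by (rule cutoff_bounds) blast
 define \<eta> :: "nat => 'a => complex" where "\<eta> k = cutoff (real (Suc k))" for k
 define T where "T k x = \<eta> k x * \<psi> x" for k and x :: 'a
 have sm: "C_diff k \<psi>" for k unfolding \<psi>_def by (rule C_diff_fourier_integral[OF h])
 have t\<eta>: "test_function (\<eta> k)" for k :: nat unfolding \<eta>_def by (rule test_function_cutoff) simp
 have tT: "test_function (T k)" for k unfolding T_def by (intro test_function_mult t\<eta> sm)
 have s: "L2 \<psi>" unfolding \<psi>_def by (rule band_limited_facts[OF h])
 have sd: "L2 (partial_deriv b \<psi>)" for b
  unfolding \<psi>_def partial_deriv_fourier_integral[OF h] by (rule band_limited_facts[OF band_limited_deriv[OF h]])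
 have sl: "L2 (laplacian \<psi>)"
  unfolding \<psi>_def laplacian_fourier_integral[OF h]
  by (rule band_limited_facts[OF band_limited_mult[OF h]]) (intro continuous_intros)
 note [measurable] = L2D(1)[OF s] L2D(1)[OF sl] test_function_facts(3)[OF tT]
  test_function_facts(3)[OF test_function_laplacian[OF tT]]
 have n1: "C / real (Suc k) <= C" for k using C(1) by (simp add: field_simps)
 have n0: "(%k. C / real (Suc k)) \<longlonglongrightarrow> 0"
  using tendsto_mult_left[OF LIMSEQ_Suc[OF lim_1_over_n], of C] by simp
 have 1: "(%k. l2norm (%x. T k x - \<psi> x)) \<longlonglongrightarrow> 0"
 proof (rule l2norm_dominated_convergence)
  show "L2 (%x. cor (C + 1) * \<psi> x)" by (intro L2_cmult s)
  show "AE x in lborel. cmod (T k x - \<psi> x) <= cmod (cor (C + 1) * \<psi> x)" for k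
  proof (rule AE_I2)
   fix x
   have "cmod (T k x - \<psi> x) = cmod (\<eta> k x - 1) * cmod (\<psi> x)"
    by (simp add: T_def left_diff_distrib flip: norm_mult)
   also have "cmod (\<eta> k x - 1) <= C + 1"
    using C(2)[of k x] norm_triangle_ineq4[of "\<eta> k x" 1] by (simp add: \<eta>_def)
   finally show "cmod (T k x - \<psi> x) <= cmod (cor (C + 1) * \<psi> x)"
    using C(1) by (simp add: norm_mult mult_right_mono del: of_real_add)
  qed
  show "AE x in lborel. (%k. T k x - \<psi> x) \<longlonglongrightarrow> 0"
  proof (rule AE_I2)
   fix x
   have "(%k. T k x - \<psi> x) \<longlonglongrightarrow> 1 * \<psi> x - \<psi> x"
    unfolding T_def \<eta>_def by (intro tendsto_intros cutoff_tendsto)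
   then show "(%k. T k x - \<psi> x) \<longlonglongrightarrow> 0" by simp
  qed
 qed measurable
 define rem where "rem k x = (\<Sum>b\<in>Basis. 2 * partial_deriv b (\<eta> k) x * partial_deriv b \<psi> x + partial_deriv b (partial_deriv b (\<eta> k)) x * \<psi> x)" for k and x :: 'a
 have lap: "laplacian (T k) x = \<eta> k x * laplacian \<psi> x + rem k x" for k x
  unfolding T_def rem_def using t\<eta>[of k] by (intro laplacian_mult sm) (simp add: test_function_def)
 define S where "S x = (\<Sum>b\<in>(Basis::'a set). 2 * cor (cmod (partial_deriv b \<psi> x)) + cor (cmod (\<psi> x)))" for x :: 'a
 have sS: "L2 S" unfolding S_def
  by (intro L2_sum L2_add L2_cmult L2_cmod sd s) auto
 have S_real: "S x = cor (\<Sum>b\<in>(Basis::'a set). 2 * cmod (partial_deriv b \<psi> x) + cmod (\<psi> x))" for x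
  by (simp add: S_def)
 have S_cmod: "cmod (S x) = (\<Sum>b\<in>(Basis::'a set). 2 * cmod (partial_deriv b \<psi> x) + cmod (\<psi> x))" for x
  unfolding S_real norm_of_real by (intro abs_of_nonneg sum_nonneg) auto
 have rem: "cmod (rem k x) <= C / real (Suc k) * cmod (S x)" for k x
  unfolding rem_def S_cmod sum_distrib_left
 proof (intro order_trans[OF norm_sum] sum_mono)
  fix b :: 'a assume b: "b \<in> Basis"
  have "cmod (2 * partial_deriv b (\<eta> k) x * partial_deriv b \<psi> x + partial_deriv b (partial_deriv b (\<eta> k)) x * \<psi> x)
   <= 2 * (cmod (partial_deriv b (\<eta> k) x) * cmod (partial_deriv b \<psi> x)) + cmod (partial_deriv b (partial_deriv b (\<eta> k)) x) * cmod (\<psi> x)"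
   by (rule order_trans[OF norm_triangle_ineq]) (simp add: norm_mult)
  also have "\<dots> <= 2 * (C / real (Suc k) * cmod (partial_deriv b \<psi> x)) + C / real (Suc k) * cmod (\<psi> x)"
   unfolding \<eta>_def by (intro add_mono mult_left_mono mult_right_mono C b) auto
  finally show "cmod (2 * partial_deriv b (\<eta> k) x * partial_deriv b \<psi> x + partial_deriv b (partial_deriv b (\<eta> k)) x * \<psi> x)
    <= C / real (Suc k) * (2 * cmod (partial_deriv b \<psi> x) + cmod (\<psi> x))"
   by (simp only: distrib_left mult.left_commute)
 qed
 have 2: "(%k. l2norm (%x. laplacian (T k) x - laplacian \<psi> x)) \<longlonglongrightarrow> 0"
 proof (rule l2norm_dominated_convergence)
  show "L2 (%x. cor (C + 1) * cor (cmod (laplacian \<psi> x)) + cor C * cor (cmod (S x)))"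
   by (intro L2_add L2_cmult L2_cmod sl sS)
  show "AE x in lborel. cmod (laplacian (T k) x - laplacian \<psi> x) <= cmod (cor (C + 1) * cor (cmod (laplacian \<psi> x)) + cor C * cor (cmod (S x)))" for k
  proof (rule AE_I2)
   fix x
   have "laplacian (T k) x - laplacian \<psi> x = (\<eta> k x - 1) * laplacian \<psi> x + rem k x"
    by (simp add: lap algebra_simps)
   then have "cmod (laplacian (T k) x - laplacian \<psi> x) <= cmod (\<eta> k x - 1) * cmod (laplacian \<psi> x) + cmod (rem k x)"
    by (metis norm_mult norm_triangle_ineq)
   also have "\<dots> <= (C + 1) * cmod (laplacian \<psi> x) + C * cmod (S x)"
   proof (intro add_mono mult_right_mono)
    show "cmod (\<eta> k x - 1) <= C + 1"
     using C(2)[of k x] norm_triangle_ineq4[of "\<eta> k x" 1] by (simp add: \<eta>_def)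
    show "cmod (rem k x) <= C * cmod (S x)"
     using rem[of k x] mult_right_mono[OF n1[of k], of "cmod (S x)"] by simp
   qed auto
   also have "\<dots> = cmod (cor ((C + 1) * cmod (laplacian \<psi> x) + C * cmod (S x)))"
    using C(1) by (simp only: norm_of_real) simp
   finally show "cmod (laplacian (T k) x - laplacian \<psi> x) <= cmod (cor (C + 1) * cor (cmod (laplacian \<psi> x)) + cor C * cor (cmod (S x)))"
    by (simp only: of_real_add of_real_mult)
  qed
  show "AE x in lborel. (%k. laplacian (T k) x - laplacian \<psi> x) \<longlonglongrightarrow> 0"
  proof (rule AE_I2)
   fix x
   have "(%k. C / real (Suc k) * cmod (S x)) \<longlonglongrightarrow> 0 * cmod (S x)" by (intro tendsto_mult n0 tendsto_const)
   then have "(%k. rem k x) \<longlonglongrightarrow> 0"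
    using rem[of _ x] by (intro Lim_null_comparison[of "%k. rem k x" "%k. C / real (Suc k) * cmod (S x)"]) auto
   then have "(%k. \<eta> k x * laplacian \<psi> x + rem k x - laplacian \<psi> x) \<longlonglongrightarrow> 1 * laplacian \<psi> x + 0 - laplacian \<psi> x"
    unfolding \<eta>_def by (intro tendsto_intros cutoff_tendsto)
   then show "(%k. laplacian (T k) x - laplacian \<psi> x) \<longlonglongrightarrow> 0" by (simp add: lap)
  qed
 qed measurable
 show ?thesis using that[OF tT 1 2 s sl] .
qed

lemma fourier_pairing_band_limited:
 assumes f: "L2 f" and h: "band_limited R h"
 shows "(LINT x|lborel. f x * fourier_integral h x) = (LINT \<xi>|lborel. fourier f \<xi> * h \<xi>)"
proof -
 note H = band_limited_facts[OF h]
 note [measurable] = L2D(1)[OF f] L2D(1)[OF H(3)] L2D(1)[OF L2_fourier[OF H(1)]]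
 have "(LINT x|lborel. f x * fourier_integral h x) = (LINT x|lborel. f x * fourier h x)"
 proof (rule integral_cong_AE)
  show "AE x in lborel. f x * fourier_integral h x = f x * fourier h x"
   using H(4) by eventually_elim simp
 qed measurable
 then show ?thesis using fourier_multiplication[OF f H(1)] by simp
qed

lemma AE_zero_band_limited:
 fixes g :: "'a::euclidean_space => complex"
 assumes g: "L2 g" and z: "!!R h. band_limited R h ==> (LINT \<xi>|lborel. g \<xi> * h \<xi>) = 0"
 shows "AE \<xi> in lborel. g \<xi> = 0"
proof -
 let ?t = "%k x. indicator (cball 0 (real k)) x *\<^sub>R g x"
 have st: "L2 (?t k)" for k by (rule L2_indicator[OF g]) simp
 have "l2norm (?t k) = 0" for k
 proof -
  have "band_limited (real k) (%\<xi>. cnj (?t k \<xi>))"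
   using L2_cnj[OF st[of k]] by (auto simp: band_limited_def)
  from z[OF this] have "(LINT \<xi>|lborel. g \<xi> * cnj (?t k \<xi>)) = 0" .
  moreover have "g \<xi> * cnj (?t k \<xi>) = cor ((cmod (?t k \<xi>))^2)" for \<xi>
   by (simp add: indicator_def complex_norm_square del: of_real_power)
  ultimately show ?thesis by (simp add: l2norm_def del: of_real_power)
 qed
 then have "(%k::nat. 0::real) \<longlonglongrightarrow> l2norm g"
  using tendsto_l2norm[OF st g truncation_tendsto[OF g]] by simp
 then have "l2norm g = 0" by (simp add: LIMSEQ_const_iff)
 then show ?thesis by (simp add: l2norm_eq_0[OF g])
qed

lemma pairing_bound_tendsto:
 assumes f: "L2 f" and "!!k. L2 (T k)" "L2 \<psi>"
  "(%k. l2norm (%x. T k x - \<psi> x)) \<longlonglongrightarrow> 0"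
 shows "(%k. LINT x|lborel. f x * T k x) \<longlonglongrightarrow> (LINT x|lborel. f x * \<psi> x)"
 by (rule tendsto_l2_pairing[OF f f assms(2,3)]) (use assms(4) in \<open>auto simp: l2norm_def\<close>)

lemma fundamental_lemma:
 fixes f :: "'a::euclidean_space => complex"
 assumes f: "L2 f" and z: "!!\<phi>. test_function \<phi> ==> (LINT x|lborel. f x * \<phi> x) = 0"
 shows "AE x in lborel. f x = 0"
proof -
 have "AE \<xi> in lborel. fourier f \<xi> = 0"
 proof (rule AE_zero_band_limited[OF L2_fourier[OF f]])
  fix R and h :: "'a => complex" assume h: "band_limited R h"
  obtain T where T: "!!k::nat. test_function (T k)" "(%k. l2norm (%x. T k x - fourier_integral h x)) \<longlonglongrightarrow> 0"
   "L2 (fourier_integral h)"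
   by (rule band_limited_approx[OF h]) blast
  have "(%k. LINT x|lborel. f x * T k x) \<longlonglongrightarrow> (LINT x|lborel. f x * fourier_integral h x)"
   by (rule pairing_bound_tendsto[OF f test_function_facts(5)[OF T(1)] T(3,2)])
  then have "(%k::nat. 0) \<longlonglongrightarrow> (LINT x|lborel. f x * fourier_integral h x)" by (simp add: z T(1))
  then show "(LINT \<xi>|lborel. fourier f \<xi> * h \<xi>) = 0"
   using fourier_pairing_band_limited[OF f h] by (simp add: LIMSEQ_const_iff)
 qed
 then have "l2norm (fourier f) = 0" by (simp add: l2norm_eq_0 L2_fourier f)
 then show ?thesis by (simp add: plancherel f l2norm_eq_0)
qed

section \<open>Sobolev spaces on the frequency side\<close>

lemma weak_partial_fourier:
 fixes f :: "'a::euclidean_space => complex"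
 assumes f: "L2 f" and b: "b \<in> Basis"
  and s: "L2 (%\<xi>. cor (\<xi> \<bullet> b) * fourier f \<xi>)"
 shows "l2norm (weak_partial b f) = l2norm (%\<xi>. cor (\<xi> \<bullet> b) * fourier f \<xi>)"
proof -
 define G where "G \<xi> = \<i> * (cor (\<xi> \<bullet> b) * fourier f \<xi>)" for \<xi>
 have sG: "L2 G" unfolding G_def by (rule L2_cmult[OF s])
 define g where "g = inverse_fourier G"
 have sg: "L2 g" unfolding g_def by (rule L2_inverse_fourier[OF sG])
 have Fg: "AE \<xi> in lborel. fourier g \<xi> = G \<xi>" unfolding g_def by (rule fourier_inverse_fourier[OF sG])
 have wp: "is_weak_partial b f g"
  unfolding is_weak_partial_def
 proof (intro conjI sg allI impI)
  fix \<phi> :: "'a => complex" assume \<phi>: "test_function \<phi>"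
  note s\<phi> = test_function_facts(5)[OF \<phi>] and sd = test_function_facts(5)[OF test_function_partial_deriv[OF \<phi> b]]
  note [measurable] = L2D(1)[OF L2_fourier[OF f]] L2D(1)[OF sG]
   L2D(1)[OF L2_fourier[OF sg]]
   L2D(1)[OF L2_inverse_fourier[OF s\<phi>]] L2D(1)[OF L2_inverse_fourier[OF sd]]
  have "(LINT x|lborel. f x * partial_deriv b \<phi> x) = (LINT \<xi>|lborel. fourier f \<xi> * inverse_fourier (partial_deriv b \<phi>) \<xi>)"
   by (rule parseval_bilinear[OF f sd])
  also have "\<dots> = (LINT \<xi>|lborel. - (fourier g \<xi> * inverse_fourier \<phi> \<xi>))"
  proof (rule integral_cong_AE)
   show "AE \<xi> in lborel. fourier f \<xi> * inverse_fourier (partial_deriv b \<phi>) \<xi> = - (fourier g \<xi> * inverse_fourier \<phi> \<xi>)"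
    using Fg inverse_fourier_partial_deriv[OF \<phi> b] by eventually_elim (simp add: G_def)
  qed measurable
  also have "\<dots> = - (LINT x|lborel. g x * \<phi> x)"
   by (simp add: parseval_bilinear[OF sg s\<phi>])
  finally show "(LINT x|lborel. f x * partial_deriv b \<phi> x) = - (LINT x|lborel. g x * \<phi> x)" .
 qed
 then have wp2: "is_weak_partial b f (weak_partial b f)" unfolding weak_partial_def by (rule someI[of "is_weak_partial b f"])
 have sw: "L2 (weak_partial b f)" using wp2 by (simp add: is_weak_partial_def)
 have "AE x in lborel. weak_partial b f x - g x = 0"
 proof (rule fundamental_lemma[OF L2_diff[OF sw sg]])
  fix \<phi> :: "'a => complex" assume \<phi>: "test_function \<phi>"
  note s\<phi> = test_function_facts(5)[OF \<phi>]
  have "(LINT x|lborel. weak_partial b f x * \<phi> x) = (LINT x|lborel. g x * \<phi> x)"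
   using wp wp2 \<phi> unfolding is_weak_partial_def by (metis minus_minus)
  then show "(LINT x|lborel. (weak_partial b f x - g x) * \<phi> x) = 0"
   by (simp add: left_diff_distrib L2_mult_integrable sw sg s\<phi>)
 qed
 then have "l2norm (weak_partial b f) = l2norm g"
  by (intro l2norm_cong_AE sw sg) auto
 also have "\<dots> = l2norm (fourier g)" by (simp add: plancherel sg)
 also have "\<dots> = l2norm G" by (rule l2norm_cong_AE[OF Fg L2_fourier[OF sg] sG])
 also have "\<dots> = l2norm (%\<xi>. cor (\<xi> \<bullet> b) * fourier f \<xi>)"
  unfolding G_def l2norm_cmult by simp
 finally show ?thesis .
qed

definition dirichlet :: "('a::euclidean_space => complex) => real" where
 "dirichlet f = (LINT \<xi>|lborel. (norm \<xi>)^2 * (cmod (f \<xi>))^2)"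

lemma dirichlet_eq_l2norm: "dirichlet f = (l2norm (%\<xi>. cor (norm \<xi>) * f \<xi>))^2"
 by (simp add: dirichlet_def l2norm_power2 norm_mult power_mult_distrib)

lemma dirichlet_nonneg: "0 <= dirichlet f"
 by (simp add: dirichlet_eq_l2norm)

lemma grad_l2norm_eq_dirichlet:
 fixes f :: "'a::euclidean_space => complex"
 assumes f: "L2 f" and s: "L2 (%\<xi>. cor (norm \<xi>) * fourier f \<xi>)"
 shows "(grad_l2norm f)^2 = dirichlet (fourier f)"
proof -
 note [measurable] = L2D(1)[OF L2_fourier[OF f]]
 have sb: "L2 (%\<xi>. cor (\<xi> \<bullet> b) * fourier f \<xi>)" if "b \<in> Basis" for b
 proof (rule L2_bound[OF s])
  show "AE x in lborel. cmod (cor (x \<bullet> b) * fourier f x) <= 1 * cmod (cor (norm x) * fourier f x)"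
   using Basis_le_norm[OF that] by (auto simp: norm_mult intro!: mult_right_mono)
 qed measurable
 have "(grad_l2norm f)^2 = (\<Sum>b\<in>Basis. (l2norm (weak_partial b f))^2)"
  by (simp add: grad_l2norm_def sum_nonneg)
 also have "\<dots> = (\<Sum>b\<in>Basis. (LINT \<xi>|lborel. (\<xi> \<bullet> b)^2 * (cmod (fourier f \<xi>))^2))"
  by (intro sum.cong refl) (simp add: weak_partial_fourier[OF f _ sb] l2norm_power2 norm_mult power_mult_distrib)
 also have "\<dots> = (LINT \<xi>|lborel. (\<Sum>b\<in>Basis. (\<xi> \<bullet> b)^2 * (cmod (fourier f \<xi>))^2))"
  by (rule Bochner_Integration.integral_sum[symmetric])
   (use L2D(2)[OF sb] in \<open>simp add: norm_mult power_mult_distrib\<close>)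
 also have "\<dots> = dirichlet (fourier f)"
  unfolding dirichlet_def power2_norm_eq_inner
  by (intro Bochner_Integration.integral_cong refl) (simp add: euclidean_inner[of x x for x] sum_distrib_right power2_eq_square)
 finally show ?thesis .
qed

definition bracket :: "real => 'a::euclidean_space => complex" where
 "bracket \<sigma> \<xi> = cor ((1 + (norm \<xi>)^2) powr (\<sigma> / 2))"

lemma cmod_bracket: "cmod (bracket \<sigma> \<xi>) = (1 + (norm \<xi>)^2) powr (\<sigma> / 2)"
 by (simp add: bracket_def)

lemma measurable_bracket [measurable]: "bracket \<sigma> \<in> borel_measurable borel"
 unfolding bracket_def[abs_def] by measurable

lemma bracket_nonzero [simp]: "bracket \<sigma> \<xi> \<noteq> 0"
 by (simp add: bracket_def add_nonneg_eq_0_iff)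

lemma bracket_mono: "\<sigma> <= \<tau> ==> cmod (bracket \<sigma> \<xi>) <= cmod (bracket \<tau> \<xi>)"
 unfolding cmod_bracket by (intro powr_mono) auto

lemma bracket_0: "cmod (bracket 0 \<xi>) = 1"
 by (simp add: cmod_bracket add_nonneg_eq_0_iff)

lemma norm_powr_le_bracket:
 assumes "0 <= s" "s <= \<sigma>"
 shows "norm \<xi> powr s <= cmod (bracket \<sigma> \<xi>)"
proof -
 have "norm \<xi> powr s = ((norm \<xi>)^2) powr (s / 2)"
  using powr_powr[of "norm \<xi>" 2 "s/2"] by (simp add: powr_numeral)
 also have "\<dots> <= (1 + (norm \<xi>)^2) powr (s / 2)" using assms by (intro powr_mono2) auto
 also have "\<dots> <= cmod (bracket \<sigma> \<xi>)" using bracket_mono[OF assms(2)] by (simp add: cmod_bracket)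
 finally show ?thesis .
qed

lemma bracket_weighted_measurable:
 assumes "L2 (%\<xi>. bracket \<sigma> \<xi> * f \<xi>)"
 shows "f \<in> borel_measurable borel"
proof -
 note [measurable] = L2D(1)[OF assms]
 have "(%\<xi>. (bracket \<sigma> \<xi> * f \<xi>) / bracket \<sigma> \<xi>) \<in> borel_measurable borel" by measurable
 then show ?thesis by simp
qed

lemma weight_dominated:
 assumes s: "L2 (%\<xi>. bracket \<sigma> \<xi> * f \<xi>)" and [measurable]: "m \<in> borel_measurable borel"
  and le: "!!\<xi>. cmod (m \<xi>) <= cmod (bracket \<sigma> \<xi>)"
 shows "L2 (%\<xi>. m \<xi> * f \<xi>)" "l2norm (%\<xi>. m \<xi> * f \<xi>) <= l2norm (%\<xi>. bracket \<sigma> \<xi> * f \<xi>)"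
proof -
 note [measurable] = bracket_weighted_measurable[OF s]
 show "L2 (%\<xi>. m \<xi> * f \<xi>)"
  by (rule L2_bound[OF s, where C=1]) (use le in \<open>auto simp: norm_mult intro!: mult_right_mono\<close>)
 show "l2norm (%\<xi>. m \<xi> * f \<xi>) <= l2norm (%\<xi>. bracket \<sigma> \<xi> * f \<xi>)"
  by (rule l2norm_mono[OF s]) (use le in \<open>auto simp: norm_mult intro!: mult_right_mono\<close>)
qed

lemma sobolev_iff: "f \<in> sobolev \<sigma> \<longleftrightarrow> L2 f \<and> L2 (%\<xi>. bracket \<sigma> \<xi> * fourier f \<xi>)"
 by (simp add: sobolev_def bracket_def)

lemma sobolev_norm_eq: "sobolev_norm \<sigma> f = l2norm (%\<xi>. bracket \<sigma> \<xi> * fourier f \<xi>)"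
 by (simp add: sobolev_norm_def bracket_def)

lemma sobolev_diff:
 assumes f: "f \<in> sobolev \<sigma>" and g: "g \<in> sobolev \<sigma>"
 shows "(%x. f x - g x) \<in> sobolev \<sigma>"
  "sobolev_norm \<sigma> (%x. f x - g x) = l2norm (%\<xi>. bracket \<sigma> \<xi> * (fourier f \<xi> - fourier g \<xi>))"
proof -
 have sf: "L2 f" "L2 (%\<xi>. bracket \<sigma> \<xi> * fourier f \<xi>)"
  and sg: "L2 g" "L2 (%\<xi>. bracket \<sigma> \<xi> * fourier g \<xi>)"
  using f g by (auto simp: sobolev_iff)
 note d = L2_diff[OF sf(1) sg(1)]
 note [measurable] = L2D(1)[OF L2_fourier[OF d]]
 have s: "L2 (%\<xi>. bracket \<sigma> \<xi> * (fourier f \<xi> - fourier g \<xi>))"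
  using L2_diff[OF sf(2) sg(2)] by (simp add: right_diff_distrib)
 have ae: "AE \<xi> in lborel. bracket \<sigma> \<xi> * fourier (%x. f x - g x) \<xi> = bracket \<sigma> \<xi> * (fourier f \<xi> - fourier g \<xi>)"
  using fourier_diff[OF sf(1) sg(1)] by eventually_elim simp
 have s2: "L2 (%\<xi>. bracket \<sigma> \<xi> * fourier (%x. f x - g x) \<xi>)"
 proof (rule L2_bound[OF s, where C=1])
  show "AE x in lborel. cmod (bracket \<sigma> x * fourier (%x. f x - g x) x) <= 1 * cmod (bracket \<sigma> x * (fourier f x - fourier g x))"
   using ae by eventually_elim simp
 qed measurable
 show "(%x. f x - g x) \<in> sobolev \<sigma>" using d s2 by (simp add: sobolev_iff)
 show "sobolev_norm \<sigma> (%x. f x - g x) = l2norm (%\<xi>. bracket \<sigma> \<xi> * (fourier f \<xi> - fourier g \<xi>))"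
  unfolding sobolev_norm_eq by (rule l2norm_cong_AE[OF ae s2 s])
qed

lemma sobolev_cmult:
 assumes f: "f \<in> sobolev \<sigma>"
 shows "(%x. c * f x) \<in> sobolev \<sigma>" 
  "AE \<xi> in lborel. fourier (%x. c * f x) \<xi> = c * fourier f \<xi>"
proof -
 have sf: "L2 f" "L2 (%\<xi>. bracket \<sigma> \<xi> * fourier f \<xi>)"
  using f by (auto simp: sobolev_iff)
 show ae: "AE \<xi> in lborel. fourier (%x. c * f x) \<xi> = c * fourier f \<xi>" by (rule fourier_cmult[OF sf(1)])
 note [measurable] = L2D(1)[OF L2_fourier[OF L2_cmult[OF sf(1), of c]]]
 have "L2 (%\<xi>. bracket \<sigma> \<xi> * fourier (%x. c * f x) \<xi>)"
 proof (rule L2_bound[OF sf(2), where C="cmod c"])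
  show "AE x in lborel. cmod (bracket \<sigma> x * fourier (%x. c * f x) x) <= cmod c * cmod (bracket \<sigma> x * fourier f x)"
   using ae by eventually_elim (simp add: norm_mult)
 qed measurable
 then show "(%x. c * f x) \<in> sobolev \<sigma>" using sf by (simp add: sobolev_iff L2_cmult)
qed

lemma sobolev_difference_quotient:
 assumes f: "f \<in> sobolev \<sigma>" and g: "g \<in> sobolev \<sigma>" and h: "h \<in> sobolev \<sigma>"
 shows "(%x. (f x - g x) / c - h x) \<in> sobolev \<sigma>"
  "sobolev_norm \<sigma> (%x. (f x - g x) / c - h x) = l2norm (%\<xi>. bracket \<sigma> \<xi> * ((fourier f \<xi> - fourier g \<xi>) / c - fourier h \<xi>))"
proof -
 have q: "(%x. (1 / c) * (f x - g x)) \<in> sobolev \<sigma>" by (intro sobolev_cmult sobolev_diff f g)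
 have e: "(%x. (f x - g x) / c - h x) = (%x. (1 / c) * (f x - g x) - h x)" by (simp add: fun_eq_iff)
 show "(%x. (f x - g x) / c - h x) \<in> sobolev \<sigma>" unfolding e by (rule sobolev_diff(1)[OF q h])
 have sf: "L2 f" "L2 (%\<xi>. bracket \<sigma> \<xi> * fourier f \<xi>)"
  and sg: "L2 g" "L2 (%\<xi>. bracket \<sigma> \<xi> * fourier g \<xi>)"
  and sh: "L2 h" "L2 (%\<xi>. bracket \<sigma> \<xi> * fourier h \<xi>)"
  and sq: "L2 (%\<xi>. bracket \<sigma> \<xi> * fourier (%x. (1 / c) * (f x - g x)) \<xi>)"
  using f g h q by (auto simp: sobolev_iff)
 have "sobolev_norm \<sigma> (%x. (f x - g x) / c - h x) = l2norm (%\<xi>. bracket \<sigma> \<xi> * (fourier (%x. (1 / c) * (f x - g x)) \<xi> - fourier h \<xi>))"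
  unfolding e by (rule sobolev_diff(2)[OF q h])
 also have "\<dots> = l2norm (%\<xi>. bracket \<sigma> \<xi> * ((fourier f \<xi> - fourier g \<xi>) / c - fourier h \<xi>))"
 proof (rule l2norm_cong_AE)
  show "AE \<xi> in lborel. bracket \<sigma> \<xi> * (fourier (%x. (1 / c) * (f x - g x)) \<xi> - fourier h \<xi>)
    = bracket \<sigma> \<xi> * ((fourier f \<xi> - fourier g \<xi>) / c - fourier h \<xi>)"
   using sobolev_cmult(2)[OF sobolev_diff(1)[OF f g], of "1 / c"] fourier_diff[OF sf(1) sg(1)]
   by eventually_elim simp
  show "L2 (%\<xi>. bracket \<sigma> \<xi> * (fourier (%x. (1 / c) * (f x - g x)) \<xi> - fourier h \<xi>))"
   using L2_diff[OF sq sh(2)] by (simp add: right_diff_distrib)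
  show "L2 (%\<xi>. bracket \<sigma> \<xi> * ((fourier f \<xi> - fourier g \<xi>) / c - fourier h \<xi>))"
   using L2_diff[OF L2_divide[OF L2_diff[OF sf(2) sg(2)], of c] sh(2)]
   by (simp add: right_diff_distrib)
 qed
 finally show "sobolev_norm \<sigma> (%x. (f x - g x) / c - h x) = l2norm (%\<xi>. bracket \<sigma> \<xi> * ((fourier f \<xi> - fourier g \<xi>) / c - fourier h \<xi>))" .
qed

lemma sobolev_mono:
 assumes f: "f \<in> sobolev \<tau>" and le: "\<sigma> <= \<tau>"
 shows "f \<in> sobolev \<sigma>" "sobolev_norm \<sigma> f <= sobolev_norm \<tau> f"
proof -
 have s: "L2 (%\<xi>. bracket \<tau> \<xi> * fourier f \<xi>)" using f by (simp add: sobolev_iff)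
 note w = weight_dominated[OF s measurable_bracket bracket_mono[OF le]]
 show "f \<in> sobolev \<sigma>" using w(1) f by (simp add: sobolev_iff)
 show "sobolev_norm \<sigma> f <= sobolev_norm \<tau> f" using w(2) by (simp add: sobolev_norm_eq)
qed

lemma kirchhoff_solution_mono:
 assumes u: "kirchhoff_solution N s0 T u u'" and le: "s1 <= s0" and T: "T1 <= T"
 shows "kirchhoff_solution N s1 T1 u u'"
proof -
 have sub: "{0..T1} \<subseteq> {0..T}" using T by auto
 have c1: "sobolev_continuous \<sigma>1 T1 w" if w: "sobolev_continuous \<sigma> T w" and "\<sigma>1 <= \<sigma>" for \<sigma> \<sigma>1 and w :: "real => 'a => complex"
  unfolding sobolev_continuous_def
 proof (intro ballI conjI)
  fix t assume t: "t \<in> {0..T1}"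
  then have t': "t \<in> {0..T}" using sub by blast
  have S: "w \<tau> \<in> sobolev \<sigma>" if "\<tau> \<in> {0..T}" for \<tau> using w that by (auto simp: sobolev_continuous_def)
  show "w t \<in> sobolev \<sigma>1" by (rule sobolev_mono(1)[OF S[OF t'] \<open>\<sigma>1 <= \<sigma>\<close>])
  have "((%\<tau>. sobolev_norm \<sigma> (%x. w \<tau> x - w t x)) \<longlongrightarrow> 0) (at t within {0..T1})"
   using w t' by (auto simp: sobolev_continuous_def intro: tendsto_within_subset[OF _ sub])
  then show "((%\<tau>. sobolev_norm \<sigma>1 (%x. w \<tau> x - w t x)) \<longlongrightarrow> 0) (at t within {0..T1})"
  proof (rule Lim_null_comparison[rotated])
   have "norm (sobolev_norm \<sigma>1 (%x. w \<tau> x - w t x)) <= sobolev_norm \<sigma> (%x. w \<tau> x - w t x)" if "\<tau> \<in> {0..T1}" for \<tau>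
    using sobolev_mono(2)[OF sobolev_diff(1)[OF S S[OF t']] \<open>\<sigma>1 <= \<sigma>\<close>, of \<tau>] that sub by (auto simp: sobolev_norm_eq)
   then show "\<forall>\<^sub>F \<tau> in at t within {0..T1}. norm (sobolev_norm \<sigma>1 (%x. w \<tau> x - w t x)) <= sobolev_norm \<sigma> (%x. w \<tau> x - w t x)"
    by (auto simp: eventually_at_filter)
  qed
 qed
 have cu: "sobolev_continuous (s0 + 1) T u" and cu': "sobolev_continuous s0 T u'"
  and du: "sobolev_time_deriv s0 T u u'" using u by (auto simp: kirchhoff_solution_def)
 have d1: "sobolev_time_deriv s1 T1 u u'"
  unfolding sobolev_time_deriv_def
 proof
  fix t assume t: "t \<in> {0..T1}"
  then have t': "t \<in> {0..T}" using sub by blast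
  have S: "u \<tau> \<in> sobolev s0" "u' \<tau> \<in> sobolev s0" if "\<tau> \<in> {0..T}" for \<tau>
   using cu cu' that sobolev_mono(1)[of "u \<tau>" "s0 + 1" s0] by (auto simp: sobolev_continuous_def)
  let ?q = "%\<tau> x. (u \<tau> x - u t x) / cor (\<tau> - t) - u' t x"
  have "((%\<tau>. sobolev_norm s0 (?q \<tau>)) \<longlongrightarrow> 0) (at t within {0..T1})"
   using du t' by (auto simp: sobolev_time_deriv_def intro: tendsto_within_subset[OF _ sub])
  then show "((%\<tau>. sobolev_norm s1 (?q \<tau>)) \<longlongrightarrow> 0) (at t within {0..T1})"
  proof (rule Lim_null_comparison[rotated])
   have "norm (sobolev_norm s1 (?q \<tau>)) <= sobolev_norm s0 (?q \<tau>)" if "\<tau> \<in> {0..T1}" for \<tau>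
    using sobolev_mono(2)[OF sobolev_difference_quotient(1)[OF S(1) S(1)[OF t'] S(2)[OF t']] le, of \<tau> "cor (\<tau> - t)"] that sub
    by (auto simp: sobolev_norm_eq)
   then show "\<forall>\<^sub>F \<tau> in at t within {0..T1}. norm (sobolev_norm s1 (?q \<tau>)) <= sobolev_norm s0 (?q \<tau>)"
    by (auto simp: eventually_at_filter)
  qed
 qed
 show ?thesis
  unfolding kirchhoff_solution_def
 proof (intro conjI ballI allI impI)
  show "sobolev_continuous (s1 + 1) T1 u" by (rule c1[OF cu]) (use le in simp)
  show "sobolev_continuous s1 T1 u'" by (rule c1[OF cu' le])
  show "sobolev_time_deriv s1 T1 u u'" by (rule d1)
  fix t and \<phi> :: "'a => complex" assume "t \<in> {0..T1}" "test_function \<phi>"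
  then show "((%\<tau>. LINT x|lborel. u' \<tau> x * \<phi> x) has_vector_derivative
      cor (1 + N ((grad_l2norm (u t))^2)) * (LINT x|lborel. u t x * laplacian \<phi> x)) (at t within {0..T1})"
   using u sub unfolding kirchhoff_solution_def by (meson has_vector_derivative_within_subset subsetD)
 qed
qed

section \<open>Solutions on the frequency side\<close>

text \<open>
  The notion of solution, rewritten for the transforms \<open>v\<close> of \<open>u\<close> and \<open>p\<close> of \<open>u'\<close>, with the coefficient as a
  given function of time and band-limited functions in place of test functions.
\<close>

definition spectral_solution ::
 "(real => real) => real => real => (real => 'a::euclidean_space => complex) => (real => 'a => complex) => bool" where
 "spectral_solution a s T v p \<longleftrightarrow> (\<forall>t\<in>{0..T}.
   L2 (%\<xi>. bracket (s + 1) \<xi> * v t \<xi>) \<and>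
   L2 (%\<xi>. bracket s \<xi> * p t \<xi>) \<and>
   ((%\<tau>. l2norm (%\<xi>. bracket (s + 1) \<xi> * (v \<tau> \<xi> - v t \<xi>))) \<longlongrightarrow> 0) (at t within {0..T}) \<and>
   ((%\<tau>. l2norm (%\<xi>. bracket s \<xi> * (p \<tau> \<xi> - p t \<xi>))) \<longlongrightarrow> 0) (at t within {0..T}) \<and>
   ((%\<tau>. l2norm (%\<xi>. bracket s \<xi> * ((v \<tau> \<xi> - v t \<xi>) / cor (\<tau> - t) - p t \<xi>))) \<longlongrightarrow> 0) (at t within {0..T}) \<and>
   (\<forall>R h. band_limited R h \<longrightarrow>
    ((%\<tau>. LINT \<xi>|lborel. p \<tau> \<xi> * h \<xi>) has_vector_derivative
     cor (- a t) * (LINT \<xi>|lborel. v t \<xi> * (cor ((norm \<xi>)^2) * h \<xi>))) (at t within {0..T})))"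

lemma weight_tendsto:
 fixes f :: "real => 'a::euclidean_space => complex"
 assumes s: "!!\<tau>. \<tau> \<in> S ==> L2 (%\<xi>. bracket \<sigma> \<xi> * f \<tau> \<xi>)" and t: "t \<in> S"
  and lim: "((%\<tau>. l2norm (%\<xi>. bracket \<sigma> \<xi> * (f \<tau> \<xi> - f t \<xi>))) \<longlongrightarrow> 0) (at t within S)"
  and m: "m \<in> borel_measurable borel" and le: "!!\<xi>. cmod (m \<xi>) <= cmod (bracket \<sigma> \<xi>)"
 shows "((%\<tau>. l2norm (%\<xi>. m \<xi> * (f \<tau> \<xi> - f t \<xi>))) \<longlongrightarrow> 0) (at t within S)"
  "((%\<tau>. l2norm (%\<xi>. m \<xi> * f \<tau> \<xi>)) \<longlongrightarrow> l2norm (%\<xi>. m \<xi> * f t \<xi>)) (at t within S)"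
proof -
 have "L2 (%\<xi>. bracket \<sigma> \<xi> * (f \<tau> \<xi> - f t \<xi>))" if "\<tau> \<in> S" for \<tau>
  using L2_diff[OF s[OF that] s[OF t]] by (simp add: right_diff_distrib)
 note w = weight_dominated[OF this m le]
 have b: "\<forall>\<^sub>F \<tau> in at t within S. norm (l2norm (%\<xi>. m \<xi> * (f \<tau> \<xi> - f t \<xi>))) <= l2norm (%\<xi>. bracket \<sigma> \<xi> * (f \<tau> \<xi> - f t \<xi>))"
  using w(2) by (auto simp: eventually_at_filter)
 show 1: "((%\<tau>. l2norm (%\<xi>. m \<xi> * (f \<tau> \<xi> - f t \<xi>))) \<longlongrightarrow> 0) (at t within S)"
  by (rule Lim_null_comparison[OF b lim])
 show "((%\<tau>. l2norm (%\<xi>. m \<xi> * f \<tau> \<xi>)) \<longlongrightarrow> l2norm (%\<xi>. m \<xi> * f t \<xi>)) (at t within S)"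
 proof (rule Lim_null[THEN iffD2], rule Lim_null_comparison[OF _ 1])
  have "norm (l2norm (%\<xi>. m \<xi> * f \<tau> \<xi>) - l2norm (%\<xi>. m \<xi> * f t \<xi>)) <= l2norm (%\<xi>. m \<xi> * (f \<tau> \<xi> - f t \<xi>))" if "\<tau> \<in> S" for \<tau>
   using abs_l2norm_diff_le[OF weight_dominated(1)[OF s[OF that] m le] weight_dominated(1)[OF s[OF t] m le]]
   by (simp add: right_diff_distrib)
  then show "\<forall>\<^sub>F \<tau> in at t within S. norm (l2norm (%\<xi>. m \<xi> * f \<tau> \<xi>) - l2norm (%\<xi>. m \<xi> * f t \<xi>)) <= l2norm (%\<xi>. m \<xi> * (f \<tau> \<xi> - f t \<xi>))"
   by (auto simp: eventually_at_filter)
 qed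
qed

lemma measurable_norm_powr [measurable]: "(%\<xi>::'a::euclidean_space. cor (norm \<xi> powr s)) \<in> borel_measurable borel"
 by measurable

lemma spectral_solution_facts:
 assumes v: "spectral_solution a s T v p" and s: "0 <= s"
 shows "t \<in> {0..T} ==> L2 (v t)" "t \<in> {0..T} ==> L2 (p t)"
  "[|t \<in> {0..T}; 0 <= \<sigma>; \<sigma> <= s + 1|] ==> L2 (%\<xi>. cor (norm \<xi> powr \<sigma>) * v t \<xi>)"
  "[|t \<in> {0..T}; 0 <= \<sigma>; \<sigma> <= s|] ==> L2 (%\<xi>. cor (norm \<xi> powr \<sigma>) * p t \<xi>)"
proof -
 assume t: "t \<in> {0..T}"
 have b: "L2 (%\<xi>. bracket (s + 1) \<xi> * v t \<xi>)" "L2 (%\<xi>. bracket s \<xi> * p t \<xi>)"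
  using v t by (auto simp: spectral_solution_def)
 have 1: "cmod 1 <= cmod (bracket r \<xi>)" if "r >= 0" for r and \<xi> :: 'a
  using bracket_mono[OF that, of \<xi>] bracket_0[of \<xi>] by simp
 show "L2 (v t)" using weight_dominated(1)[OF b(1), of "%_. 1"] 1 s by simp
 show "L2 (p t)" using weight_dominated(1)[OF b(2), of "%_. 1"] 1 s by simp
 show "L2 (%\<xi>. cor (norm \<xi> powr \<sigma>) * v t \<xi>)" if "0 <= \<sigma>" "\<sigma> <= s + 1"
  by (rule weight_dominated(1)[OF b(1)]) (use norm_powr_le_bracket[OF that] in auto)
 show "L2 (%\<xi>. cor (norm \<xi> powr \<sigma>) * p t \<xi>)" if "0 <= \<sigma>" "\<sigma> <= s"
  by (rule weight_dominated(1)[OF b(2)]) (use norm_powr_le_bracket[OF that] in auto)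
qed

lemma norm_powr_1 [simp]: "norm \<xi> powr 1 = norm \<xi>"
 by simp

lemma spectral_energy_continuous:
 assumes v: "spectral_solution a s T v p" and s: "0 <= s"
 shows "continuous_on {0..T} (%t. dirichlet (v t))" "continuous_on {0..T} (%t. l2norm (p t))"
  "continuous_on {0..T} (%t. l2norm (v t))"
proof -
 note F = v[unfolded spectral_solution_def, rule_format]
 have 1: "cmod 1 <= cmod (bracket r \<xi>)" if "r >= 0" for r and \<xi> :: 'a
  using bracket_mono[OF that, of \<xi>] bracket_0[of \<xi>] by simp
 have "((%\<tau>. l2norm (%\<xi>. cor (norm \<xi> powr 1) * v \<tau> \<xi>)) \<longlongrightarrow> l2norm (%\<xi>. cor (norm \<xi> powr 1) * v t \<xi>)) (at t within {0..T})"
  if "t \<in> {0..T}" for t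
  by (rule weight_tendsto(2)[where \<sigma>="s+1"])
    (use F that norm_powr_le_bracket[of 1 "s + 1"] s in auto)
 then show "continuous_on {0..T} (%t. dirichlet (v t))"
  unfolding continuous_on_def dirichlet_eq_l2norm by (auto intro!: tendsto_power)
 have "((%\<tau>. l2norm (%\<xi>. 1 * p \<tau> \<xi>)) \<longlongrightarrow> l2norm (%\<xi>. 1 * p t \<xi>)) (at t within {0..T})"
  if "t \<in> {0..T}" for t
  by (rule weight_tendsto(2)[where \<sigma>=s]) (use F that 1[OF s] in auto)
 then show "continuous_on {0..T} (%t. l2norm (p t))" unfolding continuous_on_def by simp
 have "((%\<tau>. l2norm (%\<xi>. 1 * v \<tau> \<xi>)) \<longlongrightarrow> l2norm (%\<xi>. 1 * v t \<xi>)) (at t within {0..T})"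
  if "t \<in> {0..T}" for t
  by (rule weight_tendsto(2)[where \<sigma>="s+1"]) (use F that 1[of "s+1"] s in auto)
 then show "continuous_on {0..T} (%t. l2norm (v t))" unfolding continuous_on_def by simp
qed

text \<open>
  Here \<open>s \<ge> 1/2\<close> enters: the derivative is \<open>2 Re \<integral> |\<xi>|\<^sup>2 p cnj v\<close>, and the weight \<open>|\<xi>|\<^sup>2\<close> is shared
  as \<open>|\<xi>|\<^bsup>1/2\<^esup>\<close> on \<open>p\<close> and \<open>|\<xi>|\<^bsup>3/2\<^esup>\<close> on \<open>v\<close>.
\<close>

lemma dirichlet_has_derivative:
 fixes v p :: "real => 'a::euclidean_space => complex"
 assumes v: "spectral_solution a s T v p" and s: "1/2 <= s" and t: "t \<in> {0..T}"
 shows "\<exists>D. ((%\<tau>. dirichlet (v \<tau>)) has_real_derivative D) (at t within {0..T}) \<and>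
   \<bar>D\<bar> <= (l2norm (%\<xi>. cor (norm \<xi> powr (3/2)) * v t \<xi>))^2 + (l2norm (%\<xi>. cor (norm \<xi> powr (1/2)) * p t \<xi>))^2"
proof -
 note F = v[unfolded spectral_solution_def, rule_format]
 have s0: "0 <= s" using s by simp
 note SF = spectral_solution_facts[OF v s0]
 define w1 where "w1 \<xi> = cor (norm \<xi> powr (1/2))" for \<xi> :: 'a
 define w3 where "w3 \<xi> = cor (norm \<xi> powr (3/2))" for \<xi> :: 'a
 have w13: "w1 \<xi> * w3 \<xi> = cor ((norm \<xi>)^2)" for \<xi> :: 'a
  unfolding w1_def w3_def of_real_mult[symmetric] powr_add[symmetric] by (simp add: powr_numeral)
 have m[measurable]: "w1 \<in> borel_measurable borel" "w3 \<in> borel_measurable borel" by (simp_all add: w1_def[abs_def] w3_def[abs_def])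
 have s1p: "L2 (%\<xi>. w1 \<xi> * p t \<xi>)" if "t \<in> {0..T}" for t
  unfolding w1_def by (rule SF(4)[OF that]) (use s in auto)
 have s1v: "L2 (%\<xi>. w1 \<xi> * v t \<xi>)" if "t \<in> {0..T}" for t
  unfolding w1_def by (rule SF(3)[OF that]) (use s in auto)
 have s3v: "L2 (%\<xi>. w3 \<xi> * v t \<xi>)" if "t \<in> {0..T}" for t
  unfolding w3_def by (rule SF(3)[OF that]) (use s in auto)
 have sn: "L2 (%\<xi>. cor (norm \<xi>) * v t \<xi>)" if "t \<in> {0..T}" for t
  using SF(3)[OF that, of 1] s by simp
 have in': "integrable lborel (%\<xi>. (norm \<xi>)^2 * (cmod (v t \<xi>))^2)" if "t \<in> {0..T}" for t
  using L2D(2)[OF sn[OF that]] by (simp add: norm_mult power_mult_distrib)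
 define D where "D = Re (LINT \<xi>|lborel. (w1 \<xi> * p t \<xi>) * (2 * cnj (w3 \<xi> * v t \<xi>)))"
 have "((%\<tau>. (dirichlet (v \<tau>) - dirichlet (v t)) / (\<tau> - t)) \<longlongrightarrow> D) (at t within {0..T})"
  unfolding tendsto_at_iff_sequentially comp_def
 proof (intro allI impI)
  fix X :: "nat => real" assume X: "\<forall>i. X i \<in> {0..T} - {t}" and XL: "X \<longlonglongrightarrow> t"
  have XT: "X i \<in> {0..T}" "X i \<noteq> t" for i using X by auto
  have filt: "filterlim X (at t within {0..T}) sequentially"
   unfolding filterlim_at using X XL by auto
  define q where "q i \<xi> = w1 \<xi> * ((v (X i) \<xi> - v t \<xi>) / cor (X i - t))" for i \<xi>
  define r where "r i \<xi> = cnj (w3 \<xi> * v (X i) \<xi> + w3 \<xi> * v t \<xi>)" for i \<xi>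
  have sq: "L2 (q i)" for i
   using L2_divide[OF L2_diff[OF s1v[OF XT(1)] s1v[OF t]], of i "cor (X i - t)"]
   by (simp add: q_def[abs_def] right_diff_distrib)
  have sr: "L2 (r i)" for i unfolding r_def
   by (intro L2_cnj L2_add s3v XT t)
  have qL: "(%i. l2norm (%\<xi>. q i \<xi> - w1 \<xi> * p t \<xi>)) \<longlonglongrightarrow> 0"
  proof -
   have d: "L2 (%\<xi>. bracket s \<xi> * ((v (X i) \<xi> - v t \<xi>) / cor (X i - t) - p t \<xi>))" for i
   proof -
    have bv: "L2 (%\<xi>. bracket s \<xi> * v \<tau> \<xi>)" if "\<tau> \<in> {0..T}" for \<tau>
     by (rule weight_dominated(1)[where \<sigma>="s+1"]) (use F that in \<open>auto intro: bracket_mono\<close>)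
    have bp: "L2 (%\<xi>. bracket s \<xi> * p t \<xi>)" using F[OF t] by blast
    show ?thesis
     using L2_diff[OF L2_divide[OF L2_diff[OF bv[OF XT(1)] bv[OF t]], of i "cor (X i - t)"] bp]
     by (simp add: right_diff_distrib)
   qed
   have le: "cmod (w1 \<xi>) <= cmod (bracket s \<xi>)" for \<xi> :: 'a
    using norm_powr_le_bracket[of "1/2" s \<xi>] s by (simp add: w1_def)
   have lim: "((%\<tau>. l2norm (%\<xi>. bracket s \<xi> * ((v \<tau> \<xi> - v t \<xi>) / cor (\<tau> - t) - p t \<xi>))) \<longlongrightarrow> 0) (at t within {0..T})"
    using F[OF t] by blast
   have "norm (l2norm (%\<xi>. q i \<xi> - w1 \<xi> * p t \<xi>)) <= l2norm (%\<xi>. bracket s \<xi> * ((v (X i) \<xi> - v t \<xi>) / cor (X i - t) - p t \<xi>))" for i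
    using weight_dominated(2)[OF d m(1) le, of i] by (simp add: q_def right_diff_distrib)
   then show ?thesis
    by (intro Lim_null_comparison[OF always_eventually filterlim_compose[OF lim filt]]) auto
  qed
  have rL: "(%i. l2norm (%\<xi>. r i \<xi> - 2 * cnj (w3 \<xi> * v t \<xi>))) \<longlonglongrightarrow> 0"
  proof -
   have "((%\<tau>. l2norm (%\<xi>. w3 \<xi> * (v \<tau> \<xi> - v t \<xi>))) \<longlongrightarrow> 0) (at t within {0..T})"
    by (rule weight_tendsto(1)[where \<sigma>="s+1"])
     (use F t norm_powr_le_bracket[of "3/2" "s + 1"] s in \<open>auto simp: w3_def\<close>)
   from filterlim_compose[OF this filt]
   have "(%i. l2norm (%\<xi>. w3 \<xi> * (v (X i) \<xi> - v t \<xi>))) \<longlonglongrightarrow> 0" .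
   moreover have "l2norm (%\<xi>. r i \<xi> - 2 * cnj (w3 \<xi> * v t \<xi>)) = l2norm (%\<xi>. cnj (w3 \<xi> * (v (X i) \<xi> - v t \<xi>)))" for i
    by (rule arg_cong[of _ _ l2norm]) (simp add: r_def fun_eq_iff algebra_simps)
   ultimately show ?thesis by (simp only: l2norm_cnj)
  qed
  have "(%i. LINT \<xi>|lborel. q i \<xi> * r i \<xi>) \<longlonglongrightarrow> (LINT \<xi>|lborel. (w1 \<xi> * p t \<xi>) * (2 * cnj (w3 \<xi> * v t \<xi>)))"
   by (rule tendsto_l2_pairing[OF sq s1p[OF t] sr L2_cmult[OF L2_cnj[OF s3v[OF t]]] qL rL])
  then have "(%i. Re (LINT \<xi>|lborel. q i \<xi> * r i \<xi>)) \<longlonglongrightarrow> D" unfolding D_def by (rule tendsto_Re)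
  moreover have "Re (LINT \<xi>|lborel. q i \<xi> * r i \<xi>) = (dirichlet (v (X i)) - dirichlet (v t)) / (X i - t)" for i
  proof -
   have pw: "Re (q i \<xi> * r i \<xi>) = ((norm \<xi>)^2 * (cmod (v (X i) \<xi>))^2 - (norm \<xi>)\<^sup>2 * (cmod (v t \<xi>))^2) / (X i - t)" for \<xi>
   proof -
    have "q i \<xi> * r i \<xi> = (w1 \<xi> * w3 \<xi>) * ((v (X i) \<xi> - v t \<xi>) * cnj (v (X i) \<xi> + v t \<xi>)) / cor (X i - t)"
    proof -
     have "r i \<xi> = w3 \<xi> * cnj (v (X i) \<xi> + v t \<xi>)" by (simp add: r_def w3_def distrib_left)
     then show ?thesis
      unfolding q_def by (simp only: times_divide_eq_left times_divide_eq_right mult.assoc mult.left_commute mult.commute)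
    qed
    also have "Re \<dots> = (norm \<xi>)^2 * Re ((v (X i) \<xi> - v t \<xi>) * cnj (v (X i) \<xi> + v t \<xi>)) / (X i - t)"
     unfolding w13 Re_divide_of_real by (simp only: Re_complex_of_real Im_complex_of_real times_complex.sel) simp
    also have "Re ((a - b) * cnj (a + b)) = (cmod a)^2 - (cmod b)\<^sup>2" for a b
     unfolding cmod_power2 by (simp add: algebra_simps power2_eq_square)
    finally show ?thesis by (simp add: right_diff_distrib)
   qed
   have "Re (LINT \<xi>|lborel. q i \<xi> * r i \<xi>) = (LINT \<xi>|lborel. Re (q i \<xi> * r i \<xi>))"
    by (rule integral_Re[symmetric]) (rule L2_mult_integrable[OF sq sr])
   then show ?thesis unfolding pw dirichlet_def using in'[OF XT(1)] in'[OF t] by simp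
  qed
  ultimately show "(%i. (dirichlet (v (X i)) - dirichlet (v t)) / (X i - t)) \<longlonglongrightarrow> D" by simp
 qed
 moreover have "\<bar>D\<bar> <= (l2norm (%\<xi>. w3 \<xi> * v t \<xi>))^2 + (l2norm (%\<xi>. w1 \<xi> * p t \<xi>))^2"
 proof -
  have "\<bar>D\<bar> <= cmod (LINT \<xi>|lborel. (w1 \<xi> * p t \<xi>) * (2 * cnj (w3 \<xi> * v t \<xi>)))"
   unfolding D_def by (rule abs_Re_le_cmod)
  also have "\<dots> <= l2norm (%\<xi>. w1 \<xi> * p t \<xi>) * l2norm (%\<xi>. 2 * cnj (w3 \<xi> * v t \<xi>))"
   by (intro Cauchy_Schwarz_l2 s1p L2_cmult L2_cnj s3v t)
  also have "l2norm (%\<xi>. 2 * cnj (w3 \<xi> * v t \<xi>)) = 2 * l2norm (%\<xi>. w3 \<xi> * v t \<xi>)"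
   unfolding l2norm_cmult l2norm_cnj by simp
  finally show ?thesis
   using sum_squares_bound[of "l2norm (%\<xi>. w1 \<xi> * p t \<xi>)" "l2norm (%\<xi>. w3 \<xi> * v t \<xi>)"] by simp
 qed
 ultimately show ?thesis by (auto simp: has_field_derivative_iff w1_def w3_def)
qed

text \<open>
  The equation, given for test functions, extends to all band-limited functions: by uniform
  convergence of the time derivatives along the approximating test functions.
\<close>

lemma kirchhoff_spectral:
 fixes u u' :: "real => 'a::euclidean_space => complex"
 assumes N: "continuous_on {0..} N" and s: "0 <= s" and u: "kirchhoff_solution N s T u u'"
 shows "spectral_solution (%t. 1 + N (dirichlet (fourier (u t)))) s T (%t. fourier (u t)) (%t. fourier (u' t))"
proof -
 define v p where "v t = fourier (u t)" and "p t = fourier (u' t)" for t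
 define a where "a t = 1 + N (dirichlet (v t))" for t
 have cu: "sobolev_continuous (s + 1) T u" and cu': "sobolev_continuous s T u'"
  and du: "sobolev_time_deriv s T u u'"
  and eq: "!!t \<phi>. t \<in> {0..T} ==> test_function \<phi> ==> ((%\<tau>. LINT x|lborel. u' \<tau> x * \<phi> x) has_vector_derivative
      cor (1 + N ((grad_l2norm (u t))^2)) * (LINT x|lborel. u t x * laplacian \<phi> x)) (at t within {0..T})"
  using u by (auto simp: kirchhoff_solution_def)
 have Su: "u \<tau> \<in> sobolev (s + 1)" "u \<tau> \<in> sobolev s" "u' \<tau> \<in> sobolev s" if "\<tau> \<in> {0..T}" for \<tau>
  using cu cu' that sobolev_mono(1)[of "u \<tau>" "s + 1" s] by (auto simp: sobolev_continuous_def)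
 have sq: "L2 (u \<tau>)" "L2 (u' \<tau>)" if "\<tau> \<in> {0..T}" for \<tau>
  using Su[OF that] by (auto simp: sobolev_iff)
 have b1: "L2 (%\<xi>. bracket (s + 1) \<xi> * v t \<xi>)" if "t \<in> {0..T}" for t
  using Su[OF that] by (auto simp: sobolev_iff v_def)
 have b2: "L2 (%\<xi>. bracket s \<xi> * p t \<xi>)" if "t \<in> {0..T}" for t
  using Su[OF that] by (auto simp: sobolev_iff p_def)
 have c1: "((%\<tau>. l2norm (%\<xi>. bracket (s + 1) \<xi> * (v \<tau> \<xi> - v t \<xi>))) \<longlongrightarrow> 0) (at t within {0..T})" if t: "t \<in> {0..T}" for t
 proof (rule Lim_transform_eventually)
  show "((%\<tau>. sobolev_norm (s + 1) (%x. u \<tau> x - u t x)) \<longlongrightarrow> 0) (at t within {0..T})"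
   using cu t by (auto simp: sobolev_continuous_def)
  show "\<forall>\<^sub>F \<tau> in at t within {0..T}. sobolev_norm (s + 1) (%x. u \<tau> x - u t x) = l2norm (%\<xi>. bracket (s + 1) \<xi> * (v \<tau> \<xi> - v t \<xi>))"
   using sobolev_diff(2)[OF Su(1) Su(1)[OF t]] by (auto simp: eventually_at_filter v_def)
 qed
 have c2: "((%\<tau>. l2norm (%\<xi>. bracket s \<xi> * (p \<tau> \<xi> - p t \<xi>))) \<longlongrightarrow> 0) (at t within {0..T})" if t: "t \<in> {0..T}" for t
 proof (rule Lim_transform_eventually)
  show "((%\<tau>. sobolev_norm s (%x. u' \<tau> x - u' t x)) \<longlongrightarrow> 0) (at t within {0..T})"
   using cu' t by (auto simp: sobolev_continuous_def)
  show "\<forall>\<^sub>F \<tau> in at t within {0..T}. sobolev_norm s (%x. u' \<tau> x - u' t x) = l2norm (%\<xi>. bracket s \<xi> * (p \<tau> \<xi> - p t \<xi>))"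
   using sobolev_diff(2)[OF Su(3) Su(3)[OF t]] by (auto simp: eventually_at_filter p_def)
 qed
 have c3: "((%\<tau>. l2norm (%\<xi>. bracket s \<xi> * ((v \<tau> \<xi> - v t \<xi>) / cor (\<tau> - t) - p t \<xi>))) \<longlongrightarrow> 0) (at t within {0..T})" if t: "t \<in> {0..T}" for t
 proof (rule Lim_transform_eventually)
  show "((%\<tau>. sobolev_norm s (%x. (u \<tau> x - u t x) / cor (\<tau> - t) - u' t x)) \<longlongrightarrow> 0) (at t within {0..T})"
   using du t by (auto simp: sobolev_time_deriv_def)
  show "\<forall>\<^sub>F \<tau> in at t within {0..T}. sobolev_norm s (%x. (u \<tau> x - u t x) / cor (\<tau> - t) - u' t x) = l2norm (%\<xi>. bracket s \<xi> * ((v \<tau> \<xi> - v t \<xi>) / cor (\<tau> - t) - p t \<xi>))"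
   using sobolev_difference_quotient(2)[OF Su(2) Su(2)[OF t] Su(3)[OF t]] by (auto simp: eventually_at_filter v_def p_def)
 qed
 have one: "cmod 1 <= cmod (bracket (s + 1) \<xi>)" for \<xi> :: 'a
  using bracket_mono[of 0 "s+1" \<xi>] bracket_0[of \<xi>] s by simp
 have nle: "cmod (cor (norm \<xi> powr 1)) <= cmod (bracket (s + 1) \<xi>)" for \<xi> :: 'a
  using norm_powr_le_bracket[of 1 "s+1" \<xi>] s by simp
 have yc: "continuous_on {0..T} (%t. dirichlet (v t))"
  unfolding continuous_on_def dirichlet_eq_l2norm
  using weight_tendsto(2)[OF b1 _ c1 _ nle] by (auto intro!: tendsto_power)
 have ac: "continuous_on {0..T} a"
  unfolding a_def by (intro continuous_intros continuous_on_compose2[OF N yc]) (auto simp: dirichlet_nonneg)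
 have uc: "continuous_on {0..T} (%t. l2norm (v t))"
  unfolding continuous_on_def using weight_tendsto(2)[OF b1 _ c1 _ one] by auto
 have grad: "(grad_l2norm (u t))^2 = dirichlet (v t)" if t: "t \<in> {0..T}" for t
  unfolding v_def
 proof (rule grad_l2norm_eq_dirichlet[OF sq(1)[OF t]])
  show "L2 (%\<xi>. cor (norm \<xi>) * fourier (u t) \<xi>)"
   using weight_dominated(1)[OF b1[OF t] _ nle] by (simp add: v_def)
 qed
 have weak: "((%\<tau>. LINT \<xi>|lborel. p \<tau> \<xi> * h \<xi>) has_vector_derivative
     cor (- a t) * (LINT \<xi>|lborel. v t \<xi> * (cor ((norm \<xi>)^2) * h \<xi>))) (at t within {0..T})"
  if h: "band_limited R h" and t: "t \<in> {0..T}" for R h t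
 proof -
  let ?\<psi> = "fourier_integral h"
  obtain \<phi> where \<phi>: "!!k::nat. test_function (\<phi> k)" and L1: "(%k. l2norm (%x. \<phi> k x - ?\<psi> x)) \<longlonglongrightarrow> 0"
   and L2: "(%k. l2norm (%x. laplacian (\<phi> k) x - laplacian ?\<psi> x)) \<longlonglongrightarrow> 0"
   and s\<psi>: "L2 ?\<psi>" "L2 (laplacian ?\<psi>)"
   by (rule band_limited_approx[OF h]) blast
  note s\<phi> = test_function_facts(5)[OF \<phi>] test_function_facts(5)[OF test_function_laplacian[OF \<phi>]]
  have hm: "band_limited R (%\<xi>. - cor ((norm \<xi>)^2) * h \<xi>)"
   by (rule band_limited_mult[OF h]) (intro continuous_intros)
  have lap: "(LINT x|lborel. u \<tau> x * laplacian ?\<psi> x) = - (LINT \<xi>|lborel. v \<tau> \<xi> * (cor ((norm \<xi>)^2) * h \<xi>))"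
   if "\<tau> \<in> {0..T}" for \<tau>
   unfolding laplacian_fourier_integral[OF h] fourier_pairing_band_limited[OF sq(1)[OF that] hm] v_def
   by simp
  have "bounded (a ` {0..T})" "bounded ((%t. l2norm (v t)) ` {0..T})"
   by (intro compact_imp_bounded compact_continuous_image ac uc compact_Icc)+
  then obtain A U where "\<forall>y\<in>a ` {0..T}. norm y <= A" "\<forall>y\<in>(%t. l2norm (v t)) ` {0..T}. norm y <= U"
   unfolding bounded_iff by blast
  then have A: "!!\<tau>. \<tau> \<in> {0..T} ==> \<bar>a \<tau>\<bar> <= A" and U: "!!\<tau>. \<tau> \<in> {0..T} ==> l2norm (v \<tau>) <= U"
   by auto
  have A0: "A >= 0" "U >= 0" using A[OF t] U[OF t] l2norm_nonneg[of "v t"] abs_ge_zero[of "a t"] by linarith+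
  let ?g' = "%\<tau>. cor (- a \<tau>) * (LINT \<xi>|lborel. v \<tau> \<xi> * (cor ((norm \<xi>)^2) * h \<xi>))"
  let ?f' = "%k \<tau>. cor (a \<tau>) * (LINT x|lborel. u \<tau> x * laplacian (\<phi> k) x)"
  have diff: "cmod (?f' k \<tau> - ?g' \<tau>) <= A * U * l2norm (%x. laplacian (\<phi> k) x - laplacian ?\<psi> x)" if \<tau>: "\<tau> \<in> {0..T}" for k \<tau>
  proof -
   have "?f' k \<tau> - ?g' \<tau> = cor (a \<tau>) * (LINT x|lborel. u \<tau> x * (laplacian (\<phi> k) x - laplacian ?\<psi> x))"
    unfolding right_diff_distrib
     Bochner_Integration.integral_diff[OF L2_mult_integrable[OF sq(1)[OF \<tau>] s\<phi>(2)[of k]]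
      L2_mult_integrable[OF sq(1)[OF \<tau>] s\<psi>(2)]] lap[OF \<tau>]
    by simp
   then have "cmod (?f' k \<tau> - ?g' \<tau>) = \<bar>a \<tau>\<bar> * cmod (LINT x|lborel. u \<tau> x * (laplacian (\<phi> k) x - laplacian ?\<psi> x))"
    by (simp add: norm_mult)
   also have "\<dots> <= A * (U * l2norm (%x. laplacian (\<phi> k) x - laplacian ?\<psi> x))"
   proof (intro mult_mono A \<tau> A0)
    have "l2norm (u \<tau>) <= U" using U[OF \<tau>] plancherel[OF sq(1)[OF \<tau>]] by (simp add: v_def)
    then show "cmod (LINT x|lborel. u \<tau> x * (laplacian (\<phi> k) x - laplacian ?\<psi> x)) <= U * l2norm (%x. laplacian (\<phi> k) x - laplacian ?\<psi> x)"
     by (intro order_trans[OF Cauchy_Schwarz_l2] mult_right_mono L2_diff sq \<tau> s\<phi> s\<psi>) auto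
   qed auto
   finally show ?thesis by simp
  qed
  have eqa: "cor (1 + N ((grad_l2norm (u \<tau>))^2)) = cor (a \<tau>)" if "\<tau> \<in> {0..T}" for \<tau>
   by (simp add: a_def grad[OF that])
  have pl: "(%k. LINT x|lborel. u' \<tau> x * \<phi> k x) \<longlonglongrightarrow> (LINT \<xi>|lborel. p \<tau> \<xi> * h \<xi>)" if \<tau>: "\<tau> \<in> {0..T}" for \<tau>
   using pairing_bound_tendsto[OF sq(2)[OF \<tau>] s\<phi>(1) s\<psi>(1) L1] fourier_pairing_band_limited[OF sq(2)[OF \<tau>] h]
   by (simp add: p_def)
  have "\<exists>g. \<forall>\<tau>\<in>{0..T}. (%k. LINT x|lborel. u' \<tau> x * \<phi> k x) \<longlonglongrightarrow> g \<tau> \<and> (g has_derivative (%h. h *\<^sub>R ?g' \<tau>)) (at \<tau> within {0..T})"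
  proof (rule has_derivative_sequence)
   show "((%\<tau>. LINT x|lborel. u' \<tau> x * \<phi> k x) has_derivative (%h. h *\<^sub>R ?f' k \<tau>)) (at \<tau> within {0..T})" if "\<tau> \<in> {0..T}" for k \<tau>
    using eq[OF that \<phi>[of k]] unfolding eqa[OF that] has_vector_derivative_def .
   show "\<forall>\<^sub>F k in sequentially. \<forall>\<tau>\<in>{0..T}. \<forall>h. norm (h *\<^sub>R ?f' k \<tau> - h *\<^sub>R ?g' \<tau>) <= e * norm h" if e: "e > 0" for e
   proof -
    have "(%k. A * U * l2norm (%x. laplacian (\<phi> k) x - laplacian ?\<psi> x)) \<longlonglongrightarrow> A * U * 0"
     by (intro tendsto_intros L2)
    then have "\<forall>\<^sub>F k in sequentially. A * U * l2norm (%x. laplacian (\<phi> k) x - laplacian ?\<psi> x) < e"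
     by (rule order_tendstoD) (use e in simp)
    then show ?thesis
    proof eventually_elim
     case (elim k)
     show ?case
     proof (intro ballI allI)
      fix \<tau> h :: real assume \<tau>: "\<tau> \<in> {0..T}"
      have "norm (h *\<^sub>R ?f' k \<tau> - h *\<^sub>R ?g' \<tau>) = \<bar>h\<bar> * cmod (?f' k \<tau> - ?g' \<tau>)"
       by (simp only: scaleR_diff_right[symmetric] norm_scaleR)
      also have "\<dots> <= \<bar>h\<bar> * e" using diff[OF \<tau>, of k] elim by (intro mult_left_mono) linarith+
      finally show "norm (h *\<^sub>R ?f' k \<tau> - h *\<^sub>R ?g' \<tau>) <= e * norm h" by (simp add: mult.commute)
     qed
    qed
   qed
   show "t \<in> {0..T}" by fact
   show "(%k. LINT x|lborel. u' t x * \<phi> k x) \<longlonglongrightarrow> (LINT \<xi>|lborel. p t \<xi> * h \<xi>)" by (rule pl[OF t])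
  qed simp
  then obtain g where g: "!!\<tau>. \<tau> \<in> {0..T} ==> (%k. LINT x|lborel. u' \<tau> x * \<phi> k x) \<longlonglongrightarrow> g \<tau>"
   and gd: "(g has_derivative (%h. h *\<^sub>R ?g' t)) (at t within {0..T})" using t by blast
  have "(LINT \<xi>|lborel. p \<tau> \<xi> * h \<xi>) = g \<tau>" if "\<tau> \<in> {0..T}" for \<tau>
   using LIMSEQ_unique[OF pl[OF that] g[OF that]] .
  then show ?thesis
   unfolding has_vector_derivative_def using gd t by (auto intro: has_derivative_transform)
 qed
 show ?thesis
  unfolding spectral_solution_def v_def[symmetric] p_def[symmetric] a_def[symmetric]
  using b1 b2 c1 c2 c3 weak by blast
qed

section \<open>The oscillator with variable coefficient\<close>

lemma deriv_le_imp_le: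
 fixes f g :: "real => real"
 assumes f: "!!t. t \<in> {0..T} ==> (f has_real_derivative f' t) (at t within {0..T})"
  and g: "!!t. t \<in> {0..T} ==> (g has_real_derivative g' t) (at t within {0..T})"
  and le: "!!t. t \<in> {0..T} ==> f' t <= g' t" and "f 0 <= g 0" and t: "t \<in> {0..T}"
 shows "f t <= g t"
proof -
 have "\<exists>x\<in>{0..t}. (%x. f x - g x) t - (%x. f x - g x) 0 = (%x h. (f' x - g' x) * h) x (t - 0)"
 proof (rule mvt_very_simple)
  fix x assume x: "0 <= x" "x <= t"
  then have "((%x. f x - g x) has_real_derivative f' x - g' x) (at x within {0..T})"
   using t by (intro DERIV_diff f g) auto
  then have "((%x. f x - g x) has_real_derivative f' x - g' x) (at x within {0..t})"
   by (rule DERIV_subset) (use t in auto)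
  then show "((%x. f x - g x) has_derivative (%h. (f' x - g' x) * h)) (at x within {0..t})"
   by (simp add: has_field_derivative_def)
 qed (use t in auto)
 then obtain x where x: "x \<in> {0..t}" "f t - g t - (f 0 - g 0) = (f' x - g' x) * t" by auto
 have "(f' x - g' x) * t <= 0" using le[of x] x t by (intro mult_nonpos_nonneg) auto
 then show ?thesis using x assms(4) by linarith
qed

lemma norm_vector_derivative_le:
 fixes f :: "real => complex"
 assumes f: "!!t. t \<in> {0..T} ==> (f has_vector_derivative f' t) (at t within {0..T})"
  and g: "!!t. t \<in> {0..T} ==> (g has_real_derivative g' t) (at t within {0..T})"
  and le: "!!t. t \<in> {0..T} ==> cmod (f' t) <= g' t" and le0: "cmod (f 0) <= g 0" and t: "t \<in> {0..T}"
 shows "cmod (f t) <= g t"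
proof -
 define c where "c = (if f t = 0 then 0 else cnj (f t) / cor (cmod (f t)))"
 have c1: "cmod c <= 1" by (simp add: c_def norm_divide)
 have ct: "Re (c * f t) = cmod (f t)"
 proof (cases "f t = 0")
  case False
  have "cnj (f t) * f t = cor ((cmod (f t))^2)"
   by (simp add: complex_norm_square mult.commute del: of_real_power)
  then have "c * f t = cor ((cmod (f t))^2) / cor (cmod (f t))"
   using False by (simp add: c_def)
  also have "\<dots> = cor (cmod (f t))"
   using False by (simp add: power2_eq_square)
  finally show ?thesis by simp
 qed simp
 have cle: "Re (c * z) <= cmod z" for z
 proof -
  have "Re (c * z) <= cmod (c * z)" by (rule complex_Re_le_cmod)
  also have "\<dots> <= 1 * cmod z" unfolding norm_mult by (intro mult_right_mono c1) auto
  finally show ?thesis by simp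
 qed
 have "Re (c * f t) <= g t"
 proof (rule deriv_le_imp_le[where f="%t. Re (c * f t)" and f'="%t. Re (c * f' t)" and T=T and g=g and g'=g'])
  show "((%t. Re (c * f t)) has_real_derivative Re (c * f' t)) (at t within {0..T})" if "t \<in> {0..T}" for t
  proof -
   have "bounded_linear (%z. Re (c * z))"
    by (intro bounded_linear_compose[OF bounded_linear_Re] bounded_linear_mult_right)
   from bounded_linear.has_vector_derivative[OF this f[OF that]]
   show ?thesis by (simp add: has_real_derivative_iff_has_vector_derivative)
  qed
 qed (use g le le0 t order_trans[OF cle] in auto)
 then show ?thesis unfolding ct .
qed

lemma gronwall:
 fixes y :: "real => real"
 assumes y: "!!t. t \<in> {0..T} ==> (y has_real_derivative y' t) (at t within {0..T})"
  and c: "continuous_on {0..T} \<phi>" and pos: "!!t. t \<in> {0..T} ==> 0 <= \<phi> t"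
  and le: "!!t. t \<in> {0..T} ==> y' t <= C * y t + \<phi> t" and C: "0 <= C" and t: "t \<in> {0..T}"
 shows "y t <= exp (C * t) * (y 0 + integral {0..t} \<phi>)"
proof -
 have "exp (- C * t) * y t <= y 0 + integral {0..t} \<phi>"
 proof (rule deriv_le_imp_le[where T=T and f="%t. exp (- C * t) * y t" and g="%t. y 0 + integral {0..t} \<phi>"])
  show "((%t. exp (- C * t) * y t) has_real_derivative exp (- C * t) * (y' t - C * y t)) (at t within {0..T})" if "t \<in> {0..T}" for t
   by (auto intro!: derivative_eq_intros y[OF that] simp: algebra_simps)
  show "((%t. y 0 + integral {0..t} \<phi>) has_real_derivative \<phi> t) (at t within {0..T})" if "t \<in> {0..T}" for t
   using integral_has_real_derivative[OF c that] by (auto intro!: derivative_eq_intros)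
  show "exp (- C * t) * (y' t - C * y t) <= \<phi> t" if "t \<in> {0..T}" for t
  proof -
   have "exp (- C * t) * (y' t - C * y t) <= exp (- C * t) * \<phi> t"
    using le[OF that] by (intro mult_left_mono) auto
   also have "\<dots> <= 1 * \<phi> t" using pos[OF that] C that by (intro mult_right_mono) auto
   finally show ?thesis by simp
  qed
 qed (use t in auto)
 then have A: "exp (C * t) * (exp (- C * t) * y t) <= exp (C * t) * (y 0 + integral {0..t} \<phi>)"
  by (rule mult_left_mono) simp
 have B: "exp (C * t) * (exp (- C * t) * y t) = y t"
  unfolding mult.assoc[symmetric] exp_add[symmetric] by simp
 show ?thesis using A unfolding B .
qed

text \<open>Solutions of \<open>S'' = - r a S\<close> as a power series in \<open>r\<close>, whose coefficients are iterated integrals.\<close>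

primrec vol :: "(real => real) => (real => real) => nat => real => real" where
 "vol a g 0 = g"
| "vol a g (Suc k) = (%t. integral {0..t} (%\<sigma>. integral {0..\<sigma>} (%\<tau>. a \<tau> * vol a g k \<tau>)))"

definition vint :: "(real => real) => (real => real) => nat => real => real" where
 "vint a g k t = integral {0..t} (%\<tau>. a \<tau> * vol a g k \<tau>)"

lemma vol_Suc: "vol a g (Suc k) t = integral {0..t} (vint a g k)"
 by (simp add: vint_def[abs_def])

definition ode_sol :: "(real => real) => (real => real) => real => real => real" where
 "ode_sol a g r t = (\<Sum>k. (- r) ^ k * vol a g k t)"

definition ode_int :: "(real => real) => (real => real) => real => real => real" where
 "ode_int a g r t = (\<Sum>k. (- r) ^ k * vint a g k t)"

context
 fixes a g :: "real => real" and T M B :: real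
 assumes a: "continuous_on {0..T} a" and g: "continuous_on {0..T} g"
  and M: "!!t. t \<in> {0..T} ==> \<bar>a t\<bar> <= M" and B: "!!t. t \<in> {0..T} ==> \<bar>g t\<bar> <= B" and T0: "0 <= T"
begin

lemma M_nonneg: "0 <= M" and B_nonneg: "0 <= B"
 using M[of 0] B[of 0] T0 by auto

lemma vol_continuous: "continuous_on {0..T} (vol a g k)"
 and vint_deriv: "t \<in> {0..T} ==> (vint a g k has_real_derivative a t * vol a g k t) (at t within {0..T})"
proof -
 have 1: "continuous_on {0..T} (vol a g k) ==> t \<in> {0..T} ==> (vint a g k has_real_derivative a t * vol a g k t) (at t within {0..T})" for k t
  unfolding vint_def[abs_def] by (rule integral_has_real_derivative) (auto intro!: continuous_intros a)
 show c: "continuous_on {0..T} (vol a g k)" for k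
 proof (induction k)
  case (Suc k)
  have "continuous_on {0..T} (vint a g k)" using 1[OF Suc] by (rule DERIV_continuous_on)
  then show ?case
   unfolding vol_Suc[abs_def] using integral_has_real_derivative by (intro DERIV_continuous_on) blast
 qed (simp add: g)
 show "t \<in> {0..T} ==> (vint a g k has_real_derivative a t * vol a g k t) (at t within {0..T})"
  using 1[OF c] .
qed

lemma vint_continuous: "continuous_on {0..T} (vint a g k)"
 using vint_deriv by (rule DERIV_continuous_on)

lemma vol_deriv: "t \<in> {0..T} ==> (vol a g (Suc k) has_real_derivative vint a g k t) (at t within {0..T})"
 unfolding vol_Suc[abs_def] by (rule integral_has_real_derivative[OF vint_continuous])

lemma vol_0: "vol a g (Suc k) 0 = 0" and vint_0: "vint a g k 0 = 0"
 by (simp_all add: vol_Suc vint_def)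

lemma vol_bound: "t \<in> {0..T} ==> \<bar>vol a g k t\<bar> <= B * (M * T * t) ^ k / fact k"
 and vint_bound: "t \<in> {0..T} ==> \<bar>vint a g k t\<bar> <= M * T * (B * (M * T * t) ^ k / fact k)"
proof -
 have step: "\<bar>vint a g k t\<bar> <= M * T * (B * (M * T * t) ^ k / fact k)"
  if IH: "!!t. t \<in> {0..T} ==> \<bar>vol a g k t\<bar> <= B * (M * T * t) ^ k / fact k" and t: "t \<in> {0..T}" for k t
 proof -
  have "\<bar>vint a g k t\<bar> <= integral {0..t} (%\<tau>. M * (B * (M * T * t) ^ k / fact k))"
   unfolding vint_def real_norm_def[symmetric]
  proof (rule integral_norm_bound_integral)
   show "(%\<tau>. a \<tau> * vol a g k \<tau>) integrable_on {0..t}"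
    by (intro integrable_continuous_interval continuous_intros continuous_on_subset[OF a] continuous_on_subset[OF vol_continuous])
     (use t in auto)
   fix \<tau> assume \<tau>: "\<tau> \<in> {0..t}"
   then have \<tau>': "\<tau> \<in> {0..T}" using t by auto
   have "\<bar>a \<tau>\<bar> * \<bar>vol a g k \<tau>\<bar> <= M * (B * (M * T * \<tau>) ^ k / fact k)"
    by (intro mult_mono M IH \<tau>' M_nonneg) auto
   also have "\<dots> <= M * (B * (M * T * t) ^ k / fact k)"
    using \<tau> M_nonneg B_nonneg T0
    by (intro mult_left_mono divide_right_mono power_mono mult_nonneg_nonneg) auto
   finally show "norm (a \<tau> * vol a g k \<tau>) <= M * (B * (M * T * t) ^ k / fact k)" by (simp add: abs_mult)
  qed (rule integrable_const_ivl)
  also have "\<dots> = t * (M * (B * (M * T * t) ^ k / fact k))" using t by simp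
  also have "\<dots> <= T * (M * (B * (M * T * t) ^ k / fact k))"
   using t M_nonneg B_nonneg T0 by (intro mult_right_mono mult_nonneg_nonneg divide_nonneg_nonneg zero_le_power) auto
  finally show ?thesis by (simp add: ac_simps)
 qed
 show vb: "t \<in> {0..T} ==> \<bar>vol a g k t\<bar> <= B * (M * T * t) ^ k / fact k" for t
 proof (induction k arbitrary: t)
  case 0
  then show ?case using B by simp
 next
  case (Suc k)
  have d: "((%t. B * (M * T * t) ^ Suc k / fact (Suc k)) has_real_derivative M * T * (B * (M * T * t) ^ k / fact k)) (at t within {0..T})" for t
  proof -
   have "((%t. B * (M * T * t) ^ Suc k / fact (Suc k)) has_real_derivative B * (real (Suc k) * (M * T * t) ^ k * (M * T)) / fact (Suc k)) (at t within {0..T})"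
    by (auto intro!: derivative_eq_intros simp del: fact_Suc power_Suc)
   moreover have "B * (real (Suc k) * X * Y) / fact (Suc k) = Y * (B * X / fact k)" for X Y
    unfolding fact_Suc by (simp del: of_nat_Suc)
   ultimately show ?thesis by (simp only:)
  qed
  have "vol a g (Suc k) t <= B * (M * T * t) ^ Suc k / fact (Suc k)"
   by (rule deriv_le_imp_le[OF vol_deriv d _ _ Suc.prems])
    (use step[OF Suc.IH] vol_0 in \<open>auto simp del: vol.simps simp: abs_le_iff\<close>)
  moreover have "- vol a g (Suc k) t <= B * (M * T * t) ^ Suc k / fact (Suc k)"
   by (rule deriv_le_imp_le[OF DERIV_minus[OF vol_deriv] d _ _ Suc.prems])
    (use step[OF Suc.IH] vol_0 in \<open>auto simp del: vol.simps simp: abs_le_iff\<close>)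
  ultimately show ?case by (simp add: abs_le_iff del: vol.simps)
 qed
 show "t \<in> {0..T} ==> \<bar>vint a g k t\<bar> <= M * T * (B * (M * T * t) ^ k / fact k)"
  by (rule step[OF vb])
qed

lemma vol_term_bound: "t \<in> {0..T} ==> \<bar>(- r) ^ k * vol a g k t\<bar> <= B * (inverse (fact k) * (\<bar>r\<bar> * M * T * T) ^ k)"
 and vint_term_bound: "t \<in> {0..T} ==> \<bar>(- r) ^ k * vint a g k t\<bar> <= M * T * (B * (inverse (fact k) * (\<bar>r\<bar> * M * T * T) ^ k))"
proof -
 assume t: "t \<in> {0..T}"
 have p: "(M * T * t) ^ k <= (M * T * T) ^ k"
  using t M_nonneg T0 by (intro power_mono mult_left_mono mult_nonneg_nonneg) auto
 have q: "B * (M * T * t) ^ k / fact k <= B * (M * T * T) ^ k / fact k"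
  using p B_nonneg by (intro divide_right_mono mult_left_mono) auto
 have e: "\<bar>r\<bar> ^ k * (B * (M * T * T) ^ k / fact k) = B * (inverse (fact k) * (\<bar>r\<bar> * M * T * T) ^ k)"
  by (simp add: power_mult_distrib divide_inverse ac_simps)
 have "\<bar>(- r) ^ k * vol a g k t\<bar> <= \<bar>r\<bar> ^ k * (B * (M * T * T) ^ k / fact k)"
  unfolding abs_mult power_abs abs_minus using vol_bound[OF t, of k] q by (intro mult_left_mono) auto
 then show "\<bar>(- r) ^ k * vol a g k t\<bar> <= B * (inverse (fact k) * (\<bar>r\<bar> * M * T * T) ^ k)" unfolding e .
 have "M * T * (B * (M * T * t) ^ k / fact k) <= M * T * (B * (M * T * T) ^ k / fact k)"
  using q M_nonneg T0 by (intro mult_left_mono) auto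
 then have "\<bar>(- r) ^ k * vint a g k t\<bar> <= \<bar>r\<bar> ^ k * (M * T * (B * (M * T * T) ^ k / fact k))"
  unfolding abs_mult power_abs abs_minus using vint_bound[OF t, of k] by (intro mult_left_mono) auto
 then show "\<bar>(- r) ^ k * vint a g k t\<bar> <= M * T * (B * (inverse (fact k) * (\<bar>r\<bar> * M * T * T) ^ k))"
  unfolding e[symmetric] by (simp add: ac_simps)
qed

lemma exp_series: "(%k. inverse (fact k) * x ^ k) sums exp (x::real)"
 using exp_converges[of x] by (simp add: divide_inverse)

lemma summable_vol: "t \<in> {0..T} ==> summable (%k. (- r) ^ k * vol a g k t)"
 and summable_vint: "t \<in> {0..T} ==> summable (%k. (- r) ^ k * vint a g k t)"
 by (rule summable_comparison_test'[of "%k. B * (inverse (fact k) * (\<bar>r\<bar> * M * T * T) ^ k)" 0],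
   auto intro!: summable_mult sums_summable[OF exp_series] vol_term_bound)
   (rule summable_comparison_test'[of "%k. M * T * (B * (inverse (fact k) * (\<bar>r\<bar> * M * T * T) ^ k))" 0],
   auto intro!: summable_mult sums_summable[OF exp_series] vint_term_bound)

lemma ode_sol_bound: "t \<in> {0..T} ==> \<bar>ode_sol a g r t\<bar> <= B * exp (\<bar>r\<bar> * M * T * T)"
 and ode_int_bound: "t \<in> {0..T} ==> \<bar>ode_int a g r t\<bar> <= M * T * (B * exp (\<bar>r\<bar> * M * T * T))"
proof -
 assume t: "t \<in> {0..T}"
 note e = sums_unique[OF exp_series, symmetric]
 have s: "summable (%k. inverse (fact k) * (\<bar>r\<bar> * M * T * T) ^ k)" by (rule sums_summable[OF exp_series])
 have 1: "norm (\<Sum>k. (- r) ^ k * vol a g k t) <= (\<Sum>k. B * (inverse (fact k) * (\<bar>r\<bar> * M * T * T) ^ k))"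
  by (rule norm_suminf_le) (use vol_term_bound[OF t] in \<open>auto intro!: summable_mult s\<close>)
 show "\<bar>ode_sol a g r t\<bar> <= B * exp (\<bar>r\<bar> * M * T * T)"
  using 1 unfolding ode_sol_def suminf_mult[OF s] e by simp
 have 2: "norm (\<Sum>k. (- r) ^ k * vint a g k t) <= (\<Sum>k. M * T * (B * (inverse (fact k) * (\<bar>r\<bar> * M * T * T) ^ k)))"
  by (rule norm_suminf_le) (use vint_term_bound[OF t] in \<open>auto intro!: summable_mult s\<close>)
 show "\<bar>ode_int a g r t\<bar> <= M * T * (B * exp (\<bar>r\<bar> * M * T * T))"
  using 2 unfolding ode_int_def suminf_mult[OF s] suminf_mult[OF summable_mult[OF s]] e by simp
qed

lemma ode_sol_uniform: "uniform_limit {0..T} (%n t. \<Sum>k<n. (- r) ^ k * vol a g k t) (ode_sol a g r) sequentially"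
 and ode_int_uniform: "uniform_limit {0..T} (%n t. \<Sum>k<n. (- r) ^ k * vint a g k t) (ode_int a g r) sequentially"
proof -
 have s: "summable (%k. inverse (fact k) * (\<bar>r\<bar> * M * T * T) ^ k)" by (rule sums_summable[OF exp_series])
 show "uniform_limit {0..T} (%n t. \<Sum>k<n. (- r) ^ k * vol a g k t) (ode_sol a g r) sequentially"
  unfolding ode_sol_def[abs_def]
  by (rule Weierstrass_m_test[where M="%k. B * (inverse (fact k) * (\<bar>r\<bar> * M * T * T) ^ k)"])
   (use vol_term_bound in \<open>auto intro!: summable_mult s\<close>)
 show "uniform_limit {0..T} (%n t. \<Sum>k<n. (- r) ^ k * vint a g k t) (ode_int a g r) sequentially"
  unfolding ode_int_def[abs_def]
  by (rule Weierstrass_m_test[where M="%k. M * T * (B * (inverse (fact k) * (\<bar>r\<bar> * M * T * T) ^ k))"])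
   (use vint_term_bound in \<open>auto intro!: summable_mult s\<close>)
qed

lemma ode_sol_continuous: "continuous_on {0..T} (ode_sol a g r)"
 by (rule uniform_limit_theorem[OF _ ode_sol_uniform])
  (auto intro!: always_eventually continuous_intros vol_continuous)

lemma ode_int_continuous: "continuous_on {0..T} (ode_int a g r)"
 by (rule uniform_limit_theorem[OF _ ode_int_uniform])
  (auto intro!: always_eventually continuous_intros vint_continuous)

lemma integral_limit:
 fixes f :: "nat => real => real"
 assumes "uniform_limit {0..T} f l sequentially" "!!n. continuous_on {0..T} (f n)" "t \<in> {0..T}"
 shows "(%n. integral {0..t} (f n)) \<longlonglongrightarrow> integral {0..t} l"
proof -
 have "uniform_limit {0..t} f l sequentially" "!!n. continuous_on {0..t} (f n)"
  using assms(1,3) by (auto intro: uniform_limit_on_subset continuous_on_subset[OF assms(2)])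
 from uniform_limit_integral[OF this] obtain I J where
  "!!n. (f n has_integral I n) {0..t}" "(l has_integral J) {0..t}" "I \<longlonglongrightarrow> J" by auto
 then have "I = (%n. integral {0..t} (f n))" "J = integral {0..t} l" "I \<longlonglongrightarrow> J"
  by (auto simp: fun_eq_iff intro: integral_unique[symmetric])
 then show ?thesis by simp
qed

lemma ode_int_eq:
 assumes t: "t \<in> {0..T}"
 shows "ode_int a g r t = integral {0..t} (%\<tau>. a \<tau> * ode_sol a g r \<tau>)"
proof (rule LIMSEQ_unique)
 show "(%n. \<Sum>k<n. (- r) ^ k * vint a g k t) \<longlonglongrightarrow> ode_int a g r t"
  using summable_LIMSEQ[OF summable_vint[OF t, of r]] by (simp add: ode_int_def)
 have "bounded (a ` {0..T})" "bounded (ode_sol a g r ` {0..T})"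
  by (intro compact_imp_bounded compact_continuous_image a ode_sol_continuous compact_Icc)+
 then have "uniform_limit {0..T} (%n \<tau>. a \<tau> * (\<Sum>k<n. (- r) ^ k * vol a g k \<tau>)) (%\<tau>. a \<tau> * ode_sol a g r \<tau>) sequentially"
  by (intro uniform_lim_mult uniform_limit_const ode_sol_uniform)
 note u = this
 have "continuous_on {0..T} (%\<tau>. a \<tau> * (\<Sum>k<n. (- r) ^ k * vol a g k \<tau>))" for n
  by (intro continuous_intros a vol_continuous)
 from integral_limit[OF u this t]
 have L: "(%n. integral {0..t} (%\<tau>. a \<tau> * (\<Sum>k<n. (- r) ^ k * vol a g k \<tau>))) \<longlonglongrightarrow> integral {0..t} (%\<tau>. a \<tau> * ode_sol a g r \<tau>)" .
 have i: "(%\<tau>. (- r) ^ k * (a \<tau> * vol a g k \<tau>)) integrable_on {0..t}" for k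
  by (intro integrable_continuous_interval continuous_intros continuous_on_subset[OF a] continuous_on_subset[OF vol_continuous])
   (use t in auto)
 have "integral {0..t} (%\<tau>. a \<tau> * (\<Sum>k<n. (- r) ^ k * vol a g k \<tau>)) = (\<Sum>k<n. (- r) ^ k * vint a g k t)" for n
 proof -
  have "integral {0..t} (%\<tau>. a \<tau> * (\<Sum>k<n. (- r) ^ k * vol a g k \<tau>)) = integral {0..t} (%\<tau>. \<Sum>k<n. (- r) ^ k * (a \<tau> * vol a g k \<tau>))"
   by (simp add: sum_distrib_left mult.left_commute)
  also have "\<dots> = (\<Sum>k<n. (- r) ^ k * vint a g k t)"
   by (subst integral_sum) (auto simp: i vint_def)
  finally show ?thesis .
 qed
 then show "(%n. \<Sum>k<n. (- r) ^ k * vint a g k t) \<longlonglongrightarrow> integral {0..t} (%\<tau>. a \<tau> * ode_sol a g r \<tau>)"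
  using L by simp
qed

lemma ode_sol_eq:
 assumes t: "t \<in> {0..T}"
 shows "ode_sol a g r t = g t - r * integral {0..t} (ode_int a g r)"
proof (rule LIMSEQ_unique)
 show "(%n. \<Sum>k<Suc n. (- r) ^ k * vol a g k t) \<longlonglongrightarrow> ode_sol a g r t"
  using LIMSEQ_Suc[OF summable_LIMSEQ[OF summable_vol[OF t, of r]]] by (simp add: ode_sol_def)
 have L: "(%n. g t - r * integral {0..t} (%\<tau>. \<Sum>k<n. (- r) ^ k * vint a g k \<tau>)) \<longlonglongrightarrow> g t - r * integral {0..t} (ode_int a g r)"
  by (intro tendsto_intros integral_limit[OF ode_int_uniform _ t]) (auto intro!: continuous_intros vint_continuous)
 have i: "(%\<tau>. (- r) ^ k * vint a g k \<tau>) integrable_on {0..t}" for k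
  by (intro integrable_continuous_interval continuous_intros continuous_on_subset[OF vint_continuous])
   (use t in auto)
 have "integral {0..t} (%\<tau>. \<Sum>k<n. (- r) ^ k * vint a g k \<tau>) = (\<Sum>k<n. (- r) ^ k * vol a g (Suc k) t)" for n
  by (subst integral_sum) (auto simp: i vol_Suc simp del: vol.simps)
 then have "g t - r * integral {0..t} (%\<tau>. \<Sum>k<n. (- r) ^ k * vint a g k \<tau>) = (\<Sum>k<Suc n. (- r) ^ k * vol a g k t)" for n
  by (simp add: sum.lessThan_Suc_shift sum_distrib_left sum_negf mult.assoc del: vol.simps(2) sum.lessThan_Suc)
 then show "(%n. \<Sum>k<Suc n. (- r) ^ k * vol a g k t) \<longlonglongrightarrow> g t - r * integral {0..t} (ode_int a g r)"
  using L by simp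
qed

lemma ode_int_deriv:
 assumes t: "t \<in> {0..T}"
 shows "(ode_int a g r has_real_derivative a t * ode_sol a g r t) (at t within {0..T})"
proof (rule has_field_derivative_transform_within[OF integral_has_real_derivative zero_less_one t])
 show "continuous_on {0..T} (%\<tau>. a \<tau> * ode_sol a g r \<tau>)" by (intro continuous_intros a ode_sol_continuous)
qed (use t ode_int_eq in auto)

lemma ode_sol_deriv:
 assumes t: "t \<in> {0..T}" and g': "(g has_real_derivative g') (at t within {0..T})"
 shows "(ode_sol a g r has_real_derivative g' - r * ode_int a g r t) (at t within {0..T})"
proof (rule has_field_derivative_transform_within[OF _ zero_less_one t])
 show "((%t. g t - r * integral {0..t} (ode_int a g r)) has_real_derivative g' - r * ode_int a g r t) (at t within {0..T})"
  by (intro DERIV_diff g' DERIV_cmult integral_has_real_derivative[OF ode_int_continuous t])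
qed (use ode_sol_eq in auto)

end

lemma measurable_ode [measurable]:
 "(%r. ode_sol a g r t) \<in> borel_measurable borel" "(%r. ode_int a g r t) \<in> borel_measurable borel"
 unfolding ode_sol_def ode_int_def by measurable

definition flow :: "(real => real) => real => complex => complex => real => complex" where
 "flow a t z w r = cor (ode_sol a (%_. 1) r t) * z + cor (ode_sol a (%t. t) r t) * w"

definition flow_deriv :: "(real => real) => real => complex => complex => real => complex" where
 "flow_deriv a t z w r = cor (- r * ode_int a (%_. 1) r t) * z + cor (1 - r * ode_int a (%t. t) r t) * w"

lemma measurable_flow:
 assumes [measurable]: "f \<in> borel_measurable borel" "h \<in> borel_measurable borel" "w \<in> borel_measurable borel"
 shows "(%\<xi>. flow a t (f \<xi>) (h \<xi>) (w \<xi>)) \<in> borel_measurable borel"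
  "(%\<xi>. flow_deriv a t (f \<xi>) (h \<xi>) (w \<xi>)) \<in> borel_measurable borel"
 unfolding flow_def flow_deriv_def by measurable

lemma continuous_coefficient_bound:
 fixes a :: "real => real"
 assumes "continuous_on {0..T} a"
 obtains M where "0 <= M" "!!t. t \<in> {0..T} ==> \<bar>a t\<bar> <= M"
proof -
 have "bounded (a ` {0..T})" by (intro compact_imp_bounded compact_continuous_image assms compact_Icc)
 then obtain M where "\<forall>y\<in>a ` {0..T}. norm y <= M" unfolding bounded_iff by blast
 then show ?thesis by (intro that[of "max M 0"]) force+
qed

lemma flow_has_derivative:
 assumes a: "continuous_on {0..T} a" and T: "0 <= T" and t: "t \<in> {0..T}"
 shows "((%t. flow a t z w r) has_vector_derivative flow_deriv a t z w r) (at t within {0..T})"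
  "((%t. flow_deriv a t z w r) has_vector_derivative cor (- (a t * r)) * flow a t z w r) (at t within {0..T})"
  "flow a 0 z w r = z" "flow_deriv a 0 z w r = w"
proof -
 obtain M where M: "!!t. t \<in> {0..T} ==> \<bar>a t\<bar> <= M" using continuous_coefficient_bound[OF a] by blast
 have c1: "continuous_on {0..T} (%_. 1::real)" and c2: "continuous_on {0..T} (%t. t::real)" by (intro continuous_intros)+
 have b1: "\<bar>1::real\<bar> <= 1" and b2: "!!t. t \<in> {0..T} ==> \<bar>t\<bar> <= T" by auto
 note S1 = ode_sol_deriv[OF a c1 M b1 T, simplified] and S2 = ode_sol_deriv[OF a c2 M b2 T]
 note I1 = ode_int_deriv[OF a c1 M b1 T] and I2 = ode_int_deriv[OF a c2 M b2 T]
 have lin: "((%t. cor (f t) * z) has_vector_derivative cor f' * z) (at t within {0..T})"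
  if "(f has_real_derivative f') (at t within {0..T})" for f f' and z :: complex
  using bounded_linear.has_vector_derivative[OF bounded_linear_compose[OF bounded_linear_mult_left bounded_linear_of_real], of f f' "at t within {0..T}" z] that
  by (simp add: has_real_derivative_iff_has_vector_derivative)
 have s1: "(ode_sol a (%_. 1) r has_real_derivative - r * ode_int a (%_. 1) r t) (at t within {0..T})"
  using ode_sol_deriv[OF a c1 M b1 T t, of 0 r] by simp
 have s2: "(ode_sol a (%t. t) r has_real_derivative 1 - r * ode_int a (%t. t) r t) (at t within {0..T})"
  by (rule ode_sol_deriv[OF a c2 M b2 T t]) (auto intro!: derivative_eq_intros)
 show "((%t. flow a t z w r) has_vector_derivative flow_deriv a t z w r) (at t within {0..T})"
  unfolding flow_def flow_deriv_def by (intro has_vector_derivative_add lin s1 s2)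
 have i1: "((%t. - r * ode_int a (%_. 1) r t) has_real_derivative - r * (a t * ode_sol a (%_. 1) r t)) (at t within {0..T})"
  by (intro DERIV_cmult ode_int_deriv[OF a c1 M b1 T t])
 have i2: "((%t. 1 - r * ode_int a (%t. t) r t) has_real_derivative - r * (a t * ode_sol a (%t. t) r t)) (at t within {0..T})"
  using DERIV_diff[OF DERIV_const DERIV_cmult[OF ode_int_deriv[OF a c2 M b2 T t]], of 1 r r] by simp
 have "((%t. flow_deriv a t z w r) has_vector_derivative
   cor (- r * (a t * ode_sol a (%_. 1) r t)) * z + cor (- r * (a t * ode_sol a (%t. t) r t)) * w) (at t within {0..T})"
  unfolding flow_deriv_def by (intro has_vector_derivative_add lin i1 i2)
 then show "((%t. flow_deriv a t z w r) has_vector_derivative cor (- (a t * r)) * flow a t z w r) (at t within {0..T})"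
  by (simp add: flow_def algebra_simps)
 have 0: "0 \<in> {0..T}" using T by simp
 have "ode_int a g r 0 = 0" for g by (simp add: ode_int_def vint_def)
 moreover have "ode_sol a g r 0 = g 0" for g
 proof -
  have "(%k. (- r) ^ k * vol a g k 0) = (%k. if k = 0 then g 0 else 0)"
   by (rule ext) (case_tac k, auto)
  then show ?thesis unfolding ode_sol_def by (simp only: sums_unique[OF sums_single[of 0 "%_. g 0"], symmetric])
 qed
 ultimately show "flow a 0 z w r = z" "flow_deriv a 0 z w r = w" by (simp_all add: flow_def flow_deriv_def)
qed

lemma flow_bound:
 assumes a: "continuous_on {0..T} a" and T: "0 <= T"
 obtains C where "0 <= C" "!!t r z w. t \<in> {0..T} ==> 0 <= r ==> r <= Q ==>
  cmod (flow a t z w r) <= C * (cmod z + cmod w) \<and> cmod (flow_deriv a t z w r) <= C * (cmod z + cmod w)"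
proof -
 obtain M where M0: "0 <= M" and M: "!!t. t \<in> {0..T} ==> \<bar>a t\<bar> <= M" using continuous_coefficient_bound[OF a] by blast
 have c1: "continuous_on {0..T} (%_. 1::real)" and c2: "continuous_on {0..T} (%t. t::real)" by (intro continuous_intros)+
 define B where "B = 1 + T"
 have b1: "\<bar>1::real\<bar> <= B" and b2: "!!t. t \<in> {0..T} ==> \<bar>t\<bar> <= B" using T by (auto simp: B_def)
 define E where "E = B * exp (\<bar>Q\<bar> * M * T * T)"
 have E0: "0 <= E" using T by (simp add: E_def B_def)
 have E: "B * exp (\<bar>r\<bar> * M * T * T) <= E" if "0 <= r" "r <= Q" for r
  using that T M0 unfolding E_def B_def by (intro mult_left_mono iffD2[OF exp_le_cancel_iff] mult_right_mono) auto
 define C where "C = E + (1 + \<bar>Q\<bar> * (M * T * E))"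
 have C1: "E <= C" "1 + \<bar>Q\<bar> * (M * T * E) <= C" "0 <= C" using E0 M0 T by (auto simp: C_def)
 show ?thesis
 proof (rule that[OF C1(3)])
  fix t r z w assume t: "t \<in> {0..T}" and r: "0 <= r" "r <= Q"
  have s: "\<bar>ode_sol a (%_. 1) r t\<bar> <= C" "\<bar>ode_sol a (%t. t) r t\<bar> <= C"
   using ode_sol_bound[OF a c1 M b1 T t, of r] ode_sol_bound[OF a c2 M b2 T t, of r] E[OF r] C1 by auto
  have i: "\<bar>ode_int a (%_. 1) r t\<bar> <= M * T * E" "\<bar>ode_int a (%t. t) r t\<bar> <= M * T * E"
   using ode_int_bound[OF a c1 M b1 T t, of r] ode_int_bound[OF a c2 M b2 T t, of r]
    mult_left_mono[OF E[OF r], of "M * T"] M0 T by auto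
  have ri: "\<bar>r * x\<bar> <= \<bar>Q\<bar> * (M * T * E)" if "\<bar>x\<bar> <= M * T * E" for x
   unfolding abs_mult using that r by (intro mult_mono) auto
  have d: "\<bar>- r * ode_int a (%_. 1) r t\<bar> <= C" "\<bar>1 - r * ode_int a (%t. t) r t\<bar> <= C"
   using ri[OF i(1)] ri[OF i(2)] C1(2) by auto
  have "cmod (cor x * z + cor y * w) <= C * (cmod z + cmod w)" if "\<bar>x\<bar> <= C" "\<bar>y\<bar> <= C" for x y
  proof -
   have "cmod (cor x * z + cor y * w) <= \<bar>x\<bar> * cmod z + \<bar>y\<bar> * cmod w"
    by (rule order_trans[OF norm_triangle_ineq]) (simp add: norm_mult)
   also have "\<dots> <= C * cmod z + C * cmod w" using that by (intro add_mono mult_right_mono) auto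
   finally show ?thesis by (simp add: distrib_left)
  qed
  then show "cmod (flow a t z w r) <= C * (cmod z + cmod w) \<and> cmod (flow_deriv a t z w r) <= C * (cmod z + cmod w)"
   using s d unfolding flow_def flow_deriv_def by blast
 qed
qed

lemma vector_lipschitz:
 fixes f :: "real => complex"
 assumes f: "!!t. t \<in> {0..T} ==> (f has_vector_derivative f' t) (at t within {0..T})"
  and le: "!!t. t \<in> {0..T} ==> cmod (f' t) <= K" and t: "t \<in> {0..T}" "s \<in> {0..T}"
 shows "cmod (f s - f t) <= K * \<bar>s - t\<bar>"
proof -
 have "norm (f s - f t) <= K * norm (s - t)"
 proof (rule differentiable_bound[of "{0..T}" f "%t h. h *\<^sub>R f' t"])
  show "onorm (%h. h *\<^sub>R f' t) <= K" if "t \<in> {0..T}" for t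
   by (rule onorm_le) (use mult_left_mono[OF le[OF that] abs_ge_zero] in \<open>simp add: mult.commute[of K]\<close>)
 qed (use f t in \<open>auto simp: has_vector_derivative_def\<close>)
 then show ?thesis by simp
qed

lemma pairing_has_derivative:
 fixes w w' :: "real => 'a::euclidean_space => complex"
 assumes [measurable]: "!!t. t \<in> {0..T} ==> w t \<in> borel_measurable borel" "h \<in> borel_measurable borel"
  and wi: "!!t. t \<in> {0..T} ==> integrable lborel (%\<xi>. w t \<xi> * h \<xi>)"
  and mw': "!!t. t \<in> {0..T} ==> w' t \<in> borel_measurable borel"
  and d: "!!t \<xi>. t \<in> {0..T} ==> ((%t. w t \<xi>) has_vector_derivative w' t \<xi>) (at t within {0..T})"
  and G: "integrable lborel G" "!!t \<xi>. t \<in> {0..T} ==> cmod (w' t \<xi> * h \<xi>) <= G \<xi>"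
  and t: "t \<in> {0..T}"
 shows "((%t. LINT \<xi>|lborel. w t \<xi> * h \<xi>) has_vector_derivative (LINT \<xi>|lborel. w' t \<xi> * h \<xi>)) (at t within {0..T})"
 unfolding has_vector_derivative_iff_tendsto tendsto_at_iff_sequentially comp_def
proof (intro allI impI)
 note [measurable] = mw'[OF t]
 have dh: "((%t. w t \<xi> * h \<xi>) has_vector_derivative w' t \<xi> * h \<xi>) (at t within {0..T})" if "t \<in> {0..T}" for t \<xi>
  by (rule bounded_linear.has_vector_derivative[OF bounded_linear_mult_left d[OF that]])
 fix X assume X: "\<forall>i. X i \<in> {0..T} - {t}" and XL: "X \<longlonglongrightarrow> t"
 have XT: "X i \<in> {0..T}" "X i \<noteq> t" for i using X by auto
 note [measurable] = assms(1)[OF XT(1)] assms(1)[OF t]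
 let ?q = "%i \<xi>. (w (X i) \<xi> * h \<xi> - w t \<xi> * h \<xi>) /\<^sub>R (X i - t)"
 have "(%i. LINT \<xi>|lborel. ?q i \<xi>) \<longlonglongrightarrow> (LINT \<xi>|lborel. w' t \<xi> * h \<xi>)"
 proof (rule integral_dominated_convergence[OF _ _ G(1)])
  show "AE \<xi> in lborel. (%i. ?q i \<xi>) \<longlonglongrightarrow> w' t \<xi> * h \<xi>"
  proof (rule AE_I2)
   fix \<xi>
   show "(%i. ?q i \<xi>) \<longlonglongrightarrow> w' t \<xi> * h \<xi>"
    using dh[OF t, of \<xi>] X XL unfolding has_vector_derivative_iff_tendsto tendsto_at_iff_sequentially comp_def by blast
  qed
  show "AE \<xi> in lborel. norm (?q i \<xi>) <= G \<xi>" for i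
  proof (rule AE_I2)
   fix \<xi>
   have "cmod (w (X i) \<xi> * h \<xi> - w t \<xi> * h \<xi>) <= G \<xi> * \<bar>X i - t\<bar>"
    by (rule vector_lipschitz[OF dh G(2) t XT(1)])
   then show "norm (?q i \<xi>) <= G \<xi>" using XT(2)[of i]
    by (simp add: divide_inverse[symmetric] mult.commute[of "inverse _"] pos_divide_le_eq)
  qed
 qed measurable
 moreover have "(LINT \<xi>|lborel. ?q i \<xi>) = ((LINT \<xi>|lborel. w (X i) \<xi> * h \<xi>) - (LINT \<xi>|lborel. w t \<xi> * h \<xi>)) /\<^sub>R (X i - t)" for i
  using wi[OF XT(1)] wi[OF t] by simp
 ultimately show "(%i. ((LINT \<xi>|lborel. w (X i) \<xi> * h \<xi>) - (LINT \<xi>|lborel. w t \<xi> * h \<xi>)) /\<^sub>R (X i - t)) \<longlonglongrightarrow> (LINT \<xi>|lborel. w' t \<xi> * h \<xi>)"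
  by (simp only:)
qed

text \<open>
  A solution need not be jointly measurable in time and frequency, so its difference from the flow of
  its data is not estimated at single frequencies but tested against band-limited \<open>h\<close>: the pairing \<open>A h\<close> satisfies \<open>(A h)'' = - a A (|\<xi>|\<^sup>2 h)\<close> with zero data, and as
  \<open>|\<xi>|\<^sup>2\<close> acts boundedly on frequencies \<open>|\<xi>| \<le> R\<close>, iterating gives \<open>|A h| \<le> c\<^sup>j/j!\<close> for all \<open>j\<close>.
\<close>

lemma spectral_solution_flow:
 fixes v p :: "real => 'a::euclidean_space => complex"
 assumes v: "spectral_solution a s T v p" and s: "0 <= s" and a: "continuous_on {0..T} a" and t0: "t0 \<in> {0..T}"
 shows "AE \<xi> in lborel. v t0 \<xi> = flow a t0 (v 0 \<xi>) (p 0 \<xi>) ((norm \<xi>)^2) \<and>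
   p t0 \<xi> = flow_deriv a t0 (v 0 \<xi>) (p 0 \<xi>) ((norm \<xi>)^2)"
proof -
 define V where "V t \<xi> = flow a t (v 0 \<xi>) (p 0 \<xi>) ((norm \<xi>)^2)" for t and \<xi> :: 'a
 define P where "P t \<xi> = flow_deriv a t (v 0 \<xi>) (p 0 \<xi>) ((norm \<xi>)^2)" for t and \<xi> :: 'a
 have T: "0 <= T" using t0 by auto
 have zT: "0 \<in> {0..T}" using T by simp
 note F = v[unfolded spectral_solution_def, rule_format]
 note sv = spectral_solution_facts(1)[OF v s] and sp = spectral_solution_facts(2)[OF v s]
 note [measurable] = L2D(1)[OF sv[OF zT]] L2D(1)[OF sp[OF zT]]
 have mV[measurable]: "V t \<in> borel_measurable borel" and mP[measurable]: "P t \<in> borel_measurable borel" for t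
  unfolding V_def P_def by (intro measurable_flow; measurable)+
 obtain M where M0: "0 <= M" and M: "!!t. t \<in> {0..T} ==> \<bar>a t\<bar> <= M" using continuous_coefficient_bound[OF a] by blast
 obtain U where U0: "0 <= U" and U: "!!t. t \<in> {0..T} ==> l2norm (v t) <= U"
  using continuous_coefficient_bound[OF spectral_energy_continuous(3)[OF v s]] by (metis abs_le_D1)
 define D where "D \<xi> = cor (cmod (v 0 \<xi>)) + cor (cmod (p 0 \<xi>))" for \<xi>
 have sD: "L2 D" unfolding D_def
  by (intro L2_add L2_cmod sv sp zT)
 have cD: "cmod (D \<xi>) = cmod (v 0 \<xi>) + cmod (p 0 \<xi>)" for \<xi>
  unfolding D_def of_real_add[symmetric] norm_of_real by simp
 have main: "(LINT \<xi>|lborel. v t0 \<xi> * h \<xi>) = (LINT \<xi>|lborel. V t0 \<xi> * h \<xi>) \<and> (LINT \<xi>|lborel. p t0 \<xi> * h \<xi>) = (LINT \<xi>|lborel. P t0 \<xi> * h \<xi>)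
   \<and> integrable lborel (%\<xi>. V t0 \<xi> * h \<xi>) \<and> integrable lborel (%\<xi>. P t0 \<xi> * h \<xi>)"
  if h0: "band_limited R h" and R: "0 <= R" for R h
 proof -
  obtain C where C0: "0 <= C" and C: "!!t r z w. t \<in> {0..T} ==> 0 <= r ==> r <= R^2 ==>
   cmod (flow a t z w r) <= C * (cmod z + cmod w) \<and> cmod (flow_deriv a t z w r) <= C * (cmod z + cmod w)"
   by (rule flow_bound[OF a T, of "R^2"]) blast
  have VP: "cmod (V t \<xi> * h \<xi>) <= C * cmod (D \<xi> * h \<xi>)" "cmod (P t \<xi> * h \<xi>) <= C * cmod (D \<xi> * h \<xi>)"
   if h: "band_limited R h" and t: "t \<in> {0..T}" for t \<xi> h
  proof -
   have "cmod (V t \<xi>) <= C * cmod (D \<xi>) \<and> cmod (P t \<xi>) <= C * cmod (D \<xi>) \<or> h \<xi> = 0"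
   proof (cases "norm \<xi> <= R")
    case True
    then have "(norm \<xi>)^2 <= R^2" by (intro power_mono) auto
    then show ?thesis using C[OF t, of "(norm \<xi>)^2" "v 0 \<xi>" "p 0 \<xi>"] by (simp add: V_def P_def cD)
   qed (use h in \<open>auto simp: band_limited_def\<close>)
   then show "cmod (V t \<xi> * h \<xi>) <= C * cmod (D \<xi> * h \<xi>)" "cmod (P t \<xi> * h \<xi>) <= C * cmod (D \<xi> * h \<xi>)"
    by (auto simp: norm_mult mult.assoc[symmetric] intro: mult_right_mono)
  qed
  have sh: "L2 h" if "band_limited R h" for h using that by (simp add: band_limited_def)
  have Dh: "integrable lborel (%\<xi>. cmod (D \<xi> * h \<xi>))" if "band_limited R h" for h
   by (intro integrable_norm L2_mult_integrable sD sh that)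
  have iV: "integrable lborel (%\<xi>. V t \<xi> * h \<xi>)" and iP: "integrable lborel (%\<xi>. P t \<xi> * h \<xi>)"
   if h: "band_limited R h" and t: "t \<in> {0..T}" for t h
  proof -
   note [measurable] = L2D(1)[OF sh[OF h]]
   have i: "integrable lborel (%\<xi>. C * cmod (D \<xi> * h \<xi>))" using Dh[OF h] by simp
   show "integrable lborel (%\<xi>. V t \<xi> * h \<xi>)" "integrable lborel (%\<xi>. P t \<xi> * h \<xi>)"
    by (rule Bochner_Integration.integrable_bound[OF i], measurable,
      rule AE_I2, unfold real_norm_def, rule order_trans[OF VP(1)[OF h t] abs_ge_self])
     (rule Bochner_Integration.integrable_bound[OF i], measurable,
      rule AE_I2, unfold real_norm_def, rule order_trans[OF VP(2)[OF h t] abs_ge_self])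
  qed
  define A where "A h t = (LINT \<xi>|lborel. v t \<xi> * h \<xi>) - (LINT \<xi>|lborel. V t \<xi> * h \<xi>)" for h t
  define B where "B h t = (LINT \<xi>|lborel. p t \<xi> * h \<xi>) - (LINT \<xi>|lborel. P t \<xi> * h \<xi>)" for h t
  define L where "L h \<xi> = cor ((norm \<xi>)^2) * h \<xi>" for h and \<xi> :: 'a
  have Lb: "band_limited R (L h)" if "band_limited R h" for h
   unfolding L_def by (rule band_limited_mult[OF that]) (intro continuous_intros)
  have Ln: "l2norm (L h) <= R^2 * l2norm h" if h: "band_limited R h" for h
  proof -
   have "l2norm (L h) <= l2norm (%\<xi>. cor (R^2) * h \<xi>)"
   proof (rule l2norm_mono)
    show "AE \<xi> in lborel. cmod (L h \<xi>) <= cmod (cor (R^2) * h \<xi>)"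
    proof (rule AE_I2)
     fix \<xi>
     show "cmod (L h \<xi>) <= cmod (cor (R^2) * h \<xi>)"
      using h by (cases "norm \<xi> <= R") (auto simp: band_limited_def L_def norm_mult norm_power intro!: mult_right_mono power_mono)
    qed
   qed (use sh[OF h] L2D(1)[OF sh[OF Lb[OF h]]] in \<open>auto intro: L2_cmult\<close>)
   then show ?thesis unfolding l2norm_cmult by (simp add: norm_power)
  qed
  have dv: "((%\<tau>. LINT \<xi>|lborel. v \<tau> \<xi> * h \<xi>) has_vector_derivative (LINT \<xi>|lborel. p t \<xi> * h \<xi>)) (at t within {0..T})"
   if h: "band_limited R h" and t: "t \<in> {0..T}" for h t
   unfolding has_vector_derivative_iff_tendsto
  proof (rule Lim_null[THEN iffD2], rule Lim_null_comparison)
   let ?q = "%\<tau> \<xi>. (v \<tau> \<xi> - v t \<xi>) / cor (\<tau> - t) - p t \<xi>"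
   have "((%\<tau>. l2norm (%\<xi>. bracket s \<xi> * ?q \<tau> \<xi>) * l2norm h) \<longlongrightarrow> 0 * l2norm h) (at t within {0..T})"
    using F[OF t] by (intro tendsto_mult tendsto_const) blast
   then show "((%\<tau>. l2norm (%\<xi>. bracket s \<xi> * ?q \<tau> \<xi>) * l2norm h) \<longlongrightarrow> 0) (at t within {0..T})" by simp
   have "norm (((LINT \<xi>|lborel. v \<tau> \<xi> * h \<xi>) - (LINT \<xi>|lborel. v t \<xi> * h \<xi>)) /\<^sub>R (\<tau> - t) - (LINT \<xi>|lborel. p t \<xi> * h \<xi>))
     <= l2norm (%\<xi>. bracket s \<xi> * ?q \<tau> \<xi>) * l2norm h" if \<tau>: "\<tau> \<in> {0..T}" "\<tau> \<noteq> t" for \<tau>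
   proof -
    have b: "L2 (%\<xi>. bracket s \<xi> * v \<tau> \<xi>)" if "\<tau> \<in> {0..T}" for \<tau>
     by (rule weight_dominated(1)[where \<sigma>="s+1"]) (use F that in \<open>auto intro: bracket_mono\<close>)
    have bp: "L2 (%\<xi>. bracket s \<xi> * p t \<xi>)" using F[OF t] by blast
    have bq: "L2 (%\<xi>. bracket s \<xi> * ?q \<tau> \<xi>)"
     using L2_diff[OF L2_divide[OF L2_diff[OF b[OF \<tau>(1)] b[OF t]], of "cor (\<tau> - t)"] bp]
     by (simp add: right_diff_distrib)
    have one: "cmod 1 <= cmod (bracket s \<xi>)" for \<xi> :: 'a
     using bracket_mono[OF s, of \<xi>] bracket_0[of \<xi>] by simp
    note q = weight_dominated[OF bq borel_measurable_const one, unfolded mult_1_left]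
    have e: "?q \<tau> \<xi> * h \<xi> = (v \<tau> \<xi> * h \<xi> - v t \<xi> * h \<xi>) /\<^sub>R (\<tau> - t) - p t \<xi> * h \<xi>" for \<xi>
     by (simp add: scaleR_conv_of_real left_diff_distrib divide_inverse algebra_simps)
    have i: "integrable lborel (%\<xi>. v \<tau> \<xi> * h \<xi>)" "integrable lborel (%\<xi>. v t \<xi> * h \<xi>)" "integrable lborel (%\<xi>. p t \<xi> * h \<xi>)"
     by (intro L2_mult_integrable sv sp \<tau> t sh h)+
    have "(LINT \<xi>|lborel. ?q \<tau> \<xi> * h \<xi>) = ((LINT \<xi>|lborel. v \<tau> \<xi> * h \<xi>) - (LINT \<xi>|lborel. v t \<xi> * h \<xi>)) /\<^sub>R (\<tau> - t) - (LINT \<xi>|lborel. p t \<xi> * h \<xi>)"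
     unfolding e using i by simp
    moreover have "cmod (LINT \<xi>|lborel. ?q \<tau> \<xi> * h \<xi>) <= l2norm (%\<xi>. bracket s \<xi> * ?q \<tau> \<xi>) * l2norm h"
     by (rule order_trans[OF Cauchy_Schwarz_l2[OF q(1) sh[OF h]] mult_right_mono[OF q(2)]]) simp
    ultimately show ?thesis by simp
   qed
   then show "\<forall>\<^sub>F \<tau> in at t within {0..T}. norm (((LINT \<xi>|lborel. v \<tau> \<xi> * h \<xi>) - (LINT \<xi>|lborel. v t \<xi> * h \<xi>)) /\<^sub>R (\<tau> - t) - (LINT \<xi>|lborel. p t \<xi> * h \<xi>))
     <= l2norm (%\<xi>. bracket s \<xi> * ?q \<tau> \<xi>) * l2norm h" by (auto simp: eventually_at_filter)
  qed
  have dV: "((%\<tau>. LINT \<xi>|lborel. V \<tau> \<xi> * h \<xi>) has_vector_derivative (LINT \<xi>|lborel. P t \<xi> * h \<xi>)) (at t within {0..T})"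
   and dP: "((%\<tau>. LINT \<xi>|lborel. P \<tau> \<xi> * h \<xi>) has_vector_derivative cor (- a t) * (LINT \<xi>|lborel. V t \<xi> * L h \<xi>)) (at t within {0..T})"
   if h: "band_limited R h" and t: "t \<in> {0..T}" for h t
  proof -
   note [measurable] = L2D(1)[OF sh[OF h]]
   show "((%\<tau>. LINT \<xi>|lborel. V \<tau> \<xi> * h \<xi>) has_vector_derivative (LINT \<xi>|lborel. P t \<xi> * h \<xi>)) (at t within {0..T})"
   proof (rule pairing_has_derivative[where G="%\<xi>. C * cmod (D \<xi> * h \<xi>)"])
    show "((%t. V t \<xi>) has_vector_derivative P t \<xi>) (at t within {0..T})" if "t \<in> {0..T}" for t \<xi>
     unfolding V_def P_def by (rule flow_has_derivative(1)[OF a T that])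
   qed (use iV[OF h] VP[OF h] Dh[OF h] t in auto)
   have "((%\<tau>. LINT \<xi>|lborel. P \<tau> \<xi> * h \<xi>) has_vector_derivative (LINT \<xi>|lborel. (cor (- (a t * (norm \<xi>)^2)) * V t \<xi>) * h \<xi>)) (at t within {0..T})"
   proof (rule pairing_has_derivative[where G="%\<xi>. M * (C * cmod (D \<xi> * L h \<xi>))"])
    show "((%t. P t \<xi>) has_vector_derivative cor (- (a t * (norm \<xi>)^2)) * V t \<xi>) (at t within {0..T})" if "t \<in> {0..T}" for t \<xi>
     unfolding V_def P_def by (rule flow_has_derivative(2)[OF a T that])
    fix \<tau> \<xi> assume \<tau>: "\<tau> \<in> {0..T}"
    have "cmod (cor (- (a \<tau> * (norm \<xi>)^2)) * V \<tau> \<xi> * h \<xi>) = \<bar>a \<tau>\<bar> * cmod (V \<tau> \<xi> * L h \<xi>)"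
     by (simp add: L_def norm_mult abs_mult norm_power)
    also have "\<dots> <= M * (C * cmod (D \<xi> * L h \<xi>))"
     by (intro mult_mono M \<tau> VP Lb h M0) auto
    finally show "cmod (cor (- (a \<tau> * (norm \<xi>)^2)) * V \<tau> \<xi> * h \<xi>) <= M * (C * cmod (D \<xi> * L h \<xi>))" .
   qed (use iP[OF h] Dh[OF Lb[OF h]] t in auto)
   moreover have "(LINT \<xi>|lborel. (cor (- (a t * (norm \<xi>)^2)) * V t \<xi>) * h \<xi>) = cor (- a t) * (LINT \<xi>|lborel. V t \<xi> * L h \<xi>)"
    unfolding integral_mult_right_zero[symmetric] by (intro Bochner_Integration.integral_cong refl) (simp add: L_def)
   ultimately show "((%\<tau>. LINT \<xi>|lborel. P \<tau> \<xi> * h \<xi>) has_vector_derivative cor (- a t) * (LINT \<xi>|lborel. V t \<xi> * L h \<xi>)) (at t within {0..T})"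
    by (simp only:)
  qed
  have dA: "(A h has_vector_derivative B h t) (at t within {0..T})" if "band_limited R h" "t \<in> {0..T}" for h t
   unfolding A_def[abs_def] B_def by (intro has_vector_derivative_diff dv dV that)
  have dB: "(B h has_vector_derivative cor (- a t) * A (L h) t) (at t within {0..T})" if h: "band_limited R h" and t: "t \<in> {0..T}" for h t
  proof -
   have "((%\<tau>. LINT \<xi>|lborel. p \<tau> \<xi> * h \<xi>) has_vector_derivative cor (- a t) * (LINT \<xi>|lborel. v t \<xi> * L h \<xi>)) (at t within {0..T})"
    using F[OF t] h unfolding L_def by blast
   from has_vector_derivative_diff[OF this dP[OF h t]] show ?thesis
    unfolding A_def B_def[abs_def] right_diff_distrib .
  qed
  have A0: "A h 0 = 0" and B0: "B h 0 = 0" for h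
   using flow_has_derivative(3,4)[OF a T zT] by (simp_all add: A_def B_def V_def P_def)
  define Z where "Z = U + C * l2norm D"
  have Z0: "0 <= Z" using U0 C0 by (simp add: Z_def)
  have Abound: "cmod (A h t) <= Z * l2norm h" if h: "band_limited R h" and t: "t \<in> {0..T}" for h t
  proof -
   have 1: "cmod (LINT \<xi>|lborel. v t \<xi> * h \<xi>) <= U * l2norm h"
    by (rule order_trans[OF Cauchy_Schwarz_l2[OF sv[OF t] sh[OF h]] mult_right_mono[OF U[OF t]]]) simp
   have "cmod (LINT \<xi>|lborel. V t \<xi> * h \<xi>) <= (LINT \<xi>|lborel. C * cmod (D \<xi> * h \<xi>))"
    by (rule order_trans[OF integral_norm_bound integral_mono]) (use iV[OF h t] Dh[OF h] VP[OF h t] in auto)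
   also have "\<dots> <= C * (l2norm D * l2norm h)"
    using Cauchy_Schwarz_abs[OF sD sh[OF h]] C0 by (simp add: norm_mult mult_left_mono)
   finally show ?thesis using 1 norm_triangle_ineq4[of "LINT \<xi>|lborel. v t \<xi> * h \<xi>" "LINT \<xi>|lborel. V t \<xi> * h \<xi>"]
    by (simp add: A_def Z_def algebra_simps)
  qed
  define \<Lambda> where "\<Lambda> = M * R^2 * T"
  have \<Lambda>0: "0 <= \<Lambda>" using M0 T by (simp add: \<Lambda>_def)
  have Bstep: "cmod (B h t) <= T * (M * K)"
   if h: "band_limited R h" and t: "t \<in> {0..T}" and K: "!!\<tau>. \<tau> \<in> {0..t} ==> cmod (A (L h) \<tau>) <= K" for h t K
  proof -
   have K0: "0 <= K" using order_trans[OF norm_ge_zero K[of 0]] t by auto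
   have sub: "{0..t} \<subseteq> {0..T}" using t by auto
   have "cmod (B h t - B h 0) <= (M * K) * \<bar>t - 0\<bar>"
   proof (rule vector_lipschitz[where T=t])
    show "(B h has_vector_derivative cor (- a \<tau>) * A (L h) \<tau>) (at \<tau> within {0..t})" if "\<tau> \<in> {0..t}" for \<tau>
     by (rule has_vector_derivative_within_subset[OF dB[OF h] sub]) (use that sub in auto)
    show "cmod (cor (- a \<tau>) * A (L h) \<tau>) <= M * K" if "\<tau> \<in> {0..t}" for \<tau>
     using M[of \<tau>] K[OF that] that sub M0 by (auto simp: norm_mult intro!: mult_mono)
   qed (use t in auto)
   also have "\<dots> <= (M * K) * T" using t M0 K0 by (intro mult_left_mono mult_nonneg_nonneg) auto
   finally show ?thesis by (simp add: B0 mult.commute)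
  qed
  have iter: "\<forall>h t. band_limited R h \<longrightarrow> t \<in> {0..T} \<longrightarrow> cmod (A h t) <= Z * l2norm h * ((\<Lambda> * t) ^ j / fact j)" for j
  proof (induction j)
   case 0
   then show ?case using Abound by simp
  next
   case (Suc j)
   show ?case
   proof (intro allI impI)
    fix h :: "'a => complex" and t assume h: "band_limited R h" and t: "t \<in> {0..T}"
    let ?g = "%t. Z * l2norm h * ((\<Lambda> * t) ^ Suc j / fact (Suc j))"
    show "cmod (A h t) <= ?g t"
    proof (rule norm_vector_derivative_le[where f="A h" and g="?g" and t=t and f'="B h" and g'="%t. Z * l2norm h * (\<Lambda> * ((\<Lambda> * t) ^ j / fact j))" and T=T])
     show "(?g has_real_derivative Z * l2norm h * (\<Lambda> * ((\<Lambda> * t) ^ j / fact j))) (at t within {0..T})" for t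
     proof -
      have "(?g has_real_derivative Z * l2norm h * ((real (Suc j) * (\<Lambda> * t) ^ j * \<Lambda>) / fact (Suc j))) (at t within {0..T})"
       by (auto intro!: derivative_eq_intros simp del: fact_Suc power_Suc of_nat_Suc)
      moreover have "(real (Suc j) * X * Y) / fact (Suc j) = Y * (X / fact j)" for X Y
       unfolding fact_Suc by (simp del: of_nat_Suc)
      ultimately show ?thesis by (simp only:)
     qed
     fix t assume t: "t \<in> {0..T}"
     have "cmod (A (L h) \<tau>) <= Z * (R^2 * l2norm h) * ((\<Lambda> * t) ^ j / fact j)" if \<tau>: "\<tau> \<in> {0..t}" for \<tau>
     proof -
      have "cmod (A (L h) \<tau>) <= Z * l2norm (L h) * ((\<Lambda> * \<tau>) ^ j / fact j)"
       using Suc.IH Lb[OF h] \<tau> t by auto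
      also have "\<dots> <= Z * (R^2 * l2norm h) * ((\<Lambda> * t) ^ j / fact j)"
       using \<tau> t Z0 \<Lambda>0 R Ln[OF h]
       by (intro mult_mono mult_nonneg_nonneg divide_right_mono power_mono divide_nonneg_nonneg zero_le_power) auto
      finally show ?thesis .
     qed
     from Bstep[OF h t this]
     show "cmod (B h t) <= Z * l2norm h * (\<Lambda> * ((\<Lambda> * t) ^ j / fact j))"
      by (simp add: \<Lambda>_def ac_simps)
    qed (use dA[OF h] A0 t Z0 in auto)
   qed
  qed
  have Az: "A h t = 0" if h: "band_limited R h" and t: "t \<in> {0..T}" for h t
  proof -
   have "(%j. (\<Lambda> * t) ^ j / fact j) \<longlonglongrightarrow> 0"
    using summable_LIMSEQ_zero[OF summable_exp[of "\<Lambda> * t"]] by (simp add: divide_inverse mult.commute)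
   then have "(%j. Z * l2norm h * ((\<Lambda> * t) ^ j / fact j)) \<longlonglongrightarrow> Z * l2norm h * 0"
    by (intro tendsto_intros)
   then have "cmod (A h t) <= Z * l2norm h * 0"
    by (rule tendsto_lowerbound) (use iter h t in auto)
   then show ?thesis by simp
  qed
  have "cmod (B h t0) <= T * (M * 0)"
   by (rule Bstep[OF h0 t0]) (use Az[OF Lb[OF h0]] t0 in auto)
  then have "B h t0 = 0" by simp
  then show ?thesis using Az[OF h0 t0] iV[OF h0 t0] iP[OF h0 t0] by (simp add: A_def B_def)
 qed
 have zero: "AE \<xi> in lborel. f \<xi> = W \<xi>"
  if f: "L2 f" and [measurable]: "W \<in> borel_measurable borel"
   and WC: "!!k::nat. \<exists>C. \<forall>\<xi>. norm \<xi> <= real k \<longrightarrow> cmod (W \<xi>) <= C * cmod (D \<xi>)"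
   and eq: "!!R h. band_limited R h ==> 0 <= R ==> (LINT \<xi>|lborel. f \<xi> * h \<xi>) = (LINT \<xi>|lborel. W \<xi> * h \<xi>) \<and> integrable lborel (%\<xi>. W \<xi> * h \<xi>)"
  for f W :: "'a => complex"
 proof -
  have "AE \<xi> in lborel. indicator (cball 0 (real k)) \<xi> *\<^sub>R f \<xi> - indicator (cball 0 (real k)) \<xi> *\<^sub>R W \<xi> = 0" for k
  proof (rule AE_zero_band_limited)
   obtain C where C: "!!\<xi>. norm \<xi> <= real k ==> cmod (W \<xi>) <= C * cmod (D \<xi>)" using WC[of k] by blast
   have sW: "L2 (%\<xi>. indicator (cball 0 (real k)) \<xi> *\<^sub>R W \<xi>)"
   proof (rule L2_bound[OF sD])
    show "AE \<xi> in lborel. cmod (indicator (cball 0 (real k)) \<xi> *\<^sub>R W \<xi>) <= max C 0 * cmod (D \<xi>)"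
    proof (rule AE_I2)
     fix \<xi>
     have "C * cmod (D \<xi>) <= max C 0 * cmod (D \<xi>)" by (intro mult_right_mono) auto
     then show "cmod (indicator (cball 0 (real k)) \<xi> *\<^sub>R W \<xi>) <= max C 0 * cmod (D \<xi>)"
      using C[of \<xi>] by (cases "norm \<xi> <= real k") auto
    qed
   qed measurable
   then show "L2 (%\<xi>. indicator (cball 0 (real k)) \<xi> *\<^sub>R f \<xi> - indicator (cball 0 (real k)) \<xi> *\<^sub>R W \<xi>)"
    by (rule L2_diff[OF L2_indicator[OF f cball_sets_borel]])
   fix R and h :: "'a => complex" assume h: "band_limited R h"
   let ?h = "%\<xi>. indicator (cball 0 (real k)) \<xi> *\<^sub>R h \<xi>"
   have hb: "band_limited (real k) ?h"
    using h L2_indicator[of h "cball 0 (real k)"] by (auto simp: band_limited_def)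
   have sh: "L2 ?h" using hb by (simp add: band_limited_def)
   note E = eq[OF hb]
   have "(LINT \<xi>|lborel. (indicator (cball 0 (real k)) \<xi> *\<^sub>R f \<xi> - indicator (cball 0 (real k)) \<xi> *\<^sub>R W \<xi>) * h \<xi>)
    = (LINT \<xi>|lborel. f \<xi> * ?h \<xi> - W \<xi> * ?h \<xi>)"
    by (intro Bochner_Integration.integral_cong refl) (simp add: indicator_def left_diff_distrib)
   also have "\<dots> = 0" using E L2_mult_integrable[OF f sh] by simp
   finally show "(LINT \<xi>|lborel. (indicator (cball 0 (real k)) \<xi> *\<^sub>R f \<xi> - indicator (cball 0 (real k)) \<xi> *\<^sub>R W \<xi>) * h \<xi>) = 0" .
  qed
  then have "AE \<xi> in lborel. \<forall>k::nat. indicator (cball 0 (real k)) \<xi> *\<^sub>R f \<xi> - indicator (cball 0 (real k)) \<xi> *\<^sub>R W \<xi> = 0"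
   unfolding AE_all_countable by blast
  then show ?thesis
  proof eventually_elim
   case (elim \<xi>)
   obtain k where "norm \<xi> <= real k" using real_arch_simple by blast
   then show ?case using elim[rule_format, of k] by simp
  qed
 qed
 have bnd: "\<exists>C. \<forall>\<xi>. norm \<xi> <= real k \<longrightarrow> cmod (V t0 \<xi>) <= C * cmod (D \<xi>)" "\<exists>C. \<forall>\<xi>. norm \<xi> <= real k \<longrightarrow> cmod (P t0 \<xi>) <= C * cmod (D \<xi>)" for k :: nat
 proof -
  obtain C where C: "!!t r z w. t \<in> {0..T} ==> 0 <= r ==> r <= (real k)^2 ==>
   cmod (flow a t z w r) <= C * (cmod z + cmod w) \<and> cmod (flow_deriv a t z w r) <= C * (cmod z + cmod w)"
   by (rule flow_bound[OF a T, of "(real k)^2"]) blast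
  have "cmod (V t0 \<xi>) <= C * cmod (D \<xi>) \<and> cmod (P t0 \<xi>) <= C * cmod (D \<xi>)" if "norm \<xi> <= real k" for \<xi>
   using C[OF t0, of "(norm \<xi>)^2" "v 0 \<xi>" "p 0 \<xi>"] that by (simp add: V_def P_def cD power_mono)
  then show "\<exists>C. \<forall>\<xi>. norm \<xi> <= real k \<longrightarrow> cmod (V t0 \<xi>) <= C * cmod (D \<xi>)" "\<exists>C. \<forall>\<xi>. norm \<xi> <= real k \<longrightarrow> cmod (P t0 \<xi>) <= C * cmod (D \<xi>)"
   by blast+
 qed
 have "AE \<xi> in lborel. v t0 \<xi> = V t0 \<xi>"
  by (rule zero[OF sv[OF t0] mV bnd(1)]) (use main in auto)
 moreover have "AE \<xi> in lborel. p t0 \<xi> = P t0 \<xi>"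
  by (rule zero[OF sp[OF t0] mP bnd(2)]) (use main in auto)
 ultimately show ?thesis by eventually_elim (simp add: V_def P_def)
qed

section \<open>Energy estimates at a single frequency\<close>

lemma cmod_square_deriv:
 assumes "(f has_vector_derivative f') (at t within S)"
 shows "((%t. (cmod (f t))^2) has_real_derivative 2 * Re (f' * cnj (f t))) (at t within S)"
proof -
 have "((%t. Re (f t)) has_real_derivative Re f') (at t within S)" "((%t. Im (f t)) has_real_derivative Im f') (at t within S)"
  using bounded_linear.has_vector_derivative[OF bounded_linear_Re assms] bounded_linear.has_vector_derivative[OF bounded_linear_Im assms]
  by (simp_all add: has_real_derivative_iff_has_vector_derivative)
 from DERIV_add[OF DERIV_power[OF this(1), of 2] DERIV_power[OF this(2), of 2]]
 show ?thesis unfolding cmod_power2 by (simp add: algebra_simps)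
qed

text \<open>
  For \<open>e = |p|\<^sup>2 + a r |v|\<^sup>2\<close> the principal terms of \<open>e'\<close> cancel; what is left is \<open>a' r |v|\<^sup>2\<close> and the
  contribution of a forcing term \<open>F\<close>.
\<close>

lemma forced_energy:
 fixes v p F :: "real => complex"
 assumes a: "!!t. t \<in> {0..T} ==> (a has_real_derivative a' t) (at t within {0..T})"
  and aL: "!!t. t \<in> {0..T} ==> \<bar>a' t\<bar> <= L" and a1: "!!t. t \<in> {0..T} ==> 1/2 <= a t \<and> a t <= 3/2"
  and v: "!!t. t \<in> {0..T} ==> (v has_vector_derivative p t) (at t within {0..T})"
  and p: "!!t. t \<in> {0..T} ==> (p has_vector_derivative cor (- (a t * r)) * v t - F t) (at t within {0..T})"
  and F: "continuous_on {0..T} F" and r: "0 <= r" and t: "t \<in> {0..T}"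
 shows "(cmod (p t))^2 + r * (cmod (v t))^2
  <= 3 * exp ((2 * L + 1) * T) * ((cmod (p 0))^2 + r * (cmod (v 0))^2 + integral {0..t} (%\<tau>. (cmod (F \<tau>))^2))"
proof -
 define e where "e t = (cmod (p t))^2 + a t * r * (cmod (v t))^2" for t
 define e' where "e' t = 2 * Re ((cor (- (a t * r)) * v t - F t) * cnj (p t)) + (a t * r * (2 * Re (p t * cnj (v t))) + a' t * r * (cmod (v t))^2)" for t
 have zT: "0 \<in> {0..T}" "0 <= T" using t by auto
 have L0: "0 <= L" using aL[OF zT(1)] by linarith
 have de: "(e has_real_derivative e' t) (at t within {0..T})" if "t \<in> {0..T}" for t
  unfolding e_def[abs_def] e'_def
  by (intro DERIV_add cmod_square_deriv p that DERIV_cong[OF DERIV_mult[OF DERIV_cmult_right[OF a[OF that]] cmod_square_deriv[OF v[OF that]]]]) simp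
 have ee: "e' t <= (2 * L + 1) * e t + (cmod (F t))^2" if t: "t \<in> {0..T}" for t
 proof -
  have 1: "2 * Re ((cor (- (a t * r)) * v t - F t) * cnj (p t)) + a t * r * (2 * Re (p t * cnj (v t)))
    = - 2 * Re (F t * cnj (p t))"
   by (simp add: algebra_simps)
  have "- Re (F t * cnj (p t)) <= cmod (F t * cnj (p t))"
   using complex_Re_le_cmod[of "- (F t * cnj (p t))"] by simp
  then have 2: "- 2 * Re (F t * cnj (p t)) <= (cmod (F t))^2 + (cmod (p t))^2"
   using sum_squares_bound[of "cmod (F t)" "cmod (p t)"] by (simp add: norm_mult)
  have "a' t * (r * (cmod (v t))^2) <= L * (r * (cmod (v t))^2)"
   using aL[OF t] r by (intro mult_right_mono) auto
  also have "\<dots> <= L * (2 * (a t * (r * (cmod (v t))^2)))"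
  proof (rule mult_left_mono[OF _ L0])
   have "(1/2) * (r * (cmod (v t))^2) <= a t * (r * (cmod (v t))^2)" using a1[OF t] r by (intro mult_right_mono) auto
   then show "r * (cmod (v t))^2 <= 2 * (a t * (r * (cmod (v t))^2))" by simp
  qed
  finally have 3: "a' t * r * (cmod (v t))^2 <= 2 * L * (a t * r * (cmod (v t))^2)" by (simp add: ac_simps)
  have 4: "0 <= a t * r * (cmod (v t))^2" using a1[OF t] r by (intro mult_nonneg_nonneg) auto
  have 5: "0 <= L * (cmod (p t))^2" using L0 by simp
  have "e' t = - 2 * Re (F t * cnj (p t)) + a' t * r * (cmod (v t))^2" unfolding e'_def using 1 by linarith
  also have "\<dots> <= (cmod (F t))^2 + (cmod (p t))^2 + 2 * L * (a t * r * (cmod (v t))^2)" using 2 3 by linarith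
  also have "\<dots> <= (2 * L + 1) * e t + (cmod (F t))^2"
   using 4 5 by (simp add: e_def algebra_simps)
  finally show ?thesis .
 qed
 let ?I = "integral {0..t} (%\<tau>. (cmod (F \<tau>))^2)"
 have I0: "0 <= ?I" by (rule integral_nonneg) (use t in \<open>auto intro!: integrable_continuous_interval continuous_intros continuous_on_subset[OF F]\<close>)
 have "e t <= exp ((2 * L + 1) * t) * (e 0 + ?I)"
  by (rule gronwall[OF de _ _ ee _ t]) (use F L0 in \<open>auto intro!: continuous_intros\<close>)
 also have "\<dots> <= exp ((2 * L + 1) * T) * ((3/2) * ((cmod (p 0))^2 + r * (cmod (v 0))^2) + (3/2) * ?I)"
 proof (intro mult_mono add_mono)
  show "exp ((2 * L + 1) * t) <= exp ((2 * L + 1) * T)" using t L0 by (simp add: mult_left_mono)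
  have "a 0 * (r * (cmod (v 0))^2) <= (3/2) * (r * (cmod (v 0))^2)" using a1[OF zT(1)] r by (intro mult_right_mono) auto
  then show "e 0 <= (3/2) * ((cmod (p 0))^2 + r * (cmod (v 0))^2)"
   unfolding e_def mult.assoc distrib_left
   using zero_le_power2[of "cmod (p 0)"] by linarith
  show "?I <= (3/2) * ?I" using I0 by simp
  show "0 <= e 0 + ?I" using I0 a1[OF zT(1)] r by (simp add: e_def)
 qed simp
 finally have "e t <= exp ((2 * L + 1) * T) * ((3/2) * ((cmod (p 0))^2 + r * (cmod (v 0))^2) + (3/2) * ?I)" .
 moreover have "(cmod (p t))^2 + r * (cmod (v t))^2 <= 2 * e t"
 proof -
  have le: "(1/2) * (r * (cmod (v t))^2) <= a t * (r * (cmod (v t))^2)" using a1[OF t] r by (intro mult_right_mono) auto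
  have gen: "1 / 2 * X <= Y ==> 0 <= q ==> q + X <= 2 * (q + Y)" for X Y q :: real by simp
  show ?thesis unfolding e_def mult.assoc by (rule gen[OF le zero_le_power2])
 qed
 ultimately show ?thesis by (simp add: algebra_simps)
qed

text \<open>
  The case without force; the constant does not depend on the frequency.
\<close>

lemma flow_energy:
 assumes a: "!!t. t \<in> {0..T} ==> (a has_real_derivative a' t) (at t within {0..T})"
  and aL: "!!t. t \<in> {0..T} ==> \<bar>a' t\<bar> <= L" and a1: "!!t. t \<in> {0..T} ==> 1/2 <= a t \<and> a t <= 3/2"
  and r: "0 <= r" and t: "t \<in> {0..T}"
 shows "(cmod (flow_deriv a t z w r))^2 + r * (cmod (flow a t z w r))^2 <= 3 * exp ((2 * L + 1) * T) * ((cmod w)^2 + r * (cmod z)^2)"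
proof -
 have c: "continuous_on {0..T} a" using a by (rule DERIV_continuous_on)
 have T: "0 <= T" using t by auto
 have "(cmod (flow_deriv a t z w r))^2 + r * (cmod (flow a t z w r))^2
   <= 3 * exp ((2 * L + 1) * T) * ((cmod (flow_deriv a 0 z w r))^2 + r * (cmod (flow a 0 z w r))^2 + integral {0..t} (%\<tau>. (cmod 0)^2))"
  by (rule forced_energy[OF a aL a1 flow_has_derivative(1)[OF c T] _ _ r t])
   (use flow_has_derivative(2)[OF c T] in auto)
 then show ?thesis using flow_has_derivative(3,4)[OF c T t] by simp
qed

lemma flow_stability:
 assumes a: "!!t. t \<in> {0..T} ==> (a has_real_derivative a' t) (at t within {0..T})"
  and aL: "!!t. t \<in> {0..T} ==> \<bar>a' t\<bar> <= L" and a1: "!!t. t \<in> {0..T} ==> 1/2 <= a t \<and> a t <= 3/2"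
  and b: "continuous_on {0..T} b" and r: "0 <= r" and t: "t \<in> {0..T}"
 shows "(cmod (flow_deriv a t z w r - flow_deriv b t z w r))^2 + r * (cmod (flow a t z w r - flow b t z w r))^2
   <= 3 * exp ((2 * L + 1) * T) * integral {0..t} (%\<tau>. (\<bar>a \<tau> - b \<tau>\<bar> * r * cmod (flow b \<tau> z w r))^2)"
proof -
 have c: "continuous_on {0..T} a" using a by (rule DERIV_continuous_on)
 have T: "0 <= T" using t by auto
 define F where "F t = cor ((a t - b t) * r) * flow b t z w r" for t
 have cf: "continuous_on {0..T} (%t. flow b t z w r)"
  using has_vector_derivative_continuous[OF flow_has_derivative(1)[OF b T]] by (auto simp: continuous_on_eq_continuous_within)
 have "(cmod (flow_deriv a t z w r - flow_deriv b t z w r))^2 + r * (cmod (flow a t z w r - flow b t z w r))^2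
   <= 3 * exp ((2 * L + 1) * T) * ((cmod (flow_deriv a 0 z w r - flow_deriv b 0 z w r))^2 + r * (cmod (flow a 0 z w r - flow b 0 z w r))^2 + integral {0..t} (%\<tau>. (cmod (F \<tau>))^2))"
 proof (rule forced_energy[OF a aL a1 _ _ _ r t])
  fix t assume t: "t \<in> {0..T}"
  show "((%t. flow a t z w r - flow b t z w r) has_vector_derivative flow_deriv a t z w r - flow_deriv b t z w r) (at t within {0..T})"
   by (intro has_vector_derivative_diff flow_has_derivative c b T t)
  have "((%t. flow_deriv a t z w r - flow_deriv b t z w r) has_vector_derivative
    cor (- (a t * r)) * flow a t z w r - cor (- (b t * r)) * flow b t z w r) (at t within {0..T})"
   by (intro has_vector_derivative_diff flow_has_derivative c b T t)
  then show "((%t. flow_deriv a t z w r - flow_deriv b t z w r) has_vector_derivative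
    cor (- (a t * r)) * (flow a t z w r - flow b t z w r) - F t) (at t within {0..T})"
   by (simp add: F_def algebra_simps)
 qed (auto simp: F_def intro!: continuous_intros c b cf)
 moreover have "(cmod (F \<tau>))^2 = (\<bar>a \<tau> - b \<tau>\<bar> * r * cmod (flow b \<tau> z w r))^2" for \<tau>
  unfolding F_def norm_mult norm_of_real using r by (simp add: abs_mult)
 ultimately show ?thesis using flow_has_derivative(3,4)[OF c T t] flow_has_derivative(3,4)[OF b T t] by simp
qed

section \<open>Back to solutions of the Kirchhoff equation\<close>

lemma flow_continuous:
 assumes a: "continuous_on {0..T} a" and T: "0 <= T" and t: "t \<in> {0..T}"
 shows "((%\<tau>. flow a \<tau> z w r - flow a t z w r) \<longlongrightarrow> 0) (at t within {0..T})"
  "((%\<tau>. flow_deriv a \<tau> z w r - flow_deriv a t z w r) \<longlongrightarrow> 0) (at t within {0..T})"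
 using has_vector_derivative_continuous[OF flow_has_derivative(1)[OF a T t, of z w r]]
  has_vector_derivative_continuous[OF flow_has_derivative(2)[OF a T t, of z w r]]
 by (simp_all add: continuous_within LIM_zero)

text \<open>
  The flow is differentiable in time at each frequency; the dominating functions \<open>DV\<close> and \<open>DP\<close> turn this into
  convergence in the weighted spaces.
\<close>

lemma kirchhoff_solution_of_flow:
 fixes f0 f1 DV DP :: "'a::euclidean_space => complex"
 assumes s: "0 <= s" and T: "0 <= T" and a: "continuous_on {0..T} a"
  and m[measurable]: "f0 \<in> borel_measurable borel" "f1 \<in> borel_measurable borel"
  and DV: "L2 (%\<xi>. bracket (s + 1) \<xi> * DV \<xi>)" and DP: "L2 (%\<xi>. bracket s \<xi> * DP \<xi>)"
  and Vle: "!!t \<xi>. t \<in> {0..T} ==> cmod (flow a t (f0 \<xi>) (f1 \<xi>) ((norm \<xi>)^2)) <= cmod (DV \<xi>)"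
  and Ple: "!!t \<xi>. t \<in> {0..T} ==> cmod (flow_deriv a t (f0 \<xi>) (f1 \<xi>) ((norm \<xi>)^2)) <= cmod (DP \<xi>)"
  and aN: "!!t. t \<in> {0..T} ==> a t = 1 + N (dirichlet (%\<xi>. flow a t (f0 \<xi>) (f1 \<xi>) ((norm \<xi>)^2)))"
 shows "kirchhoff_solution N s T (%t. inverse_fourier (%\<xi>. flow a t (f0 \<xi>) (f1 \<xi>) ((norm \<xi>)^2)))
   (%t. inverse_fourier (%\<xi>. flow_deriv a t (f0 \<xi>) (f1 \<xi>) ((norm \<xi>)^2)))"
proof -
 define V where "V t \<xi> = flow a t (f0 \<xi>) (f1 \<xi>) ((norm \<xi>)^2)" for t and \<xi> :: 'a
 define P where "P t \<xi> = flow_deriv a t (f0 \<xi>) (f1 \<xi>) ((norm \<xi>)^2)" for t and \<xi> :: 'a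
 have mV[measurable]: "V t \<in> borel_measurable borel" and mP[measurable]: "P t \<in> borel_measurable borel" for t
  unfolding V_def P_def by (intro measurable_flow; measurable)+
 note Vle' = Vle[folded V_def] and Ple' = Ple[folded P_def]
 define u where "u t = inverse_fourier (V t)" for t
 define u' where "u' t = inverse_fourier (P t)" for t
 note [measurable] = bracket_weighted_measurable[OF DV] bracket_weighted_measurable[OF DP]
 have one: "cmod 1 <= cmod (bracket \<sigma> \<xi>)" if "0 <= \<sigma>" for \<xi> :: 'a and \<sigma>
  using bracket_mono[OF that, of \<xi>] bracket_0[of \<xi>] by simp
 have sDV: "L2 DV"
  using weight_dominated(1)[OF DV borel_measurable_const one] s by simp
 have bV: "L2 (%\<xi>. bracket (s + 1) \<xi> * V t \<xi>)" if "t \<in> {0..T}" for t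
  by (rule L2_bound[OF DV, where C=1]) (use Vle'[OF that] in \<open>auto simp: norm_mult intro!: mult_left_mono\<close>)
 have bP: "L2 (%\<xi>. bracket s \<xi> * P t \<xi>)" if "t \<in> {0..T}" for t
  by (rule L2_bound[OF DP, where C=1]) (use Ple'[OF that] in \<open>auto simp: norm_mult intro!: mult_left_mono\<close>)
 have bV': "L2 (%\<xi>. bracket s \<xi> * V t \<xi>)" if "t \<in> {0..T}" for t
  by (rule weight_dominated(1)[OF bV[OF that]]) (auto intro: bracket_mono)
 have sV: "L2 (V t)" if "t \<in> {0..T}" for t
  using weight_dominated(1)[OF bV[OF that] borel_measurable_const one] s by simp
 have sP: "L2 (P t)" if "t \<in> {0..T}" for t
  using weight_dominated(1)[OF bP[OF that] borel_measurable_const one] s by simp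
 have su: "L2 (u t)" "L2 (u' t)" if "t \<in> {0..T}" for t
  unfolding u_def u'_def by (intro L2_inverse_fourier sV sP that)+
 have Fu: "AE \<xi> in lborel. fourier (u t) \<xi> = V t \<xi>" "AE \<xi> in lborel. fourier (u' t) \<xi> = P t \<xi>" if "t \<in> {0..T}" for t
  unfolding u_def u'_def by (intro fourier_inverse_fourier sV sP that)+
 have sob: "f \<in> sobolev \<sigma>" if "L2 f" "L2 (%\<xi>. bracket \<sigma> \<xi> * W \<xi>)" "AE \<xi> in lborel. fourier f \<xi> = W \<xi>" for f W :: "'a => complex" and \<sigma>
 proof -
  note [measurable] = L2D(1)[OF L2_fourier[OF that(1)]]
  have "L2 (%\<xi>. bracket \<sigma> \<xi> * fourier f \<xi>)"
  proof (rule L2_bound[OF that(2), where C=1])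
   show "AE \<xi> in lborel. cmod (bracket \<sigma> \<xi> * fourier f \<xi>) <= 1 * cmod (bracket \<sigma> \<xi> * W \<xi>)"
    using that(3) by eventually_elim simp
  qed measurable
  then show ?thesis using that(1) by (simp add: sobolev_iff)
 qed
 have Su: "u t \<in> sobolev (s + 1)" "u t \<in> sobolev s" "u' t \<in> sobolev s" if "t \<in> {0..T}" for t
  using sob[OF su(1) bV Fu(1)] sob[OF su(1) bV' Fu(1)] sob[OF su(2) bP Fu(2)] that by auto
 have cong: "l2norm (%\<xi>. bracket \<sigma> \<xi> * F \<xi>) = l2norm (%\<xi>. bracket \<sigma> \<xi> * G \<xi>)"
  if "AE \<xi> in lborel. F \<xi> = G \<xi>" "F \<in> borel_measurable borel" "G \<in> borel_measurable borel" for F G :: "'a => complex" and \<sigma>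
 proof -
  note [measurable] = that(2,3)
  have "(LINT x|lborel. (cmod (bracket \<sigma> x * F x))^2) = (LINT x|lborel. (cmod (bracket \<sigma> x * G x))^2)"
   by (rule integral_cong_AE) (use that(1) in auto)
  then show ?thesis by (simp add: l2norm_def)
 qed
 have mF: "fourier (u t) \<in> borel_measurable borel" "fourier (u' t) \<in> borel_measurable borel" if "t \<in> {0..T}" for t
  by (intro L2D(1) L2_fourier su that)+
 have cont: "sobolev_continuous \<sigma> T w"
  if sob: "!!t. t \<in> {0..T} ==> w t \<in> sobolev \<sigma>" and F: "!!t. t \<in> {0..T} ==> AE \<xi> in lborel. fourier (w t) \<xi> = W t \<xi>"
   and mW: "!!t. W t \<in> borel_measurable borel" and D: "L2 (%\<xi>. bracket \<sigma> \<xi> * D \<xi>)"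
   and le: "!!t \<xi>. t \<in> {0..T} ==> cmod (W t \<xi>) <= cmod (D \<xi>)"
   and lim: "!!t \<xi>. t \<in> {0..T} ==> ((%\<tau>. W \<tau> \<xi> - W t \<xi>) \<longlongrightarrow> 0) (at t within {0..T})"
  for \<sigma> and w W :: "real => 'a => complex" and D
  unfolding sobolev_continuous_def
 proof (intro ballI conjI sob)
  note [measurable] = mW
  fix t assume t: "t \<in> {0..T}"
  have "((%\<tau>. l2norm (%\<xi>. bracket \<sigma> \<xi> * (W \<tau> \<xi> - W t \<xi>))) \<longlongrightarrow> 0) (at t within {0..T})"
  proof (rule l2norm_dominated_convergence_at[OF L2_cmult[OF D, of 2]])
   show "AE \<xi> in lborel. cmod (bracket \<sigma> \<xi> * (W \<tau> \<xi> - W t \<xi>)) <= cmod (2 * (bracket \<sigma> \<xi> * D \<xi>))" if \<tau>: "\<tau> \<in> {0..T}" for \<tau>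
   proof (rule AE_I2)
    fix \<xi>
    have "cmod (W \<tau> \<xi> - W t \<xi>) <= 2 * cmod (D \<xi>)"
     using norm_triangle_ineq4[of "W \<tau> \<xi>" "W t \<xi>"] le[OF \<tau>, of \<xi>] le[OF t, of \<xi>] by linarith
    then show "cmod (bracket \<sigma> \<xi> * (W \<tau> \<xi> - W t \<xi>)) <= cmod (2 * (bracket \<sigma> \<xi> * D \<xi>))"
     by (simp add: norm_mult mult.left_commute mult_left_mono)
   qed
   show "AE \<xi> in lborel. ((%\<tau>. bracket \<sigma> \<xi> * (W \<tau> \<xi> - W t \<xi>)) \<longlongrightarrow> 0) (at t within {0..T})"
    by (intro AE_I2 tendsto_mult_right_zero lim t)
  qed measurable
  then show "((%\<tau>. sobolev_norm \<sigma> (%x. w \<tau> x - w t x)) \<longlongrightarrow> 0) (at t within {0..T})"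
  proof (rule Lim_transform_eventually)
   have "l2norm (%\<xi>. bracket \<sigma> \<xi> * (W \<tau> \<xi> - W t \<xi>)) = sobolev_norm \<sigma> (%x. w \<tau> x - w t x)" if \<tau>: "\<tau> \<in> {0..T}" for \<tau>
   proof -
    have [measurable]: "fourier (w \<tau>) \<in> borel_measurable borel" "fourier (w t) \<in> borel_measurable borel"
     using sob[OF \<tau>] sob[OF t] by (auto simp: sobolev_iff intro!: L2D(1) L2_fourier)
    show ?thesis
     unfolding sobolev_diff(2)[OF sob[OF \<tau>] sob[OF t]]
    proof (rule cong)
     show "AE \<xi> in lborel. W \<tau> \<xi> - W t \<xi> = fourier (w \<tau>) \<xi> - fourier (w t) \<xi>"
      using F[OF \<tau>] F[OF t] by eventually_elim simp
    qed measurable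
   qed
   then show "\<forall>\<^sub>F \<tau> in at t within {0..T}. l2norm (%\<xi>. bracket \<sigma> \<xi> * (W \<tau> \<xi> - W t \<xi>)) = sobolev_norm \<sigma> (%x. w \<tau> x - w t x)"
    by (auto simp: eventually_at_filter)
  qed
 qed
 have c1: "sobolev_continuous (s + 1) T u"
  by (rule cont[OF Su(1) Fu(1) mV DV Vle']) (simp_all add: V_def flow_continuous[OF a T])
 have c2: "sobolev_continuous s T u'"
  by (rule cont[OF Su(3) Fu(2) mP DP Ple']) (simp_all add: P_def flow_continuous[OF a T])
 have dVP: "((%t. V t \<xi>) has_vector_derivative P t \<xi>) (at t within {0..T})" if "t \<in> {0..T}" for t \<xi>
  unfolding V_def P_def by (rule flow_has_derivative(1)[OF a T that])
 have c3: "sobolev_time_deriv s T u u'"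
  unfolding sobolev_time_deriv_def
 proof
  fix t assume t: "t \<in> {0..T}"
  let ?q = "%\<tau> \<xi>. (V \<tau> \<xi> - V t \<xi>) / cor (\<tau> - t) - P t \<xi>"
  have "((%\<tau>. l2norm (%\<xi>. bracket s \<xi> * ?q \<tau> \<xi>)) \<longlongrightarrow> 0) (at t within {0..T})"
  proof (rule l2norm_dominated_convergence_at[OF L2_cmult[OF DP, of 2]])
   show "AE \<xi> in lborel. cmod (bracket s \<xi> * ?q \<tau> \<xi>) <= cmod (2 * (bracket s \<xi> * DP \<xi>))" if \<tau>: "\<tau> \<in> {0..T}" "\<tau> \<noteq> t" for \<tau>
   proof (rule AE_I2)
    fix \<xi>
    have "cmod (V \<tau> \<xi> - V t \<xi>) <= cmod (DP \<xi>) * \<bar>\<tau> - t\<bar>"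
     by (rule vector_lipschitz[OF dVP Ple' t \<tau>(1)])
    then have "cmod ((V \<tau> \<xi> - V t \<xi>) / cor (\<tau> - t)) <= cmod (DP \<xi>)"
     using \<tau>(2) by (simp add: norm_divide pos_divide_le_eq del: of_real_diff)
    then have "cmod (?q \<tau> \<xi>) <= 2 * cmod (DP \<xi>)"
     using norm_triangle_ineq4[of "(V \<tau> \<xi> - V t \<xi>) / cor (\<tau> - t)" "P t \<xi>"] Ple'[OF t, of \<xi>] by linarith
    then show "cmod (bracket s \<xi> * ?q \<tau> \<xi>) <= cmod (2 * (bracket s \<xi> * DP \<xi>))"
     unfolding norm_mult by (simp add: mult.left_commute[of 2] mult_left_mono)
   qed
   show "AE \<xi> in lborel. ((%\<tau>. bracket s \<xi> * ?q \<tau> \<xi>) \<longlongrightarrow> 0) (at t within {0..T})"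
   proof (rule AE_I2, rule tendsto_mult_right_zero, rule LIM_zero)
    fix \<xi>
    show "((%\<tau>. (V \<tau> \<xi> - V t \<xi>) / cor (\<tau> - t)) \<longlongrightarrow> P t \<xi>) (at t within {0..T})"
     using dVP[OF t, of \<xi>] unfolding has_vector_derivative_iff_tendsto
     by (simp add: scaleR_conv_of_real divide_inverse mult.commute)
   qed
  qed measurable
  then show "((%\<tau>. sobolev_norm s (%x. (u \<tau> x - u t x) / cor (\<tau> - t) - u' t x)) \<longlongrightarrow> 0) (at t within {0..T})"
  proof (rule Lim_transform_eventually)
   have "l2norm (%\<xi>. bracket s \<xi> * ?q \<tau> \<xi>) = sobolev_norm s (%x. (u \<tau> x - u t x) / cor (\<tau> - t) - u' t x)" if \<tau>: "\<tau> \<in> {0..T}" for \<tau>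
   proof -
    note [measurable] = mF(1)[OF \<tau>] mF(1)[OF t] mF(2)[OF t]
    show ?thesis
     unfolding sobolev_difference_quotient(2)[OF Su(2)[OF \<tau>] Su(2)[OF t] Su(3)[OF t]]
    proof (rule cong)
     show "AE \<xi> in lborel. ?q \<tau> \<xi> = (fourier (u \<tau>) \<xi> - fourier (u t) \<xi>) / cor (\<tau> - t) - fourier (u' t) \<xi>"
      using Fu(1)[OF \<tau>] Fu(1)[OF t] Fu(2)[OF t] by eventually_elim simp
    qed measurable
   qed
   then show "\<forall>\<^sub>F \<tau> in at t within {0..T}. l2norm (%\<xi>. bracket s \<xi> * ?q \<tau> \<xi>) = sobolev_norm s (%x. (u \<tau> x - u t x) / cor (\<tau> - t) - u' t x)"
    by (auto simp: eventually_at_filter)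
  qed
 qed
 obtain M where M0: "0 <= M" and M: "!!t. t \<in> {0..T} ==> \<bar>a t\<bar> <= M" using continuous_coefficient_bound[OF a] by blast
 have c4: "((%\<tau>. LINT x|lborel. u' \<tau> x * \<phi> x) has_vector_derivative
      cor (1 + N ((grad_l2norm (u t))^2)) * (LINT x|lborel. u t x * laplacian \<phi> x)) (at t within {0..T})"
  if t: "t \<in> {0..T}" and \<phi>: "test_function \<phi>" for t \<phi>
 proof -
  define h where "h = inverse_fourier \<phi>"
  note s\<phi> = test_function_facts(5)[OF \<phi>] and sl = test_function_facts(5)[OF test_function_laplacian[OF \<phi>]]
  have sh: "L2 h" unfolding h_def by (rule L2_inverse_fourier[OF s\<phi>])
  note [measurable] = L2D(1)[OF sh] L2D(1)[OF L2_inverse_fourier[OF sl]] mF(1)[OF t]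
  have lap: "AE \<xi> in lborel. inverse_fourier (laplacian \<phi>) \<xi> = - cor ((norm \<xi>)^2) * h \<xi>"
   unfolding h_def by (rule inverse_fourier_laplacian[OF \<phi>])
  have sh2: "L2 (%\<xi>. cor ((norm \<xi>)^2) * h \<xi>)"
  proof (rule L2_bound[OF L2_inverse_fourier[OF sl], where C=1])
   show "AE \<xi> in lborel. cmod (cor ((norm \<xi>)^2) * h \<xi>) <= 1 * cmod (inverse_fourier (laplacian \<phi>) \<xi>)"
    using lap by eventually_elim (simp add: norm_mult)
  qed measurable
  have "((%t. LINT \<xi>|lborel. P t \<xi> * h \<xi>) has_vector_derivative (LINT \<xi>|lborel. (cor (- (a t * (norm \<xi>)^2)) * V t \<xi>) * h \<xi>)) (at t within {0..T})"
  proof (rule pairing_has_derivative[where G="%\<xi>. M * cmod (DV \<xi> * (cor ((norm \<xi>)^2) * h \<xi>))"])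
   show "integrable lborel (%\<xi>. M * cmod (DV \<xi> * (cor ((norm \<xi>)^2) * h \<xi>)))"
    by (intro integrable_mult_right integrable_norm L2_mult_integrable sDV sh2)
   show "((%t. P t \<xi>) has_vector_derivative cor (- (a t * (norm \<xi>)^2)) * V t \<xi>) (at t within {0..T})" if "t \<in> {0..T}" for t \<xi>
    unfolding V_def P_def by (rule flow_has_derivative(2)[OF a T that])
   fix t \<xi> assume t: "t \<in> {0..T}"
   have "cmod (cor (- (a t * (norm \<xi>)^2)) * V t \<xi> * h \<xi>) = \<bar>a t\<bar> * (cmod (V t \<xi>) * cmod (cor ((norm \<xi>)^2) * h \<xi>))"
    by (simp add: norm_mult abs_mult norm_power)
   also have "\<dots> <= M * (cmod (DV \<xi>) * cmod (cor ((norm \<xi>)^2) * h \<xi>))"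
    by (intro mult_mono M t mult_right_mono Vle' M0) auto
   finally show "cmod (cor (- (a t * (norm \<xi>)^2)) * V t \<xi> * h \<xi>) <= M * cmod (DV \<xi> * (cor ((norm \<xi>)^2) * h \<xi>))"
    by (simp only: norm_mult)
  qed (use t L2_mult_integrable[OF sP sh] in auto)
  moreover have "(LINT \<xi>|lborel. (cor (- (a t * (norm \<xi>)^2)) * V t \<xi>) * h \<xi>) = cor (a t) * (LINT x|lborel. u t x * laplacian \<phi> x)"
  proof -
   have "(LINT x|lborel. u t x * laplacian \<phi> x) = (LINT \<xi>|lborel. fourier (u t) \<xi> * inverse_fourier (laplacian \<phi>) \<xi>)"
    by (rule parseval_bilinear[OF su(1)[OF t] sl])
   also have "\<dots> = (LINT \<xi>|lborel. V t \<xi> * (- cor ((norm \<xi>)^2) * h \<xi>))"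
   proof (rule integral_cong_AE)
    show "AE \<xi> in lborel. fourier (u t) \<xi> * inverse_fourier (laplacian \<phi>) \<xi> = V t \<xi> * (- cor ((norm \<xi>)^2) * h \<xi>)"
     using lap Fu(1)[OF t] by eventually_elim simp
   qed measurable
   finally have pair: "(LINT x|lborel. u t x * laplacian \<phi> x) = (LINT \<xi>|lborel. V t \<xi> * (- cor ((norm \<xi>)^2) * h \<xi>))" .
   have "(LINT \<xi>|lborel. (cor (- (a t * (norm \<xi>)^2)) * V t \<xi>) * h \<xi>)
     = (LINT \<xi>|lborel. cor (a t) * (V t \<xi> * (- cor ((norm \<xi>)^2) * h \<xi>)))"
    by (intro Bochner_Integration.integral_cong refl) simp
   then show ?thesis unfolding pair by (simp only: integral_mult_right_zero)
  qed
  ultimately have d: "((%t. LINT \<xi>|lborel. P t \<xi> * h \<xi>) has_vector_derivative cor (a t) * (LINT x|lborel. u t x * laplacian \<phi> x)) (at t within {0..T})"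
   by (simp only:)
  have e: "(LINT x|lborel. u' \<tau> x * \<phi> x) = (LINT \<xi>|lborel. P \<tau> \<xi> * h \<xi>)" if \<tau>: "\<tau> \<in> {0..T}" for \<tau>
  proof -
   note [measurable] = mF(2)[OF \<tau>]
   have "(LINT x|lborel. u' \<tau> x * \<phi> x) = (LINT \<xi>|lborel. fourier (u' \<tau>) \<xi> * h \<xi>)"
    unfolding h_def by (rule parseval_bilinear[OF su(2)[OF \<tau>] s\<phi>])
   also have "\<dots> = (LINT \<xi>|lborel. P \<tau> \<xi> * h \<xi>)"
   proof (rule integral_cong_AE)
    show "AE \<xi> in lborel. fourier (u' \<tau>) \<xi> * h \<xi> = P \<tau> \<xi> * h \<xi>"
     using Fu(2)[OF \<tau>] by eventually_elim simp
   qed measurable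
   finally show ?thesis .
  qed
  have "(grad_l2norm (u t))^2 = dirichlet (fourier (u t))"
  proof (rule grad_l2norm_eq_dirichlet[OF su(1)[OF t]])
   have "L2 (%\<xi>. bracket (s + 1) \<xi> * fourier (u t) \<xi>)" using Su(1)[OF t] by (simp add: sobolev_iff)
   then show "L2 (%\<xi>. cor (norm \<xi>) * fourier (u t) \<xi>)"
    by (rule weight_dominated(1)) (use norm_powr_le_bracket[of 1 "s + 1"] s in auto)
  qed
  also have "\<dots> = dirichlet (V t)"
   unfolding dirichlet_def by (rule integral_cong_AE) (use Fu(1)[OF t] in auto)
  finally have "1 + N ((grad_l2norm (u t))^2) = a t" using aN[OF t] by (simp add: V_def[abs_def])
  then show ?thesis
   using has_vector_derivative_transform[OF t e d] by simp
 qed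
 have "kirchhoff_solution N s T u u'"
  unfolding kirchhoff_solution_def using c1 c2 c3 c4 by blast
 then show ?thesis unfolding u_def[abs_def] u'_def[abs_def] V_def[abs_def] P_def[abs_def] .
qed

section \<open>Frequency truncated problems\<close>

lemma forced_energy_crude:
 fixes v p F :: "real => complex"
 assumes a: "!!t. t \<in> {0..T} ==> \<bar>a t\<bar> <= 2"
  and v: "!!t. t \<in> {0..T} ==> (v has_vector_derivative p t) (at t within {0..T})"
  and p: "!!t. t \<in> {0..T} ==> (p has_vector_derivative cor (- (a t * r)) * v t - F t) (at t within {0..T})"
  and F: "continuous_on {0..T} F" and r: "0 <= r" "r <= Q" and t: "t \<in> {0..T}"
 shows "(cmod (p t))^2 + (cmod (v t))^2
  <= exp ((2 + 2 * Q) * T) * ((cmod (p 0))^2 + (cmod (v 0))^2 + integral {0..t} (%\<tau>. (cmod (F \<tau>))^2))"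
proof -
 define e where "e t = (cmod (p t))^2 + (cmod (v t))^2" for t
 define e' where "e' t = 2 * Re ((cor (- (a t * r)) * v t - F t) * cnj (p t)) + 2 * Re (p t * cnj (v t))" for t
 have zT: "0 \<in> {0..T}" "0 <= T" using t by auto
 have Q0: "0 <= Q" using r by linarith
 have de: "(e has_real_derivative e' t) (at t within {0..T})" if "t \<in> {0..T}" for t
  unfolding e_def[abs_def] e'_def by (intro DERIV_add cmod_square_deriv p v that)
 have ee: "e' t <= (2 + 2 * Q) * e t + (cmod (F t))^2" if t: "t \<in> {0..T}" for t
 proof -
  have R: "2 * Re (x * y) <= 2 * (cmod x * cmod y)" for x y
   using complex_Re_le_cmod[of "x * y"] by (simp add: norm_mult)
  have "e' t = 2 * Re (cor (- (a t * r)) * v t * cnj (p t)) + 2 * Re (- F t * cnj (p t)) + 2 * Re (p t * cnj (v t))"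
   unfolding e'_def by (simp add: left_diff_distrib)
  also have "\<dots> <= 2 * (\<bar>a t\<bar> * r * (cmod (v t) * cmod (p t))) + 2 * (cmod (F t) * cmod (p t)) + 2 * (cmod (p t) * cmod (v t))"
  proof (intro add_mono)
   have "cmod (cor (- (a t * r)) * v t) = \<bar>a t\<bar> * r * cmod (v t)"
    unfolding norm_mult norm_of_real using r by (simp add: abs_mult)
   then show "2 * Re (cor (- (a t * r)) * v t * cnj (p t)) <= 2 * (\<bar>a t\<bar> * r * (cmod (v t) * cmod (p t)))"
    using R[of "cor (- (a t * r)) * v t" "cnj (p t)"] by (simp only: complex_mod_cnj mult.assoc)
   show "2 * Re (- F t * cnj (p t)) <= 2 * (cmod (F t) * cmod (p t))"
    using R[of "- F t" "cnj (p t)"] by (simp only: complex_mod_cnj norm_minus_cancel)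
   show "2 * Re (p t * cnj (v t)) <= 2 * (cmod (p t) * cmod (v t))"
    using R[of "p t" "cnj (v t)"] by (simp only: complex_mod_cnj)
  qed
  also have "\<dots> <= 2 * (2 * Q * (cmod (v t) * cmod (p t))) + 2 * (cmod (F t) * cmod (p t)) + 2 * (cmod (p t) * cmod (v t))"
  proof -
   have "\<bar>a t\<bar> * r <= 2 * Q" using a[OF t] r by (intro mult_mono) auto
   then have "\<bar>a t\<bar> * r * (cmod (v t) * cmod (p t)) <= 2 * Q * (cmod (v t) * cmod (p t))"
    by (intro mult_right_mono) auto
   then show ?thesis by linarith
  qed
  also have "\<dots> <= 2 * Q * e t + ((cmod (F t))^2 + (cmod (p t))^2) + e t"
  proof -
   have 1: "2 * (cmod (v t) * cmod (p t)) <= e t" "2 * (cmod (p t) * cmod (v t)) <= e t"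
    using sum_squares_bound[of "cmod (v t)" "cmod (p t)"] by (simp_all add: e_def mult.commute)
   have "Q * (2 * (cmod (v t) * cmod (p t))) <= Q * e t" by (rule mult_left_mono[OF 1(1) Q0])
   then show ?thesis using 1(2) sum_squares_bound[of "cmod (F t)" "cmod (p t)"] by simp
  qed
  also have "\<dots> <= (2 + 2 * Q) * e t + (cmod (F t))^2"
   by (simp add: e_def algebra_simps)
  finally show ?thesis .
 qed
 let ?I = "integral {0..t} (%\<tau>. (cmod (F \<tau>))^2)"
 have I0: "0 <= ?I" by (rule integral_nonneg) (use t in \<open>auto intro!: integrable_continuous_interval continuous_intros continuous_on_subset[OF F]\<close>)
 have "e t <= exp ((2 + 2 * Q) * t) * (e 0 + ?I)"
  by (rule gronwall[OF de _ _ ee _ t]) (use F Q0 in \<open>auto intro!: continuous_intros\<close>)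
 also have "\<dots> <= exp ((2 + 2 * Q) * T) * (e 0 + ?I)"
  using t Q0 I0 by (intro mult_right_mono) (auto simp: e_def intro!: mult_left_mono)
 finally show ?thesis by (simp add: e_def)
qed

lemma flow_crude:
 assumes b: "continuous_on {0..T} b" "!!t. t \<in> {0..T} ==> \<bar>b t\<bar> <= 2" and r: "0 <= r" "r <= Q" and t: "t \<in> {0..T}"
 shows "(cmod (flow_deriv b t z w r))^2 + (cmod (flow b t z w r))^2 <= exp ((2 + 2 * Q) * T) * ((cmod w)^2 + (cmod z)^2)"
  "[|continuous_on {0..T} a; !!t. t \<in> {0..T} ==> \<bar>a t\<bar> <= 2|] ==>
   (cmod (flow a t z w r - flow b t z w r))^2 <= exp ((2 + 2 * Q) * T) * integral {0..t} (%\<tau>. (\<bar>a \<tau> - b \<tau>\<bar> * r * cmod (flow b \<tau> z w r))^2)"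
proof -
 have T: "0 <= T" using t by auto
 have "(cmod (flow_deriv b t z w r))^2 + (cmod (flow b t z w r))^2
   <= exp ((2 + 2 * Q) * T) * ((cmod (flow_deriv b 0 z w r))^2 + (cmod (flow b 0 z w r))^2 + integral {0..t} (%\<tau>. (cmod 0)^2))"
  by (rule forced_energy_crude[OF b(2) flow_has_derivative(1)[OF b(1) T] _ _ r t])
   (use flow_has_derivative(2)[OF b(1) T] in auto)
 then show "(cmod (flow_deriv b t z w r))^2 + (cmod (flow b t z w r))^2 <= exp ((2 + 2 * Q) * T) * ((cmod w)^2 + (cmod z)^2)"
  using flow_has_derivative(3,4)[OF b(1) T t] by simp
 assume c: "continuous_on {0..T} a" and a: "!!t. t \<in> {0..T} ==> \<bar>a t\<bar> <= 2"
 define F where "F t = cor ((a t - b t) * r) * flow b t z w r" for t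
 have cf: "continuous_on {0..T} (%t. flow b t z w r)"
  using has_vector_derivative_continuous[OF flow_has_derivative(1)[OF b(1) T]] by (auto simp: continuous_on_eq_continuous_within)
 have "(cmod (flow_deriv a t z w r - flow_deriv b t z w r))^2 + (cmod (flow a t z w r - flow b t z w r))^2
   <= exp ((2 + 2 * Q) * T) * ((cmod (flow_deriv a 0 z w r - flow_deriv b 0 z w r))^2 + (cmod (flow a 0 z w r - flow b 0 z w r))^2 + integral {0..t} (%\<tau>. (cmod (F \<tau>))^2))"
 proof (rule forced_energy_crude[OF a _ _ _ r t])
  fix t assume t: "t \<in> {0..T}"
  show "((%t. flow a t z w r - flow b t z w r) has_vector_derivative flow_deriv a t z w r - flow_deriv b t z w r) (at t within {0..T})"
   by (intro has_vector_derivative_diff flow_has_derivative c b T t)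
  have "((%t. flow_deriv a t z w r - flow_deriv b t z w r) has_vector_derivative
    cor (- (a t * r)) * flow a t z w r - cor (- (b t * r)) * flow b t z w r) (at t within {0..T})"
   by (intro has_vector_derivative_diff flow_has_derivative c b T t)
  then show "((%t. flow_deriv a t z w r - flow_deriv b t z w r) has_vector_derivative
    cor (- (a t * r)) * (flow a t z w r - flow b t z w r) - F t) (at t within {0..T})"
   by (simp add: F_def algebra_simps)
 qed (auto simp: F_def intro!: continuous_intros c b cf)
 moreover have "(cmod (F \<tau>))^2 = (\<bar>a \<tau> - b \<tau>\<bar> * r * cmod (flow b \<tau> z w r))^2" for \<tau>
  unfolding F_def norm_mult norm_of_real using r by (simp add: abs_mult)
 ultimately show "(cmod (flow a t z w r - flow b t z w r))^2 <= exp ((2 + 2 * Q) * T) * integral {0..t} (%\<tau>. (\<bar>a \<tau> - b \<tau>\<bar> * r * cmod (flow b \<tau> z w r))^2)"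
  using flow_has_derivative(3,4)[OF c T t] flow_has_derivative(3,4)[OF b(1) T t]
   order_trans[OF le_add_same_cancel2[THEN iffD2, OF zero_le_power2]] by simp
qed

lemma dirichlet_flow_continuous:
 fixes f0 f1 G :: "'a::euclidean_space => complex"
 assumes T: "0 <= T" and a: "continuous_on {0..T} a"
  and [measurable]: "f0 \<in> borel_measurable borel" "f1 \<in> borel_measurable borel" and G: "L2 G"
  and le: "!!t \<xi>. t \<in> {0..T} ==> norm \<xi> * cmod (flow a t (f0 \<xi>) (f1 \<xi>) ((norm \<xi>)^2)) <= cmod (G \<xi>)"
 shows "continuous_on {0..T} (%t. dirichlet (%\<xi>. flow a t (f0 \<xi>) (f1 \<xi>) ((norm \<xi>)^2)))"
  "t \<in> {0..T} ==> L2 (%\<xi>. cor (norm \<xi>) * flow a t (f0 \<xi>) (f1 \<xi>) ((norm \<xi>)^2))"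
proof -
 define V where "V t \<xi> = cor (norm \<xi>) * flow a t (f0 \<xi>) (f1 \<xi>) ((norm \<xi>)^2)" for t and \<xi> :: 'a
 note [measurable] = measurable_flow(1)
 have mV[measurable]: "V t \<in> borel_measurable borel" for t
  unfolding V_def by measurable
 have Vle: "cmod (V t \<xi>) <= cmod (G \<xi>)" if "t \<in> {0..T}" for t \<xi> using le[OF that] by (simp add: V_def norm_mult)
 have sV: "L2 (V t)" if "t \<in> {0..T}" for t
  by (rule L2_bound[OF G, where C=1]) (use Vle[OF that] in auto)
 then show "t \<in> {0..T} ==> L2 (%\<xi>. cor (norm \<xi>) * flow a t (f0 \<xi>) (f1 \<xi>) ((norm \<xi>)^2))"
  using sV[of t] by (simp add: V_def[abs_def])
 have "((%\<tau>. l2norm (V \<tau>)) \<longlongrightarrow> l2norm (V t)) (at t within {0..T})" if t: "t \<in> {0..T}" for t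
 proof (rule Lim_null[THEN iffD2], rule Lim_null_comparison)
  show "\<forall>\<^sub>F \<tau> in at t within {0..T}. norm (l2norm (V \<tau>) - l2norm (V t)) <= l2norm (%\<xi>. V \<tau> \<xi> - V t \<xi>)"
   using abs_l2norm_diff_le[OF sV sV[OF t]] by (auto simp: eventually_at_filter)
  show "((%\<tau>. l2norm (%\<xi>. V \<tau> \<xi> - V t \<xi>)) \<longlongrightarrow> 0) (at t within {0..T})"
  proof (rule l2norm_dominated_convergence_at[OF L2_cmult[OF G, of 2]])
   show "AE \<xi> in lborel. cmod (V \<tau> \<xi> - V t \<xi>) <= cmod (2 * G \<xi>)" if \<tau>: "\<tau> \<in> {0..T}" for \<tau>
   proof (rule AE_I2)
    fix \<xi>
    show "cmod (V \<tau> \<xi> - V t \<xi>) <= cmod (2 * G \<xi>)"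
     using norm_triangle_ineq4[of "V \<tau> \<xi>" "V t \<xi>"] Vle[OF \<tau>, of \<xi>] Vle[OF t, of \<xi>] by (simp add: norm_mult)
   qed
   show "AE \<xi> in lborel. ((%\<tau>. V \<tau> \<xi> - V t \<xi>) \<longlongrightarrow> 0) (at t within {0..T})"
    unfolding V_def right_diff_distrib[symmetric] by (intro AE_I2 tendsto_mult_right_zero flow_continuous a T t)
  qed measurable
 qed
 then show "continuous_on {0..T} (%t. dirichlet (%\<xi>. flow a t (f0 \<xi>) (f1 \<xi>) ((norm \<xi>)^2)))"
  unfolding continuous_on_def dirichlet_eq_l2norm V_def by (auto intro!: tendsto_power)
qed

lemma dirichlet_diff_le:
 fixes F G :: "'a::euclidean_space => complex"
 assumes F: "L2 (%\<xi>. cor (norm \<xi>) * F \<xi>)" and G: "L2 (%\<xi>. cor (norm \<xi>) * G \<xi>)"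
  and AB: "integrable lborel (%\<xi>. A \<xi> * B \<xi>)" and k: "0 <= \<kappa>"
  and 1: "!!\<xi>. norm \<xi> * cmod (F \<xi> - G \<xi>) <= \<kappa> * A \<xi>" and 2: "!!\<xi>. norm \<xi> * (cmod (F \<xi>) + cmod (G \<xi>)) <= B \<xi>" and A0: "!!\<xi>. 0 <= A \<xi>"
 shows "\<bar>dirichlet F - dirichlet G\<bar> <= \<kappa> * (LINT \<xi>|lborel. A \<xi> * B \<xi>)"
proof -
 have i: "integrable lborel (%\<xi>. (norm \<xi>)^2 * (cmod (F \<xi>))^2)" "integrable lborel (%\<xi>. (norm \<xi>)^2 * (cmod (G \<xi>))^2)"
  using L2D(2)[OF F] L2D(2)[OF G] by (simp_all add: norm_mult power_mult_distrib)
 have "\<bar>dirichlet F - dirichlet G\<bar> = norm (LINT \<xi>|lborel. (norm \<xi>)^2 * (cmod (F \<xi>))^2 - (norm \<xi>)\<^sup>2 * (cmod (G \<xi>))^2)"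
  unfolding dirichlet_def using i by simp
 also have "\<dots> <= (LINT \<xi>|lborel. norm ((norm \<xi>)^2 * (cmod (F \<xi>))^2 - (norm \<xi>)\<^sup>2 * (cmod (G \<xi>))^2))"
  by (rule integral_norm_bound)
 also have "\<dots> <= (LINT \<xi>|lborel. \<kappa> * (A \<xi> * B \<xi>))"
 proof (intro integral_mono integrable_norm Bochner_Integration.integrable_diff i integrable_mult_right AB)
  fix \<xi>
  have "norm ((norm \<xi>)^2 * (cmod (F \<xi>))^2 - (norm \<xi>)\<^sup>2 * (cmod (G \<xi>))^2)
   = (norm \<xi> * \<bar>cmod (F \<xi>) - cmod (G \<xi>)\<bar>) * (norm \<xi> * (cmod (F \<xi>) + cmod (G \<xi>)))"
  proof -
   have "(norm \<xi>)^2 * (cmod (F \<xi>))^2 - (norm \<xi>)\<^sup>2 * (cmod (G \<xi>))^2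
    = (norm \<xi> * (cmod (F \<xi>) - cmod (G \<xi>))) * (norm \<xi> * (cmod (F \<xi>) + cmod (G \<xi>)))"
    by (simp add: power2_eq_square algebra_simps)
   then show ?thesis by (simp add: abs_mult)
  qed
  also have "\<dots> <= (\<kappa> * A \<xi>) * B \<xi>"
  proof (rule mult_mono[OF _ 2])
   have "norm \<xi> * \<bar>cmod (F \<xi>) - cmod (G \<xi>)\<bar> <= norm \<xi> * cmod (F \<xi> - G \<xi>)"
    by (intro mult_left_mono norm_triangle_ineq3) auto
   then show "norm \<xi> * \<bar>cmod (F \<xi>) - cmod (G \<xi>)\<bar> <= \<kappa> * A \<xi>" using 1 order_trans by blast
  qed (use k A0 in auto)
  finally show "norm ((norm \<xi>)^2 * (cmod (F \<xi>))^2 - (norm \<xi>)\<^sup>2 * (cmod (G \<xi>))^2) <= \<kappa> * (A \<xi> * B \<xi>)"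
   by (simp add: mult.assoc)
 qed
 finally show ?thesis by simp
qed

text \<open>
  With all frequencies bounded by \<open>R\<close> the coefficient \<open>a = 1 + N(\<parallel>\<nabla>u\<parallel>\<^sup>2)\<close> depends on itself through
  a Volterra map, so Picard iteration converges on the whole interval.
\<close>

lemma truncated_coefficient:
 fixes f0 f1 :: "'a::euclidean_space => complex"
 assumes f0: "band_limited R f0" and f1: "band_limited R f1" and R: "0 <= R" and T: "0 <= T"
  and Nb: "!!y. 0 <= y ==> \<bar>Nt y\<bar> <= 1/2" and NL: "!!x y. 0 <= x ==> 0 <= y ==> \<bar>Nt x - Nt y\<bar> <= \<Lambda> * \<bar>x - y\<bar>"
 obtains a where "continuous_on {0..T} a"
  "!!t. t \<in> {0..T} ==> a t = 1 + Nt (dirichlet (%\<xi>. flow a t (f0 \<xi>) (f1 \<xi>) ((norm \<xi>)^2)))"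
proof -
 define V where "V a t \<xi> = flow a t (f0 \<xi>) (f1 \<xi>) ((norm \<xi>)^2)" for a t and \<xi> :: 'a
 define \<Phi> where "\<Phi> a t = 1 + Nt (dirichlet (V a t))" for a t
 have s0: "L2 f0" and s1: "L2 f1" using f0 f1 by (auto simp: band_limited_def)
 note [measurable] = L2D(1)[OF s0] L2D(1)[OF s1]
 define E where "E = exp ((2 + 2 * R^2) * T)"
 have E0: "0 < E" by (simp add: E_def)
 define D where "D \<xi> = sqrt ((cmod (f0 \<xi>))^2 + (cmod (f1 \<xi>))^2)" for \<xi>
 have D0: "0 <= D \<xi>" for \<xi> by (simp add: D_def)
 have D2: "(D \<xi>)^2 = (cmod (f0 \<xi>))^2 + (cmod (f1 \<xi>))^2" for \<xi> by (simp add: D_def)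
 have [measurable]: "D \<in> borel_measurable borel" unfolding D_def by measurable
 have Di: "integrable lborel (%\<xi>. (D \<xi>)^2)"
  unfolding D2 using L2D(2)[OF s0] L2D(2)[OF s1] by simp
 define G where "G \<xi> = cor (R * sqrt E * D \<xi>)" for \<xi>
 have sG: "L2 G"
 proof -
  have "L2 (%\<xi>. cor (D \<xi>))" using Di by (simp add: square_integrable_def)
  from L2_cmult[OF this, of "cor (R * sqrt E)"] show ?thesis by (simp add: G_def[abs_def])
 qed
 have outside: "V a t \<xi> = 0" if "norm \<xi> > R" for a t \<xi>
  using that f0 f1 by (simp add: V_def flow_def band_limited_def)
 define adm where "adm a \<longleftrightarrow> continuous_on {0..T} a \<and> (\<forall>t\<in>{0..T}. \<bar>a t\<bar> <= 2)" for a :: "real => real"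
 have Vb: "cmod (V a t \<xi>) <= sqrt E * D \<xi>" if a: "adm a" and t: "t \<in> {0..T}" for a t \<xi>
 proof (cases "norm \<xi> <= R")
  case True
  then have r: "0 <= (norm \<xi>)^2" "(norm \<xi>)^2 <= R^2" by (auto intro: power_mono)
  have "(cmod (flow_deriv a t (f0 \<xi>) (f1 \<xi>) ((norm \<xi>)^2)))^2 + (cmod (V a t \<xi>))^2 <= E * ((cmod (f1 \<xi>))^2 + (cmod (f0 \<xi>))^2)"
   unfolding V_def E_def by (rule flow_crude(1)[OF _ _ r t]) (use a in \<open>auto simp: adm_def\<close>)
  then have "(cmod (V a t \<xi>))^2 <= E * (D \<xi>)^2"
   using zero_le_power2[of "cmod (flow_deriv a t (f0 \<xi>) (f1 \<xi>) ((norm \<xi>)^2))"] unfolding D2 add.commute[of "(cmod (f0 \<xi>))^2"] by linarith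
  also have "\<dots> = (sqrt E * D \<xi>)^2" using E0 by (simp add: power_mult_distrib)
  finally show ?thesis by (rule power2_le_imp_le) (use E0 D0 in simp)
 next
  case False then show ?thesis using outside[of \<xi>] E0 D0 by simp
 qed
 have Vb': "norm \<xi> * cmod (V a t \<xi>) <= R * sqrt E * D \<xi>" if "adm a" "t \<in> {0..T}" for a t \<xi>
 proof (cases "norm \<xi> <= R")
  case True
  then show ?thesis using mult_mono[OF True Vb[OF that]] R by (simp add: mult.assoc)
 next
  case False then show ?thesis using outside[of \<xi>] E0 D0 R by simp
 qed
 have VG: "norm \<xi> * cmod (V a t \<xi>) <= cmod (G \<xi>)" if "adm a" "t \<in> {0..T}" for a t \<xi>
  using Vb'[OF that] R E0 D0[of \<xi>] by (simp add: G_def norm_mult)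
 have dc: "continuous_on {0..T} (%t. dirichlet (V a t))" if a: "adm a" for a
  unfolding V_def by (rule dirichlet_flow_continuous(1)[OF T _ _ _ sG]) (use a VG[OF a] in \<open>auto simp: adm_def V_def\<close>)
 have sV: "L2 (%\<xi>. cor (norm \<xi>) * V a t \<xi>)" if a: "adm a" and t: "t \<in> {0..T}" for a t
  unfolding V_def by (rule dirichlet_flow_continuous(2)[OF T _ _ _ sG _ t]) (use a VG[OF a] in \<open>auto simp: adm_def V_def\<close>)
 have Nc: "continuous_on {0..} Nt"
 proof (rule continuous_onI)
  fix x e :: real assume x: "x \<in> {0..}" and e: "0 < e"
  show "\<exists>d>0. \<forall>x'\<in>{0..}. dist x' x < d \<longrightarrow> dist (Nt x') (Nt x) <= e"
  proof (intro exI[of _ "e / (\<bar>\<Lambda>\<bar> + 1)"] conjI ballI impI)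
   fix x' assume x': "x' \<in> {0..}" "dist x' x < e / (\<bar>\<Lambda>\<bar> + 1)"
   have "\<bar>Nt x' - Nt x\<bar> <= \<Lambda> * \<bar>x' - x\<bar>" using NL[of x' x] x x' by auto
   also have "\<dots> <= (\<bar>\<Lambda>\<bar> + 1) * \<bar>x' - x\<bar>" by (intro mult_right_mono) auto
   also have "\<dots> <= e" using x' by (simp add: dist_real_def pos_less_divide_eq mult.commute)
   finally show "dist (Nt x') (Nt x) <= e" by (simp add: dist_real_def)
  qed (use e in auto)
 qed
 have \<Phi>adm: "adm (\<Phi> a)" if a: "adm a" for a
  unfolding adm_def
 proof
  show "continuous_on {0..T} (\<Phi> a)"
   unfolding \<Phi>_def by (intro continuous_intros continuous_on_compose2[OF Nc dc[OF a]]) (auto simp: dirichlet_nonneg)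
  show "\<forall>t\<in>{0..T}. \<bar>\<Phi> a t\<bar> <= 2"
  proof
   fix t show "\<bar>\<Phi> a t\<bar> <= 2" using Nb[OF dirichlet_nonneg, of "V a t"] unfolding \<Phi>_def by linarith
  qed
 qed
 \<comment> \<open>the iteration contracts by \<open>1/4\<close> for squares weighted by \<open>exp(-4Kt)\<close>\<close>
 define K where "K = (\<bar>\<Lambda>\<bar> * (R * E * R^2 * (LINT \<xi>|lborel. D \<xi> * (2 * R * sqrt E * D \<xi>))))^2"
 have K0: "0 <= K" by (simp add: K_def)
 have contr: "(\<Phi> a t - \<Phi> b t)^2 <= K * integral {0..t} (%\<tau>. (a \<tau> - b \<tau>)^2)" if a: "adm a" and b: "adm b" and t: "t \<in> {0..T}" for a b t
 proof -
  let ?I = "integral {0..t} (%\<tau>. (a \<tau> - b \<tau>)^2)"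
  have sub: "{0..t} \<subseteq> {0..T}" using t by auto
  have ca: "continuous_on {0..T} a" and cb: "continuous_on {0..T} b" using a b by (auto simp: adm_def)
  have iI: "(%\<tau>. (a \<tau> - b \<tau>)^2) integrable_on {0..t}"
   by (intro integrable_continuous_interval continuous_intros continuous_on_subset[OF ca sub] continuous_on_subset[OF cb sub])
  have I0: "0 <= ?I" by (rule integral_nonneg[OF iI]) simp
  have diff: "norm \<xi> * cmod (V a t \<xi> - V b t \<xi>) <= (R * E * R^2 * sqrt ?I) * D \<xi>" for \<xi>
  proof (cases "norm \<xi> <= R")
   case True
   then have r: "0 <= (norm \<xi>)^2" "(norm \<xi>)^2 <= R^2" by (auto intro: power_mono)
   have cf: "continuous_on {0..T} (%\<tau>. V b \<tau> \<xi>)"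
    using has_vector_derivative_continuous[OF flow_has_derivative(1)[OF cb T]] unfolding V_def
    by (auto simp: continuous_on_eq_continuous_within)
   have "(cmod (V a t \<xi> - V b t \<xi>))^2 <= E * integral {0..t} (%\<tau>. (\<bar>a \<tau> - b \<tau>\<bar> * (norm \<xi>)^2 * cmod (V b \<tau> \<xi>))^2)"
    unfolding V_def E_def by (rule flow_crude(2)[OF cb _ r t ca]) (use a b in \<open>auto simp: adm_def\<close>)
   also have "integral {0..t} (%\<tau>. (\<bar>a \<tau> - b \<tau>\<bar> * (norm \<xi>)^2 * cmod (V b \<tau> \<xi>))^2)
    <= integral {0..t} (%\<tau>. (a \<tau> - b \<tau>)^2 * (R^2 * (sqrt E * D \<xi>))^2)"
   proof (rule integral_le)
    show "(%\<tau>. (\<bar>a \<tau> - b \<tau>\<bar> * (norm \<xi>)^2 * cmod (V b \<tau> \<xi>))^2) integrable_on {0..t}"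
     by (intro integrable_continuous_interval continuous_intros continuous_on_subset[OF ca sub] continuous_on_subset[OF cb sub] continuous_on_subset[OF cf sub])
    show "(%\<tau>. (a \<tau> - b \<tau>)^2 * (R^2 * (sqrt E * D \<xi>))^2) integrable_on {0..t}"
     by (intro integrable_continuous_interval continuous_intros continuous_on_subset[OF ca sub] continuous_on_subset[OF cb sub])
    fix \<tau> assume "\<tau> \<in> {0..t}"
    then have \<tau>: "\<tau> \<in> {0..T}" using sub by blast
    have "(norm \<xi>)^2 * cmod (V b \<tau> \<xi>) <= R^2 * (sqrt E * D \<xi>)"
     by (intro mult_mono r Vb b \<tau>) auto
    then have "((norm \<xi>)^2 * cmod (V b \<tau> \<xi>))^2 <= (R^2 * (sqrt E * D \<xi>))^2" by (intro power_mono) auto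
    then have "(a \<tau> - b \<tau>)^2 * ((norm \<xi>)^2 * cmod (V b \<tau> \<xi>))^2 <= (a \<tau> - b \<tau>)^2 * (R^2 * (sqrt E * D \<xi>))^2"
     by (rule mult_left_mono) simp
    then show "(\<bar>a \<tau> - b \<tau>\<bar> * (norm \<xi>)^2 * cmod (V b \<tau> \<xi>))^2 <= (a \<tau> - b \<tau>)^2 * (R^2 * (sqrt E * D \<xi>))^2"
     by (simp add: power_mult_distrib mult.assoc)
   qed
   also have "\<dots> = ?I * (R^2 * (sqrt E * D \<xi>))^2" by (rule integral_mult_left)
   finally have "(cmod (V a t \<xi> - V b t \<xi>))^2 <= E * (?I * (R^2 * (sqrt E * D \<xi>))^2)"
    using E0 by (simp add: mult_left_mono)
   also have "\<dots> = (E * R^2 * sqrt ?I * D \<xi>)^2"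
    using E0 I0 by (simp add: power_mult_distrib power2_eq_square[of E] mult.assoc mult.left_commute)
   finally have "cmod (V a t \<xi> - V b t \<xi>) <= E * R^2 * sqrt ?I * D \<xi>"
    by (rule power2_le_imp_le) (use E0 I0 D0 in \<open>auto intro!: mult_nonneg_nonneg\<close>)
   from mult_mono[OF True this] R show ?thesis by (simp add: mult.assoc)
  next
   case False
   then show ?thesis using outside[of \<xi>] R E0 I0 D0[of \<xi>] by (auto intro!: mult_nonneg_nonneg)
  qed
  have "\<bar>dirichlet (V a t) - dirichlet (V b t)\<bar> <= (R * E * R^2 * sqrt ?I) * (LINT \<xi>|lborel. D \<xi> * (2 * R * sqrt E * D \<xi>))"
  proof (rule dirichlet_diff_le[OF sV[OF a t] sV[OF b t] _ _ diff])
   show "integrable lborel (%\<xi>. D \<xi> * (2 * R * sqrt E * D \<xi>))"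
    using integrable_mult_right[OF Di, of "2 * R * sqrt E"] by (simp add: power2_eq_square mult.left_commute)
   show "norm \<xi> * (cmod (V a t \<xi>) + cmod (V b t \<xi>)) <= 2 * R * sqrt E * D \<xi>" for \<xi>
    using Vb'[OF a t, of \<xi>] Vb'[OF b t, of \<xi>] by (simp add: distrib_left)
  qed (use R E0 I0 D0 in auto)
  then have "\<bar>\<Phi> a t - \<Phi> b t\<bar> <= \<bar>\<Lambda>\<bar> * ((R * E * R^2 * sqrt ?I) * (LINT \<xi>|lborel. D \<xi> * (2 * R * sqrt E * D \<xi>)))"
  proof -
   assume *: "\<bar>dirichlet (V a t) - dirichlet (V b t)\<bar> <= (R * E * R^2 * sqrt ?I) * (LINT \<xi>|lborel. D \<xi> * (2 * R * sqrt E * D \<xi>))"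
   have "\<bar>\<Phi> a t - \<Phi> b t\<bar> <= \<Lambda> * \<bar>dirichlet (V a t) - dirichlet (V b t)\<bar>"
    using NL[OF dirichlet_nonneg dirichlet_nonneg, of "V a t" "V b t"] by (simp add: \<Phi>_def)
   also have "\<dots> <= \<bar>\<Lambda>\<bar> * \<bar>dirichlet (V a t) - dirichlet (V b t)\<bar>" by (intro mult_right_mono) auto
   also have "\<dots> <= \<bar>\<Lambda>\<bar> * ((R * E * R^2 * sqrt ?I) * (LINT \<xi>|lborel. D \<xi> * (2 * R * sqrt E * D \<xi>)))"
    by (rule mult_left_mono[OF *]) simp
   finally show ?thesis .
  qed
  then have "\<bar>\<Phi> a t - \<Phi> b t\<bar>^2 <= (\<bar>\<Lambda>\<bar> * ((R * E * R^2 * sqrt ?I) * (LINT \<xi>|lborel. D \<xi> * (2 * R * sqrt E * D \<xi>))))^2"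
   by (rule power_mono) simp
  also have "\<dots> = K * ?I" unfolding K_def power_mult_distrib using I0 by simp
  finally show ?thesis by simp
 qed
 define A where "A = rec_nat (%_. 1) (%n. \<Phi>)"
 have A0: "A 0 = (%_. 1)" and AS: "A (Suc n) = \<Phi> (A n)" for n by (simp_all add: A_def)
 have Aadm: "adm (A n)" for n
  by (induction n) (auto simp: AS \<Phi>adm, simp add: A0 adm_def)
 have cA: "continuous_on {0..T} (A n)" for n using Aadm by (simp add: adm_def)
 have Abd: "(A (Suc n) t - A n t)^2 <= (1/4) ^ n * exp (4 * K * t)" if "t \<in> {0..T}" for n t
  using that
 proof (induction n arbitrary: t)
  case 0
  have "\<bar>Nt (dirichlet (V (A 0) t))\<bar>^2 <= (1/2)^2" by (intro power_mono Nb dirichlet_nonneg) auto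
  also have "\<dots> <= exp (4 * K * t)" using 0 K0 by (intro order_trans[OF _ one_le_exp_iff[THEN iffD2]]) (auto simp: power2_eq_square)
  finally show ?case by (simp add: AS \<Phi>_def A0)
 next
  case (Suc n)
  have "K * integral {0..t} (%\<tau>. (A (Suc n) \<tau> - A n \<tau>)^2) <= (1/4) ^ Suc n * exp (4 * K * t)"
  proof (rule deriv_le_imp_le[where T=T and f="%t. K * integral {0..t} (%\<tau>. (A (Suc n) \<tau> - A n \<tau>)^2)" and g="%t. (1/4) ^ Suc n * exp (4 * K * t)"])
   fix t assume t: "t \<in> {0..T}"
   show "((%t. K * integral {0..t} (%\<tau>. (A (Suc n) \<tau> - A n \<tau>)^2)) has_real_derivative K * (A (Suc n) t - A n t)^2) (at t within {0..T})"
    by (intro DERIV_cmult integral_has_real_derivative[OF _ t] continuous_intros cA)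
   show "((%t. (1/4) ^ Suc n * exp (4 * K * t)) has_real_derivative K * ((1/4) ^ n * exp (4 * K * t))) (at t within {0..T})"
    by (auto intro!: derivative_eq_intros)
   show "K * (A (Suc n) t - A n t)^2 <= K * ((1/4) ^ n * exp (4 * K * t))"
    by (rule mult_left_mono[OF Suc.IH[OF t] K0])
  qed (use Suc.prems in auto)
  then show ?case
   unfolding AS[of "Suc n"] using contr[OF Aadm[of "Suc n"] Aadm[of n] Suc.prems] by (simp add: AS)
 qed
 define m where "m n = (1/2) ^ n * exp (2 * K * T)" for n :: nat
 have ms: "summable m" unfolding m_def by (intro summable_mult2 summable_geometric) simp
 have Am: "norm (A (Suc n) t - A n t) <= m n" if t: "t \<in> {0..T}" for n t
 proof -
  have "(A (Suc n) t - A n t)^2 <= (1/4) ^ n * exp (4 * K * t)" by (rule Abd[OF t])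
  also have "\<dots> <= (1/4) ^ n * exp (4 * K * T)" using t K0 by (simp add: mult_left_mono)
  also have "\<dots> = (m n)^2"
   by (simp add: m_def power_mult_distrib power_mult[symmetric] power_divide exp_double[symmetric] mult.commute[of n] power_mult)
  finally have "\<bar>A (Suc n) t - A n t\<bar>^2 <= (m n)^2" by simp
  then show ?thesis unfolding real_norm_def by (rule power2_le_imp_le) (simp add: m_def)
 qed
 define a where "a t = 1 + (\<Sum>n. A (Suc n) t - A n t)" for t
 have ul: "uniform_limit {0..T} A a sequentially"
 proof -
  have "uniform_limit {0..T} (%n t. \<Sum>i<n. A (Suc i) t - A i t) (%t. \<Sum>n. A (Suc n) t - A n t) sequentially"
   by (rule Weierstrass_m_test[OF Am ms])
  then have "uniform_limit {0..T} (%n t. 1 + (\<Sum>i<n. A (Suc i) t - A i t)) (%t. 1 + (\<Sum>n. A (Suc n) t - A n t)) sequentially"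
   by (intro uniform_limit_intros)
  moreover have "1 + (\<Sum>i<n. A (Suc i) t - A i t) = A n t" for n t
   using sum_lessThan_telescope[of "%i. A i t" n] by (simp add: A0)
  ultimately show ?thesis by (simp add: a_def[abs_def])
 qed
 have ca: "continuous_on {0..T} a"
  by (rule uniform_limit_theorem[OF _ ul]) (auto simp: cA)
 have pl: "(%n. A n t) \<longlonglongrightarrow> a t" if "t \<in> {0..T}" for t
  using tendsto_uniform_limitI[OF ul that] .
 have aadm: "adm a"
  unfolding adm_def
 proof (intro conjI ca ballI)
  fix t assume t: "t \<in> {0..T}"
  have "(%n. \<bar>A n t\<bar>) \<longlonglongrightarrow> \<bar>a t\<bar>" by (intro tendsto_intros pl t)
  then show "\<bar>a t\<bar> <= 2" by (rule tendsto_upperbound) (use Aadm t in \<open>auto simp: adm_def\<close>)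
 qed
 have "\<Phi> a t = a t" if t: "t \<in> {0..T}" for t
 proof (rule LIMSEQ_unique)
  show "(%n. \<Phi> (A n) t) \<longlonglongrightarrow> a t" using LIMSEQ_Suc[OF pl[OF t]] by (simp add: AS)
  show "(%n. \<Phi> (A n) t) \<longlonglongrightarrow> \<Phi> a t"
  proof (rule LIMSEQ_I)
   fix e :: real assume e: "0 < e"
   define d where "d = e / (sqrt (K * T) + 1)"
   have KT: "0 <= sqrt (K * T)" using K0 T by simp
   have d0: "0 < d" using e KT by (simp add: d_def add_nonneg_pos)
   obtain n0 where n0: "!!n t. n >= n0 ==> t \<in> {0..T} ==> dist (A n t) (a t) < d"
    using uniform_limitD[OF ul d0] unfolding eventually_sequentially by blast
   have "norm (\<Phi> (A n) t - \<Phi> a t) < e" if n: "n >= n0" for n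
   proof -
    have sub: "{0..t} \<subseteq> {0..T}" using t by auto
    have "(\<Phi> (A n) t - \<Phi> a t)^2 <= K * integral {0..t} (%\<tau>. (A n \<tau> - a \<tau>)^2)"
     by (rule contr[OF Aadm aadm t])
    also have "integral {0..t} (%\<tau>. (A n \<tau> - a \<tau>)^2) <= integral {0..t} (%\<tau>. d^2)"
    proof (rule integral_le)
     show "(%\<tau>. (A n \<tau> - a \<tau>)^2) integrable_on {0..t}"
      by (intro integrable_continuous_interval continuous_intros continuous_on_subset[OF ca sub] continuous_on_subset[OF cA sub])
     fix \<tau> assume "\<tau> \<in> {0..t}"
     then have "\<bar>A n \<tau> - a \<tau>\<bar> < d" using n0[OF n, of \<tau>] sub by (auto simp: dist_real_def)
     then have "\<bar>A n \<tau> - a \<tau>\<bar>^2 <= d^2" by (intro power_mono) auto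
     then show "(A n \<tau> - a \<tau>)^2 <= d^2" by simp
    qed (rule integrable_const_ivl)
    also have "\<dots> <= T * d^2" using t by (simp add: mult_right_mono)
    finally have "(\<Phi> (A n) t - \<Phi> a t)^2 <= K * (T * d^2)" using K0 by (simp add: mult_left_mono)
    also have "\<dots> = (sqrt (K * T) * d)^2" using K0 T by (simp add: power_mult_distrib)
    finally have "\<bar>\<Phi> (A n) t - \<Phi> a t\<bar>^2 <= (sqrt (K * T) * d)^2" by simp
    then have "\<bar>\<Phi> (A n) t - \<Phi> a t\<bar> <= sqrt (K * T) * d"
     by (rule power2_le_imp_le) (use KT d0 in simp)
    also have "\<dots> < (sqrt (K * T) + 1) * d" using d0 by simp
    also have "\<dots> = e"
    proof -
     have "sqrt (K * T) + 1 \<noteq> 0" using KT by linarith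
     then show ?thesis unfolding d_def by simp
    qed
    finally show ?thesis by simp
   qed
   then show "\<exists>n0. \<forall>n\<ge>n0. norm (\<Phi> (A n) t - \<Phi> a t) < e" by blast
  qed
 qed
 then show ?thesis using that[OF ca] by (simp add: \<Phi>_def V_def[abs_def])
qed

section \<open>A priori bounds\<close>

text \<open>
  Continuity argument: up to the first time at which the value \<open>m\<close> is reached, \<open>step\<close> gives \<open>m/2\<close>, so that
  time does not exist.
\<close>

lemma bootstrap:
 fixes h :: "real => real"
 assumes h: "continuous_on {0..T} h" and m: "0 < m" and h0: "h 0 <= m / 2"
  and step: "!!T'. 0 < T' ==> T' <= T ==> (!!t. t \<in> {0..T'} ==> h t <= m) ==> (!!t. t \<in> {0..T'} ==> h t <= m / 2)"
  and t: "t \<in> {0..T}"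
 shows "h t <= m / 2"
proof -
 define B where "B = {t \<in> {0..T}. h t = m}"
 have below: "\<exists>s\<in>B. s <= t" if "t \<in> {0..T}" "h t > m" for t
 proof -
  have "\<exists>s\<ge>0. s <= t \<and> h s = m"
   by (rule IVT') (use that h0 m in \<open>auto intro: continuous_on_subset[OF h]\<close>)
  then show ?thesis using that by (auto simp: B_def)
 qed
 have le: "h t <= m" if "t \<in> {0..T}" for t
 proof (rule ccontr)
  assume "\<not> h t <= m"
  then have "B \<noteq> {}" using below[OF that] by auto
  have "closed B" unfolding B_def
   using continuous_closed_preimage_constant[OF h closed_atLeastAtMost] by simp
  moreover have "B \<inter> {0..T} = B" by (auto simp: B_def)
  ultimately have "compact B" using closed_Int_compact[OF _ compact_Icc, of B 0 T] by simp
  then obtain t1 where t1: "t1 \<in> B" "!!s. s \<in> B ==> t1 <= s"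
   using compact_attains_inf[OF _ \<open>B \<noteq> {}\<close>] by blast
  have t1T: "t1 \<in> {0..T}" "h t1 = m" using t1 by (auto simp: B_def)
  have "t1 \<noteq> 0" using t1T h0 m by auto
  have "h s <= m" if s: "s \<in> {0..t1}" for s
  proof (rule ccontr)
   assume "\<not> h s <= m"
   then obtain r where r: "r \<in> B" "r <= s" using below[of s] s t1T by auto
   then have "r = t1" "s = t1" using t1(2)[of r] s by auto
   then show False using \<open>\<not> h s <= m\<close> t1T by simp
  qed
  then have "h t1 <= m / 2" using step[of t1 t1] t1T \<open>t1 \<noteq> 0\<close> by auto
  then show False using t1T m by simp
 qed
 show ?thesis
 proof (cases "T = 0")
  case True then show ?thesis using t h0 by simp
 next
  case False then show ?thesis using step[of T t] le t by auto
 qed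
qed

text \<open>
  Comparison with \<open>Z' = C Z\<^sup>3\<close>, whose solution doubles its size only after a time of order \<open>1/Z(0)\<^sup>2\<close>.
  The shift \<open>Z = X + e\<^sup>2\<close> keeps the inequality and makes division by \<open>Z\<close> possible where \<open>X\<close> vanishes.
\<close>

lemma cubic_ode_bound:
 fixes X :: "real => real"
 assumes d: "!!t. t \<in> {0..T} ==> (X has_real_derivative X' t) (at t within {0..T})"
  and le: "!!t. t \<in> {0..T} ==> X' t <= C * (X t * (X t)^2)" and pos: "!!t. t \<in> {0..T} ==> 0 <= X t"
  and C: "1 <= C" and e: "0 < e" and X0: "X 0 <= C * e^2" and T: "T <= 1 / (4 * C * (C + 1)^2) * (1 / e ^ 4)" and t: "t \<in> {0..T}"
 shows "X t <= 2 * (C + 1) * e^2"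
proof -
 define Z where "Z t = X t + e^2" for t
 have Zpos: "0 < Z t" if "t \<in> {0..T}" for t using pos[OF that] e by (simp add: Z_def add_nonneg_pos)
 have zT: "0 \<in> {0..T}" using t by auto
 have "- (1 / (Z t)^2) <= - (1 / (Z 0)^2) + 2 * C * t"
 proof (rule deriv_le_imp_le[where T=T and f="%t. - (1 / (Z t)^2)" and g="%t. - (1 / (Z 0)^2) + 2 * C * t"])
  fix t assume t: "t \<in> {0..T}"
  show "((%t. - (1 / (Z t)^2)) has_real_derivative 2 * X' t / (Z t) ^ 3) (at t within {0..T})"
  proof -
   have dZ: "(Z has_real_derivative X' t) (at t within {0..T})"
    unfolding Z_def[abs_def] by (auto intro!: derivative_eq_intros d[OF t])
   have n: "(Z t)^2 \<noteq> 0" using Zpos[OF t] by simp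
   show ?thesis
    using DERIV_cong[OF DERIV_minus[OF DERIV_inverse_fun[OF DERIV_power[OF dZ, of 2] n]], of "2 * X' t / (Z t) ^ 3"] Zpos[OF t]
    by (simp add: inverse_eq_divide field_simps power2_eq_square power3_eq_cube)
  qed
  show "((%t. - (1 / (Z 0)^2) + 2 * C * t) has_real_derivative 2 * C) (at t within {0..T})"
   by (auto intro!: derivative_eq_intros)
  have "X' t <= C * (X t) ^ 3" using le[OF t] by (simp add: power3_eq_cube power2_eq_square)
  also have "\<dots> <= C * (Z t) ^ 3"
   using C pos[OF t] e by (intro mult_left_mono power_mono) (auto simp: Z_def)
  finally show "2 * X' t / (Z t) ^ 3 <= 2 * C" using Zpos[OF t] by (simp add: pos_divide_le_eq)
 qed (use t in auto)
 then have 1: "1 / (Z 0)^2 - 2 * C * t <= 1 / (Z t)^2" by linarith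
 have c1: "0 < C + 1" using C by simp
 have "Z 0 <= (C + 1) * e^2" using X0 by (simp add: Z_def algebra_simps)
 then have "(Z 0)^2 <= ((C + 1) * e^2)^2" using Zpos[OF zT] by (intro power_mono) auto
 also have e4: "((C + 1) * e^2)^2 = (C + 1)^2 * e ^ 4" by (simp add: power_mult_distrib)
 finally have 2: "1 / ((C + 1)^2 * e ^ 4) <= 1 / (Z 0)^2" using Zpos[OF zT] by (intro divide_left_mono) (use c1 e in auto)
 have "2 * C * t <= 2 * C * (1 / (4 * C * (C + 1)^2) * (1 / e ^ 4))"
  using t T C by (intro mult_left_mono) auto
 also have "\<dots> = (1 / 2) * (1 / ((C + 1)^2 * e ^ 4))" using C by simp
 finally have 3: "(1 / 2) * (1 / ((C + 1)^2 * e ^ 4)) <= 1 / (Z t)^2" using 1 2 by linarith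
 have q: "0 < (C + 1)^2 * e ^ 4" using c1 e by simp
 have "(Z t)^2 <= 2 * ((C + 1)^2 * e ^ 4)"
  using 3 Zpos[OF t] q by (simp add: field_simps)
 also have "\<dots> <= (2 * (C + 1) * e^2)^2"
  unfolding mult.assoc[of 2 "C + 1"] power_mult_distrib[of 2] e4 using q by simp
 finally have "Z t <= 2 * (C + 1) * e^2" by (rule power2_le_imp_le) (use c1 in simp)
 then show ?thesis using e zero_le_power2[of e] unfolding Z_def by linarith
qed

lemma hdot_norm_0:
 assumes g: "L2 g"
 shows "hdot_norm 0 g = l2norm g"
proof -
 note s = L2_fourier[OF g]
 note [measurable] = L2D(1)[OF s]
 have ae: "AE \<xi> in lborel. cor (norm \<xi> powr 0) * fourier g \<xi> = fourier g \<xi>"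
  using AE_lborel_singleton[of 0] by eventually_elim simp
 have "L2 (%\<xi>. cor (norm \<xi> powr 0) * fourier g \<xi>)"
  by (rule L2_bound[OF s, where C=1]) (auto simp: norm_mult powr_def)
 then have "hdot_norm 0 g = l2norm (fourier g)"
  unfolding hdot_norm_def by (rule l2norm_cong_AE[OF ae _ s])
 then show ?thesis by (simp add: plancherel[OF g])
qed

lemma hdot1_l2_eq_hdot_pair: "L2 g ==> hdot1_l2_norm f g = hdot_pair_norm 0 f g"
 by (simp add: hdot1_l2_norm_def hdot_pair_norm_def hdot_norm_0)

lemma hdot_norm_nonneg [simp]: "0 <= hdot_norm s f"
 by (simp add: hdot_norm_def)

lemma hdot_pair_norm_nonneg [simp]: "0 <= hdot_pair_norm s f g"
 by (simp add: hdot_pair_norm_def)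

lemma hdot_pair_norm_power2: "(hdot_pair_norm s f g)^2 = (hdot_norm (1 + s) f)^2 + (hdot_norm s g)^2"
 by (simp add: hdot_pair_norm_def)

lemma hdot_norm_1_power2: "(hdot_norm 1 f)^2 = dirichlet (fourier f)"
 by (simp add: hdot_norm_def dirichlet_eq_l2norm)

text \<open>The energy property with its constant; enlarging the constant, it may be taken to be at least \<open>1\<close>.\<close>

definition energy_control :: "'a::euclidean_space itself => (real => real) => real => real => real => bool" where
 "energy_control _ N s0 \<delta> C \<longleftrightarrow> 1 <= C \<and> (\<forall>T>0. \<forall>(u :: real => 'a => complex) u'. kirchhoff_solution N s0 T u u' \<longrightarrow>
    (\<exists>E :: real => real => real. \<forall>t\<in>{0..T}. hdot1_l2_norm (u t) (u' t) <= \<delta> \<longrightarrow>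
      (\<forall>s\<in>{0..s0}. 0 <= E s t \<and>
       (hdot_pair_norm s (u t) (u' t))^2 <= C * E s t \<and>
       E s t <= C * (hdot_pair_norm s (u t) (u' t))^2 \<and>
       (\<exists>D. (E s has_real_derivative D) (at t within {0..T}) \<and>
          D <= C * (E s t * (E (1/4) t)^2)))))"

lemma energy_threshold_control:
 assumes "energy_threshold TYPE('a::euclidean_space) N s0 \<delta>"
 obtains C where "energy_control TYPE('a) N s0 \<delta> C" "0 < \<delta>"
proof -
 note th = assms[unfolded energy_threshold_def]
 note d = conjunct1[OF th]
 from conjunct2[OF th] obtain C where CC: "C > 0 \<and> (\<forall>T>0. \<forall>(u :: real => 'a => complex) u'. kirchhoff_solution N s0 T u u' \<longrightarrow>
    (\<exists>E :: real => real => real. \<forall>t\<in>{0..T}. hdot1_l2_norm (u t) (u' t) <= \<delta> \<longrightarrow>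
      (\<forall>s\<in>{0..s0}.
       (hdot_pair_norm s (u t) (u' t))^2 <= C * E s t \<and>
       E s t <= C * (hdot_pair_norm s (u t) (u' t))^2 \<and>
       (\<exists>D. (E s has_real_derivative D) (at t within {0..T}) \<and>
          D <= C * (E s t * (E (1/4) t)^2)))))"
  by (rule exE)
 note C = conjunct1[OF CC] and H = conjunct2[OF CC, rule_format]
 have "energy_control TYPE('a) N s0 \<delta> (max C 1)"
  unfolding energy_control_def
 proof (intro conjI allI impI)
  fix T :: real and u u' :: "real => 'a => complex"
  assume "0 < T" "kirchhoff_solution N s0 T u u'"
  from H[OF this] obtain E where E: "!!t s. t \<in> {0..T} ==> hdot1_l2_norm (u t) (u' t) <= \<delta> ==> s \<in> {0..s0} ==>
       (hdot_pair_norm s (u t) (u' t))^2 <= C * E s t \<and>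
       E s t <= C * (hdot_pair_norm s (u t) (u' t))^2 \<and>
       (\<exists>D. (E s has_real_derivative D) (at t within {0..T}) \<and> D <= C * (E s t * (E (1/4) t)^2))" by blast
  show "\<exists>E. \<forall>t\<in>{0..T}. hdot1_l2_norm (u t) (u' t) <= \<delta> \<longrightarrow>
      (\<forall>s\<in>{0..s0}. 0 <= E s t \<and>
       (hdot_pair_norm s (u t) (u' t))^2 <= max C 1 * E s t \<and>
       E s t <= max C 1 * (hdot_pair_norm s (u t) (u' t))^2 \<and>
       (\<exists>D. (E s has_real_derivative D) (at t within {0..T}) \<and>
          D <= max C 1 * (E s t * (E (1/4) t)^2)))"
  proof (intro exI[of _ E] ballI impI)
   fix t s assume A: "t \<in> {0..T}" "hdot1_l2_norm (u t) (u' t) <= \<delta>" "s \<in> {0..s0}"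
   note e = E[OF A]
   have "0 <= C * E s t" using e zero_le_power2 order_trans by blast
   then have E0: "0 <= E s t" using C by (simp add: zero_le_mult_iff)
   have mono: "C * x <= max C 1 * x" if "0 <= x" for x using that by (intro mult_right_mono) auto
   have "C * (E s t * (E (1/4) t)^2) <= max C 1 * (E s t * (E (1/4) t)^2)" using E0 by (intro mono) simp
   then show "0 <= E s t \<and> (hdot_pair_norm s (u t) (u' t))^2 <= max C 1 * E s t \<and>
       E s t <= max C 1 * (hdot_pair_norm s (u t) (u' t))^2 \<and>
       (\<exists>D. (E s has_real_derivative D) (at t within {0..T}) \<and>
          D <= max C 1 * (E s t * (E (1/4) t)^2))"
    using e E0 mono[OF E0] mono[OF zero_le_power2[of "hdot_pair_norm s (u t) (u' t)"]] by (meson order_trans)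
  qed
 qed auto
 then show ?thesis using that d by blast
qed

lemma energy_controlE:
 fixes u u' :: "real => 'a::euclidean_space => complex"
 assumes c: "energy_control TYPE('a) N s0 \<delta> C" and u: "kirchhoff_solution N s0 T u u'" and T0: "0 < T"
  and sm: "!!t. t \<in> {0..T} ==> hdot1_l2_norm (u t) (u' t) <= \<delta>"
 obtains E D where "\<forall>t\<in>{0..T}. \<forall>s\<in>{0..s0}. 0 <= E s t \<and> (hdot_pair_norm s (u t) (u' t))^2 <= C * E s t \<and>
  E s t <= C * (hdot_pair_norm s (u t) (u' t))^2 \<and> (E s has_real_derivative D s t) (at t within {0..T}) \<and>
  D s t <= C * (E s t * (E (1/4) t)^2)"
proof -
 note c' = conjunct2[OF c[unfolded energy_control_def], rule_format, OF T0 u]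
 obtain E where E: "\<forall>t\<in>{0..T}. hdot1_l2_norm (u t) (u' t) <= \<delta> \<longrightarrow>
      (\<forall>s\<in>{0..s0}. 0 <= E s t \<and>
       (hdot_pair_norm s (u t) (u' t))^2 <= C * E s t \<and>
       E s t <= C * (hdot_pair_norm s (u t) (u' t))^2 \<and>
       (\<exists>D. (E s has_real_derivative D) (at t within {0..T}) \<and>
          D <= C * (E s t * (E (1/4) t)^2)))"
  using c' by (rule exE)
 note E' = E[rule_format, OF _ sm]
 define D where "D s t = (SOME D. (E s has_real_derivative D) (at t within {0..T}) \<and> D <= C * (E s t * (E (1/4) t)^2))" for s t
 have D: "(E s has_real_derivative D s t) (at t within {0..T}) \<and> D s t <= C * (E s t * (E (1/4) t)^2)"
  if "t \<in> {0..T}" "s \<in> {0..s0}" for s t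
  unfolding D_def by (rule someI_ex[OF E'[OF that(1) that(1) that(2), THEN conjunct2, THEN conjunct2, THEN conjunct2]])
 show ?thesis
 proof (rule that[of E D], intro ballI)
  fix t s assume A: "t \<in> {0..T}" "s \<in> {0..s0}"
  note e = E'[OF A(1) A(1) A(2)]
  show "0 <= E s t \<and> (hdot_pair_norm s (u t) (u' t))^2 <= C * E s t \<and>
  E s t <= C * (hdot_pair_norm s (u t) (u' t))^2 \<and> (E s has_real_derivative D s t) (at t within {0..T}) \<and>
  D s t <= C * (E s t * (E (1/4) t)^2)"
   by (intro conjI conjunct1[OF e] conjunct1[OF conjunct2[OF e]] conjunct1[OF conjunct2[OF conjunct2[OF e]]] conjunct1[OF D[OF A]] conjunct2[OF D[OF A]])
 qed
qed

text \<open>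
  The energy of order \<open>1/4\<close> obeys the closed cubic inequality, independently of the other orders.
\<close>

lemma quarter_bound:
 fixes u u' :: "real => 'a::euclidean_space => complex"
 assumes c: "energy_control TYPE('a) N s \<delta> C" and s: "1/4 <= s" and u: "kirchhoff_solution N s T u u'"
  and T0: "0 < T" and T: "T <= 1 / (4 * C * (C + 1)^2) * (1 / e ^ 4)" and e: "0 < e"
  and sm: "!!t. t \<in> {0..T} ==> hdot1_l2_norm (u t) (u' t) <= \<delta>" and i: "hdot_pair_norm (1/4) (u 0) (u' 0) <= e"
  and t: "t \<in> {0..T}"
 shows "hdot_pair_norm (1/4) (u t) (u' t) <= 2 * (C + 1) * e"
proof -
 have C1: "1 <= C" using c by (simp add: energy_control_def)
 obtain E D where EE: "\<forall>t\<in>{0..T}. \<forall>s\<in>{0..s}. 0 <= E s t \<and> (hdot_pair_norm s (u t) (u' t))^2 <= C * E s t \<and>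
  E s t <= C * (hdot_pair_norm s (u t) (u' t))^2 \<and> (E s has_real_derivative D s t) (at t within {0..T}) \<and>
  D s t <= C * (E s t * (E (1/4) t)^2)"
  by (rule energy_controlE[OF c u T0 sm])
 note E = EE[rule_format, THEN conjunct1] EE[rule_format, THEN conjunct2, THEN conjunct1]
  EE[rule_format, THEN conjunct2, THEN conjunct2, THEN conjunct1]
  EE[rule_format, THEN conjunct2, THEN conjunct2, THEN conjunct2, THEN conjunct1]
  EE[rule_format, THEN conjunct2, THEN conjunct2, THEN conjunct2, THEN conjunct2]
 have q: "1/4 \<in> {0..s}" using s by simp
 have z: "0 \<in> {0..T}" using t by auto
 have "E (1/4) 0 <= C * (hdot_pair_norm (1/4) (u 0) (u' 0))^2" by (rule E(3)[OF z q])
 also have "\<dots> <= C * e^2" using i C1 by (intro mult_left_mono power_mono) auto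
 finally have X0: "E (1/4) 0 <= C * e^2" .
 have "E (1/4) t <= 2 * (C + 1) * e^2"
  by (rule cubic_ode_bound[OF E(4)[OF _ q] E(5)[OF _ q] E(1)[OF _ q] C1 e X0 T t])
 then have "C * E (1/4) t <= C * (2 * (C + 1) * e^2)" using C1 by (intro mult_left_mono) auto
 also have "\<dots> <= (2 * (C + 1) * e)^2"
 proof -
  have "C * (2 * (C + 1) * e^2) <= (C + 1) * (2 * (C + 1) * (2 * e^2))" using C1 e by (intro mult_mono) auto
  also have "\<dots> = (2 * (C + 1) * e)^2" by (simp add: power2_eq_square algebra_simps)
  finally show ?thesis .
 qed
 finally have "(hdot_pair_norm (1/4) (u t) (u' t))^2 <= (2 * (C + 1) * e)^2" using E(2)[OF t q] by linarith
 then show ?thesis by (rule power2_le_imp_le) (use C1 e in simp)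
qed

text \<open>
  Once the order \<open>1/4\<close> is under control, \<open>(E\<^sup>s)' \<le> C\<^sup>3 w\<^sup>4 E\<^sup>s\<close> is linear, and \<open>w\<^sup>4 T\<close> is bounded
  independently of the size of the data.
\<close>

lemma all_orders_bound:
 fixes u u' :: "real => 'a::euclidean_space => complex"
 assumes c: "energy_control TYPE('a) N s0 \<delta> C" and s0: "1/4 <= s0" and u: "kirchhoff_solution N s0 T u u'"
  and T0: "0 < T" and sm: "!!t. t \<in> {0..T} ==> hdot1_l2_norm (u t) (u' t) <= \<delta>"
  and q: "!!t. t \<in> {0..T} ==> hdot_pair_norm (1/4) (u t) (u' t) <= w" and w4: "w ^ 4 * T <= \<rho>"
  and s: "s \<in> {0..s0}" and t: "t \<in> {0..T}"
 shows "hdot_pair_norm s (u t) (u' t) <= C * exp (C ^ 3 * \<rho>) * hdot_pair_norm s (u 0) (u' 0)"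
proof -
 have C1: "1 <= C" using c by (simp add: energy_control_def)
 obtain E D where EE: "\<forall>t\<in>{0..T}. \<forall>s\<in>{0..s0}. 0 <= E s t \<and> (hdot_pair_norm s (u t) (u' t))^2 <= C * E s t \<and>
  E s t <= C * (hdot_pair_norm s (u t) (u' t))^2 \<and> (E s has_real_derivative D s t) (at t within {0..T}) \<and>
  D s t <= C * (E s t * (E (1/4) t)^2)"
  by (rule energy_controlE[OF c u T0 sm])
 note E = EE[rule_format, THEN conjunct1] EE[rule_format, THEN conjunct2, THEN conjunct1]
  EE[rule_format, THEN conjunct2, THEN conjunct2, THEN conjunct1]
  EE[rule_format, THEN conjunct2, THEN conjunct2, THEN conjunct2, THEN conjunct1]
  EE[rule_format, THEN conjunct2, THEN conjunct2, THEN conjunct2, THEN conjunct2]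
 have z: "0 \<in> {0..T}" using t by auto
 have Dle: "D s t <= (C ^ 3 * w ^ 4) * E s t + 0" if t: "t \<in> {0..T}" for t
 proof -
  have q4: "1/4 \<in> {0..s0}" using s0 by simp
  have "(hdot_pair_norm (1/4) (u t) (u' t))^2 <= w^2" by (intro power_mono q t) simp
  then have "C * (hdot_pair_norm (1/4) (u t) (u' t))^2 <= C * w^2" using C1 by (intro mult_left_mono) auto
  then have "E (1/4) t <= C * w^2" using E(3)[OF t q4] by linarith
  then have "(E (1/4) t)^2 <= (C * w^2)^2" using E(1)[OF t q4] by (intro power_mono)
  then have "C * (E s t * (E (1/4) t)^2) <= C * (E s t * (C * w^2)^2)"
   using C1 E(1)[OF t s] by (intro mult_left_mono) auto
  also have "\<dots> = (C ^ 3 * w ^ 4) * E s t + 0"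
   by (simp add: power_mult_distrib power3_eq_cube power2_eq_square power4_eq_xxxx)
  finally show ?thesis using E(5)[OF t s] by linarith
 qed
 have "E s t <= exp ((C ^ 3 * w ^ 4) * t) * (E s 0 + integral {0..t} (%_. 0))"
  by (rule gronwall[OF E(4)[OF _ s] _ _ Dle _ t]) (use C1 in auto)
 then have 1: "E s t <= exp ((C ^ 3 * w ^ 4) * t) * E s 0" by simp
 have "exp ((C ^ 3 * w ^ 4) * t) <= exp (C ^ 3 * \<rho>)"
 proof -
  have "w ^ 4 * t <= w ^ 4 * T" using t by (intro mult_left_mono) auto
  then have "C ^ 3 * (w ^ 4 * t) <= C ^ 3 * \<rho>" using w4 C1 by (intro mult_left_mono) auto
  then show ?thesis by (simp add: mult.assoc)
 qed
 then have "exp ((C ^ 3 * w ^ 4) * t) * E s 0 <= exp (C ^ 3 * \<rho>) * (C * (hdot_pair_norm s (u 0) (u' 0))^2)"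
  using E(1,3)[OF z s] by (intro mult_mono) auto
 then have 2: "E s t <= exp (C ^ 3 * \<rho>) * (C * (hdot_pair_norm s (u 0) (u' 0))^2)" using 1 by linarith
 let ?e = "exp (C ^ 3 * \<rho>)"
 have "w ^ 4 * T >= 0" using T0 by simp
 then have r0: "0 <= C ^ 3 * \<rho>" using w4 C1 by (intro mult_nonneg_nonneg) auto
 have "(hdot_pair_norm s (u t) (u' t))^2 <= C * E s t" by (rule E(2)[OF t s])
 also have "\<dots> <= C * (?e * (C * (hdot_pair_norm s (u 0) (u' 0))^2))" using 2 C1 by (intro mult_left_mono) auto
 also have "\<dots> <= C * (?e * ?e * (C * (hdot_pair_norm s (u 0) (u' 0))^2))"
 proof -
  have "1 <= ?e" using r0 by simp
  then have "?e * 1 <= ?e * ?e" by (intro mult_left_mono) auto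
  then show ?thesis using C1 by (intro mult_left_mono mult_right_mono) auto
 qed
 also have "\<dots> = (C * ?e * hdot_pair_norm s (u 0) (u' 0))^2" by (simp add: power2_eq_square ac_simps)
 finally show ?thesis by (rule power2_le_imp_le) (use C1 in simp)
qed

lemma kirchhoff_solution_L2:
 assumes u: "kirchhoff_solution N s T u u'" and t: "t \<in> {0..T}"
 shows "L2 (u t)" "L2 (u' t)" "u t \<in> sobolev (s + 1)" "u' t \<in> sobolev s"
 using u t by (auto simp: kirchhoff_solution_def sobolev_continuous_def sobolev_iff)

lemma hdot1_l2_continuous:
 assumes N: "continuous_on {0..} N" and s: "0 <= s" and u: "kirchhoff_solution N s T u u'"
 shows "continuous_on {0..T} (%t. hdot1_l2_norm (u t) (u' t))"
proof -
 note S = spectral_energy_continuous[OF kirchhoff_spectral[OF N s u] s]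
 have "continuous_on {0..T} (%t. sqrt (dirichlet (fourier (u t)) + (l2norm (fourier (u' t)))^2))"
  by (intro continuous_intros S)
 then show ?thesis
  by (rule continuous_on_cong[THEN iffD1, rotated 2])
    (auto simp: hdot1_l2_norm_def hdot_norm_1_power2 plancherel kirchhoff_solution_L2[OF u])
qed

lemma dirichlet_le_hdot1: "dirichlet (fourier f) <= (hdot1_l2_norm f g)^2"
 by (simp add: hdot1_l2_norm_def hdot_norm_1_power2 dirichlet_nonneg)

section \<open>Stability of the coefficient\<close>

text \<open>
  The coefficients for which the energy at a single frequency is almost conserved: bounded derivative,
  and bounded away from \<open>0\<close>.
\<close>

definition admissible :: "real => real => (real => real) => bool" where
 "admissible L T a \<longleftrightarrow> (\<exists>a'. \<forall>t\<in>{0..T}. (a has_real_derivative a' t) (at t within {0..T}) \<and> \<bar>a' t\<bar> <= L \<and> 1/2 <= a t \<and> a t <= 3/2)"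

text \<open>
  The square root of the energy of the data at the frequency \<open>\<xi>\<close>.
\<close>

definition density :: "('a::euclidean_space => complex) => ('a => complex) => 'a => real" where
 "density f0 f1 \<xi> = sqrt ((cmod (f1 \<xi>))^2 + (norm \<xi> * cmod (f0 \<xi>))^2)"

definition growth :: "real => real => real" where
 "growth L T = sqrt (3 * exp ((2 * L + 1) * T))"

lemma density_nonneg [simp]: "0 <= density f0 f1 \<xi>" and growth_nonneg [simp]: "0 <= growth L T"
 by (simp_all add: density_def growth_def)

lemma density_power2: "(density f0 f1 \<xi>)^2 = (cmod (f1 \<xi>))^2 + (norm \<xi> * cmod (f0 \<xi>))^2"
 by (simp add: density_def)

lemma growth_power2: "(growth L T)^2 = 3 * exp ((2 * L + 1) * T)"
 by (simp add: growth_def)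

lemma measurable_density:
 assumes [measurable]: "f0 \<in> borel_measurable borel" "f1 \<in> borel_measurable borel"
 shows "density f0 f1 \<in> borel_measurable borel"
 unfolding density_def[abs_def] by measurable

lemma admissible_cong:
 assumes "admissible L T a" "!!t. t \<in> {0..T} ==> a t = b t"
 shows "admissible L T b"
proof -
 from assms(1) obtain a' where a: "!!t. t \<in> {0..T} ==> (a has_real_derivative a' t) (at t within {0..T}) \<and> \<bar>a' t\<bar> <= L \<and> 1/2 <= a t \<and> a t <= 3/2"
  unfolding admissible_def by blast
 have "(b has_real_derivative a' t) (at t within {0..T})" if "t \<in> {0..T}" for t
  by (rule has_field_derivative_transform_within[of a _ _ _ 1]) (use a[OF that] that assms(2) in auto)
 then show ?thesis using a assms(2) unfolding admissible_def by (intro exI[of _ a']) auto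
qed

lemma admissible_continuous: "admissible L T a ==> continuous_on {0..T} a"
 unfolding admissible_def by (blast intro: DERIV_continuous_on)

lemma admissible_flow_energy:
 assumes a: "admissible L T a" and t: "t \<in> {0..T}"
 shows "(cmod (flow_deriv a t (f0 \<xi>) (f1 \<xi>) ((norm \<xi>)^2)))^2 + (norm \<xi> * cmod (flow a t (f0 \<xi>) (f1 \<xi>) ((norm \<xi>)^2)))^2
   <= (growth L T * density f0 f1 \<xi>)^2"
  "cmod (flow_deriv a t (f0 \<xi>) (f1 \<xi>) ((norm \<xi>)^2)) <= growth L T * density f0 f1 \<xi>"
  "norm \<xi> * cmod (flow a t (f0 \<xi>) (f1 \<xi>) ((norm \<xi>)^2)) <= growth L T * density f0 f1 \<xi>"
proof -
 from a obtain a' where a': "!!t. t \<in> {0..T} ==> (a has_real_derivative a' t) (at t within {0..T})"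
  "!!t. t \<in> {0..T} ==> \<bar>a' t\<bar> <= L" "!!t. t \<in> {0..T} ==> 1/2 <= a t \<and> a t <= 3/2"
  unfolding admissible_def by blast
 show 1: "(cmod (flow_deriv a t (f0 \<xi>) (f1 \<xi>) ((norm \<xi>)^2)))^2 + (norm \<xi> * cmod (flow a t (f0 \<xi>) (f1 \<xi>) ((norm \<xi>)^2)))^2
   <= (growth L T * density f0 f1 \<xi>)^2"
  using flow_energy[OF a' zero_le_power2 t, of "f0 \<xi>" "f1 \<xi>" "norm \<xi>"]
  by (simp add: power_mult_distrib growth_power2 density_power2)
 show "cmod (flow_deriv a t (f0 \<xi>) (f1 \<xi>) ((norm \<xi>)^2)) <= growth L T * density f0 f1 \<xi>"
  by (rule power2_le_imp_le[OF order_trans[OF _ 1]]) auto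
 show "norm \<xi> * cmod (flow a t (f0 \<xi>) (f1 \<xi>) ((norm \<xi>)^2)) <= growth L T * density f0 f1 \<xi>"
  by (rule power2_le_imp_le[OF order_trans[OF _ 1]]) auto
qed

text \<open>
  The difference of two flows solves the wave equation with the force \<open>(a - b) |\<xi>|\<^sup>2\<close> times one of the
  flows, so the comparison costs one power of \<open>|\<xi>|\<close> relative to the energy.
\<close>

lemma admissible_flow_diff:
 fixes f0 f1 :: "'a::euclidean_space => complex"
 assumes a: "admissible L T a" and b: "admissible L T b" and t: "t \<in> {0..T}"
 shows "norm \<xi> * cmod (flow a t (f0 \<xi>) (f1 \<xi>) ((norm \<xi>)^2) - flow b t (f0 \<xi>) (f1 \<xi>) ((norm \<xi>)^2))
   <= ((growth L T)^2 * sqrt (integral {0..t} (%\<tau>. (a \<tau> - b \<tau>)^2))) * (norm \<xi> * density f0 f1 \<xi>)"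
proof -
 let ?V = "%b t. flow b t (f0 \<xi>) (f1 \<xi>) ((norm \<xi>)^2)" and ?d = "density f0 f1 \<xi>" and ?G = "growth L T"
 from a obtain a' where a': "!!t. t \<in> {0..T} ==> (a has_real_derivative a' t) (at t within {0..T})"
  "!!t. t \<in> {0..T} ==> \<bar>a' t\<bar> <= L" "!!t. t \<in> {0..T} ==> 1/2 <= a t \<and> a t <= 3/2"
  unfolding admissible_def by blast
 have T: "0 <= T" using t by auto
 note ca = admissible_continuous[OF a] and cb = admissible_continuous[OF b]
 have cV: "continuous_on {0..T} (?V b)"
  using has_vector_derivative_continuous[OF flow_has_derivative(1)[OF cb T]] by (auto simp: continuous_on_eq_continuous_within)
 have sub: "{0..t} \<subseteq> {0..T}" using t by auto
 define J where "J = integral {0..t} (%\<tau>. (a \<tau> - b \<tau>)^2)"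
 have ci: "continuous_on {0..T} (%\<tau>. (a \<tau> - b \<tau>)^2)" by (intro continuous_intros ca cb)
 have J0: "0 <= J" unfolding J_def by (intro integral_nonneg integrable_continuous_interval continuous_on_subset[OF ci sub]) auto
 have "(norm \<xi> * cmod (?V a t - ?V b t))^2 <= ?G^2 * integral {0..t} (%\<tau>. (\<bar>a \<tau> - b \<tau>\<bar> * (norm \<xi>)^2 * cmod (?V b \<tau>))^2)"
  using flow_stability[OF a' cb zero_le_power2 t, of "f0 \<xi>" "f1 \<xi>" "norm \<xi>"]
   zero_le_power2[of "cmod (flow_deriv a t (f0 \<xi>) (f1 \<xi>) ((norm \<xi>)^2) - flow_deriv b t (f0 \<xi>) (f1 \<xi>) ((norm \<xi>)^2))"]
  unfolding growth_power2 power_mult_distrib[of "norm \<xi>" "cmod _"] by linarith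
 also have "integral {0..t} (%\<tau>. (\<bar>a \<tau> - b \<tau>\<bar> * (norm \<xi>)^2 * cmod (?V b \<tau>))^2) <= integral {0..t} (%\<tau>. (a \<tau> - b \<tau>)^2 * (norm \<xi> * (?G * ?d))^2)"
 proof (intro integral_le integrable_continuous_interval)
  show "continuous_on {0..t} (%\<tau>. (\<bar>a \<tau> - b \<tau>\<bar> * (norm \<xi>)^2 * cmod (?V b \<tau>))^2)"
   by (rule continuous_on_subset[OF _ sub]) (intro continuous_intros ca cb cV)
  show "continuous_on {0..t} (%\<tau>. (a \<tau> - b \<tau>)^2 * (norm \<xi> * (?G * ?d))^2)"
   by (rule continuous_on_subset[OF _ sub]) (intro continuous_intros ca cb)
  fix \<tau> assume "\<tau> \<in> {0..t}"
  then have \<tau>: "\<tau> \<in> {0..T}" using sub by auto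
  have "(norm \<xi> * (norm \<xi> * cmod (?V b \<tau>)))^2 <= (norm \<xi> * (?G * ?d))^2"
   using admissible_flow_energy(3)[OF b \<tau>, of \<xi> f0 f1] by (intro power_mono mult_left_mono) auto
  then have "(a \<tau> - b \<tau>)^2 * (norm \<xi> * (norm \<xi> * cmod (?V b \<tau>)))^2 <= (a \<tau> - b \<tau>)^2 * (norm \<xi> * (?G * ?d))^2"
   by (intro mult_left_mono) auto
  then show "(\<bar>a \<tau> - b \<tau>\<bar> * (norm \<xi>)^2 * cmod (?V b \<tau>))^2 <= (a \<tau> - b \<tau>)^2 * (norm \<xi> * (?G * ?d))^2"
   by (simp add: power_mult_distrib power2_eq_square[of "norm \<xi>"] mult.assoc)
 qed
 also have "\<dots> = J * (norm \<xi> * (?G * ?d))^2" by (simp add: J_def)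
 also have "?G^2 * (J * (norm \<xi> * (?G * ?d))^2) = ((?G^2 * sqrt J) * (norm \<xi> * ?d))^2"
  using J0 by (simp add: power_mult_distrib power2_eq_square[of "?G^2"] mult.assoc mult.left_commute)
 finally have "(norm \<xi> * cmod (?V a t - ?V b t))^2 <= ((?G^2 * sqrt J) * (norm \<xi> * ?d))^2"
  by (simp add: mult_left_mono)
 then show ?thesis unfolding J_def[symmetric] by (rule power2_le_imp_le) (use J0 in simp)
qed

lemma L2_flow:
 fixes f0 f1 :: "'a::euclidean_space => complex"
 assumes a: "admissible L T a" and t: "t \<in> {0..T}" and m[measurable]: "f0 \<in> borel_measurable borel" "f1 \<in> borel_measurable borel"
  and d: "integrable lborel (%\<xi>. (density f0 f1 \<xi>)^2)"
 shows "L2 (%\<xi>. cor (norm \<xi>) * flow a t (f0 \<xi>) (f1 \<xi>) ((norm \<xi>)^2))"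
proof -
 note [measurable] = measurable_density[OF m] measurable_flow(1)
 have "L2 (%\<xi>. cor (density f0 f1 \<xi>))"
  using d by (simp add: square_integrable_def)
 then show ?thesis
  by (rule L2_bound[where C="growth L T"]) (use admissible_flow_energy(3)[OF a t, of _ f0 f1] in \<open>auto simp: norm_mult\<close>)
qed

lemma dirichlet_flow_stability:
 fixes f0 f1 :: "'a::euclidean_space => complex"
 assumes a: "admissible L T a" and b: "admissible L T b" and t: "t \<in> {0..T}" and m: "f0 \<in> borel_measurable borel" "f1 \<in> borel_measurable borel"
  and d: "integrable lborel (%\<xi>. (density f0 f1 \<xi>)^2)" and d2: "integrable lborel (%\<xi>. norm \<xi> * (density f0 f1 \<xi>)^2)"
 shows "\<bar>dirichlet (%\<xi>. flow a t (f0 \<xi>) (f1 \<xi>) ((norm \<xi>)^2)) - dirichlet (%\<xi>. flow b t (f0 \<xi>) (f1 \<xi>) ((norm \<xi>)^2))\<bar>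
  <= (2 * growth L T ^ 3 * (LINT \<xi>|lborel. norm \<xi> * (density f0 f1 \<xi>)^2)) * sqrt (integral {0..t} (%\<tau>. (a \<tau> - b \<tau>)^2))"
proof -
 let ?G = "growth L T" and ?d = "density f0 f1"
 define J where "J = integral {0..t} (%\<tau>. (a \<tau> - b \<tau>)^2)"
 have ci: "continuous_on {0..T} (%\<tau>. (a \<tau> - b \<tau>)^2)" by (intro continuous_intros admissible_continuous[OF a] admissible_continuous[OF b])
 have J0: "0 <= J" unfolding J_def by (intro integral_nonneg integrable_continuous_interval continuous_on_subset[OF ci]) (use t in auto)
 have eq: "norm \<xi> * ?d \<xi> * (2 * ?G * ?d \<xi>) = (2 * ?G) * (norm \<xi> * (?d \<xi>)^2)" for \<xi> by (simp add: power2_eq_square ac_simps)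
 have "\<bar>dirichlet (%\<xi>. flow a t (f0 \<xi>) (f1 \<xi>) ((norm \<xi>)^2)) - dirichlet (%\<xi>. flow b t (f0 \<xi>) (f1 \<xi>) ((norm \<xi>)^2))\<bar>
  <= (?G^2 * sqrt J) * (LINT \<xi>|lborel. (norm \<xi> * ?d \<xi>) * (2 * ?G * ?d \<xi>))"
 proof (rule dirichlet_diff_le[OF L2_flow[OF a t m d] L2_flow[OF b t m d]])
  show "integrable lborel (%\<xi>. norm \<xi> * ?d \<xi> * (2 * ?G * ?d \<xi>))" unfolding eq using d2 by simp
  fix \<xi> :: 'a
  show "norm \<xi> * cmod (flow a t (f0 \<xi>) (f1 \<xi>) ((norm \<xi>)^2) - flow b t (f0 \<xi>) (f1 \<xi>) ((norm \<xi>)^2)) <= ?G^2 * sqrt J * (norm \<xi> * ?d \<xi>)"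
   unfolding J_def by (rule admissible_flow_diff[OF a b t])
  show "norm \<xi> * (cmod (flow a t (f0 \<xi>) (f1 \<xi>) ((norm \<xi>)^2)) + cmod (flow b t (f0 \<xi>) (f1 \<xi>) ((norm \<xi>)^2))) <= 2 * ?G * ?d \<xi>"
   using admissible_flow_energy(3)[OF a t, of \<xi> f0 f1] admissible_flow_energy(3)[OF b t, of \<xi> f0 f1] by (simp add: distrib_left)
 qed (use J0 in auto)
 also have "\<dots> = (2 * ?G ^ 3 * (LINT \<xi>|lborel. norm \<xi> * (?d \<xi>)^2)) * sqrt J"
  unfolding eq by (simp add: power2_eq_square power3_eq_cube)
 finally show ?thesis unfolding J_def .
qed

text \<open>
  Gronwall's inequality for the integral of \<open>w\<close>, inserted once more into the hypothesis.
\<close>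

lemma integral_gronwall:
 fixes w :: "real => real"
 assumes w: "continuous_on {0..T} w" and le: "!!t. t \<in> {0..T} ==> w t <= c + K * integral {0..t} w"
  and c: "0 <= c" and K: "0 <= K" and t: "t \<in> {0..T}"
 shows "w t <= c * (1 + K * T * exp (K * T))"
proof -
 have "integral {0..t} w <= exp (K * t) * (integral {0..0} w + integral {0..t} (%_. c))"
  by (rule gronwall[OF integral_has_real_derivative[OF w] _ _ _ K t]) (use le c in \<open>auto simp: add.commute\<close>)
 also have "\<dots> = exp (K * t) * (c * t)" using t by simp
 also have "\<dots> <= exp (K * T) * (c * T)" using t c K by (intro mult_mono mult_nonneg_nonneg) (auto intro: mult_left_mono)
 finally have "K * integral {0..t} w <= K * (exp (K * T) * (c * T))" using K by (intro mult_left_mono)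
 then show ?thesis using le[OF t] by (simp add: algebra_simps)
qed

text \<open>
  The coefficient determines the flow and the flow determines the coefficient; the two comparisons
  together leave only the discrepancy \<open>\<eta>\<close> with which each coefficient satisfies its equation.
\<close>

lemma coefficient_comparison:
 fixes f0 f1 :: "'a::euclidean_space => complex"
 assumes a: "admissible L T a" and b: "admissible L T b" and m: "f0 \<in> borel_measurable borel" "f1 \<in> borel_measurable borel"
  and d: "integrable lborel (%\<xi>. (density f0 f1 \<xi>)^2)" and d2: "integrable lborel (%\<xi>. norm \<xi> * (density f0 f1 \<xi>)^2)"
  and \<Lambda>: "0 <= \<Lambda>" and \<eta>: "0 <= \<eta>"
  and le: "!!t. t \<in> {0..T} ==> \<bar>a t - b t\<bar> <= \<Lambda> * (\<eta> + \<bar>dirichlet (%\<xi>. flow a t (f0 \<xi>) (f1 \<xi>) ((norm \<xi>)^2)) - dirichlet (%\<xi>. flow b t (f0 \<xi>) (f1 \<xi>) ((norm \<xi>)^2))\<bar>)"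
  and S: "S = 2 * growth L T ^ 3 * (LINT \<xi>|lborel. norm \<xi> * (density f0 f1 \<xi>)^2)" and K: "K = 2 * \<Lambda>^2 * S^2" and t: "t \<in> {0..T}"
 shows "(a t - b t)^2 <= \<eta>^2 * (2 * \<Lambda>^2 * (1 + K * T * exp (K * T)))"
proof -
 have ci: "continuous_on {0..T} (%\<tau>. (a \<tau> - b \<tau>)^2)" by (intro continuous_intros admissible_continuous[OF a] admissible_continuous[OF b])
 have "(a t - b t)^2 <= (2 * \<Lambda>^2 * \<eta>^2) * (1 + K * T * exp (K * T))"
 proof (rule integral_gronwall[OF ci _ _ _ t])
  fix t assume t: "t \<in> {0..T}"
  define J where "J = integral {0..t} (%\<tau>. (a \<tau> - b \<tau>)^2)"
  have J0: "0 <= J" unfolding J_def by (intro integral_nonneg integrable_continuous_interval continuous_on_subset[OF ci]) (use t in auto)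
  have "\<bar>a t - b t\<bar> <= \<Lambda> * (\<eta> + S * sqrt J)"
   using le[OF t] mult_left_mono[OF dirichlet_flow_stability[OF a b t m d d2] \<Lambda>] unfolding S J_def by (simp add: distrib_left)
  then have "(a t - b t)^2 <= (\<Lambda> * (\<eta> + S * sqrt J))^2" using power_mono[OF _ abs_ge_zero, of _ _ 2] by fastforce
  also have "\<dots> = \<Lambda>^2 * (\<eta> + S * sqrt J)^2" by (rule power_mult_distrib)
  also have "\<dots> <= \<Lambda>^2 * (2 * \<eta>^2 + 2 * (S * sqrt J)^2)"
   using sum_squares_bound[of \<eta> "S * sqrt J"] by (intro mult_left_mono) (auto simp: power2_sum)
  also have "\<dots> = 2 * \<Lambda>^2 * \<eta>^2 + K * J" using J0 by (simp add: K power_mult_distrib algebra_simps)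
  finally show "(a t - b t)^2 <= 2 * \<Lambda>^2 * \<eta>^2 + K * integral {0..t} (%\<tau>. (a \<tau> - b \<tau>)^2)" by (simp add: J_def)
 qed (auto simp: K)
 then show ?thesis by (simp add: ac_simps)
qed

section \<open>Small data on the time interval of the theorem\<close>

lemma kirchhoff_solution_cong:
 assumes "kirchhoff_solution N s T u u'" "!!t. t \<in> {0..T} ==> N ((grad_l2norm (u t))^2) = M ((grad_l2norm (u t))^2)"
 shows "kirchhoff_solution M s T u u'"
 using assms unfolding kirchhoff_solution_def by auto

lemma sobolev_weighted:
 assumes "f \<in> sobolev \<sigma>" "0 <= s" "s <= \<sigma>"
 shows "L2 (%\<xi>. cor (norm \<xi> powr s) * fourier f \<xi>)"
 by (rule weight_dominated(1)[OF conjunct2[OF assms(1)[unfolded sobolev_iff]]])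
  (simp_all add: norm_powr_le_bracket[OF assms(2,3)])

lemma kirchhoff_solution_grad:
 assumes u: "kirchhoff_solution N s T u u'" and s: "0 <= s" and t: "t \<in> {0..T}"
 shows "(grad_l2norm (u t))^2 = dirichlet (fourier (u t))"
 using sobolev_weighted[OF kirchhoff_solution_L2(3)[OF u t], of 1] s
 by (intro grad_l2norm_eq_dirichlet kirchhoff_solution_L2(1)[OF u t]) simp

lemma dirichlet_cong_AE:
 assumes "AE \<xi> in lborel. f \<xi> = g \<xi>" and [measurable]: "f \<in> borel_measurable borel" "g \<in> borel_measurable borel"
 shows "dirichlet f = dirichlet g"
 unfolding dirichlet_def by (rule integral_cong_AE) (use assms(1) in auto)

lemma hdot_pair_norm_mono:
 assumes u: "u0 \<in> sobolev (s0 + 1)" "u1 \<in> sobolev s0" and v: "L2 v0" "L2 v1"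
  and le: "AE \<xi> in lborel. cmod (fourier v0 \<xi>) <= cmod (fourier u0 \<xi>)" "AE \<xi> in lborel. cmod (fourier v1 \<xi>) <= cmod (fourier u1 \<xi>)"
  and s: "0 <= s" "s <= s0"
 shows "hdot_pair_norm s v0 v1 <= hdot_pair_norm s u0 u1"
proof -
 note [measurable] = L2D(1)[OF L2_fourier[OF v(1)]] L2D(1)[OF L2_fourier[OF v(2)]]
 have "hdot_norm (1 + s) v0 <= hdot_norm (1 + s) u0"
  unfolding hdot_norm_def
  by (rule l2norm_mono[OF sobolev_weighted[OF u(1)]]) (use le(1) s in \<open>auto simp: norm_mult intro!: mult_left_mono elim!: eventually_mono\<close>)
 moreover have "hdot_norm s v1 <= hdot_norm s u1"
  unfolding hdot_norm_def
  by (rule l2norm_mono[OF sobolev_weighted[OF u(2)]]) (use le(2) s in \<open>auto simp: norm_mult intro!: mult_left_mono elim!: eventually_mono\<close>)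
 ultimately show ?thesis
  unfolding hdot_pair_norm_def by (intro real_sqrt_le_mono add_mono power_mono) auto
qed

locale kirchhoff_regime =
 fixes X :: "'a::euclidean_space itself" and N N' :: "real => real" and s0 \<delta>1 \<delta>s C1 C0 m \<Lambda> e T \<rho> :: real
 assumes dN: "!!y. 0 <= y ==> (N has_real_derivative N' y) (at y within {0..})"
  and dN_le: "!!y. 0 <= y ==> y <= m^2 ==> \<bar>N' y\<bar> <= \<Lambda>" and N_le: "!!y. 0 <= y ==> y <= m^2 ==> \<bar>N y\<bar> <= 1/2"
  and s0: "1/2 <= s0" and m: "0 < m" "m <= \<delta>1" "m <= \<delta>s"
  and c1: "energy_control TYPE('a) N (1/2) \<delta>1 C1" and c0: "energy_control TYPE('a) N s0 \<delta>s C0"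
  and T0: "0 < T" and Te: "T <= 1 / (4 * C1 * (C1 + 1)^2) * (1 / e ^ 4)" and e: "0 < e"
  and \<rho>: "(2 * (C1 + 1) * e) ^ 4 * T <= \<rho>"
begin

definition Bc :: real where "Bc = C0 * exp (C0 ^ 3 * \<rho>)"

lemma N_continuous: "continuous_on {0..} N"
 by (rule DERIV_continuous_on[OF dN]) simp

lemma Bc_pos: "0 < Bc"
 using c0 by (auto simp: Bc_def energy_control_def)

lemma \<Lambda>_nonneg: "0 <= \<Lambda>"
 using dN_le[of 0] by simp

lemma N_lipschitz:
 assumes "0 <= x" "x <= m^2" "0 <= y" "y <= m^2"
 shows "\<bar>N x - N y\<bar> <= \<Lambda> * \<bar>x - y\<bar>"
proof -
 have "norm (N x - N y) <= \<Lambda> * norm (x - y)"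
 proof (rule field_differentiable_bound[of "{0..m^2}" N N'])
  fix z assume "z \<in> {0..m^2}"
  then show "(N has_real_derivative N' z) (at z within {0..m^2})" "norm (N' z) <= \<Lambda>"
   using dN_le DERIV_subset[OF dN, of z "{0..m^2}"] by auto
 qed (use assms in auto)
 then show ?thesis by simp
qed

text \<open>
  Below the level \<open>m\<close> the argument of the nonlinearity stays in \<open>[0, m\<^sup>2]\<close>, where \<open>Nt\<close> and \<open>N\<close> agree. So the
  energies, which are attached to \<open>N\<close>, also control solutions for a modified nonlinearity.
\<close>

lemma controlled_by_data:
 fixes u u' :: "real => 'a => complex"
 assumes u: "kirchhoff_solution Nt s0 T u u'" and Nt: "!!y. 0 <= y ==> y <= m^2 ==> Nt y = N y"
  and T': "0 < T'" "T' <= T" and sm: "!!t. t \<in> {0..T'} ==> hdot1_l2_norm (u t) (u' t) <= m"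
  and i: "hdot_pair_norm (1/4) (u 0) (u' 0) <= e"
 shows "kirchhoff_solution N s0 T' u u'"
  "t \<in> {0..T'} ==> hdot_pair_norm (1/4) (u t) (u' t) <= 2 * (C1 + 1) * e"
  "t \<in> {0..T'} ==> s \<in> {0..s0} ==> hdot_pair_norm s (u t) (u' t) <= Bc * hdot_pair_norm s (u 0) (u' 0)"
proof -
 have u1: "kirchhoff_solution Nt s0 T' u u'" by (rule kirchhoff_solution_mono[OF u order_refl T'(2)])
 show uN: "kirchhoff_solution N s0 T' u u'"
 proof (rule kirchhoff_solution_cong[OF u1])
  fix t assume t: "t \<in> {0..T'}"
  have "dirichlet (fourier (u t)) <= m^2"
   using dirichlet_le_hdot1[of "u t" "u' t"] power_mono[OF sm[OF t], of 2] by (simp add: hdot1_l2_norm_def)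
  then show "Nt ((grad_l2norm (u t))^2) = N ((grad_l2norm (u t))^2)"
   using kirchhoff_solution_grad[OF u1 _ t] s0 dirichlet_nonneg by (intro Nt) auto
 qed
 have T1: "T' <= 1 / (4 * C1 * (C1 + 1)^2) * (1 / e ^ 4)" using T' Te by linarith
 have q: "hdot_pair_norm (1/4) (u t) (u' t) <= 2 * (C1 + 1) * e" if "t \<in> {0..T'}" for t
  by (rule quarter_bound[OF c1 _ kirchhoff_solution_mono[OF uN s0 order_refl] T'(1) T1 e _ i that]) (use sm m in force)+
 then show "t \<in> {0..T'} ==> hdot_pair_norm (1/4) (u t) (u' t) <= 2 * (C1 + 1) * e" .
 have r: "(2 * (C1 + 1) * e) ^ 4 * T' <= \<rho>"
  using \<rho> mult_left_mono[OF T'(2), of "(2 * (C1 + 1) * e) ^ 4"] by simp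
 show "t \<in> {0..T'} ==> s \<in> {0..s0} ==> hdot_pair_norm s (u t) (u' t) <= Bc * hdot_pair_norm s (u 0) (u' 0)"
  unfolding Bc_def by (rule all_orders_bound[OF c0 _ uN T'(1) _ q r]) (use s0 sm m in force)+
qed

lemma bounds_persist:
 fixes u u' :: "real => 'a => complex"
 assumes u: "kirchhoff_solution Nt s0 T u u'" and Nt: "!!y. 0 <= y ==> y <= m^2 ==> Nt y = N y" and cNt: "continuous_on {0..} Nt"
  and i: "hdot_pair_norm (1/4) (u 0) (u' 0) <= e" "hdot1_l2_norm (u 0) (u' 0) <= m / 2" "Bc * hdot1_l2_norm (u 0) (u' 0) <= m / 2"
  and t: "t \<in> {0..T}"
 shows "hdot1_l2_norm (u t) (u' t) <= m / 2"
proof (rule bootstrap[OF hdot1_l2_continuous[OF cNt _ u] m(1) i(2) _ t])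
 show "0 <= s0" using s0 by simp
 fix T' t assume T': "0 < T'" "T' <= T" and sm: "!!t. t \<in> {0..T'} ==> hdot1_l2_norm (u t) (u' t) <= m" and t: "t \<in> {0..T'}"
 have q: "L2 (u' t)" "L2 (u' 0)" using kirchhoff_solution_L2(2)[OF u] T' t by auto
 have "hdot_pair_norm 0 (u t) (u' t) <= Bc * hdot_pair_norm 0 (u 0) (u' 0)"
  using controlled_by_data(3)[OF u Nt T' sm i(1) t, of 0] s0 by simp
 then show "hdot1_l2_norm (u t) (u' t) <= m / 2"
  using i(3) by (simp add: hdot1_l2_eq_hdot_pair q)
qed

text \<open>
  The chain rule; the derivative of the Dirichlet integral is bounded by the squared norm of order \<open>1/2\<close>.
\<close>

lemma coefficient_admissible:
 fixes u u' :: "real => 'a => complex"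
 assumes u: "kirchhoff_solution N s0 T u u'"
  and sm: "!!t. t \<in> {0..T} ==> hdot1_l2_norm (u t) (u' t) <= m" and H: "!!t. t \<in> {0..T} ==> hdot_pair_norm (1/2) (u t) (u' t) <= H"
 shows "admissible (\<Lambda> * H^2) T (%t. 1 + N (dirichlet (fourier (u t))))"
proof -
 let ?y = "%t. dirichlet (fourier (u t))"
 have s: "0 <= s0" using s0 by simp
 have y: "0 <= ?y t \<and> ?y t <= m^2" if t: "t \<in> {0..T}" for t
  using dirichlet_le_hdot1[of "u t" "u' t"] power_mono[OF sm[OF t], of 2] by (simp add: hdot1_l2_norm_def dirichlet_nonneg)
 have "\<exists>D. (?y has_real_derivative D) (at t within {0..T}) \<and> \<bar>D\<bar> <= H^2" if t: "t \<in> {0..T}" for t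
 proof -
  have "(hdot_pair_norm (1/2) (u t) (u' t))^2 <= H^2" by (intro power_mono H t) simp
  then show ?thesis using dirichlet_has_derivative[OF kirchhoff_spectral[OF N_continuous s u] s0 t]
   by (auto simp: hdot_pair_norm_power2 hdot_norm_def)
 qed
 then obtain D where D: "!!t. t \<in> {0..T} ==> (?y has_real_derivative D t) (at t within {0..T}) \<and> \<bar>D t\<bar> <= H^2" by metis
 show ?thesis
  unfolding admissible_def
 proof (intro exI[of _ "%t. N' (?y t) * D t"] ballI conjI)
  fix t assume t: "t \<in> {0..T}"
  have "((N \<circ> ?y) has_real_derivative N' (?y t) * D t) (at t within {0..T})"
   by (rule DERIV_image_chain[OF DERIV_subset[OF dN] conjunct1[OF D[OF t]]]) (use y[OF t] dirichlet_nonneg in auto)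
  then show "((%t. 1 + N (?y t)) has_real_derivative N' (?y t) * D t) (at t within {0..T})"
   by (auto intro!: derivative_eq_intros simp: o_def)
  show "\<bar>N' (?y t) * D t\<bar> <= \<Lambda> * H^2" unfolding abs_mult using D[OF t] dN_le y[OF t] \<Lambda>_nonneg by (intro mult_mono) auto
  show "1/2 <= 1 + N (?y t)" "1 + N (?y t) <= 3/2" using N_le[of "?y t"] y[OF t] by linarith+
 qed
qed

end

locale kirchhoff_data = kirchhoff_regime X N N' s0 \<delta>1 \<delta>s C1 C0 m \<Lambda> e T \<rho>
 for X :: "'a::euclidean_space itself" and N N' s0 \<delta>1 \<delta>s C1 C0 m \<Lambda> e T \<rho> +
 fixes u0 u1 :: "'a => complex"
 assumes u0: "u0 \<in> sobolev (s0 + 1)" and u1: "u1 \<in> sobolev s0"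
  and i: "hdot_pair_norm (1/4) u0 u1 <= e" "hdot1_l2_norm u0 u1 <= m / 2" "Bc * hdot1_l2_norm u0 u1 <= m / 2"
begin

definition L :: real where "L = \<Lambda> * (Bc * hdot_pair_norm (1/2) u0 u1)^2"

text \<open>
  The hypothesis on the data is an inequality, so that it applies both to the data and to their truncations.
\<close>

lemma solution_facts:
 fixes u u' :: "real => 'a => complex"
 assumes u: "kirchhoff_solution Nt s0 T u u'" and Nt: "!!y. 0 <= y ==> y <= m^2 ==> Nt y = N y" and cNt: "continuous_on {0..} Nt"
  and le: "AE \<xi> in lborel. cmod (fourier (u 0) \<xi>) <= cmod (fourier u0 \<xi>)" "AE \<xi> in lborel. cmod (fourier (u' 0) \<xi>) <= cmod (fourier u1 \<xi>)"
 shows "kirchhoff_solution N s0 T u u'"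
  "t \<in> {0..T} ==> hdot1_l2_norm (u t) (u' t) <= m"
  "t \<in> {0..T} ==> dirichlet (fourier (u t)) <= m^2"
  "t \<in> {0..T} ==> hdot_pair_norm (1/4) (u t) (u' t) <= 2 * (C1 + 1) * e"
  "t \<in> {0..T} ==> s \<in> {0..s0} ==> hdot_pair_norm s (u t) (u' t) <= Bc * hdot_pair_norm s u0 u1"
  "admissible L T (%t. 1 + N (dirichlet (fourier (u t))))"
proof -
 have zT: "0 \<in> {0..T}" using T0 by simp
 note q = kirchhoff_solution_L2[OF u zT]
 have mono: "hdot_pair_norm s (u 0) (u' 0) <= hdot_pair_norm s u0 u1" if "s \<in> {0..s0}" for s
  by (rule hdot_pair_norm_mono[OF u0 u1 q(1,2) le]) (use that in auto)
 have h1: "hdot1_l2_norm (u 0) (u' 0) <= hdot1_l2_norm u0 u1"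
  using mono[of 0] s0 u1 by (simp add: hdot1_l2_eq_hdot_pair q sobolev_iff)
 have i0: "hdot_pair_norm (1/4) (u 0) (u' 0) <= e" using mono[of "1/4"] s0 i(1) by simp
 have "Bc * hdot1_l2_norm (u 0) (u' 0) <= Bc * hdot1_l2_norm u0 u1" using h1 Bc_pos by simp
 then have sm: "hdot1_l2_norm (u t) (u' t) <= m" if "t \<in> {0..T}" for t
  using bounds_persist[OF u Nt cNt i0 _ _ that] h1 i(2,3) m(1) by force
 note C = controlled_by_data[OF u Nt T0 order_refl sm i0]
 have C3: "hdot_pair_norm s (u t) (u' t) <= Bc * hdot_pair_norm s (u 0) (u' 0)" if "t \<in> {0..T}" "s \<in> {0..s0}" for s t
  by (rule C(3)) (use that in auto)
 show uN: "kirchhoff_solution N s0 T u u'" by (rule C(1))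
 show "t \<in> {0..T} ==> hdot1_l2_norm (u t) (u' t) <= m" by (rule sm)
 show "t \<in> {0..T} ==> dirichlet (fourier (u t)) <= m^2"
  using dirichlet_le_hdot1[of "u t" "u' t"] power_mono[OF sm, of t 2] by (simp add: hdot1_l2_norm_def)
 show "t \<in> {0..T} ==> hdot_pair_norm (1/4) (u t) (u' t) <= 2 * (C1 + 1) * e" by (rule C(2))
 have B: "hdot_pair_norm s (u t) (u' t) <= Bc * hdot_pair_norm s u0 u1" if "t \<in> {0..T}" "s \<in> {0..s0}" for s t
  using C3[OF that] mult_left_mono[OF mono[OF that(2)], of Bc] Bc_pos by linarith
 then show "t \<in> {0..T} ==> s \<in> {0..s0} ==> hdot_pair_norm s (u t) (u' t) <= Bc * hdot_pair_norm s u0 u1" .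
 show "admissible L T (%t. 1 + N (dirichlet (fourier (u t))))"
  unfolding L_def by (rule coefficient_admissible[OF uN sm B]) (use s0 in auto)
qed

end

section \<open>Existence and uniqueness for small data\<close>

lemma powr_power2: "0 <= x ==> (x powr s)^2 = x powr (2 * s)" for x :: real
 by (simp add: power2_eq_square powr_add[symmetric])

lemma bracket_add: "bracket (\<sigma> + \<tau>) \<xi> = bracket \<sigma> \<xi> * bracket \<tau> \<xi>"
 unfolding bracket_def by (simp add: add_divide_distrib powr_add)

lemma norm_le_bracket_1: "norm \<xi> <= cmod (bracket 1 \<xi>)" and bracket_1_le: "cmod (bracket 1 \<xi>) <= 1 + norm \<xi>"
 by (auto simp: cmod_bracket powr_half_sqrt add_nonneg_nonneg power2_sum intro: real_le_rsqrt real_le_lsqrt)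

text \<open>
  The energy estimate for the difference; the error is uniform in time but not in frequency.
\<close>

lemma flow_tendsto:
 assumes b: "!!j. admissible L T (b j)" and a: "continuous_on {0..T} a" and le: "!!j t. t \<in> {0..T} ==> \<bar>b j t - a t\<bar> <= \<sigma> j"
  and \<sigma>: "\<sigma> \<longlonglongrightarrow> 0" and t: "t \<in> {0..T}" and k: "0 <= k"
 shows "(%j. flow_deriv (b j) t z w (k^2)) \<longlonglongrightarrow> flow_deriv a t z w (k^2)"
  "(%j. k * cmod (flow (b j) t z w (k^2))) \<longlonglongrightarrow> k * cmod (flow a t z w (k^2))"
proof -
 have T: "0 <= T" using t by auto
 have cV: "continuous_on {0..T} (%t. flow a t z w (k^2))"
  using has_vector_derivative_continuous[OF flow_has_derivative(1)[OF a T]] by (auto simp: continuous_on_eq_continuous_within)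
 have "bounded ((%t. flow a t z w (k^2)) ` {0..T})"
  by (intro compact_imp_bounded compact_continuous_image cV) simp
 then obtain B where B: "!!t. t \<in> {0..T} ==> cmod (flow a t z w (k^2)) <= B"
  unfolding bounded_iff by blast
 define K where "K = 3 * exp ((2 * L + 1) * T) * ((k^2 * B)^2 * t)"
 let ?P = "%j. cmod (flow_deriv (b j) t z w (k^2) - flow_deriv a t z w (k^2))"
 let ?V = "%j. k * cmod (flow (b j) t z w (k^2) - flow a t z w (k^2))"
 have main: "(?P j)^2 + (?V j)^2 <= K * (\<sigma> j)^2" for j
 proof -
  from b[of j] obtain a' where a': "!!t. t \<in> {0..T} ==> (b j has_real_derivative a' t) (at t within {0..T})"
   "!!t. t \<in> {0..T} ==> \<bar>a' t\<bar> <= L" "!!t. t \<in> {0..T} ==> 1/2 <= b j t \<and> b j t <= 3/2"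
   unfolding admissible_def by blast
  have c: "continuous_on {0..T} (%\<tau>. (\<bar>b j \<tau> - a \<tau>\<bar> * k^2 * cmod (flow a \<tau> z w (k^2)))^2)"
   by (intro continuous_intros admissible_continuous[OF b] a cV)
  have "integral {0..t} (%\<tau>. (\<bar>b j \<tau> - a \<tau>\<bar> * k^2 * cmod (flow a \<tau> z w (k^2)))^2) <= integral {0..t} (%\<tau>. (\<sigma> j * k^2 * B)^2)"
  proof (intro integral_le integrable_continuous_interval)
   show "continuous_on {0..t} (%\<tau>. (\<bar>b j \<tau> - a \<tau>\<bar> * k^2 * cmod (flow a \<tau> z w (k^2)))^2)"
    by (rule continuous_on_subset[OF c]) (use t in auto)
   fix \<tau> assume "\<tau> \<in> {0..t}"
   then have \<tau>: "\<tau> \<in> {0..T}" using t by auto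
   have "0 <= \<sigma> j" using le[OF \<tau>, of j] abs_ge_zero order_trans by blast
   then show "(\<bar>b j \<tau> - a \<tau>\<bar> * k^2 * cmod (flow a \<tau> z w (k^2)))^2 <= (\<sigma> j * k^2 * B)^2"
    using le[OF \<tau>] B[OF \<tau>] k by (intro power_mono mult_mono) auto
  qed simp
  also have "\<dots> = (\<sigma> j * k^2 * B)^2 * t" using t by simp
  finally have "3 * exp ((2 * L + 1) * T) * integral {0..t} (%\<tau>. (\<bar>b j \<tau> - a \<tau>\<bar> * k^2 * cmod (flow a \<tau> z w (k^2)))^2)
   <= 3 * exp ((2 * L + 1) * T) * ((\<sigma> j * k^2 * B)^2 * t)" by (intro mult_left_mono) auto
  also have "\<dots> = K * (\<sigma> j)^2" by (simp add: K_def power_mult_distrib)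
  finally show ?thesis
   using flow_stability[OF a' a zero_le_power2 t, of z w k] unfolding power_mult_distrib[of k "cmod _"] by linarith
 qed
 have lim: "(%j. sqrt (K * (\<sigma> j)^2)) \<longlonglongrightarrow> 0"
  using tendsto_real_sqrt[OF tendsto_mult_left[OF tendsto_power[OF \<sigma>, of 2], of K]] by simp
 have "?P j <= sqrt (K * (\<sigma> j)^2)" "?V j <= sqrt (K * (\<sigma> j)^2)" for j
  using main[of j] zero_le_power2[of "?P j"] zero_le_power2[of "?V j"] by (intro real_le_rsqrt; linarith)+
 note le2 = this
 have "(%j. flow_deriv (b j) t z w (k^2) - flow_deriv a t z w (k^2)) \<longlonglongrightarrow> 0"
  by (rule Lim_null_comparison[OF _ lim]) (use le2(1) in auto)
 then show "(%j. flow_deriv (b j) t z w (k^2)) \<longlonglongrightarrow> flow_deriv a t z w (k^2)" by (simp add: LIM_zero_iff)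
 have "(%j. k * cmod (flow (b j) t z w (k^2)) - k * cmod (flow a t z w (k^2))) \<longlonglongrightarrow> 0"
 proof (rule Lim_null_comparison[OF _ lim], intro always_eventually allI)
  fix j
  have "norm (k * cmod (flow (b j) t z w (k^2)) - k * cmod (flow a t z w (k^2))) = k * \<bar>cmod (flow (b j) t z w (k^2)) - cmod (flow a t z w (k^2))\<bar>"
   using k by (simp add: right_diff_distrib[symmetric] abs_mult)
  also have "\<dots> <= ?V j" by (intro mult_left_mono norm_triangle_ineq3 k)
  finally show "norm (k * cmod (flow (b j) t z w (k^2)) - k * cmod (flow a t z w (k^2))) <= sqrt (K * (\<sigma> j)^2)" using le2(2)[of j] by linarith
 qed
 then show "(%j. k * cmod (flow (b j) t z w (k^2))) \<longlonglongrightarrow> k * cmod (flow a t z w (k^2))" by (simp add: LIM_zero_iff)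
qed

context kirchhoff_data begin

definition W :: "(real => real) => real => 'a => complex" where
 "W a t \<xi> = flow a t (fourier u0 \<xi>) (fourier u1 \<xi>) ((norm \<xi>)^2)"

definition P :: "(real => real) => real => 'a => complex" where
 "P a t \<xi> = flow_deriv a t (fourier u0 \<xi>) (fourier u1 \<xi>) ((norm \<xi>)^2)"

definition d :: "'a => real" where "d = density (fourier u0) (fourier u1)"

definition G :: real where "G = growth L T"

lemma data: "L2 u0" "L2 u1" "L2 (fourier u0)" "L2 (fourier u1)"
 "L2 (%\<xi>. bracket (s0 + 1) \<xi> * fourier u0 \<xi>)" "L2 (%\<xi>. bracket s0 \<xi> * fourier u1 \<xi>)"
 using u0 u1 by (auto simp: sobolev_iff L2_fourier)

lemma measurable_data [measurable]: "fourier u0 \<in> borel_measurable borel" "fourier u1 \<in> borel_measurable borel"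
 using data L2D(1) by auto

lemma measurable_Wd [measurable]: "W a t \<in> borel_measurable borel" "P a t \<in> borel_measurable borel" "d \<in> borel_measurable borel"
 unfolding W_def[abs_def] P_def[abs_def] d_def by (intro measurable_flow measurable_density; measurable)+

lemma G_nonneg [simp]: "0 <= G" and d_nonneg [simp]: "0 <= d \<xi>"
 by (simp_all add: G_def d_def)

lemma density_integrable: "integrable lborel (%\<xi>. (d \<xi>)^2)" "integrable lborel (%\<xi>. norm \<xi> * (d \<xi>)^2)"
 and L2_bracket_density: "L2 (%\<xi>. bracket s0 \<xi> * cor (d \<xi>))"
proof -
 have i: "integrable lborel (%\<xi>. (norm \<xi> powr \<sigma>)^2 * (cmod (fourier u0 \<xi>))^2)" if "0 <= \<sigma>" "\<sigma> <= s0 + 1" for \<sigma>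
  using L2D(2)[OF sobolev_weighted[OF u0 that]] by (simp add: norm_mult power_mult_distrib)
 have i': "integrable lborel (%\<xi>. (norm \<xi> powr \<sigma>)^2 * (cmod (fourier u1 \<xi>))^2)" if "0 <= \<sigma>" "\<sigma> <= s0" for \<sigma>
  using L2D(2)[OF sobolev_weighted[OF u1 that]] by (simp add: norm_mult power_mult_distrib)
 show "integrable lborel (%\<xi>. (d \<xi>)^2)"
  using Bochner_Integration.integrable_add[OF L2D(2)[OF data(4)] i[of 1]] s0
  by (simp add: d_def density_power2 power_mult_distrib)
 have e: "norm \<xi> * (norm \<xi>)^2 = (norm \<xi>) ^ 3" for \<xi> :: 'a by (simp add: power2_eq_square power3_eq_cube)
 show "integrable lborel (%\<xi>. norm \<xi> * (d \<xi>)^2)"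
  using Bochner_Integration.integrable_add[OF i'[of "1/2"] i[of "3/2"]] s0
  by (simp add: d_def density_power2 power_mult_distrib powr_power2 distrib_left e mult.assoc[symmetric])
 have "integrable lborel (%\<xi>. (cmod (bracket s0 \<xi> * fourier u1 \<xi>))^2 + (cmod (bracket (s0 + 1) \<xi> * fourier u0 \<xi>))^2)"
  by (intro Bochner_Integration.integrable_add L2D(2) data)
 then have "integrable lborel (%\<xi>. (cmod (bracket s0 \<xi> * cor (d \<xi>)))^2)"
 proof (rule Bochner_Integration.integrable_bound)
  show "AE \<xi> in lborel. norm ((cmod (bracket s0 \<xi> * cor (d \<xi>)))^2) <= norm ((cmod (bracket s0 \<xi> * fourier u1 \<xi>))^2 + (cmod (bracket (s0 + 1) \<xi> * fourier u0 \<xi>))^2)"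
  proof (intro always_eventually allI)
   fix \<xi>
   have "(cmod (bracket s0 \<xi>) * norm \<xi> * cmod (fourier u0 \<xi>))^2 <= (cmod (bracket s0 \<xi>) * cmod (bracket 1 \<xi>) * cmod (fourier u0 \<xi>))^2"
    by (intro power_mono mult_mono norm_le_bracket_1) auto
   then show "norm ((cmod (bracket s0 \<xi> * cor (d \<xi>)))^2) <= norm ((cmod (bracket s0 \<xi> * fourier u1 \<xi>))^2 + (cmod (bracket (s0 + 1) \<xi> * fourier u0 \<xi>))^2)"
    by (simp add: norm_mult bracket_add power_mult_distrib d_def density_power2 distrib_left mult.assoc)
  qed
 qed measurable
 then show "L2 (%\<xi>. bracket s0 \<xi> * cor (d \<xi>))" by (simp add: square_integrable_def)
qed

definition trunc :: "nat => ('a => complex) => 'a => complex" where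
 "trunc j f \<xi> = indicator (cball 0 (real j)) \<xi> *\<^sub>R f \<xi>"

lemma trunc_flow:
 "flow a t (trunc j (fourier u0) \<xi>) (trunc j (fourier u1) \<xi>) ((norm \<xi>)^2) = trunc j (W a t) \<xi>"
 "flow_deriv a t (trunc j (fourier u0) \<xi>) (trunc j (fourier u1) \<xi>) ((norm \<xi>)^2) = trunc j (P a t) \<xi>"
 by (simp_all add: trunc_def W_def P_def flow_def flow_deriv_def indicator_def)

lemma trunc_band_limited: "L2 f ==> band_limited (real j) (trunc j f)"
 unfolding band_limited_def trunc_def by (auto intro: L2_indicator)

lemma measurable_trunc [measurable]: "f \<in> borel_measurable borel ==> trunc j f \<in> borel_measurable borel"
 unfolding trunc_def[abs_def] by measurable

lemma cmod_trunc: "cmod (trunc j f \<xi>) <= cmod (f \<xi>)"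
 by (simp add: trunc_def indicator_def)

text \<open>
  For truncated data the coefficient is found by contraction for a nonlinearity that is frozen above
  \<open>m\<^sup>2\<close>; the a priori bound shows that the frozen range is never entered.
\<close>

lemma truncated_solution:
 "\<exists>a. admissible L T a \<and> (\<forall>t\<in>{0..T}. dirichlet (trunc j (W a t)) <= m^2 \<and> a t = 1 + N (dirichlet (trunc j (W a t))))"
proof -
 define Nt where "Nt y = N (min y (m^2))" for y
 have Tn: "0 <= T" using T0 by simp
 note b0 = trunc_band_limited[OF data(3), of j] and b1 = trunc_band_limited[OF data(4), of j]
 have Nb: "\<bar>Nt y\<bar> <= 1/2" if "0 <= y" for y unfolding Nt_def using that by (intro N_le) auto
 have NL: "\<bar>Nt x - Nt y\<bar> <= \<Lambda> * \<bar>x - y\<bar>" if "0 <= x" "0 <= y" for x y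
 proof -
  have "\<bar>Nt x - Nt y\<bar> <= \<Lambda> * \<bar>min x (m^2) - min y (m^2)\<bar>" unfolding Nt_def using that by (intro N_lipschitz) auto
  also have "\<dots> <= \<Lambda> * \<bar>x - y\<bar>" by (intro mult_left_mono \<Lambda>_nonneg) (auto simp: min_def)
  finally show ?thesis .
 qed
 have cNt: "continuous_on {0..} Nt"
  unfolding Nt_def by (rule continuous_on_compose2[OF N_continuous]) (auto intro!: continuous_intros)
 obtain a where a: "continuous_on {0..T} a" and aeq: "!!t. t \<in> {0..T} ==> a t = 1 + Nt (dirichlet (trunc j (W a t)))"
  using truncated_coefficient[OF b0 b1 _ Tn Nb NL] unfolding trunc_flow by auto
 obtain C where C: "0 <= C" "!!t r z w. t \<in> {0..T} ==> 0 <= r ==> r <= (real j)^2 ==>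
  cmod (flow a t z w r) <= C * (cmod z + cmod w) \<and> cmod (flow_deriv a t z w r) <= C * (cmod z + cmod w)"
  using flow_bound[OF a Tn] by blast
 define D where "D \<xi> = cor (C * (cmod (trunc j (fourier u0) \<xi>) + cmod (trunc j (fourier u1) \<xi>)))" for \<xi>
 have "L2 (%\<xi>. cor C * (cor (cmod (trunc j (fourier u0) \<xi>)) + cor (cmod (trunc j (fourier u1) \<xi>))))"
  using b0 b1 by (intro L2_cmult L2_add L2_cmod) (auto simp: band_limited_def)
 moreover have "D \<xi> = 0" if "norm \<xi> > real j" for \<xi> using that by (simp add: D_def trunc_def)
 ultimately have bD: "band_limited (real j) D" unfolding band_limited_def D_def[abs_def] by simp
 have cb: "continuous_on UNIV (bracket \<sigma> :: 'a => complex)" for \<sigma>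
 proof -
  have p: "1 + (norm x)^2 \<noteq> 0" for x :: 'a using zero_le_power2[of "norm x"] by linarith
  show ?thesis unfolding bracket_def[abs_def] by (intro continuous_intros) (use p in auto)
 qed
 have sD: "L2 (%\<xi>. bracket \<sigma> \<xi> * D \<xi>)" for \<sigma>
  using band_limited_mult[OF bD cb] by (simp add: band_limited_def)
 have le: "cmod (trunc j (W a t) \<xi>) <= cmod (D \<xi>) \<and> cmod (trunc j (P a t) \<xi>) <= cmod (D \<xi>)" if t: "t \<in> {0..T}" for t \<xi>
 proof (cases "norm \<xi> <= real j")
  case True
  then show ?thesis
   using C(2)[OF t zero_le_power2 power_mono[OF True, of 2], of "fourier u0 \<xi>" "fourier u1 \<xi>"] C(1)
   by (simp add: D_def trunc_def W_def P_def del: of_real_add of_real_mult)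
 qed (simp add: trunc_def)
 define u where "u t = inverse_fourier (trunc j (W a t))" for t
 define u' where "u' t = inverse_fourier (trunc j (P a t))" for t
 have u: "kirchhoff_solution Nt s0 T u u'"
  using kirchhoff_solution_of_flow[where N=Nt and DV=D and DP=D, OF _ Tn a measurable_trunc[OF measurable_data(1), of j] measurable_trunc[OF measurable_data(2), of j] sD sD]
   le aeq s0 unfolding trunc_flow u_def u'_def by auto
 have sq: "L2 (trunc j (W a t))" "L2 (trunc j (P a t))" if t: "t \<in> {0..T}" for t
  by (rule L2_bound[where C=1, of D]; use bD le[OF t] in \<open>simp add: band_limited_def\<close>)+
 have fu: "AE \<xi> in lborel. fourier (u t) \<xi> = trunc j (W a t) \<xi>" "AE \<xi> in lborel. fourier (u' t) \<xi> = trunc j (P a t) \<xi>" if t: "t \<in> {0..T}" for t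
  unfolding u_def u'_def by (intro fourier_inverse_fourier sq[OF t])+
 have zT: "0 \<in> {0..T}" using Tn by simp
 have z: "W a 0 \<xi> = fourier u0 \<xi>" "P a 0 \<xi> = fourier u1 \<xi>" for \<xi>
  unfolding W_def P_def by (rule flow_has_derivative(3,4)[OF a Tn zT])+
 have ae: "AE \<xi> in lborel. cmod (fourier (u 0) \<xi>) <= cmod (fourier u0 \<xi>)" "AE \<xi> in lborel. cmod (fourier (u' 0) \<xi>) <= cmod (fourier u1 \<xi>)"
  using fu[OF zT] by (eventually_elim; metis z cmod_trunc)+
 have dir: "dirichlet (fourier (u t)) = dirichlet (trunc j (W a t))" if t: "t \<in> {0..T}" for t
  by (rule dirichlet_cong_AE[OF fu(1)[OF t] L2D(1)[OF L2_fourier]])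
   (use kirchhoff_solution_L2(1)[OF u t] in auto)
 have small: "dirichlet (trunc j (W a t)) <= m^2" if t: "t \<in> {0..T}" for t
  using solution_facts(3)[OF u _ cNt ae t] by (simp add: dir[OF t] Nt_def)
 have eq: "a t = 1 + N (dirichlet (trunc j (W a t)))" if t: "t \<in> {0..T}" for t
  using aeq[OF t] small[OF t] by (simp add: Nt_def)
 have adm: "admissible L T (%t. 1 + N (dirichlet (fourier (u t))))"
  by (rule solution_facts(6)[OF u _ cNt ae]) (simp add: Nt_def)
 have "admissible L T a"
  by (rule admissible_cong[OF adm]) (simp add: dir eq[symmetric])
 then show ?thesis using small eq by blast
qed

definition tail :: "nat => real" where
 "tail j = G^2 * (LINT \<xi>|lborel. indicator (- cball 0 (real j)) \<xi> * (d \<xi>)^2)"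

lemma tail_nonneg: "0 <= tail j"
 by (simp add: tail_def)

lemma tail_tendsto: "tail \<longlonglongrightarrow> 0"
proof -
 have "(%j. LINT \<xi>|lborel. indicator (- cball 0 (real j)) \<xi> * (d \<xi>)^2) \<longlonglongrightarrow> (LINT \<xi>|(lborel :: 'a measure). (0::real))"
 proof (rule integral_dominated_convergence[where w="%\<xi>. (d \<xi>)^2"])
  show "AE \<xi> in lborel. (%j. indicator (- cball 0 (real j)) \<xi> * (d \<xi>)^2) \<longlonglongrightarrow> 0"
  proof (rule always_eventually, rule allI, rule tendsto_eventually)
   fix \<xi> :: 'a
   obtain n where n: "norm \<xi> <= real n" using real_arch_simple by blast
   show "\<forall>\<^sub>F j in sequentially. indicator (- cball 0 (real j)) \<xi> * (d \<xi>)^2 = 0"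
    using eventually_ge_at_top[of n] by eventually_elim (use n in auto)
  qed
  show "AE \<xi> in lborel. norm (indicator (- cball 0 (real j)) \<xi> * (d \<xi>)^2) <= (d \<xi>)^2" for j
   by (auto simp: indicator_def)
 qed (use density_integrable(1) in measurable)
 from tendsto_mult_left[OF this, of "G^2"] show ?thesis by (simp add: tail_def[abs_def])
qed

lemma flow_energy_data:
 assumes "admissible L T a" "t \<in> {0..T}"
 shows "cmod (P a t \<xi>) <= G * d \<xi>" "norm \<xi> * cmod (W a t \<xi>) <= G * d \<xi>"
 using admissible_flow_energy(2,3)[OF assms] unfolding W_def P_def d_def G_def by auto

text \<open>
  Only frequencies beyond \<open>j\<close> are lost, and there the energy bound dominates by the tail of the data.
\<close>

lemma truncation_error:
 assumes a: "admissible L T a" and t: "t \<in> {0..T}"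
 shows "\<bar>dirichlet (trunc j (W a t)) - dirichlet (W a t)\<bar> <= tail j"
proof -
 have Gi: "integrable lborel (%\<xi>. G^2 * (d \<xi>)^2)" using density_integrable(1) by simp
 have le: "(norm \<xi>)^2 * (cmod (W a t \<xi>))^2 <= G^2 * (d \<xi>)^2" for \<xi>
  using power_mono[OF flow_energy_data(2)[OF a t], of \<xi> 2] by (simp add: power_mult_distrib)
 have le': "(norm \<xi>)^2 * (cmod (trunc j (W a t) \<xi>))^2 <= G^2 * (d \<xi>)^2" for \<xi>
  using le[of \<xi>] by (simp add: trunc_def indicator_def)
 have i: "integrable lborel (%\<xi>. (norm \<xi>)^2 * (cmod (W a t \<xi>))^2)"
  by (rule Bochner_Integration.integrable_bound[OF Gi]) (use le in auto)
 have i': "integrable lborel (%\<xi>. (norm \<xi>)^2 * (cmod (trunc j (W a t) \<xi>))^2)"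
  by (rule Bochner_Integration.integrable_bound[OF Gi]) (use le' in auto)
 have "\<bar>dirichlet (trunc j (W a t)) - dirichlet (W a t)\<bar> = \<bar>LINT \<xi>|lborel. (norm \<xi>)^2 * (cmod (trunc j (W a t) \<xi>))^2 - (norm \<xi>)\<^sup>2 * (cmod (W a t \<xi>))^2\<bar>"
  unfolding dirichlet_def using i i' by simp
 also have "\<dots> <= (LINT \<xi>|lborel. \<bar>(norm \<xi>)^2 * (cmod (trunc j (W a t) \<xi>))^2 - (norm \<xi>)\<^sup>2 * (cmod (W a t \<xi>))^2\<bar>)"
  by (rule integral_abs_bound)
 also have "\<dots> <= (LINT \<xi>|lborel. G^2 * (indicator (- cball 0 (real j)) \<xi> * (d \<xi>)^2))"
 proof (rule integral_mono)
  show "integrable lborel (%\<xi>. G^2 * (indicator (- cball 0 (real j)) \<xi> * (d \<xi>)^2))"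
   by (rule Bochner_Integration.integrable_bound[OF Gi]) (auto simp: indicator_def)
  show "\<bar>(norm \<xi>)^2 * (cmod (trunc j (W a t) \<xi>))^2 - (norm \<xi>)\<^sup>2 * (cmod (W a t \<xi>))^2\<bar> <= G^2 * (indicator (- cball 0 (real j)) \<xi> * (d \<xi>)^2)" for \<xi>
   using le[of \<xi>] by (simp add: trunc_def indicator_def)
 qed (use i i' in \<open>auto intro: Bochner_Integration.integrable_diff\<close>)
 also have "\<dots> = tail j" by (simp add: tail_def)
 finally show ?thesis .
qed

definition Kc :: real where
 "Kc = (let K = 2 * \<Lambda>^2 * (2 * growth L T ^ 3 * (LINT \<xi>|lborel. norm \<xi> * (d \<xi>)^2))^2 in 2 * \<Lambda>^2 * (1 + K * T * exp (K * T)))"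

lemma Kc_nonneg: "0 <= Kc"
 using T0 by (simp add: Kc_def Let_def)

lemma coefficient_comparison_data:
 assumes a: "admissible L T a" and b: "admissible L T b" and \<eta>: "0 <= \<eta>"
  and le: "!!t. t \<in> {0..T} ==> \<bar>a t - b t\<bar> <= \<Lambda> * (\<eta> + \<bar>dirichlet (W a t) - dirichlet (W b t)\<bar>)" and t: "t \<in> {0..T}"
 shows "\<bar>a t - b t\<bar> <= \<eta> * sqrt Kc"
proof -
 have "(a t - b t)^2 <= \<eta>^2 * Kc"
  unfolding Kc_def Let_def d_def
  by (rule coefficient_comparison[OF a b measurable_data density_integrable[unfolded d_def] \<Lambda>_nonneg \<eta> le[unfolded W_def[abs_def]] refl refl t])
 then have "\<bar>a t - b t\<bar>^2 <= (\<eta> * sqrt Kc)^2" using Kc_nonneg by (simp add: power_mult_distrib)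
 then show ?thesis by (rule power2_le_imp_le) (use \<eta> Kc_nonneg in simp)
qed

text \<open>
  The limit \<open>a\<close> is only known to be continuous, so the energy bound for its flow is not deduced from
  admissibility but inherited from the approximating flows, frequency by frequency.
\<close>

lemma coefficient_limit:
 "\<exists>a. continuous_on {0..T} a \<and> (\<forall>t\<in>{0..T}. a t = 1 + N (dirichlet (W a t)) \<and>
   (\<forall>\<xi>. cmod (P a t \<xi>) <= G * d \<xi> \<and> norm \<xi> * cmod (W a t \<xi>) <= G * d \<xi>))"
proof -
 obtain b where adm: "!!j. admissible L T (b j)" and small: "!!j t. t \<in> {0..T} ==> dirichlet (trunc j (W (b j) t)) <= m^2"
  and beq: "!!j t. t \<in> {0..T} ==> b j t = 1 + N (dirichlet (trunc j (W (b j) t)))"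
  using choice[OF allI, of "%j a. admissible L T a \<and> (\<forall>t\<in>{0..T}. dirichlet (trunc j (W a t)) <= m^2 \<and> a t = 1 + N (dirichlet (trunc j (W a t))))", OF truncated_solution]
  by blast
 have diff: "\<bar>b i t - b j t\<bar> <= (tail i + tail j) * sqrt Kc" if t: "t \<in> {0..T}" for i j t
 proof (rule coefficient_comparison_data[OF adm adm _ _ t])
  fix t assume t: "t \<in> {0..T}"
  have "\<bar>b i t - b j t\<bar> <= \<Lambda> * \<bar>dirichlet (trunc i (W (b i) t)) - dirichlet (trunc j (W (b j) t))\<bar>"
   unfolding beq[OF t, of i] beq[OF t, of j] add_diff_cancel_left by (intro N_lipschitz dirichlet_nonneg small[OF t])
  also have "\<dots> <= \<Lambda> * (tail i + tail j + \<bar>dirichlet (W (b i) t) - dirichlet (W (b j) t)\<bar>)"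
   using truncation_error[OF adm t, of i i] truncation_error[OF adm t, of j j] by (intro mult_left_mono \<Lambda>_nonneg) linarith
  finally show "\<bar>b i t - b j t\<bar> <= \<Lambda> * (tail i + tail j + \<bar>dirichlet (W (b i) t) - dirichlet (W (b j) t)\<bar>)" .
 qed (simp add: tail_nonneg)
 have tl: "(%j. tail j * sqrt Kc) \<longlonglongrightarrow> 0" using tendsto_mult_right[OF tail_tendsto, of "sqrt Kc"] by simp
 have "Cauchy (%j. b j t)" if t: "t \<in> {0..T}" for t
 proof (rule metric_CauchyI)
  fix r :: real assume "0 < r"
  then obtain n where n: "!!j. j >= n ==> tail j * sqrt Kc < r / 2"
   using order_tendstoD(2)[OF tl, of "r / 2"] by (auto simp: eventually_sequentially)
  have "dist (b i t) (b j t) < r" if "i >= n" "j >= n" for i j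
   using diff[OF t, of i j] n[OF that(1)] n[OF that(2)] by (simp add: dist_real_def distrib_right)
  then show "\<exists>n. \<forall>i\<ge>n. \<forall>j\<ge>n. dist (b i t) (b j t) < r" by blast
 qed
 then have "\<exists>l. (%j. b j t) \<longlonglongrightarrow> l" if "t \<in> {0..T}" for t using that by (auto simp: Cauchy_convergent_iff convergent_def)
 then obtain a where a: "!!t. t \<in> {0..T} ==> (%j. b j t) \<longlonglongrightarrow> a t" by metis
 define \<sigma> where "\<sigma> j = tail j * sqrt Kc" for j
 have le: "\<bar>b j t - a t\<bar> <= \<sigma> j" if t: "t \<in> {0..T}" for j t
 proof (rule tendsto_le[of sequentially])
  show "(%i. (tail i + tail j) * sqrt Kc) \<longlonglongrightarrow> \<sigma> j"
   using tendsto_mult_right[OF tendsto_add[OF tail_tendsto tendsto_const[of "tail j"]], of "sqrt Kc"] by (simp add: \<sigma>_def)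
  show "(%i. \<bar>b j t - b i t\<bar>) \<longlonglongrightarrow> \<bar>b j t - a t\<bar>" by (intro tendsto_intros a t)
  show "\<forall>\<^sub>F i in sequentially. \<bar>b j t - b i t\<bar> <= (tail i + tail j) * sqrt Kc"
   using diff[OF t, of j] by (simp add: add.commute)
 qed simp
 have s0': "\<sigma> \<longlonglongrightarrow> 0" using tl by (simp add: \<sigma>_def[abs_def])
 have "uniform_limit {0..T} b a sequentially"
 proof (rule uniform_limitI)
  fix r :: real assume "0 < r"
  from order_tendstoD(2)[OF s0' this] show "\<forall>\<^sub>F j in sequentially. \<forall>t\<in>{0..T}. dist (b j t) (a t) < r"
  proof eventually_elim
   case (elim j) show ?case
   proof
    fix t assume "t \<in> {0..T}"
    from le[OF this, of j] elim show "dist (b j t) (a t) < r" by (simp add: dist_real_def)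
   qed
  qed
 qed
 then have ca: "continuous_on {0..T} a"
  by (rule uniform_limit_theorem[rotated]) (simp_all add: admissible_continuous[OF adm])
 have limP: "(%j. P (b j) t \<xi>) \<longlonglongrightarrow> P a t \<xi>" and limW: "(%j. norm \<xi> * cmod (W (b j) t \<xi>)) \<longlonglongrightarrow> norm \<xi> * cmod (W a t \<xi>)"
  if t: "t \<in> {0..T}" for t \<xi>
  unfolding P_def W_def by (rule flow_tendsto[OF adm ca le s0' t]; simp)+
 have bP: "cmod (P a t \<xi>) <= G * d \<xi>" and bW: "norm \<xi> * cmod (W a t \<xi>) <= G * d \<xi>" if t: "t \<in> {0..T}" for t \<xi>
  by (rule LIMSEQ_le_const2[OF tendsto_norm[OF limP[OF t]]], use flow_energy_data(1)[OF adm t] in auto)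
   (rule LIMSEQ_le_const2[OF limW[OF t]], use flow_energy_data(2)[OF adm t] in auto)
 have "a t = 1 + N (dirichlet (W a t))" if t: "t \<in> {0..T}" for t
 proof (rule LIMSEQ_unique[OF a[OF t]])
  have "(%j. dirichlet (trunc j (W (b j) t))) \<longlonglongrightarrow> dirichlet (W a t)"
   unfolding dirichlet_def
  proof (rule integral_dominated_convergence[where w="%\<xi>. G^2 * (d \<xi>)^2"])
   show "integrable lborel (%\<xi>. G^2 * (d \<xi>)^2)" using density_integrable(1) by simp
   have le: "(norm \<xi>)^2 * (cmod (W (b j) t \<xi>))^2 <= G^2 * (d \<xi>)^2" for \<xi> j
    using power_mono[OF flow_energy_data(2)[OF adm t], of \<xi> j 2] by (simp add: power_mult_distrib)
   then show "AE \<xi> in lborel. norm ((norm \<xi>)^2 * (cmod (trunc j (W (b j) t) \<xi>))^2) <= G^2 * (d \<xi>)^2" for j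
    by (auto simp: trunc_def indicator_def)
   show "AE \<xi> in lborel. (%j. (norm \<xi>)^2 * (cmod (trunc j (W (b j) t) \<xi>))^2) \<longlonglongrightarrow> (norm \<xi>)^2 * (cmod (W a t \<xi>))^2"
   proof (intro always_eventually allI)
    fix \<xi> :: 'a
    obtain n where n: "norm \<xi> <= real n" using real_arch_simple by blast
    have "(%j. (norm \<xi> * cmod (W (b j) t \<xi>))^2) \<longlonglongrightarrow> (norm \<xi> * cmod (W a t \<xi>))^2" by (intro tendsto_intros limW t)
    moreover have "\<forall>\<^sub>F j in sequentially. (norm \<xi> * cmod (W (b j) t \<xi>))^2 = (norm \<xi>)^2 * (cmod (trunc j (W (b j) t) \<xi>))^2"
     using eventually_ge_at_top[of n] by eventually_elim (use n in \<open>auto simp: trunc_def power_mult_distrib\<close>)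
    ultimately show "(%j. (norm \<xi>)^2 * (cmod (trunc j (W (b j) t) \<xi>))^2) \<longlonglongrightarrow> (norm \<xi>)^2 * (cmod (W a t \<xi>))^2"
     by (simp add: power_mult_distrib Lim_transform_eventually)
   qed
  qed measurable
  then have "(%j. N (dirichlet (trunc j (W (b j) t)))) \<longlonglongrightarrow> N (dirichlet (W a t))"
   by (rule continuous_on_tendsto_compose[OF N_continuous]) (auto simp: dirichlet_nonneg)
  then have "(%j. 1 + N (dirichlet (trunc j (W (b j) t)))) \<longlonglongrightarrow> 1 + N (dirichlet (W a t))" by (intro tendsto_intros)
  then show "(%j. b j t) \<longlonglongrightarrow> 1 + N (dirichlet (W a t))" by (simp add: beq[OF t, symmetric])
 qed
 then show ?thesis using ca bP bW by blast
qed

end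

context kirchhoff_data begin

text \<open>
  The dominating functions come from the energy bound. At low frequencies \<open>|\<xi>||v|\<close> says nothing about \<open>v\<close>;
  there \<open>|v| \<le> |v(0)| + T sup |v'|\<close> is used instead.
\<close>

lemma solution_exists:
 "\<exists>u u'. kirchhoff_solution N s0 T u u' \<and> (AE x in lborel. u 0 x = u0 x) \<and> (AE x in lborel. u' 0 x = u1 x)"
proof -
 obtain a where a: "continuous_on {0..T} a" and aeq: "!!t. t \<in> {0..T} ==> a t = 1 + N (dirichlet (W a t))"
  and bP: "!!t \<xi>. t \<in> {0..T} ==> cmod (P a t \<xi>) <= G * d \<xi>" and bW: "!!t \<xi>. t \<in> {0..T} ==> norm \<xi> * cmod (W a t \<xi>) <= G * d \<xi>"
  using coefficient_limit by blast
 have Tn: "0 <= T" and s: "0 <= s0" and zT: "0 \<in> {0..T}" using T0 s0 by auto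
 have z: "W a 0 \<xi> = fourier u0 \<xi>" "P a 0 \<xi> = fourier u1 \<xi>" for \<xi>
  unfolding W_def P_def by (rule flow_has_derivative(3,4)[OF a Tn zT])+
 define E where "E \<xi> = cmod (fourier u0 \<xi>) + (T + 1) * (G * d \<xi>)" for \<xi>
 define DP where "DP \<xi> = cor (G * d \<xi>)" for \<xi>
 define DV where "DV \<xi> = cor (E \<xi>) / bracket 1 \<xi>" for \<xi>
 have sDP: "L2 (%\<xi>. bracket s0 \<xi> * DP \<xi>)"
  using L2_cmult[OF L2_bracket_density, of "cor G"] by (simp add: DP_def ac_simps)
 have "L2 (%\<xi>. bracket s0 \<xi> * fourier u0 \<xi>)"
  by (rule weight_dominated(1)[OF data(5)]) (auto intro: bracket_mono)
 from L2_add[OF L2_cmod[OF this] L2_cmult[OF L2_bracket_density, of "cor ((T + 1) * G)"]]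
 have "L2 (%\<xi>. bracket s0 \<xi> * cor (E \<xi>))"
  by (simp add: E_def bracket_def norm_mult algebra_simps)
 then have sDV: "L2 (%\<xi>. bracket (s0 + 1) \<xi> * DV \<xi>)"
  by (simp add: DV_def bracket_add)
 have leP: "cmod (P a t \<xi>) <= cmod (DP \<xi>)" if t: "t \<in> {0..T}" for t \<xi>
  using bP[OF t, of \<xi>] by (simp add: DP_def norm_mult)
 have leW: "cmod (W a t \<xi>) <= cmod (DV \<xi>)" if t: "t \<in> {0..T}" for t \<xi>
 proof -
  have "cmod (W a t \<xi> - W a 0 \<xi>) <= (G * d \<xi>) * \<bar>t - 0\<bar>"
   using vector_lipschitz[of T "%t. W a t \<xi>" "%t. P a t \<xi>", OF _ bP zT t] flow_has_derivative(1)[OF a Tn] unfolding W_def P_def by blast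
  also have "\<dots> <= T * (G * d \<xi>)" using t mult_right_mono[of t T "G * d \<xi>"] by (simp add: mult.commute)
  finally have "cmod (W a t \<xi>) <= cmod (fourier u0 \<xi>) + T * (G * d \<xi>)"
   using norm_triangle_sub[of "W a t \<xi>" "W a 0 \<xi>"] by (simp add: z)
  then have "(1 + norm \<xi>) * cmod (W a t \<xi>) <= E \<xi>" using bW[OF t, of \<xi>] by (simp add: E_def distrib_right)
  moreover have "cmod (bracket 1 \<xi>) * cmod (W a t \<xi>) <= (1 + norm \<xi>) * cmod (W a t \<xi>)"
   by (intro mult_right_mono bracket_1_le) simp
  ultimately have "cmod (W a t \<xi>) * cmod (bracket 1 \<xi>) <= E \<xi>" by (simp add: mult.commute)
  moreover have "0 < cmod (bracket 1 \<xi>)" by simp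
  ultimately have "cmod (W a t \<xi>) <= E \<xi> / cmod (bracket 1 \<xi>)" by (simp only: pos_le_divide_eq)
  also have "\<dots> <= cmod (DV \<xi>)" by (simp add: DV_def norm_divide divide_right_mono)
  finally show ?thesis .
 qed
 define u where "u t = inverse_fourier (W a t)" for t
 define u' where "u' t = inverse_fourier (P a t)" for t
 have u: "kirchhoff_solution N s0 T u u'"
  using kirchhoff_solution_of_flow[OF s Tn a measurable_data sDV sDP, of N] leP leW aeq
  unfolding W_def[abs_def] P_def[abs_def] u_def u'_def by blast
 note q = kirchhoff_solution_L2(1,2)[OF u zT]
 have "AE \<xi> in lborel. fourier (u 0) \<xi> = fourier u0 \<xi>" "AE \<xi> in lborel. fourier (u' 0) \<xi> = fourier u1 \<xi>"
  using fourier_inverse_fourier[OF data(3)] fourier_inverse_fourier[OF data(4)] by (simp_all add: u_def u'_def z[abs_def])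
 then have "AE x in lborel. u 0 x = u0 x" "AE x in lborel. u' 0 x = u1 x"
  using fourier_inj_AE[OF q(1) data(1)] fourier_inj_AE[OF q(2) data(2)] by auto
 then show ?thesis using u by blast
qed

context
 fixes u u' :: "real => 'a => complex"
 assumes u: "kirchhoff_solution N s0 T u u'" and u_0: "AE x in lborel. u 0 x = u0 x" "AE x in lborel. u' 0 x = u1 x"
begin

lemma fourier_initial: "AE \<xi> in lborel. fourier (u 0) \<xi> = fourier u0 \<xi>" "AE \<xi> in lborel. fourier (u' 0) \<xi> = fourier u1 \<xi>"
 using T0 by (intro fourier_cong_AE data kirchhoff_solution_L2[OF u] u_0; simp)+

lemma initial_dominated:
 "AE \<xi> in lborel. cmod (fourier (u 0) \<xi>) <= cmod (fourier u0 \<xi>)" "AE \<xi> in lborel. cmod (fourier (u' 0) \<xi>) <= cmod (fourier u1 \<xi>)"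
 using fourier_initial by (eventually_elim; simp)+

lemmas facts = solution_facts[OF u refl N_continuous initial_dominated]

definition coef where "coef t = 1 + N (dirichlet (fourier (u t)))"

lemma solution_flow:
 assumes t: "t \<in> {0..T}"
 shows "AE \<xi> in lborel. fourier (u t) \<xi> = W coef t \<xi>" "dirichlet (fourier (u t)) = dirichlet (W coef t)"
proof -
 have s: "0 <= s0" using s0 by simp
 have adm: "admissible L T coef" using facts(6) by (simp add: coef_def[abs_def])
 have "AE \<xi> in lborel. fourier (u t) \<xi> = flow coef t (fourier (u 0) \<xi>) (fourier (u' 0) \<xi>) ((norm \<xi>)^2) \<and>
   fourier (u' t) \<xi> = flow_deriv coef t (fourier (u 0) \<xi>) (fourier (u' 0) \<xi>) ((norm \<xi>)^2)"
  using spectral_solution_flow[OF kirchhoff_spectral[OF N_continuous s u] s _ t] admissible_continuous[OF adm] by (simp add: coef_def[abs_def])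
 with fourier_initial show 1: "AE \<xi> in lborel. fourier (u t) \<xi> = W coef t \<xi>"
  by eventually_elim (simp add: W_def)
 show "dirichlet (fourier (u t)) = dirichlet (W coef t)"
  by (rule dirichlet_cong_AE[OF 1 L2D(1)[OF L2_fourier[OF kirchhoff_solution_L2(1)[OF u t]]]]) simp
qed

end

text \<open>Two solutions satisfy the coefficient equation exactly, so their coefficients agree.\<close>

lemma solution_unique:
 fixes u u' w w' :: "real => 'a => complex"
 assumes u: "kirchhoff_solution N s0 T u u'" "AE x in lborel. u 0 x = u0 x" "AE x in lborel. u' 0 x = u1 x"
  and w: "kirchhoff_solution N s0 T w w'" "AE x in lborel. w 0 x = u0 x" "AE x in lborel. w' 0 x = u1 x"
  and t: "t \<in> {0..T}"
 shows "AE x in lborel. w t x = u t x"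
proof -
 let ?a = "coef u" and ?b = "coef w"
 have a: "admissible L T ?a" and b: "admissible L T ?b"
  using facts(6)[OF u] facts(6)[OF w] by (simp_all add: coef_def[OF u, abs_def] coef_def[OF w, abs_def])
 have eq: "?a t = ?b t" if t: "t \<in> {0..T}" for t
 proof -
  have "\<bar>?a t - ?b t\<bar> <= 0 * sqrt Kc"
  proof (rule coefficient_comparison_data[OF a b order_refl _ t])
   fix t assume t: "t \<in> {0..T}"
   have "\<bar>?a t - ?b t\<bar> <= \<Lambda> * \<bar>dirichlet (fourier (u t)) - dirichlet (fourier (w t))\<bar>"
    unfolding coef_def[OF u] coef_def[OF w] add_diff_cancel_left
    by (intro N_lipschitz dirichlet_nonneg facts(3)[OF u t] facts(3)[OF w t])
   then show "\<bar>?a t - ?b t\<bar> <= \<Lambda> * (0 + \<bar>dirichlet (W ?a t) - dirichlet (W ?b t)\<bar>)"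
    by (simp add: solution_flow(2)[OF u t] solution_flow(2)[OF w t])
  qed
  then show ?thesis by simp
 qed
 have "integral {0..t} (%\<tau>. (?a \<tau> - ?b \<tau>)^2) = integral {0..t} (%\<tau>. 0)"
  by (rule integral_cong) (use eq t in auto)
 then have "norm \<xi> * cmod (W ?a t \<xi> - W ?b t \<xi>) <= 0" for \<xi>
  using admissible_flow_diff[OF a b t, of \<xi> "fourier u0" "fourier u1"] by (simp add: W_def)
 from this[unfolded mult_le_0_iff] have "\<xi> \<noteq> 0 ==> W ?a t \<xi> = W ?b t \<xi>" for \<xi> by fastforce
 then have "AE \<xi> in lborel. W ?a t \<xi> = W ?b t \<xi>"
  using AE_lborel_singleton[of "0::'a"] by (auto elim!: eventually_mono)
 with solution_flow(1)[OF u t] solution_flow(1)[OF w t] have "AE \<xi> in lborel. fourier (w t) \<xi> = fourier (u t) \<xi>"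
  by eventually_elim simp
 then show ?thesis
  by (rule fourier_inj_AE[OF kirchhoff_solution_L2(1)[OF w(1) t] kirchhoff_solution_L2(1)[OF u(1) t]])
qed

end

section \<open>The theorem\<close>

text \<open>
  Since \<open>N\<close> is continuous with \<open>N(0) = 0\<close>, small solutions see a nonlinearity of size at most \<open>1/2\<close>.
\<close>

lemma small_range:
 assumes N: "C2_loc N" "N 0 = 0" and D: "0 < D"
 obtains N' m \<Lambda> where "!!y. 0 <= y ==> (N has_real_derivative N' y) (at y within {0..})"
  "0 < m" "m <= D" "!!y. 0 <= y ==> y <= m^2 ==> \<bar>N' y\<bar> <= \<Lambda>" "!!y. 0 <= y ==> y <= m^2 ==> \<bar>N y\<bar> <= 1/2"
proof -
 from N(1) obtain N' N'' where d: "!!y. 0 <= y ==> (N has_real_derivative N' y) (at y within {0..})"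
  "!!y. 0 <= y ==> (N' has_real_derivative N'' y) (at y within {0..})" unfolding C2_loc_def by blast
 have "continuous_on {0..} N" by (rule DERIV_continuous_on[OF d(1)]) simp
 from this[unfolded continuous_on_iff, rule_format, of 0 "1/2"]
 obtain r where r: "0 < r" "!!y. 0 <= y ==> y < r ==> \<bar>N y\<bar> < 1/2"
  by (auto simp: dist_real_def N(2))
 define m where "m = min D (sqrt (r / 2))"
 have m: "0 < m" "m <= D" using D r by (auto simp: m_def)
 have "m^2 <= (sqrt (r / 2))^2" using m by (intro power_mono) (auto simp: m_def)
 then have mr: "m^2 < r" using r by simp
 have "continuous_on {0..} N'" by (rule DERIV_continuous_on[OF d(2)]) simp
 then have "continuous_on {0..m^2} N'" by (rule continuous_on_subset) auto
 from continuous_coefficient_bound[OF this] obtain \<Lambda> where "!!y. y \<in> {0..m^2} ==> \<bar>N' y\<bar> <= \<Lambda>" by blast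
 then show ?thesis using r mr by (intro that[OF d(1) m]) (auto intro: less_imp_le)
qed

theorem theorem2:
  fixes N :: "real \<Rightarrow> real" and \<delta> :: "real \<Rightarrow> real"
  assumes "C2_loc N" and "N 0 = 0"
    and "\<And>s0. s0 \<ge> 1/2 \<Longrightarrow> energy_threshold TYPE(real ^ 'n) N s0 (\<delta> s0)"
  shows "\<exists>A>0. \<forall>s0\<ge>1/2. \<exists>K>0. \<forall>\<epsilon>>0. \<exists>c>0. \<exists>B>0.
    \<forall>(u0 :: real ^ 'n \<Rightarrow> complex) u1 \<delta>0.
      u0 \<in> sobolev (s0 + 1) \<longrightarrow> u1 \<in> sobolev s0 \<longrightarrow>
      hdot_pair_norm (1/4) u0 u1 = \<epsilon> \<longrightarrow>
      hdot1_l2_norm u0 u1 = \<delta>0 \<longrightarrow> \<delta>0 \<le> c * \<delta> s0 \<longrightarrow>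
      (\<exists>T. T \<le> K * (1 / \<epsilon> ^ 4) \<and> 1 / \<epsilon> ^ 4 \<le> K * T \<and>
        (\<exists>u u'.
          kirchhoff_solution N s0 T u u' \<and>
          (AE x in lborel. u 0 x = u0 x) \<and> (AE x in lborel. u' 0 x = u1 x) \<and>
          (\<forall>w w'. kirchhoff_solution N s0 T w w' \<and>
             (AE x in lborel. w 0 x = u0 x) \<and> (AE x in lborel. w' 0 x = u1 x) \<longrightarrow>
             (\<forall>t\<in>{0..T}. AE x in lborel. w t x = u t x)) \<and>
          (\<forall>s\<in>{0..s0}. \<forall>t\<in>{0..T}.
             hdot_pair_norm s (u t) (u' t) \<le> B * hdot_pair_norm s u0 u1) \<and>
          (\<forall>t\<in>{0..T}. hdot1_l2_norm (u t) (u' t) \<le> \<delta> s0) \<and>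
          (\<forall>t\<in>{0..T}. hdot_pair_norm (1/4) (u t) (u' t) \<le> A * \<epsilon>)))"
proof -
 obtain C1 where c1: "energy_control TYPE(real ^ 'n) N (1/2) (\<delta> (1/2)) C1" and d1: "0 < \<delta> (1/2)"
  using energy_threshold_control[OF assms(3)[of "1/2"]] by blast
 have C1: "1 <= C1" using c1 by (simp add: energy_control_def)
 define A where "A = 2 * (C1 + 1)"
 define \<kappa> where "\<kappa> = 1 / (4 * C1 * (C1 + 1)^2)"
 have A: "0 < A" and \<kappa>: "0 < \<kappa>" using C1 by (auto simp: A_def \<kappa>_def)
 show ?thesis
 proof (rule exI[of _ A], rule conjI[OF A], rule allI, rule impI)
  fix s0 :: real assume s0: "1/2 <= s0"
  obtain C0 where c0: "energy_control TYPE(real ^ 'n) N s0 (\<delta> s0) C0" and ds: "0 < \<delta> s0"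
   using energy_threshold_control[OF assms(3)[OF s0]] by blast
  \<comment> \<open>the value of \<open>(A\<epsilon>)\<^sup>4 T\<close>, in which \<open>\<epsilon>\<close> cancels\<close>
  define \<rho> where "\<rho> = A ^ 4 * \<kappa>"
  define B where "B = C0 * exp (C0 ^ 3 * \<rho>)"
  have B: "0 < B" using c0 by (auto simp: B_def energy_control_def)
  have "0 < min (\<delta> (1/2)) (\<delta> s0)" using d1 ds by simp
  from small_range[OF assms(1,2) this] obtain N' m \<Lambda> where N': "!!y. 0 <= y ==> (N has_real_derivative N' y) (at y within {0..})"
   and m: "0 < m" "m <= min (\<delta> (1/2)) (\<delta> s0)"
   and \<Lambda>: "!!y. 0 <= y ==> y <= m^2 ==> \<bar>N' y\<bar> <= \<Lambda>" and Nh: "!!y. 0 <= y ==> y <= m^2 ==> \<bar>N y\<bar> <= 1/2" by blast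
  \<comment> \<open>small enough that both the data and their amplification by \<open>B\<close> stay below \<open>m/2\<close>\<close>
  define c where "c = m / (2 * (1 + B) * \<delta> s0)"
  have c: "0 < c" using m B ds by (simp add: c_def)
  have cd: "c * \<delta> s0 = (m / 2) / (1 + B)" using ds by (simp add: c_def)
  have c2: "c * \<delta> s0 <= m / 2" "B * (c * \<delta> s0) <= m / 2"
   unfolding cd using m B by (auto simp: field_simps)
  show "\<exists>K>0. \<forall>\<epsilon>>0. \<exists>c>0. \<exists>B>0.
  \<forall>(u0 :: real ^ 'n => complex) u1 \<delta>0.
   u0 \<in> sobolev (s0 + 1) \<longrightarrow> u1 \<in> sobolev s0 \<longrightarrow>
   hdot_pair_norm (1/4) u0 u1 = \<epsilon> \<longrightarrow>
   hdot1_l2_norm u0 u1 = \<delta>0 \<longrightarrow> \<delta>0 <= c * \<delta> s0 \<longrightarrow>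
   (\<exists>T. T <= K * (1 / \<epsilon> ^ 4) \<and> 1 / \<epsilon> ^ 4 <= K * T \<and>
    (\<exists>u u'.
     kirchhoff_solution N s0 T u u' \<and>
     (AE x in lborel. u 0 x = u0 x) \<and> (AE x in lborel. u' 0 x = u1 x) \<and>
     (\<forall>w w'. kirchhoff_solution N s0 T w w' \<and>
       (AE x in lborel. w 0 x = u0 x) \<and> (AE x in lborel. w' 0 x = u1 x) \<longrightarrow>
       (\<forall>t\<in>{0..T}. AE x in lborel. w t x = u t x)) \<and>
     (\<forall>s\<in>{0..s0}. \<forall>t\<in>{0..T}.
       hdot_pair_norm s (u t) (u' t) <= B * hdot_pair_norm s u0 u1) \<and>
     (\<forall>t\<in>{0..T}. hdot1_l2_norm (u t) (u' t) <= \<delta> s0) \<and>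
     (\<forall>t\<in>{0..T}. hdot_pair_norm (1/4) (u t) (u' t) <= A * \<epsilon>)))"
  proof (rule exI[of _ "max \<kappa> (1 / \<kappa>)"], rule conjI, use \<kappa> in simp, rule allI, rule impI,
    rule exI[of _ c], rule conjI[OF c], rule exI[of _ B], rule conjI[OF B], intro allI impI)
   fix \<epsilon> \<delta>0 :: real and u0 u1 :: "real ^ 'n => complex"
   assume \<epsilon>: "0 < \<epsilon>" and u0: "u0 \<in> sobolev (s0 + 1)" and u1: "u1 \<in> sobolev s0" and q: "hdot_pair_norm (1/4) u0 u1 = \<epsilon>"
    and h: "hdot1_l2_norm u0 u1 = \<delta>0" and \<delta>0: "\<delta>0 <= c * \<delta> s0"
   define T where "T = \<kappa> * (1 / \<epsilon> ^ 4)"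
   have T: "0 < T" using \<kappa> \<epsilon> by (simp add: T_def)
   interpret R: kirchhoff_regime "TYPE(real ^ 'n)" N N' s0 "\<delta> (1/2)" "\<delta> s0" C1 C0 m \<Lambda> \<epsilon> T \<rho>
   proof
    show "(2 * (C1 + 1) * \<epsilon>) ^ 4 * T <= \<rho>"
     unfolding A_def[symmetric] using \<epsilon> by (simp add: power_mult_distrib[of A] T_def \<rho>_def)
   qed (use N' \<Lambda> Nh s0 m c1 c0 T \<epsilon> in \<open>auto simp: T_def \<kappa>_def\<close>)
   have Bc: "R.Bc = B" by (simp add: R.Bc_def B_def)
   have "B * \<delta>0 <= B * (c * \<delta> s0)" using \<delta>0 B by simp
   then interpret D: kirchhoff_data "TYPE(real ^ 'n)" N N' s0 "\<delta> (1/2)" "\<delta> s0" C1 C0 m \<Lambda> \<epsilon> T \<rho> u0 u1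
    using u0 u1 q h \<delta>0 c2 by unfold_locales (auto simp: Bc)
   obtain u u' where u: "kirchhoff_solution N s0 T u u'" "AE x in lborel. u 0 x = u0 x" "AE x in lborel. u' 0 x = u1 x"
    using D.solution_exists by blast
   note F = D.facts[OF u]
   have Tle: "T <= max \<kappa> (1 / \<kappa>) * (1 / \<epsilon> ^ 4)"
    unfolding T_def using \<epsilon> by (intro mult_right_mono) auto
   have "(1 / \<kappa>) * T <= max \<kappa> (1 / \<kappa>) * T" using T by (intro mult_right_mono) auto
   then have Tge: "1 / \<epsilon> ^ 4 <= max \<kappa> (1 / \<kappa>) * T" using \<kappa> by (simp add: T_def)
   have uniq: "\<forall>w w'. kirchhoff_solution N s0 T w w' \<and> (AE x in lborel. w 0 x = u0 x) \<and> (AE x in lborel. w' 0 x = u1 x) \<longrightarrow>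
       (\<forall>t\<in>{0..T}. AE x in lborel. w t x = u t x)"
    using D.solution_unique[OF u] by blast
   have b: "\<forall>s\<in>{0..s0}. \<forall>t\<in>{0..T}. hdot_pair_norm s (u t) (u' t) <= B * hdot_pair_norm s u0 u1"
    using F(5) unfolding Bc by blast
   have sm: "\<forall>t\<in>{0..T}. hdot1_l2_norm (u t) (u' t) <= \<delta> s0" using F(2) m by fastforce
   have qu: "\<forall>t\<in>{0..T}. hdot_pair_norm (1/4) (u t) (u' t) <= A * \<epsilon>" using F(4) by (simp add: A_def)
   show "\<exists>T. T <= max \<kappa> (1 / \<kappa>) * (1 / \<epsilon> ^ 4) \<and> 1 / \<epsilon> ^ 4 <= max \<kappa> (1 / \<kappa>) * T \<and>
    (\<exists>u u'.
     kirchhoff_solution N s0 T u u' \<and>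
     (AE x in lborel. u 0 x = u0 x) \<and> (AE x in lborel. u' 0 x = u1 x) \<and>
     (\<forall>w w'. kirchhoff_solution N s0 T w w' \<and>
       (AE x in lborel. w 0 x = u0 x) \<and> (AE x in lborel. w' 0 x = u1 x) \<longrightarrow>
       (\<forall>t\<in>{0..T}. AE x in lborel. w t x = u t x)) \<and>
     (\<forall>s\<in>{0..s0}. \<forall>t\<in>{0..T}.
       hdot_pair_norm s (u t) (u' t) <= B * hdot_pair_norm s u0 u1) \<and>
     (\<forall>t\<in>{0..T}. hdot1_l2_norm (u t) (u' t) <= \<delta> s0) \<and>
     (\<forall>t\<in>{0..T}. hdot_pair_norm (1/4) (u t) (u' t) <= A * \<epsilon>))"
    by (rule exI[of _ T], rule conjI[OF Tle conjI[OF Tge]], rule exI[of _ u], rule exI[of _ u'], intro conjI u uniq b sm qu)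
  qed
 qed
qed

end
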